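(* For $0<a<\pi/2$ let $\varphi_a:B^n\to\mathbb{S}^n$ be the map $\varphi_a(x)=\left(\sin a\,\frac{x}{|x|},\,\cos a\right)$. Let $(r,n,a)$ be one of the triples $\left(3,\,7,\,\frac12\arccos\left(\frac19(2\sqrt{10}-11)\right)\right)$, $\left(4,\,9,\,\frac12\arccos\left(\frac1{16}(\sqrt{105}-19)\right)\right)$, $\left(5,\,11,\,\frac12\arccos\left(\frac1{25}(6\sqrt6-29)\right)\right)$ (for each of these triples $\varphi_a$ is a proper weakly $r$-harmonic and weakly $ES$-$r$-harmonic map). Then $\varphi_a$ is unstable both as a critical point of $E_r$ and as a critical point of $E_r^{ES}$.
   Context: $B^n\subset\mathbb{R}^n$ is the Euclidean unit ball and $\mathbb{S}^n\subset\mathbb{R}^n\times\mathbb{R}$ the Euclidean unit sphere. For a map $\varphi:(M,g_M)\to(N,g_N)$ of Riemannian manifolds, $m=\dim M$, $\tau(\varphi)=-d^*d\varphi=\mathrm{trace}_{g_M}\nabla d\varphi$ is the tension field, a section of $\varphi^{-1}TN$; $d,d^*$ denote exterior covariant differentiation and codifferential on $\varphi^{-1}TN$-valued forms ($d^*$ vanishes on $0$-forms). The rough Laplacian on sections of $\varphi^{-1}TN$ is $\overline{\Delta}=d^*d=-\sum_{i=1}^m\left(\nabla^\varphi_{e_i}\nabla^\varphi_{e_i}-\nabla^\varphi_{\nabla^M_{e_i}e_i}\right)$, $\{e_i\}$ a local orthonormal frame. The $r$-energy is $E_{2s}(\varphi)=\frac12\int_M|\overline{\Delta}^{s-1}\tau(\varphi)|^2\,dV$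 and $E_{2s+1}(\varphi)=\frac12\int_M\sum_{j=1}^m|\nabla^\varphi_{e_j}\overline{\Delta}^{s-1}\tau(\varphi)|^2\,dV$ ($s\ge1$). The $ES$-$r$-energy is $E_r^{ES}(\varphi)=\frac12\int_M|(d^*+d)^r(\varphi)|^2\,dV$, where $(d^*+d)\varphi=d\varphi$, $(d^*+d)^2\varphi=-\tau(\varphi)$ and $(d^*+d)^r\varphi=-(d^*+d)^{r-2}\tau(\varphi)$ for $r\geq 3$. $W^{r,2}(B^n,\mathbb{S}^n)$ is the set of $\varphi\in W^{r,2}(B^n,\mathbb{R}^{n+1})$ with $\varphi(x)\in\mathbb{S}^n$ a.e. A map is weakly $r$-harmonic (weakly $ES$-$r$-harmonic) if it belongs to $W^{r,2}(B^n,\mathbb{S}^n)$ and solves the Euler-Lagrange equation of $E_r$ ($E_r^{ES}$) in the sense of distributions; it is proper if it is not (weakly) harmonic. For $\varphi_0\in W^{r,2}(B^n,\mathbb{S}^n)$, let $W^{r,2}_{\varphi_0}(B^n,\mathbb{S}^n)$ be the set of $\varphi\in W^{r,2}(B^n,\mathbb{S}^n)$ such that $\nabla^k(\varphi-\varphi_0)|_{\partial B^n}\equiv0$ for $0\le k\le r-1$ (in the sense of traces). A weak critical point $\varphi_0$ of $F\in\{E_r,E_r^{ES}\}$ is stable for $F$ if $\frac{d^2}{ds^2}F(\varphi_s)\big|_{s=0}\ge0$ for all variations $\varphi_s$ ($s\ge0$) of $\varphi_0$ through maps in $W^{r,2}_{\varphi_0}(B^n,\mathbb{S}^n)$; it is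 unstable if it is not stable. *)

theory Defs
  imports "HOL-Analysis.Analysis"
begin

text \<open>
  The domain is the open unit ball of a Euclidean space \<open>'a\<close> with its flat metric, the target is the
  unit sphere of a Euclidean space \<open>'b\<close> (for \<open>'b = (real ^ 'n) \<times> real\<close> this is the sphere in
  $R^n \times R$). Functions represent their a.e. classes on the ball; the values off the ball
  are irrelevant.
\<close>

abbreviation unit_ball :: "'a::euclidean_space set" where
  "unit_ball \<equiv> ball 0 1"

subsection \<open>Smooth functions, weak derivatives, Sobolev spaces\<close>

primrec C_k :: "nat \<Rightarrow> ('a::euclidean_space \<Rightarrow> 'b::euclidean_space) \<Rightarrow> bool" where
  "C_k 0 f \<longleftrightarrow> continuous_on UNIV f"
| "C_k (Suc k) f \<longleftrightarrow> (\<forall>x. f differentiable (at x)) \<and>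
     (\<forall>e\<in>Basis. C_k k (\<lambda>x. frechet_derivative f (at x) e))"

definition smooth :: "('a::euclidean_space \<Rightarrow> 'b::euclidean_space) \<Rightarrow> bool" where
  "smooth f \<longleftrightarrow> (\<forall>k. C_k k f)"

text \<open>The closed support is automatically compact, since the ball is bounded.\<close>

definition test_function :: "('a::euclidean_space \<Rightarrow> 'b::euclidean_space) \<Rightarrow> bool" where
  "test_function \<eta> \<longleftrightarrow> smooth \<eta> \<and> closure {x. \<eta> x \<noteq> 0} \<subseteq> unit_ball"

definition locally_integrable :: "('a::euclidean_space \<Rightarrow> 'b::euclidean_space) \<Rightarrow> bool" where
  "locally_integrable f \<longleftrightarrow>
     (\<forall>K. compact K \<and> K \<subseteq> unit_ball \<longrightarrow> integrable (lebesgue_on K) f)"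

definition has_weak_partial ::
    "'a::euclidean_space \<Rightarrow> ('a \<Rightarrow> 'b::euclidean_space) \<Rightarrow> ('a \<Rightarrow> 'b) \<Rightarrow> bool" where
  "has_weak_partial e f g \<longleftrightarrow> locally_integrable f \<and> locally_integrable g \<and>
     (\<forall>\<eta>::'a \<Rightarrow> real. test_function \<eta> \<longrightarrow>
        (LINT x|lebesgue_on unit_ball. frechet_derivative \<eta> (at x) e *\<^sub>R f x) =
        - (LINT x|lebesgue_on unit_ball. \<eta> x *\<^sub>R g x))"

text \<open>A weak derivative is unique up to null sets; one representative is chosen. Functions that
  agree a.e. on the ball get the same representative.\<close>

definition weak_partial ::
    "'a::euclidean_space \<Rightarrow> ('a \<Rightarrow> 'b::euclidean_space) \<Rightarrow> 'a \<Rightarrow> 'b" where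
  "weak_partial e f = (SOME g. has_weak_partial e f g)"

definition weak_partials ::
    "'a::euclidean_space list \<Rightarrow> ('a \<Rightarrow> 'b::euclidean_space) \<Rightarrow> 'a \<Rightarrow> 'b" where
  "weak_partials es f = foldr weak_partial es f"

definition L2 :: "('a::euclidean_space \<Rightarrow> 'b::euclidean_space) \<Rightarrow> bool" where
  "L2 f \<longleftrightarrow> f \<in> borel_measurable (lebesgue_on unit_ball) \<and>
     integrable (lebesgue_on unit_ball) (\<lambda>x. (norm (f x))\<^sup>2)"

primrec sobolev :: "nat \<Rightarrow> ('a::euclidean_space \<Rightarrow> 'b::euclidean_space) \<Rightarrow> bool" where
  "sobolev 0 f \<longleftrightarrow> L2 f"
| "sobolev (Suc k) f \<longleftrightarrow> L2 f \<and>
     (\<forall>e\<in>Basis. (\<exists>g. has_weak_partial e f g) \<and> sobolev k (weak_partial e f))"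

definition sobolev_norm :: "nat \<Rightarrow> ('a::euclidean_space \<Rightarrow> 'b::euclidean_space) \<Rightarrow> real" where
  "sobolev_norm k f = sqrt (\<Sum>es | set es \<subseteq> Basis \<and> length es \<le> k.
     (LINT x|lebesgue_on unit_ball. (norm (weak_partials es f x))\<^sup>2))"

definition sobolev_sphere :: "nat \<Rightarrow> ('a::euclidean_space \<Rightarrow> 'b::euclidean_space) \<Rightarrow> bool" where
  "sobolev_sphere r \<phi> \<longleftrightarrow>
     sobolev r \<phi> \<and> (AE x in lebesgue_on unit_ball. \<phi> x \<in> sphere 0 1)"

subsection \<open>Traces\<close>

text \<open>Polar coordinates: the surface measure of a Borel set \<open>A\<close> of the unit sphere is $n$ times the
  volume of the cone over \<open>A\<close>.\<close>

definition surface_measure :: "'a::euclidean_space measure" where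
  "surface_measure =
     distr (scale_measure (of_nat DIM('a)) (restrict_space lborel unit_ball)) borel sgn"

text \<open>The trace operator is the continuous extension to $W^{1,2}$ of the restriction to the boundary of
  functions that are smooth up to the boundary.\<close>

definition has_trace ::
    "('a::euclidean_space \<Rightarrow> 'b::euclidean_space) \<Rightarrow> ('a \<Rightarrow> 'b) \<Rightarrow> bool" where
  "has_trace u g \<longleftrightarrow> sobolev 1 u \<and> g \<in> borel_measurable borel \<and>
     (\<exists>v::nat \<Rightarrow> 'a \<Rightarrow> 'b. (\<forall>k. smooth (v k)) \<and>
        (\<lambda>k. sobolev_norm 1 (\<lambda>x. v k x - u x)) \<longlonglongrightarrow> 0 \<and>
        (\<lambda>k. \<integral>\<^sup>+ x. ennreal ((norm (v k x - g x))\<^sup>2) \<partial>surface_measure) \<longlonglongrightarrow> 0)"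

definition sobolev_sphere_rel ::
    "nat \<Rightarrow> ('a::euclidean_space \<Rightarrow> 'b::euclidean_space) \<Rightarrow> ('a \<Rightarrow> 'b) \<Rightarrow> bool" where
  "sobolev_sphere_rel r \<phi>\<^sub>0 \<phi> \<longleftrightarrow> sobolev_sphere r \<phi> \<and>
     (\<forall>es. set es \<subseteq> Basis \<and> length es < r \<longrightarrow>
        has_trace (weak_partials es (\<lambda>x. \<phi> x - \<phi>\<^sub>0 x)) (\<lambda>_. 0))"

subsection \<open>Covariant calculus along a map into the unit sphere\<close>

text \<open>Sections of $\varphi^{-1}TN$ are \<open>'b\<close>-valued functions orthogonal to \<open>\<phi>\<close>. As the sphere has
  the induced metric, the pull-back connection is the derivative followed by orthogonal
  projection onto the tangent space at \<open>\<phi> x\<close>. The constant frame \<open>Basis\<close> is orthonormal and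
  parallel, so the terms $\nabla^\varphi_{\nabla^M_{e_i} e_i}$ vanish.\<close>

definition cov ::
    "('a::euclidean_space \<Rightarrow> 'b::euclidean_space) \<Rightarrow> 'a \<Rightarrow> ('a \<Rightarrow> 'b) \<Rightarrow> 'a \<Rightarrow> 'b" where
  "cov \<phi> e V = (\<lambda>x. weak_partial e V x - (weak_partial e V x \<bullet> \<phi> x) *\<^sub>R \<phi> x)"

definition tension :: "('a::euclidean_space \<Rightarrow> 'b::euclidean_space) \<Rightarrow> 'a \<Rightarrow> 'b" where
  "tension \<phi> = (\<lambda>x. \<Sum>e\<in>Basis. cov \<phi> e (weak_partial e \<phi>) x)"

definition rough_laplacian ::
    "('a::euclidean_space \<Rightarrow> 'b::euclidean_space) \<Rightarrow> ('a \<Rightarrow> 'b) \<Rightarrow> 'a \<Rightarrow> 'b" where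
  "rough_laplacian \<phi> V = (\<lambda>x. - (\<Sum>e\<in>Basis. cov \<phi> e (cov \<phi> e V) x))"

text \<open>For $r \ge 1$; $E_1$ is the Dirichlet energy, whose critical points are the harmonic maps.\<close>

definition r_energy :: "nat \<Rightarrow> ('a::euclidean_space \<Rightarrow> 'b::euclidean_space) \<Rightarrow> real" where
  "r_energy r \<phi> =
    (if r = 1 then
       1/2 * (LINT x|lebesgue_on unit_ball. (\<Sum>e\<in>Basis. (norm (weak_partial e \<phi> x))\<^sup>2))
     else if even r then
       1/2 * (LINT x|lebesgue_on unit_ball.
         (norm ((rough_laplacian \<phi> ^^ (r div 2 - 1)) (tension \<phi>) x))\<^sup>2)
     else
       1/2 * (LINT x|lebesgue_on unit_ball. (\<Sum>e\<in>Basis.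
         (norm (cov \<phi> e ((rough_laplacian \<phi> ^^ (r div 2 - 1)) (tension \<phi>)) x))\<^sup>2)))"

text \<open>A differential form of mixed degree with values in $\varphi^{-1}TN$ is given by its components
  \<open>\<omega> [e\<^sub>1, \<dots>, e\<^sub>p]\<close> on basis vectors, over all degrees \<open>p\<close> at once; the entry at \<open>[]\<close> is the
  part of degree 0.\<close>

type_synonym ('a, 'b) form = "'a list \<Rightarrow> 'a \<Rightarrow> 'b"

definition form_of_section :: "('a \<Rightarrow> 'b::euclidean_space) \<Rightarrow> ('a, 'b) form" where
  "form_of_section V = (\<lambda>es. if es = [] then V else (\<lambda>_. 0))"

definition differential_form ::
    "('a::euclidean_space \<Rightarrow> 'b::euclidean_space) \<Rightarrow> ('a, 'b) form" where
  "differential_form \<phi> = (\<lambda>es. if length es = 1 then weak_partial (hd es) \<phi> else (\<lambda>_. 0))"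

definition ext_d ::
    "('a::euclidean_space \<Rightarrow> 'b::euclidean_space) \<Rightarrow> ('a, 'b) form \<Rightarrow> ('a, 'b) form" where
  "ext_d \<phi> \<omega> = (\<lambda>es x. \<Sum>k<length es.
     (-1) ^ k *\<^sub>R cov \<phi> (es ! k) (\<omega> (take k es @ drop (Suc k) es)) x)"

definition codiff ::
    "('a::euclidean_space \<Rightarrow> 'b::euclidean_space) \<Rightarrow> ('a, 'b) form \<Rightarrow> ('a, 'b) form" where
  "codiff \<phi> \<omega> = (\<lambda>es x. - (\<Sum>e\<in>Basis. cov \<phi> e (\<omega> (e # es)) x))"

definition hodge_dirac ::
    "('a::euclidean_space \<Rightarrow> 'b::euclidean_space) \<Rightarrow> ('a, 'b) form \<Rightarrow> ('a, 'b) form" where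
  "hodge_dirac \<phi> \<omega> = (\<lambda>es x. codiff \<phi> \<omega> es x + ext_d \<phi> \<omega> es x)"

text \<open>The factor \<open>1 / fact p\<close> turns the sum over all index tuples of length \<open>p\<close> into the sum over
  $i_1 < \dots < i_p$; components of different degree are orthogonal.\<close>

definition form_norm_sq ::
    "('a::euclidean_space, 'b::euclidean_space) form \<Rightarrow> 'a \<Rightarrow> real" where
  "form_norm_sq \<omega> x = (\<Sum>p\<le>DIM('a). 1 / fact p *
     (\<Sum>es | set es \<subseteq> Basis \<and> length es = p. (norm (\<omega> es x))\<^sup>2))"

text \<open>$(d^*+d)^r(\varphi)$ for $r \ge 1$.\<close>

definition ES_form ::
    "nat \<Rightarrow> ('a::euclidean_space \<Rightarrow> 'b::euclidean_space) \<Rightarrow> ('a, 'b) form" where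
  "ES_form r \<phi> =
    (if r = 1 then differential_form \<phi>
     else (\<lambda>es x. - (hodge_dirac \<phi> ^^ (r - 2)) (form_of_section (tension \<phi>)) es x))"

definition ES_energy :: "nat \<Rightarrow> ('a::euclidean_space \<Rightarrow> 'b::euclidean_space) \<Rightarrow> real" where
  "ES_energy r \<phi> = 1/2 * (LINT x|lebesgue_on unit_ball. form_norm_sq (ES_form r \<phi>) x)"

subsection \<open>Weak critical points and stability\<close>

text \<open>The Euler-Lagrange equation in the sense of distributions: the first variation of \<open>F\<close> vanishes
  on all test fields, i.e. along $(\varphi+t\eta)/|\varphi+t\eta|$ (which is defined for small \<open>t\<close>).\<close>

definition weakly_critical ::
    "(('a::euclidean_space \<Rightarrow> 'b::euclidean_space) \<Rightarrow> real) \<Rightarrow> nat \<Rightarrow> ('a \<Rightarrow> 'b) \<Rightarrow> bool" where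
  "weakly_critical F r \<phi> \<longleftrightarrow> sobolev_sphere r \<phi> \<and>
     (\<forall>\<eta>. test_function \<eta> \<longrightarrow>
        ((\<lambda>t. F (\<lambda>x. sgn (\<phi> x + t *\<^sub>R \<eta> x))) has_real_derivative 0) (at 0))"

definition weakly_r_harmonic ::
    "nat \<Rightarrow> ('a::euclidean_space \<Rightarrow> 'b::euclidean_space) \<Rightarrow> bool" where
  "weakly_r_harmonic r \<phi> \<longleftrightarrow> weakly_critical (r_energy r) r \<phi>"

definition weakly_ES_r_harmonic ::
    "nat \<Rightarrow> ('a::euclidean_space \<Rightarrow> 'b::euclidean_space) \<Rightarrow> bool" where
  "weakly_ES_r_harmonic r \<phi> \<longleftrightarrow> weakly_critical (ES_energy r) r \<phi>"

definition proper :: "('a::euclidean_space \<Rightarrow> 'b::euclidean_space) \<Rightarrow> bool" where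
  "proper \<phi> \<longleftrightarrow> \<not> weakly_r_harmonic 1 \<phi>"

text \<open>A variation is a curve \<open>\<phi>\<^sub>s\<close>, \<open>0 \<le> s < \<epsilon>\<close>, that is smooth (one-sided at 0) as a curve in the
  Banach space $W^{r,2}$; \<open>\<Psi> k\<close> is its \<open>k\<close>-th derivative.\<close>

definition variation ::
    "nat \<Rightarrow> ('a::euclidean_space \<Rightarrow> 'b::euclidean_space) \<Rightarrow> real \<Rightarrow> (real \<Rightarrow> 'a \<Rightarrow> 'b) \<Rightarrow> bool" where
  "variation r \<phi>\<^sub>0 \<epsilon> \<phi> \<longleftrightarrow> 0 < \<epsilon> \<and> \<phi> 0 = \<phi>\<^sub>0 \<and>
     (\<forall>s\<in>{0..<\<epsilon>}. sobolev_sphere_rel r \<phi>\<^sub>0 (\<phi> s)) \<and>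
     (\<exists>\<Psi>::nat \<Rightarrow> real \<Rightarrow> 'a \<Rightarrow> 'b. \<Psi> 0 = \<phi> \<and>
        (\<forall>k. \<forall>s\<in>{0..<\<epsilon>}. sobolev r (\<Psi> k s) \<and>
          ((\<lambda>t. sobolev_norm r (\<lambda>x. (\<Psi> k t x - \<Psi> k s x) /\<^sub>R (t - s) - \<Psi> (Suc k) s x))
             \<longlongrightarrow> 0) (at s within {0..<\<epsilon>})))"

text \<open>\<open>f\<close> is differentiable on \<open>[0, \<epsilon>)\<close> and its second (one-sided) derivative at 0 is \<open>D\<close>.\<close>

definition has_second_derivative_at_0 :: "(real \<Rightarrow> real) \<Rightarrow> real \<Rightarrow> real \<Rightarrow> bool" where
  "has_second_derivative_at_0 f \<epsilon> D \<longleftrightarrow>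
     (\<exists>f'. (\<forall>s\<in>{0..<\<epsilon>}. (f has_real_derivative f' s) (at s within {0..<\<epsilon>})) \<and>
           (f' has_real_derivative D) (at 0 within {0..<\<epsilon>}))"

definition stable ::
    "(('a::euclidean_space \<Rightarrow> 'b::euclidean_space) \<Rightarrow> real) \<Rightarrow> nat \<Rightarrow> ('a \<Rightarrow> 'b) \<Rightarrow> bool" where
  "stable F r \<phi>\<^sub>0 \<longleftrightarrow> weakly_critical F r \<phi>\<^sub>0 \<and>
     (\<forall>\<epsilon> \<phi> D. variation r \<phi>\<^sub>0 \<epsilon> \<phi> \<and>
        has_second_derivative_at_0 (\<lambda>s. F (\<phi> s)) \<epsilon> D \<longrightarrow> D \<ge> 0)"

text \<open>Instability is a property of weak critical points only.\<close>

definition unstable ::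
    "(('a::euclidean_space \<Rightarrow> 'b::euclidean_space) \<Rightarrow> real) \<Rightarrow> nat \<Rightarrow> ('a \<Rightarrow> 'b) \<Rightarrow> bool" where
  "unstable F r \<phi>\<^sub>0 \<longleftrightarrow> weakly_critical F r \<phi>\<^sub>0 \<and> \<not> stable F r \<phi>\<^sub>0"

definition phi :: "real \<Rightarrow> real ^ 'n \<Rightarrow> (real ^ 'n) \<times> real" where
  "phi a x = (sin a *\<^sub>R (x /\<^sub>R norm x), cos a)"

end

theory Submission
  imports Defs
begin

text \<open>
  \<^emph>\<open>Idea.\<close> Let $n = 2r+1$ be the dimension of the ball. If the constant latitude \<open>a\<close> of the map is
  replaced by $a + t\,\beta(\ln |x|)$, then the energy densities become $|x|^{-2r}$ times explicit
  trigonometric expressions in $t\beta, t\beta', \dots$, and the second variation is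
  \[ \frac12 \int_{B^n} |x|^{-2r}\, Q(\beta, \beta', \beta'', \dots)(\ln |x|)\, dx, \]
  with a quadratic form \<open>Q\<close> that depends on \<open>a\<close> and on the energy. In the variable $s = \ln |x|$ the
  measure is a multiple of $e^{s} Q(\beta,\beta',\dots)\, ds$, so that the borderline profile is
  $e^{-s/2}$: inserting $\beta(s) = e^{-s/2} b(s/L)$ for a bump function \<open>b\<close> yields, for large \<open>L\<close>,
  nearly $L\, Q(1, -\frac12, \frac14, \dots) \int b^2$. As $\cos^2 a$ is the root of a quadratic
  equation, the number $Q(1, -\frac12, \frac14, \dots)$ can be reduced to an affine expression in
  $\cos^2 a$, and it is negative in all cases (\<open>negative_energy_form\<close>). A profile with negative
  second variation is therefore obtained by a slow cut-off (\<open>negative_profile\<close>,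
  \<open>integral_annuli_negative\<close>). It vanishes near the origin and near the boundary, so the variation is
  admissible (\<open>cone_map_unstable\<close>).

  \<^emph>\<open>Analysis.\<close> The energies are defined by weak derivatives, while the maps have a homogeneous
  singularity at the origin. The link is the class \<open>symbol d k\<close> of smooth families on the punctured
  ball with the growth $|x|^{-k}$, one more power for each derivative in \<open>x\<close>. For such families the
  weak derivatives are the classical ones as long as the weight stays below the dimension
  (\<open>rep_weak_partial\<close>), integrals of partial derivatives of compactly supported fields vanish
  (\<open>integral_partial_symbol\<close>), and one may differentiate under the integral sign
  (\<open>has_real_derivative_integral_symbol\<close>). The condition \<open>2 * r < n\<close> is what makes all the weights that
  occur admissible.

  \<^emph>\<open>Criticality.\<close> At the map itself every iterated rough Laplacian of the tension field is a constant
  multiple of $|x|^{-2j-2}$ times one normal field (\<open>iter_const\<close>). In the first variation the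
  Laplacians are moved to one side by parts, and each commutator with the time derivative leaves a
  curvature term (\<open>first_variation_rl\<close>, \<open>first_variation_tau\<close>). All terms are multiples of the same
  integral, and the total coefficient contains the quadratic polynomial that vanishes at $\cos^2 a$
  (\<open>cone_map_critical\<close>). The additional terms of the Eells--Sampson energies involve the curvature
  form $d^2\tau$, which is zero at the map and does not affect the first variation, but does enter
  the second one.
\<close>

section \<open>Smooth functions and bump functions\<close>

lemma C_k_SucD: "C_k (Suc k) f ==> C_k k f"
proof (induction k arbitrary: f)
  case 0
  then show ?case
    by (auto simp: continuous_on_eq_continuous_at differentiable_imp_continuous_within)
next
  case (Suc k)
  then show ?case by (metis C_k.simps(2))
qed

lemma C_k_continuous: "C_k k f ==> continuous_on UNIV f"
  by (induction k) (auto dest: C_k_SucD simp del: C_k.simps(2))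

lemma C_k_const [simp]: "C_k k (\<lambda>x. c)"
  by (induction k arbitrary: c) auto

lemma C_k_add: "C_k k f ==> C_k k g ==> C_k k (\<lambda>x. f x + g x)"
proof (induction k arbitrary: f g)
  case (Suc k)
  have "frechet_derivative (\<lambda>x. f x + g x) (at x) e
      = frechet_derivative f (at x) e + frechet_derivative g (at x) e" for x e
  proof -
    have "((\<lambda>x. f x + g x) has_derivative
        (\<lambda>e. frechet_derivative f (at x) e + frechet_derivative g (at x) e)) (at x)"
      using Suc.prems by (intro has_derivative_add) (auto simp: frechet_derivative_works)
    from frechet_derivative_at[OF this] show ?thesis by metis
  qed
  with Suc show ?case by auto
qed (auto intro: continuous_intros)

lemma C_k_bilinear:
  assumes "bounded_bilinear bl"
  shows "C_k k f ==> C_k k g ==> C_k k (\<lambda>x. bl (f x) (g x))"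
proof (induction k arbitrary: f g)
  case 0
  then show ?case
    using bounded_bilinear.continuous_on[OF assms] by simp
next
  case (Suc k)
  have d: "((\<lambda>x. bl (f x) (g x)) has_derivative
        (\<lambda>e. bl (f x) (frechet_derivative g (at x) e) + bl (frechet_derivative f (at x) e) (g x)))
        (at x)" for x
    using Suc.prems
    by (intro bounded_bilinear.FDERIV[OF assms]) (auto simp: frechet_derivative_works)
  have "frechet_derivative (\<lambda>x. bl (f x) (g x)) (at x) e
      = bl (f x) (frechet_derivative g (at x) e) + bl (frechet_derivative f (at x) e) (g x)" for x e
    using frechet_derivative_at[OF d[of x]] by metis
  moreover have "(\<lambda>x. bl (f x) (g x)) differentiable at x" for x
    using d by (auto simp: differentiable_def)
  moreover have "C_k k f" "C_k k g"
    using Suc.prems by (auto intro: C_k_SucD simp del: C_k.simps(2))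
  ultimately show ?case using Suc by (auto intro!: C_k_add)
qed

lemmas C_k_mult = C_k_bilinear[OF bounded_bilinear_mult]

lemma C_k_linear:
  assumes "bounded_linear f"
  shows "C_k k f"
proof (cases k)
  case 0
  then show ?thesis using assms by (simp add: linear_continuous_on)
next
  case (Suc l)
  have d: "(f has_derivative f) (at x)" for x
    using assms by (rule bounded_linear_imp_has_derivative)
  then have "frechet_derivative f (at x) = f" for x
    by (metis frechet_derivative_at)
  with Suc d show ?thesis by (auto simp: differentiable_def)
qed

text \<open>A real function is smooth when it is the first member of a sequence in which each member is
  the derivative of the one before; in this form composites and products need no derivative
  formula of higher order.\<close>

definition derivative_sequence :: "(nat => real => real) => bool" where
  "derivative_sequence h \<longleftrightarrow> (\<forall>j s. (h j has_real_derivative h (Suc j) s) (at s))"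

lemma derivative_sequenceD: "derivative_sequence h ==> (h j has_real_derivative h (Suc j) s) (at s)"
  by (auto simp: derivative_sequence_def)

lemma derivative_sequence_continuous: "derivative_sequence h ==> continuous_on A (h j)"
  by (meson DERIV_isCont continuous_at_imp_continuous_on derivative_sequenceD)

lemma C_k_compose_real:
  fixes p :: "'a::euclidean_space => real"
  assumes h: "derivative_sequence h"
  shows "C_k k p ==> C_k k (\<lambda>x. h j (p x))"
proof (induction k arbitrary: j)
  case 0
  then show ?case
    using continuous_on_compose2[OF derivative_sequence_continuous[OF h, of UNIV]] by auto
next
  case (Suc k)
  have d: "((\<lambda>x. h j (p x)) has_derivative (\<lambda>e. h (Suc j) (p x) * frechet_derivative p (at x) e))
      (at x)" for x
  proof -
    have "(p has_derivative frechet_derivative p (at x)) (at x)"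
      using Suc.prems by (simp add: frechet_derivative_works)
    from has_derivative_compose[OF this derivative_sequenceD[OF h, unfolded has_field_derivative_def]]
    show ?thesis by (simp add: mult.commute)
  qed
  have "frechet_derivative (\<lambda>x. h j (p x)) (at x) e = h (Suc j) (p x) * frechet_derivative p (at x) e" for x e
    using frechet_derivative_at[OF d[of x]] by metis
  moreover have "(\<lambda>x. h j (p x)) differentiable at x" for x
    using d by (auto simp: differentiable_def)
  moreover have "C_k k p"
    using Suc.prems by (auto intro: C_k_SucD simp del: C_k.simps(2))
  ultimately show ?case using Suc by (auto intro!: C_k_mult)
qed

lemma smooth_derivative_sequence:
  fixes b :: "real => real"
  assumes "smooth b"
  obtains B where "derivative_sequence B" "B 0 = b"
proof
  define B where "B j = ((\<lambda>f x. frechet_derivative f (at x) 1) ^^ j) b" for j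
  show "B 0 = b" by (simp add: B_def)
  have "C_k k (B j)" for j k
  proof (induction j arbitrary: k)
    case 0
    then show ?case using assms by (simp add: B_def smooth_def)
  next
    case (Suc j)
    from Suc[of "Suc k"] show ?case by (simp add: B_def)
  qed
  then have "C_k (Suc 0) (B j)" for j by blast
  then have "B j differentiable (at x)" for j x by simp
  then have "(B j has_derivative frechet_derivative (B j) (at x)) (at x)" for j x
    by (simp add: frechet_derivative_works)
  moreover have "y * frechet_derivative (B j) (at x) 1 = frechet_derivative (B j) (at x) y" for j x y
    using linear_scale[OF has_derivative_linear[OF calculation[of j x]], of y 1] by simp
  ultimately have "(B j has_real_derivative frechet_derivative (B j) (at x) 1) (at x)" for j x
    by (rule has_derivative_imp_has_field_derivative)
  then show "derivative_sequence B"
    by (simp add: derivative_sequence_def B_def)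
qed

subsection \<open>The function \<open>exp (- 1 / t)\<close>\<close>

primrec exp_inv_poly :: "nat => real poly" where
  "exp_inv_poly 0 = 1"
| "exp_inv_poly (Suc j) = monom 1 2 * (exp_inv_poly j - pderiv (exp_inv_poly j))"

definition exp_inv :: "nat => real => real" where
  "exp_inv j t = (if t \<le> 0 then 0 else poly (exp_inv_poly j) (1 / t) * exp (- (1 / t)))"

lemma poly_div_exp_tendsto_0: "((\<lambda>y. poly p y / exp y) \<longlongrightarrow> (0::real)) at_top"
proof -
  have "((\<lambda>y. \<Sum>i\<le>degree p. coeff p i * (y ^ i / exp y)) \<longlongrightarrow> (\<Sum>i\<le>degree p. coeff p i * 0)) at_top"
    by (intro tendsto_sum tendsto_mult tendsto_const tendsto_power_div_exp_0)
  then show ?thesis by (simp add: poly_altdef sum_divide_distrib)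
qed

lemma exp_inv_div_tendsto_0: "((\<lambda>t. poly p (1 / t) * exp (- (1 / t))) \<longlongrightarrow> 0) (at_right (0::real))"
proof -
  have "filterlim (\<lambda>t::real. inverse t) at_top (at_right 0)"
    by (rule filterlim_inverse_at_top_right)
  from filterlim_compose[OF poly_div_exp_tendsto_0 this, of p] show ?thesis
    by (simp add: exp_minus divide_inverse)
qed

text \<open>At 0 the difference quotients tend to 0, because the exponential beats every power of \<open>1 / t\<close>.\<close>

lemma derivative_sequence_exp_inv: "derivative_sequence exp_inv"
  unfolding derivative_sequence_def
proof (intro allI)
  fix j and s :: real
  consider "s < 0" | "s = 0" | "s > 0" by linarith
  then show "(exp_inv j has_real_derivative exp_inv (Suc j) s) (at s)"
  proof cases
    case 1
    have "((\<lambda>_. 0) has_real_derivative exp_inv (Suc j) s) (at s)"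
      using 1 by (simp add: exp_inv_def)
    then show ?thesis
      using 1 by (elim has_field_derivative_transform_within_open[where S = "{..<0}"])
        (auto simp: exp_inv_def)
  next
    case 3
    let ?p = "exp_inv_poly j"
    have i: "((\<lambda>t. 1 / t) has_real_derivative - (1 / s\<^sup>2)) (at s)"
      using 3 by (auto intro!: derivative_eq_intros simp: power2_eq_square)
    have "((\<lambda>t. poly ?p (1 / t)) has_real_derivative poly (pderiv ?p) (1 / s) * - (1 / s\<^sup>2)) (at s)"
      by (rule DERIV_chain2[OF poly_DERIV i])
    moreover have "((\<lambda>t. exp (- (1 / t))) has_real_derivative exp (- (1 / s)) * - (- (1 / s\<^sup>2))) (at s)"
      by (rule DERIV_chain2[OF DERIV_exp DERIV_minus[OF i]])
    ultimately have "((\<lambda>t. poly ?p (1 / t) * exp (- (1 / t))) has_real_derivative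
        poly (pderiv ?p) (1 / s) * - (1 / s\<^sup>2) * exp (- (1 / s))
        + exp (- (1 / s)) * - (- (1 / s\<^sup>2)) * poly ?p (1 / s)) (at s)"
      by (rule DERIV_mult)
    moreover have "poly (pderiv ?p) (1 / s) * - (1 / s\<^sup>2) * exp (- (1 / s))
        + exp (- (1 / s)) * - (- (1 / s\<^sup>2)) * poly ?p (1 / s) = exp_inv (Suc j) s"
      using 3 by (simp add: exp_inv_def poly_monom power_divide) (simp add: algebra_simps diff_divide_distrib)
    ultimately have "((\<lambda>t. poly ?p (1 / t) * exp (- (1 / t))) has_real_derivative
        exp_inv (Suc j) s) (at s)"
      by simp
    then show ?thesis
      using 3 by (elim has_field_derivative_transform_within_open[where S = "{0<..}"])
        (auto simp: exp_inv_def)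
  next
    case 2
    have r: "((\<lambda>t. exp_inv j t / t) \<longlongrightarrow> 0) (at_right 0)"
    proof (rule Lim_transform_eventually[OF exp_inv_div_tendsto_0[of "monom 1 1 * exp_inv_poly j"]])
      show "\<forall>\<^sub>F t in at_right 0. poly (monom 1 1 * exp_inv_poly j) (1 / t) * exp (- (1 / t)) = exp_inv j t / t"
        using eventually_at_right_less[of "0::real"]
        by eventually_elim (simp add: exp_inv_def poly_monom)
    qed
    have l: "((\<lambda>t. exp_inv j t / t) \<longlongrightarrow> 0) (at_left 0)"
    proof (rule Lim_transform_eventually[OF tendsto_const])
      have "\<forall>\<^sub>F t in at_left (0::real). t < 0" by (simp add: eventually_at_filter)
      then show "\<forall>\<^sub>F t in at_left 0. 0 = exp_inv j t / t"
        by eventually_elim (simp add: exp_inv_def)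
    qed
    have "((\<lambda>t. exp_inv j t / t) \<longlongrightarrow> 0) (at 0)"
      using l r by (rule filterlim_split_at)
    then show ?thesis using 2 by (simp add: has_field_derivative_iff exp_inv_def)
  qed
qed

lemma exp_inv_0: "exp_inv 0 t = (if t \<le> 0 then 0 else exp (- (1 / t)))"
  by (simp add: exp_inv_def)

lemma exp_inv_0_bounds: "0 \<le> exp_inv 0 t" "exp_inv 0 t \<le> 1"
  by (auto simp: exp_inv_0)

lemma exp_inv_0_tendsto_indicator:
  "(\<lambda>m. exp_inv 0 (real m * t)) \<longlonglongrightarrow> (if 0 < t then 1 else 0)"
proof (cases "0 < t")
  case True
  have "(\<lambda>m. exp (- (inverse (real m) / t))) \<longlonglongrightarrow> exp (- (0 / t))"
    by (intro tendsto_intros lim_inverse_n) (use True in auto)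
  then have "(\<lambda>m. exp (- (inverse (real m) / t))) \<longlonglongrightarrow> 1" by simp
  moreover have "\<forall>\<^sub>F m in sequentially. exp (- (inverse (real m) / t)) = exp_inv 0 (real m * t)"
    using eventually_gt_at_top[of 0]
    by eventually_elim (use True in \<open>auto simp: exp_inv_0 field_simps mult_le_0_iff\<close>)
  ultimately show ?thesis using True by (auto intro: Lim_transform_eventually)
next
  case False
  then have "exp_inv 0 (real m * t) = 0" for m
    by (simp add: exp_inv_0 mult_nonneg_nonpos)
  with False show ?thesis by simp
qed

section \<open>Uniqueness of weak derivatives\<close>

lemma C_k_prod:
  fixes f :: "'i => 'a::euclidean_space => real"
  shows "finite I ==> (\<And>i. i \<in> I ==> C_k k (f i)) ==> C_k k (\<lambda>x. \<Prod>i\<in>I. f i x)"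
  by (induction I rule: finite_induct) (auto intro: C_k_mult)

definition box_bump :: "'a::euclidean_space => 'a => real => nat => 'a => real" where
  "box_bump c d \<rho> m x =
    (\<Prod>i\<in>Basis. exp_inv 0 (real m * (x \<bullet> i - c \<bullet> i)) * exp_inv 0 (real m * (d \<bullet> i - x \<bullet> i))) *
    exp_inv 0 (real m * (\<rho>\<^sup>2 - x \<bullet> x))"

lemma smooth_box_bump: "smooth (box_bump c d \<rho> m)"
  unfolding smooth_def
proof
  fix k
  have lin: "C_k k (\<lambda>x::'a. x \<bullet> i)" for i
    by (intro C_k_linear bounded_linear_inner_left)
  have id: "C_k k (\<lambda>x::'a. x)" by (intro C_k_linear bounded_linear_ident)
  have 1: "C_k k (\<lambda>x. real m * (x \<bullet> i + - (c \<bullet> i)))" for i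
    by (intro C_k_mult C_k_const C_k_add lin)
  have 2: "C_k k (\<lambda>x. real m * (d \<bullet> i + (-1) * (x \<bullet> i)))" for i
    by (intro C_k_mult C_k_const C_k_add lin)
  have 3: "C_k k (\<lambda>x::'a. real m * (\<rho>\<^sup>2 + (-1) * (x \<bullet> x)))"
    by (intro C_k_mult C_k_const C_k_add C_k_bilinear[OF bounded_bilinear_inner] id)
  have "C_k k (\<lambda>x. (\<Prod>i\<in>Basis. exp_inv 0 (real m * (x \<bullet> i + - (c \<bullet> i))) *
        exp_inv 0 (real m * (d \<bullet> i + (-1) * (x \<bullet> i)))) *
      exp_inv 0 (real m * (\<rho>\<^sup>2 + (-1) * (x \<bullet> x))))"
    by (intro C_k_mult[of k "\<lambda>x. \<Prod>i\<in>Basis. p i x * q i x" for p q]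
        C_k_mult[of k "\<lambda>x. exp_inv 0 (p x)" for p] C_k_prod finite_Basis
        C_k_compose_real[OF derivative_sequence_exp_inv] 1 2 3)
  then show "C_k k (box_bump c d \<rho> m)"
    by (simp add: box_bump_def[abs_def])
qed

lemma box_bump_eq_0: "\<rho> \<ge> 0 ==> x \<notin> ball 0 \<rho> ==> box_bump c d \<rho> m x = 0"
  by (simp add: box_bump_def exp_inv_0 mult_nonneg_nonpos dot_square_norm power_mono)

lemma test_function_box_bump:
  assumes "0 \<le> \<rho>" "\<rho> < 1"
  shows "test_function (box_bump c d \<rho> m :: 'a::euclidean_space => real)"
proof -
  have "{x. box_bump c d \<rho> m x \<noteq> 0} \<subseteq> cball 0 \<rho>"
    using box_bump_eq_0[OF assms(1)] by force
  then have "closure {x. box_bump c d \<rho> m x \<noteq> 0} \<subseteq> cball 0 \<rho>"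
    by (simp add: closure_minimal)
  with assms show ?thesis
    by (auto simp: test_function_def smooth_box_bump)
qed

lemma box_bump_nonneg: "0 \<le> box_bump c d \<rho> m x"
  by (auto simp: box_bump_def intro!: mult_nonneg_nonneg prod_nonneg exp_inv_0_bounds)

lemma box_bump_le_1: "box_bump c d \<rho> m x \<le> 1"
  unfolding box_bump_def
  by (intro mult_le_one prod_le_1 conjI mult_nonneg_nonneg prod_nonneg exp_inv_0_bounds)

text \<open>Each factor is 0 where its argument is nonpositive and tends to 1 where it is positive, and a
  point lies in the open box and ball exactly when all arguments are positive.\<close>

lemma box_bump_tendsto_indicator:
  assumes "0 \<le> \<rho>"
  shows "(\<lambda>m. box_bump c d \<rho> m x) \<longlonglongrightarrow> indicator (box c d \<inter> ball 0 \<rho>) x"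
proof -
  have "(\<lambda>m. box_bump c d \<rho> m x) \<longlonglongrightarrow>
    (\<Prod>i\<in>Basis. (if 0 < x \<bullet> i - c \<bullet> i then 1 else 0) * (if 0 < d \<bullet> i - x \<bullet> i then 1 else 0)) *
    (if 0 < \<rho>\<^sup>2 - x \<bullet> x then 1 else 0)"
    unfolding box_bump_def
    by (intro tendsto_mult tendsto_prod exp_inv_0_tendsto_indicator)
  also have "(\<Prod>i\<in>Basis. (if 0 < x \<bullet> i - c \<bullet> i then 1 else 0) * (if 0 < d \<bullet> i - x \<bullet> i then 1 else 0)) =
      (indicator (box c d) x :: real)"
  proof (cases "x \<in> box c d")
    case True
    then have "(if 0 < x \<bullet> i - c \<bullet> i then 1 else 0) * (if 0 < d \<bullet> i - x \<bullet> i then 1 else 0) = (1::real)"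
      if "i \<in> Basis" for i
      using that by (simp add: mem_box)
    with True show ?thesis by simp
  next
    case False
    then obtain i where i: "i \<in> Basis" "\<not> (c \<bullet> i < x \<bullet> i \<and> x \<bullet> i < d \<bullet> i)"
      by (metis mem_box(1))
    have "\<exists>i\<in>Basis. (if 0 < x \<bullet> i - c \<bullet> i then 1 else 0) * (if 0 < d \<bullet> i - x \<bullet> i then 1 else 0) = (0::real)"
      using i by (intro bexI[of _ i]) auto
    then have "(\<Prod>i\<in>Basis. (if 0 < x \<bullet> i - c \<bullet> i then 1 else 0) * (if 0 < d \<bullet> i - x \<bullet> i then 1 else 0)) = (0::real)"
      by (rule prod_zero[OF finite_Basis])
    with False show ?thesis by simp
  qed
  also have "(if 0 < \<rho>\<^sup>2 - x \<bullet> x then 1 else 0) = (indicator (ball 0 \<rho>) x :: real)"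
  proof -
    have "x \<bullet> x < \<rho>\<^sup>2 \<longleftrightarrow> norm x < \<rho>"
      unfolding dot_square_norm using assms by (meson norm_ge_zero power_less_imp_less_base power_strict_mono zero_less_numeral)
    then show ?thesis by (simp add: indicator_def)
  qed
  finally show ?thesis by (simp add: indicator_inter_arith)
qed

lemma integral_lebesgue_on:
  fixes f :: "'a::euclidean_space => 'b::euclidean_space"
  shows "S \<in> sets lebesgue ==>
    (LINT x|lebesgue_on S. f x) = (LINT x|lebesgue. indicator S x *\<^sub>R f x)"
  by (simp add: integral_restrict_space)

lemma lebesgue_ball: "ball c r \<in> sets lebesgue"
  by simp

lemma locally_integrable_ball:
  assumes "locally_integrable g" "\<rho> < 1"
  shows "integrable (lebesgue_on (ball 0 \<rho>)) g"
proof -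
  have "integrable (lebesgue_on (cball 0 \<rho>)) g"
    using assms unfolding locally_integrable_def
    by (metis cball_subset_ball_iff compact_cball dist_self add.left_neutral)
  then have "integrable lebesgue (\<lambda>x. indicator (cball 0 \<rho>) x *\<^sub>R g x)"
    by (simp add: integrable_restrict_space)
  then have "integrable lebesgue (\<lambda>x. indicator (ball 0 \<rho>) x *\<^sub>R indicator (cball 0 \<rho>) x *\<^sub>R g x)"
    by (rule integrable_mult_indicator[rotated]) simp
  also have "(\<lambda>x. indicator (ball 0 \<rho>) x *\<^sub>R indicator (cball 0 \<rho>) x *\<^sub>R g x) =
      (\<lambda>x. indicator (ball 0 \<rho>) x *\<^sub>R g x)"
    by (auto simp: indicator_def)
  finally show ?thesis by (simp add: integrable_restrict_space)
qed

text \<open>Dominated convergence: the bumps stay between 0 and 1 and tend to the indicator of the box.\<close>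

lemma integral_box_eq_0:
  fixes g :: "'a::euclidean_space => 'b::euclidean_space"
  assumes g: "locally_integrable g"
    and z: "\<And>\<eta>. test_function \<eta> ==> (LINT x|lebesgue_on unit_ball. \<eta> x *\<^sub>R g x) = 0"
    and \<rho>: "0 < \<rho>" "\<rho> < 1"
  shows "set_lebesgue_integral (lebesgue_on (ball 0 \<rho>)) (box c d) g = 0"
proof -
  let ?M = "lebesgue_on (ball (0::'a) \<rho>)"
  have gi: "integrable ?M g" by (rule locally_integrable_ball[OF g \<rho>(2)])
  have meas: "box_bump c d \<rho> m \<in> borel_measurable ?M" for m
  proof (rule continuous_imp_measurable_on_sets_lebesgue)
    show "continuous_on (ball 0 \<rho>) (box_bump c d \<rho> m)"
      using C_k_continuous[of 0 "box_bump c d \<rho> m"] smooth_box_bump[of c d \<rho> m]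
      by (metis continuous_on_subset smooth_def subset_UNIV)
  qed simp
  have "(\<lambda>m. LINT x|?M. box_bump c d \<rho> m x *\<^sub>R g x) \<longlonglongrightarrow>
      (LINT x|?M. indicator (box c d) x *\<^sub>R g x)"
  proof (rule integral_dominated_convergence[where w = "\<lambda>x. norm (g x)"])
    show "AE x in ?M. (\<lambda>m. box_bump c d \<rho> m x *\<^sub>R g x) \<longlonglongrightarrow> indicator (box c d) x *\<^sub>R g x"
    proof (rule AE_I2)
      fix x assume "x \<in> space ?M"
      then have "x \<in> ball 0 \<rho>" by simp
      then have "indicator (box c d \<inter> ball 0 \<rho>) x = (indicator (box c d) x :: real)"
        by (simp add: indicator_def)
      with box_bump_tendsto_indicator[of \<rho> c d x] \<rho>
      show "(\<lambda>m. box_bump c d \<rho> m x *\<^sub>R g x) \<longlonglongrightarrow> indicator (box c d) x *\<^sub>R g x"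
        by (intro tendsto_scaleR tendsto_const) auto
    qed
    show "AE x in ?M. norm (box_bump c d \<rho> m x *\<^sub>R g x) \<le> norm (g x)" for m
      by (rule AE_I2) (simp add: box_bump_nonneg box_bump_le_1 mult_left_le_one_le)
    have bm: "box c d \<inter> ball 0 \<rho> \<in> sets ?M" by (simp add: sets_restrict_space_iff)
    have "(\<lambda>x. indicator (box c d \<inter> ball 0 \<rho>) x *\<^sub>R g x) \<in> borel_measurable ?M"
      by (intro borel_measurable_scaleR borel_measurable_indicator bm borel_measurable_integrable gi)
    then show "(\<lambda>x. indicator (box c d) x *\<^sub>R g x) \<in> borel_measurable ?M"
      by (rule measurable_cong[THEN iffD1, rotated]) (simp add: indicator_def)
    show "(\<lambda>x. box_bump c d \<rho> m x *\<^sub>R g x) \<in> borel_measurable ?M" for m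
      by (intro borel_measurable_scaleR meas borel_measurable_integrable gi)
    show "integrable ?M (\<lambda>x. norm (g x))" using gi by simp
  qed
  moreover have "(LINT x|?M. box_bump c d \<rho> m x *\<^sub>R g x) = 0" for m
  proof -
    have "(LINT x|?M. box_bump c d \<rho> m x *\<^sub>R g x) =
        (LINT x|lebesgue_on unit_ball. box_bump c d \<rho> m x *\<^sub>R g x)"
    proof -
      have "indicator (ball 0 \<rho>) x *\<^sub>R box_bump c d \<rho> m x *\<^sub>R g x =
          indicator unit_ball x *\<^sub>R box_bump c d \<rho> m x *\<^sub>R g x" for x
      proof (cases "x \<in> ball 0 \<rho>")
        case True
        then have "x \<in> unit_ball" using \<rho> by auto
        with True show ?thesis by (simp only: indicator_simps)
      qed (use \<rho> in \<open>simp add: box_bump_eq_0\<close>)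
      then show ?thesis
        by (simp only: integral_lebesgue_on[OF lebesgue_ball])
    qed
    also have "\<dots> = 0" using \<rho> by (intro z test_function_box_bump) auto
    finally show ?thesis .
  qed
  ultimately show ?thesis
    by (simp add: set_lebesgue_integral_def LIMSEQ_const_iff)
qed

text \<open>Boxes form an intersection-stable generator of the Borel sets, and the sets on which the
  integral vanishes are closed under complements and countable disjoint unions.\<close>

lemma borel_integral_eq_0:
  fixes g :: "'a::euclidean_space => 'b::euclidean_space"
  assumes gi: "integrable (lebesgue_on (ball 0 \<rho>)) g"
    and box: "\<And>c d. set_lebesgue_integral (lebesgue_on (ball 0 \<rho>)) (box c d) g = 0"
    and A: "A \<in> sets borel"
  shows "set_lebesgue_integral (lebesgue_on (ball 0 \<rho>)) (A \<inter> ball 0 \<rho>) g = 0"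
proof -
  let ?M = "lebesgue_on (ball (0::'a) \<rho>)"
  let ?G = "range (\<lambda>(a, b). box a b :: 'a set)"
  have sb: "sigma_sets UNIV ?G = sets borel"
    by (subst borel_eq_box) (simp add: sets_measure_of)
  have m: "A \<inter> ball 0 \<rho> \<in> sets ?M" if "A \<in> sets borel" for A
    using that by (simp add: sets_restrict_space_iff)
  have sI: "set_integrable ?M (A \<inter> ball 0 \<rho>) g" if "A \<in> sets borel" for A
    unfolding set_integrable_def by (rule integrable_mult_indicator[OF m[OF that] gi])
  have whole: "set_lebesgue_integral ?M (ball 0 \<rho>) g = 0"
  proof -
    obtain c d where "ball 0 \<rho> \<subseteq> box c (d::'a)"
      using bounded_subset_box_symmetric[OF bounded_ball] by metis
    then have "set_lebesgue_integral ?M (ball 0 \<rho>) g = set_lebesgue_integral ?M (box c d) g"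
      unfolding set_lebesgue_integral_def
      by (intro Bochner_Integration.integral_cong) (auto simp: indicator_def)
    with box show ?thesis by simp
  qed
  have "Int_stable ?G"
    by (rule Int_stableI_image) (auto simp: box_Int_box, blast)
  moreover have "?G \<subseteq> Pow UNIV" by simp
  moreover have "A \<in> sigma_sets UNIV ?G" using A by (simp add: sb)
  ultimately show ?thesis
  proof (induction A rule: sigma_sets_induct_disjoint)
    case (basic A)
    then obtain c d where "A = box c d" by auto
    moreover have "set_lebesgue_integral ?M (box c d \<inter> ball 0 \<rho>) g = set_lebesgue_integral ?M (box c d) g"
      unfolding set_lebesgue_integral_def
      by (intro Bochner_Integration.integral_cong) (auto simp: indicator_def)
    ultimately show ?case using box by simp
  next
    case empty
    then show ?case by (simp add: set_lebesgue_integral_def)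
  next
    case (compl A)
    then have A: "A \<in> sets borel" by (simp add: sb)
    have "set_lebesgue_integral ?M ((A \<inter> ball 0 \<rho>) \<union> ((UNIV - A) \<inter> ball 0 \<rho>)) g
        = set_lebesgue_integral ?M (A \<inter> ball 0 \<rho>) g + set_lebesgue_integral ?M ((UNIV - A) \<inter> ball 0 \<rho>) g"
      using A by (intro set_integral_Un sI) auto
    moreover have "(A \<inter> ball 0 \<rho>) \<union> ((UNIV - A) \<inter> ball 0 \<rho>) = ball 0 \<rho>" by auto
    ultimately show ?case using compl whole by simp
  next
    case (union A)
    then have A: "A i \<in> sets borel" for i by (auto simp: sb)
    have eq: "(\<Union>i. A i) \<inter> ball 0 \<rho> = (\<Union>i. A i \<inter> ball 0 \<rho>)" by auto
    have "set_lebesgue_integral ?M (\<Union>i. A i \<inter> ball 0 \<rho>) g =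
        (\<Sum>i. set_lebesgue_integral ?M (A i \<inter> ball 0 \<rho>) g)"
    proof (rule lebesgue_integral_countable_add)
      show "A i \<inter> ball 0 \<rho> \<in> sets ?M" for i using m A by auto
      show "i \<noteq> j ==> (A i \<inter> ball 0 \<rho>) \<inter> (A j \<inter> ball 0 \<rho>) = {}" for i j
        using union(1) by (auto simp: disjoint_family_on_def)
      show "set_integrable ?M (\<Union>i. A i \<inter> ball 0 \<rho>) g"
        unfolding eq[symmetric] using A by (intro sI) auto
    qed
    also have "\<dots> = 0" by (simp only: union.IH suminf_zero)
    finally show ?case by (simp only: eq)
  qed
qed

text \<open>The fundamental lemma of the calculus of variations. Indicators of boxes are bounded pointwise
  limits of test functions, and boxes generate the Borel sets.\<close>

lemma AE_eq_0_if_test_integrals_0: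
  fixes g :: "'a::euclidean_space => 'b::euclidean_space"
  assumes g: "locally_integrable g"
    and z: "\<And>\<eta>. test_function \<eta> ==> (LINT x|lebesgue_on unit_ball. \<eta> x *\<^sub>R g x) = 0"
  shows "AE x in lebesgue_on unit_ball. g x = 0"
proof -
  have *: "AE x in lebesgue. x \<in> ball 0 \<rho> --> g x = 0" if \<rho>: "0 < \<rho>" "\<rho> < 1" for \<rho>
  proof -
    let ?M = "lebesgue_on (ball (0::'a) \<rho>)"
    interpret M: finite_measure ?M
      by (rule finite_measureI) (use less_imp_neq[OF emeasure_bounded_finite[OF bounded_ball, of 0 \<rho>]] in \<open>simp add: emeasure_restrict_space\<close>)
    have gi: "integrable ?M g" by (rule locally_integrable_ball[OF g \<rho>(2)])
    have "AE x in ?M. g x = 0"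
    proof (rule M.density_zero[OF gi])
      fix A assume "A \<in> sets ?M"
      then have A: "A \<in> sets lebesgue" "A \<subseteq> ball 0 \<rho>" by (auto simp: sets_restrict_space_iff)
      obtain C T where C: "fsigma C" "T \<in> null_sets lebesgue" "C \<union> T = A" "disjnt C T"
        using lebesgue_set_almost_fsigma[OF A(1)] by metis
      have Cb: "C \<in> sets borel"
      proof -
        obtain F :: "nat => 'a set" where F: "\<And>i. closed (F i)" "C = (\<Union>i. F i)"
          using C(1) by (auto simp: fsigma.simps)
        then show ?thesis by auto
      qed
      have "AE x in lebesgue. x \<notin> T" using C(2) by (rule AE_not_in)
      then have ae: "AE x in ?M. x \<notin> T"
        by (auto simp: AE_restrict_space_iff)
      have "set_lebesgue_integral ?M A g = set_lebesgue_integral ?M (C \<inter> ball 0 \<rho>) g"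
        unfolding set_lebesgue_integral_def
      proof (rule integral_cong_AE)
        show "AE x in ?M. indicator A x *\<^sub>R g x = indicator (C \<inter> ball 0 \<rho>) x *\<^sub>R g x"
          using ae by eventually_elim (use C A in \<open>auto simp: indicator_def\<close>)
        have "C \<inter> ball 0 \<rho> \<in> sets ?M" using Cb by (simp add: sets_restrict_space_iff)
        then show "(\<lambda>x. indicator (C \<inter> ball 0 \<rho>) x *\<^sub>R g x) \<in> borel_measurable ?M"
          by (intro borel_measurable_scaleR borel_measurable_indicator borel_measurable_integrable gi)
        show "(\<lambda>x. indicator A x *\<^sub>R g x) \<in> borel_measurable ?M"
          by (intro borel_measurable_scaleR borel_measurable_indicator borel_measurable_integrable gi
              \<open>A \<in> sets ?M\<close>)
      qed
      also have "\<dots> = 0"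
        by (intro borel_integral_eq_0 gi integral_box_eq_0 g z \<rho> Cb)
      finally show "set_lebesgue_integral ?M A g = 0" .
    qed
    then show ?thesis by (simp add: AE_restrict_space_iff)
  qed
  have "AE x in lebesgue. \<forall>k::nat. x \<in> ball 0 (1 - 1 / (real k + 2)) --> g x = 0"
    unfolding AE_all_countable by (intro allI *) (auto simp: field_simps)
  then have "AE x in lebesgue. x \<in> unit_ball --> g x = 0"
  proof eventually_elim
    fix x :: 'a assume x: "\<forall>k::nat. x \<in> ball 0 (1 - 1 / (real k + 2)) --> g x = 0"
    show "x \<in> unit_ball --> g x = 0"
    proof
      assume "x \<in> unit_ball"
      then obtain k where k: "inverse (real (Suc k)) < 1 - norm x"
        using reals_Archimedean[of "1 - norm x"] by auto
      have "1 / (real k + 2) \<le> inverse (real (Suc k))" by (simp add: field_simps)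
      with k have "x \<in> ball 0 (1 - 1 / (real k + 2))" by auto
      with x show "g x = 0" by blast
    qed
  qed
  then show ?thesis by (simp add: AE_restrict_space_iff)
qed

lemma locally_integrable_test_integrable:
  fixes \<eta> :: "'a::euclidean_space => real" and g :: "'a => 'b::euclidean_space"
  assumes "locally_integrable g" "test_function \<eta>"
  shows "integrable (lebesgue_on unit_ball) (\<lambda>x. \<eta> x *\<^sub>R g x)"
proof -
  let ?K = "closure {x. \<eta> x \<noteq> 0}"
  have K: "compact ?K" "?K \<subseteq> unit_ball"
    using assms(2) by (auto simp: test_function_def compact_eq_bounded_closed intro: bounded_subset)
  have cont: "continuous_on UNIV \<eta>"
    using assms(2) by (auto simp: test_function_def smooth_def intro: C_k_continuous[of 0])
  then have "bounded (\<eta> ` ?K)"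
    using K by (intro compact_imp_bounded compact_continuous_image) (auto intro: continuous_on_subset)
  then obtain C where C: "\<And>x. x \<in> ?K ==> norm (\<eta> x) \<le> C" by (auto simp: bounded_iff)
  have gK: "integrable (lebesgue_on ?K) g"
    using assms(1) K by (auto simp: locally_integrable_def)
  have Ks: "?K \<in> sets lebesgue" by (simp add: borel_closed)
  have "integrable (lebesgue_on ?K) (\<lambda>x. \<eta> x *\<^sub>R g x)"
  proof (rule Bochner_Integration.integrable_bound)
    show "integrable (lebesgue_on ?K) (\<lambda>x. C *\<^sub>R g x)" using gK by simp
    show "(\<lambda>x. \<eta> x *\<^sub>R g x) \<in> borel_measurable (lebesgue_on ?K)"
      by (intro borel_measurable_scaleR continuous_imp_measurable_on_sets_lebesgue Ks
          continuous_on_subset[OF cont] subset_UNIV borel_measurable_integrable gK)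
    show "AE x in lebesgue_on ?K. norm (\<eta> x *\<^sub>R g x) \<le> norm (C *\<^sub>R g x)"
    proof (rule AE_I2)
      fix x assume "x \<in> space (lebesgue_on ?K)"
      then have "\<bar>\<eta> x\<bar> \<le> \<bar>C\<bar>" using C[of x] by simp
      then show "norm (\<eta> x *\<^sub>R g x) \<le> norm (C *\<^sub>R g x)" by (simp add: mult_right_mono)
    qed
  qed
  then have "integrable lebesgue (\<lambda>x. indicator ?K x *\<^sub>R \<eta> x *\<^sub>R g x)"
    using Ks by (simp add: integrable_restrict_space)
  also have "(\<lambda>x. indicator ?K x *\<^sub>R \<eta> x *\<^sub>R g x) = (\<lambda>x. indicator unit_ball x *\<^sub>R \<eta> x *\<^sub>R g x)"
  proof
    fix x
    show "indicator ?K x *\<^sub>R \<eta> x *\<^sub>R g x = indicator unit_ball x *\<^sub>R \<eta> x *\<^sub>R g x"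
      using K(2) closure_subset[of "{x. \<eta> x \<noteq> 0}"]
      by (cases "\<eta> x = 0") (auto simp: indicator_def)
  qed
  finally show ?thesis by (simp add: integrable_restrict_space)
qed

text \<open>The difference of two weak derivatives annihilates all test functions. This makes the representative
  chosen in \<open>weak_partial\<close> computable: it agrees a.e. with any weak derivative that can be exhibited.\<close>

lemma has_weak_partial_unique:
  assumes "has_weak_partial e f g" "has_weak_partial e f h"
  shows "AE x in lebesgue_on unit_ball. g x = h x"
proof -
  have gh: "locally_integrable g" "locally_integrable h"
    using assms by (auto simp: has_weak_partial_def)
  have "AE x in lebesgue_on unit_ball. g x - h x = 0"
  proof (rule AE_eq_0_if_test_integrals_0)
    show "locally_integrable (\<lambda>x. g x - h x)"
      using gh by (auto simp: locally_integrable_def)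
    fix \<eta> :: "'a => real" assume \<eta>: "test_function \<eta>"
    then have "(LINT x|lebesgue_on unit_ball. \<eta> x *\<^sub>R g x) = (LINT x|lebesgue_on unit_ball. \<eta> x *\<^sub>R h x)"
      using assms by (auto simp: has_weak_partial_def)
    with gh \<eta> show "(LINT x|lebesgue_on unit_ball. \<eta> x *\<^sub>R (g x - h x)) = 0"
      by (simp add: scaleR_diff_right locally_integrable_test_integrable)
  qed
  then show ?thesis by simp
qed

lemma weak_partial_AE:
  assumes "has_weak_partial e f g"
  shows "AE x in lebesgue_on unit_ball. weak_partial e f x = g x"
proof -
  have "has_weak_partial e f (weak_partial e f)"
    unfolding weak_partial_def by (rule someI[of "has_weak_partial e f", OF assms])
  from has_weak_partial_unique[OF this assms] show ?thesis .
qed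

section \<open>Negative powers of the norm\<close>

text \<open>The integral is compared with the sum of $2^{(j+1)k}$ times the indicator of the ball of radius
  $2^{-j}$.\<close>

lemma nn_integral_inverse_norm_power_finite:
  fixes k :: nat
  assumes k: "k < DIM('a::euclidean_space)"
  shows "(\<integral>\<^sup>+x. ennreal (indicator unit_ball x * inverse (norm (x::'a)) ^ k) \<partial>lborel) < \<infinity>"
proof -
  let ?n = "DIM('a)" and ?w = "measure lborel (ball (0::'a) 1)"
  let ?c = "\<lambda>j::nat. 2 ^ k * ?w * ((1 / 2) ^ (?n - k)) ^ j :: real"
  have pt: "ennreal (indicator unit_ball x * inverse (norm x) ^ k) \<le>
      (\<Sum>j. ennreal (2 ^ ((j + 1) * k)) * indicator (ball 0 ((1 / 2) ^ j)) x)" for x :: 'a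
  proof (cases "x = 0 \<or> x \<notin> unit_ball")
    case True
    show ?thesis
    proof (cases "x = 0 \<and> k = 0")
      case True
      have "ennreal 1 = (\<Sum>j\<in>{0::nat}. ennreal (2 ^ ((j + 1) * k)) * indicator (ball 0 ((1 / 2) ^ j)) x)"
        using True by simp
      also have "\<dots> \<le> (\<Sum>j. ennreal (2 ^ ((j + 1) * k)) * indicator (ball 0 ((1 / 2) ^ j)) x)"
        by (rule sum_le_suminf) auto
      finally show ?thesis using True by simp
    next
      case False
      with True have "indicator unit_ball x * inverse (norm x) ^ k = 0" by auto
      then show ?thesis by (simp only: ennreal_0 zero_le)
    qed
  next
    case False
    then have x: "0 < norm x" "norm x < 1" by auto
    \<comment> \<open>the dyadic shell that contains \<open>x\<close>\<close>
    define j where "j = (LEAST j. (1 / 2) ^ Suc j \<le> norm x)"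
    have ex: "\<exists>j. (1 / 2) ^ Suc j \<le> norm x"
    proof -
      obtain m where "(1 / 2) ^ m < norm x"
        using real_arch_pow_inv[of "norm x" "1 / 2"] x by auto
      moreover have "(1 / 2) ^ Suc m \<le> ((1 / 2) ^ m :: real)" by simp
      ultimately show ?thesis by (intro exI[of _ m]) linarith
    qed
    have j1: "(1 / 2) ^ Suc j \<le> norm x" unfolding j_def by (rule LeastI_ex[OF ex])
    have j2: "norm x < (1 / 2) ^ j"
    proof (cases j)
      case 0
      with x show ?thesis by simp
    next
      case (Suc i)
      then have "i < (LEAST j. (1 / 2) ^ Suc j \<le> norm x)" by (simp add: j_def)
      from not_less_Least[OF this] Suc show ?thesis by simp
    qed
    have "inverse (norm x) \<le> inverse ((1 / 2) ^ Suc j)"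
      using j1 by (intro le_imp_inverse_le) auto
    then have "inverse (norm x) ^ k \<le> (2 ^ Suc j) ^ k"
      by (intro power_mono) (auto simp: power_one_over)
    then have "ennreal (indicator unit_ball x * inverse (norm x) ^ k) \<le> ennreal (2 ^ ((j + 1) * k))"
      using x unfolding power_mult Suc_eq_plus1[symmetric] by (intro ennreal_leI) simp
    also have "\<dots> = (\<Sum>i\<in>{j}. ennreal (2 ^ ((i + 1) * k)) * indicator (ball 0 ((1 / 2) ^ i)) x)"
      using j2 by (simp add: indicator_def)
    also have "\<dots> \<le> (\<Sum>j. ennreal (2 ^ ((j + 1) * k)) * indicator (ball 0 ((1 / 2) ^ j)) x)"
      by (rule sum_le_suminf) auto
    finally show ?thesis .
  qed
  have "(\<integral>\<^sup>+x. ennreal (indicator unit_ball x * inverse (norm (x::'a)) ^ k) \<partial>lborel) \<le>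
      (\<integral>\<^sup>+x. (\<Sum>j. ennreal (2 ^ ((j + 1) * k)) * indicator (ball 0 ((1 / 2) ^ j)) (x::'a)) \<partial>lborel)"
    by (intro nn_integral_mono pt)
  also have "\<dots> = (\<Sum>j. \<integral>\<^sup>+x. ennreal (2 ^ ((j + 1) * k)) * indicator (ball 0 ((1 / 2) ^ j)) (x::'a) \<partial>lborel)"
    by (rule nn_integral_suminf) (intro borel_measurable_times_ennreal borel_measurable_const
        borel_measurable_indicator, simp)
  also have "\<dots> = (\<Sum>j. ennreal (?c j))"
  proof (rule suminf_cong)
    fix j :: nat
    have "emeasure lborel (ball (0::'a) ((1 / 2) ^ j)) = ennreal (((1 / 2) ^ j) ^ ?n * ?w)"
      using content_ball_conv_unit_ball[of "(1 / 2) ^ j" "0::'a"]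
        emeasure_eq_ennreal_measure[of lborel "ball (0::'a) ((1 / 2) ^ j)"]
        emeasure_bounded_finite[of "ball (0::'a) ((1 / 2) ^ j)"] by auto
    then have "(\<integral>\<^sup>+x. ennreal (2 ^ ((j + 1) * k)) * indicator (ball 0 ((1 / 2) ^ j)) (x::'a) \<partial>lborel)
        = ennreal (2 ^ ((j + 1) * k) * (((1 / 2) ^ j) ^ ?n * ?w))"
      by (simp add: nn_integral_cmult_indicator ennreal_mult')
    also have "2 ^ ((j + 1) * k) * (((1 / 2) ^ j) ^ ?n * ?w) = ?c j"
    proof -
      have 1: "((1 / 2 :: real) ^ j) ^ ?n = ((1 / 2) ^ j) ^ (?n - k) * ((1 / 2) ^ j) ^ k"
        using k by (simp flip: power_add)
      have 2: "(2::real) ^ ((j + 1) * k) * ((1 / 2) ^ j) ^ k = 2 ^ k"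
      proof -
        have "(2::real) ^ ((j + 1) * k) * ((1 / 2) ^ j) ^ k = (2 ^ (j + 1) * (1 / 2) ^ j) ^ k"
          by (simp only: power_mult power_mult_distrib)
        also have "2 ^ (j + 1) * (1 / 2) ^ j = (2::real)"
          by (simp add: power_one_over)
        finally show ?thesis .
      qed
      have 3: "((1 / 2 :: real) ^ j) ^ (?n - k) = ((1 / 2) ^ (?n - k)) ^ j"
        by (simp only: mult.commute flip: power_mult)
      have "2 ^ ((j + 1) * k) * (((1 / 2) ^ j) ^ ?n * ?w)
          = (2 ^ ((j + 1) * k) * ((1 / 2) ^ j) ^ k) * ?w * ((1 / 2) ^ j) ^ (?n - k)"
        unfolding 1 by (simp only: ac_simps)
      then show ?thesis by (simp only: 2 3)
    qed
    finally show "(\<integral>\<^sup>+x. ennreal (2 ^ ((j + 1) * k)) * indicator (ball 0 ((1 / 2) ^ j)) (x::'a) \<partial>lborel) = ennreal (?c j)" .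
  qed
  also have "\<dots> = ennreal (\<Sum>j. ?c j)"
  proof (rule suminf_ennreal2)
    have "((1 / 2) ^ (?n - k) :: real) < 1 ^ (?n - k)"
      using k by (intro power_strict_mono) auto
    then show "summable ?c" by (intro summable_mult summable_geometric) simp
  qed auto
  finally show ?thesis by (rule le_less_trans) simp
qed

lemma integrable_inverse_norm_power:
  fixes k :: nat
  assumes k: "k < DIM('a::euclidean_space)"
  shows "integrable (lebesgue_on unit_ball) (\<lambda>x::'a. inverse (norm x) ^ k)"
proof -
  have "integrable lborel (\<lambda>x::'a. indicator unit_ball x * inverse (norm x) ^ k)"
  proof (rule integrableI_nonneg)
    show "(\<lambda>x::'a. indicator unit_ball x * inverse (norm x) ^ k) \<in> borel_measurable lborel"
      by (intro borel_measurable_times borel_measurable_indicator borel_measurable_power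
          borel_measurable_inverse borel_measurable_norm) auto
    show "AE x::'a in lborel. 0 \<le> indicator unit_ball x * inverse (norm x) ^ k" by auto
    show "(\<integral>\<^sup>+x. ennreal (indicator unit_ball x * inverse (norm (x::'a)) ^ k) \<partial>lborel) < \<infinity>"
      by (rule nn_integral_inverse_norm_power_finite[OF k])
  qed
  then have "integrable lebesgue (\<lambda>x::'a. indicator unit_ball x * inverse (norm x) ^ k)"
    by (subst integrable_completion) auto
  then show ?thesis by (simp add: integrable_restrict_space)
qed

section \<open>Symbols: families of functions with a homogeneous singularity at the origin\<close>

abbreviation dd :: "'c::euclidean_space => ('c => 'b::euclidean_space) => 'c => 'b" where
  "dd v F z \<equiv> frechet_derivative F (at z) v"

lemma dd_eqI: "(F has_derivative F') (at z) ==> dd v F z = F' v"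
  by (metis frechet_derivative_at)

lemma dd_works: "F differentiable (at z) ==> (F has_derivative (\<lambda>v. dd v F z)) (at z)"
  by (simp add: frechet_derivative_works)

lemma dd_cong:
  assumes "open S" "z \<in> S" "\<And>z. z \<in> S ==> F z = G z"
  shows "dd v F z = dd v G z"
proof -
  have "(F has_derivative D) (at z) \<longleftrightarrow> (G has_derivative D) (at z)" for D
    using assms by (metis has_derivative_transform_within_open)
  then show ?thesis by (simp add: frechet_derivative_def)
qed

lemma dd_bilinear:
  assumes "bounded_bilinear bl" "F differentiable (at z)" "G differentiable (at z)"
  shows "dd v (\<lambda>z. bl (F z) (G z)) z = bl (F z) (dd v G z) + bl (dd v F z) (G z)"
  by (rule dd_eqI[OF bounded_bilinear.FDERIV[OF assms(1) dd_works[OF assms(2)] dd_works[OF assms(3)]]])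

lemma dd_add:
  assumes "F differentiable (at z)" "G differentiable (at z)"
  shows "dd v (\<lambda>z. F z + G z) z = dd v F z + dd v G z"
  by (rule dd_eqI[OF has_derivative_add[OF dd_works[OF assms(1)] dd_works[OF assms(2)]]])

lemma dd_linear:
  assumes "bounded_linear h" "F differentiable (at z)"
  shows "dd v (\<lambda>z. h (F z)) z = h (dd v F z)"
  by (rule dd_eqI[OF bounded_linear.has_derivative[OF assms(1) dd_works[OF assms(2)]]])

lemma dd_const [simp]: "dd v (\<lambda>z. c) z = 0"
  by simp

definition cyl :: "real => (real \<times> 'a::euclidean_space) set" where
  "cyl d = {-d<..<d} \<times> (unit_ball - {0})"

lemma open_cyl: "open (cyl d)"
  unfolding cyl_def by (intro open_Times open_greaterThanLessThan open_Diff) auto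

lemma cylD: "z \<in> cyl d ==> snd z \<noteq> 0 \<and> norm (snd z) < 1 \<and> 1 \<le> inverse (norm (snd z))"
  by (auto simp: cyl_def one_le_inverse_iff)

definition symb0 :: "real => nat => (real \<times> 'a::euclidean_space => 'b::euclidean_space) => bool" where
  "symb0 d k F \<longleftrightarrow> continuous_on (cyl d) F \<and>
     (\<exists>C. \<forall>z\<in>cyl d. norm (F z) \<le> C * inverse (norm (snd z)) ^ k)"

primrec symb :: "nat => real => nat => (real \<times> 'a::euclidean_space => 'b::euclidean_space) => bool" where
  "symb 0 d k F \<longleftrightarrow> symb0 d k F"
| "symb (Suc N) d k F \<longleftrightarrow> symb0 d k F \<and>
     (\<forall>z\<in>cyl d. F differentiable (at z)) \<and> symb N d k (dd (1, 0) F) \<and>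
     (\<forall>e\<in>Basis. symb N d (Suc k) (dd (0, e) F))"

lemma symb0I:
  assumes "continuous_on (cyl d) F" "\<And>z. z \<in> cyl d ==> norm (F z) \<le> C * inverse (norm (snd z)) ^ k"
  shows "symb0 d k F"
  using assms by (fastforce simp: symb0_def)

lemma symb0E:
  assumes "symb0 d k F"
  obtains C where "continuous_on (cyl d) F" "0 \<le> C"
    "\<And>z. z \<in> cyl d ==> norm (F z) \<le> C * inverse (norm (snd z)) ^ k"
proof -
  from assms obtain C where C: "continuous_on (cyl d) F"
      "\<And>z. z \<in> cyl d ==> norm (F z) \<le> C * inverse (norm (snd z)) ^ k"
    by (auto simp: symb0_def)
  have "norm (F z) \<le> \<bar>C\<bar> * inverse (norm (snd z)) ^ k" if "z \<in> cyl d" for z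
    using C(2)[OF that] by (rule order_trans) (intro mult_right_mono, auto)
  with C(1) that[of "\<bar>C\<bar>"] show ?thesis by auto
qed

lemma symb0_differentiableI:
  assumes "\<And>z. z \<in> cyl d ==> F differentiable (at z)"
    "\<And>z. z \<in> cyl d ==> norm (F z) \<le> C * inverse (norm (snd z)) ^ k"
  shows "symb0 d k F"
  using assms by (intro symb0I continuous_at_imp_continuous_on ballI differentiable_imp_continuous_within)

lemma symb0_cong:
  assumes "symb0 d k F" "\<And>z. z \<in> cyl d ==> F z = G z"
  shows "symb0 d k G"
  using assms unfolding symb0_def by (metis continuous_on_cong)

lemma symb0_const: "symb0 d k (\<lambda>z. c)"
proof (rule symb0I)
  show "norm c \<le> norm c * inverse (norm (snd z)) ^ k" if "z \<in> cyl d" for z :: "real \<times> 'a"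
    using cylD[OF that] one_le_power[of "inverse (norm (snd z))" k]
    by (metis mult_left_mono mult.right_neutral norm_ge_zero)
qed simp

lemma symb0_Suc_weight: 
  assumes "symb0 d k F"
  shows "symb0 d (Suc k) F"
  using assms
proof (rule symb0E)
  fix C assume C: "continuous_on (cyl d) F" "0 \<le> C"
    "\<And>z. z \<in> cyl d ==> norm (F z) \<le> C * inverse (norm (snd z)) ^ k"
  show ?thesis
  proof (rule symb0I)
    show "norm (F z) \<le> C * inverse (norm (snd z)) ^ Suc k" if z: "z \<in> cyl d" for z
    proof -
      have "C * inverse (norm (snd z)) ^ k * 1 \<le> C * inverse (norm (snd z)) ^ k * inverse (norm (snd z))"
        using cylD[OF z] C(2) by (intro mult_left_mono) auto
      also have "\<dots> = C * inverse (norm (snd z)) ^ Suc k" by simp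
      finally show ?thesis using C(3)[OF z] by simp
    qed
  qed (rule C(1))
qed

lemma symb0_add:
  assumes "symb0 d k F" "symb0 d k G"
  shows "symb0 d k (\<lambda>z. F z + G z)"
proof -
  obtain C where C: "continuous_on (cyl d) F"
    "\<And>z. z \<in> cyl d ==> norm (F z) \<le> C * inverse (norm (snd z)) ^ k" using assms(1) by (elim symb0E) blast
  obtain D where D: "continuous_on (cyl d) G"
    "\<And>z. z \<in> cyl d ==> norm (G z) \<le> D * inverse (norm (snd z)) ^ k" using assms(2) by (elim symb0E) blast
  show ?thesis
  proof (rule symb0I)
    show "norm (F z + G z) \<le> (C + D) * inverse (norm (snd z)) ^ k" if "z \<in> cyl d" for z
      using norm_triangle_mono[OF C(2)[OF that] D(2)[OF that]] by (simp add: distrib_right)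
  qed (intro continuous_on_add C D)
qed

lemma symb0_bilinear:
  fixes F :: "real \<times> 'a::euclidean_space => 'b::euclidean_space"
    and G :: "real \<times> 'a => 'c::euclidean_space" and bl :: "'b => 'c => 'd::euclidean_space"
  assumes bl: "bounded_bilinear bl" and "symb0 d k F" "symb0 d l G"
  shows "symb0 d (k + l) (\<lambda>z. bl (F z) (G z))"
proof -
  obtain K where K: "\<And>a b. norm (bl a b) \<le> norm a * norm b * K" "0 \<le> K"
    using bounded_bilinear.nonneg_bounded[OF bl] by auto
  obtain C where C: "continuous_on (cyl d) F"
    "\<And>z. z \<in> cyl d ==> norm (F z) \<le> C * inverse (norm (snd z)) ^ k" using assms(2) by (elim symb0E) blast
  obtain D where D: "continuous_on (cyl d) G"
    "\<And>z. z \<in> cyl d ==> norm (G z) \<le> D * inverse (norm (snd z)) ^ l" using assms(3) by (elim symb0E) blast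
  show ?thesis
  proof (rule symb0I)
    fix z :: "real \<times> 'a" assume z: "z \<in> cyl d"
    have "norm (bl (F z) (G z)) \<le> norm (F z) * norm (G z) * K" by (rule K)
    also have "\<dots> \<le> (C * inverse (norm (snd z)) ^ k) * (D * inverse (norm (snd z)) ^ l) * K"
      by (intro mult_right_mono mult_mono' C(2)[OF z] D(2)[OF z] norm_ge_zero K)
    finally show "norm (bl (F z) (G z)) \<le> (C * D * K) * inverse (norm (snd z)) ^ (k + l)"
      by (simp add: power_add ac_simps)
  qed (intro bounded_bilinear.continuous_on[OF bl] C D)
qed

text \<open>The symbol class \<open>symbol d k\<close>: smooth functions of \<open>(t, x)\<close> for \<open>\<bar>t\<bar> < d\<close> and
  \<open>x\<close> in the punctured ball, of size $|x|^{-k}$, such that each derivative in \<open>x\<close> costs one more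
  power of $|x|^{-1}$ and derivatives in the parameter \<open>t\<close> cost nothing. All maps and fields in
  the sequel belong to such classes, which are closed under the operations that occur, so that
  integrability is a matter of counting powers.\<close>

definition symbol :: "real => nat => (real \<times> 'a::euclidean_space => 'b::euclidean_space) => bool" where
  "symbol d k F \<longleftrightarrow> (\<forall>N. symb N d k F)"

lemma symb_0: "symb N d k F ==> symb0 d k F"
  by (cases N) auto

lemma symb_SucD: "symb (Suc N) d k F ==> symb N d k F"
proof (induction N arbitrary: k F)
  case (Suc N)
  then show ?case by (metis symb.simps(2))
qed auto

lemma symb_cong:
  "symb N d k F ==> (\<And>z. z \<in> cyl d ==> F z = G z) ==> symb N d k G"
proof (induction N arbitrary: k F G)
  case 0
  then show ?case unfolding symb.simps by (rule symb0_cong)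
next
  case (Suc N)
  have dd: "dd v F z = dd v G z" if "z \<in> cyl d" for v z
    using open_cyl that Suc.prems(2) by (rule dd_cong)
  have "symb0 d k G" using symb_0[OF Suc.prems(1)] Suc.prems(2) by (rule symb0_cong)
  moreover have "G differentiable (at z)" if z: "z \<in> cyl d" for z
  proof -
    have "(F has_derivative (\<lambda>v. dd v F z)) (at z)" using Suc.prems z by (intro dd_works) auto
    then have "(G has_derivative (\<lambda>v. dd v F z)) (at z)"
      by (rule has_derivative_transform_within_open[OF _ open_cyl z Suc.prems(2)])
    then show ?thesis by (auto simp: differentiable_def)
  qed
  moreover have "symb N d k (dd (1, 0) G)"
    by (rule Suc.IH[where F = "dd (1, 0) F"]) (use Suc.prems(1) dd in auto)
  moreover have "symb N d (Suc k) (dd (0, e) G)" if "e \<in> Basis" for e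
    by (rule Suc.IH[where F = "dd (0, e) F"]) (use Suc.prems(1) dd that in auto)
  ultimately show ?case by simp
qed

lemma symb_SucI:
  assumes "symb0 d k F" "\<And>z. z \<in> cyl d ==> (F has_derivative F' z) (at z)"
    and "symb N d k (\<lambda>z. F' z (1, 0))" "\<And>e. e \<in> Basis ==> symb N d (Suc k) (\<lambda>z. F' z (0, e))"
  shows "symb (Suc N) d k F"
proof -
  have dd: "F' z v = dd v F z" if "z \<in> cyl d" for v z
    using dd_eqI[OF assms(2)[OF that], of v] by simp
  have "symb N d k (dd (1, 0) F)" by (rule symb_cong[OF assms(3) dd])
  moreover have "symb N d (Suc k) (dd (0, e) F)" if "e \<in> Basis" for e
    by (rule symb_cong[OF assms(4)[OF that] dd])
  ultimately show ?thesis using assms(1,2) by (auto simp: differentiable_def)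
qed

lemma symb_const: "symb N d k (\<lambda>z. c)"
proof (induction N arbitrary: k c)
  case (Suc N)
  show ?case
    by (rule symb_SucI[where F' = "\<lambda>z v. 0"]) (use Suc symb0_const in auto)
qed (simp add: symb0_const)

lemma symb_Suc_weight: "symb N d k F ==> symb N d (Suc k) F"
proof (induction N arbitrary: k F)
  case (Suc N)
  with symb0_Suc_weight[OF symb_0[OF Suc.prems]] show ?case by auto
qed (simp add: symb0_Suc_weight)

lemma symb_mono_weight: "symb N d k F ==> k \<le> l ==> symb N d l F"
  by (induction l) (auto simp: le_Suc_eq intro: symb_Suc_weight)

lemma symb_add: "symb N d k F ==> symb N d k G ==> symb N d k (\<lambda>z. F z + G z)"
proof (induction N arbitrary: k F G)
  case (Suc N)
  show ?case
    by (rule symb_SucI[where F' = "\<lambda>z v. dd v F z + dd v G z"])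
      (use Suc symb0_add[OF symb_0[OF Suc.prems(1)] symb_0[OF Suc.prems(2)]]
        in \<open>auto intro!: has_derivative_add dd_works\<close>)
qed (simp add: symb0_add)

text \<open>Weights add under multiplication, and the Leibniz rule preserves this after each differentiation.\<close>

lemma symb_bilinear:
  fixes F :: "real \<times> 'a::euclidean_space => 'b::euclidean_space"
    and G :: "real \<times> 'a => 'c::euclidean_space" and bl :: "'b => 'c => 'd::euclidean_space"
  assumes bl: "bounded_bilinear bl"
  shows "symb N d k F ==> symb N d l G ==> symb N d (k + l) (\<lambda>z. bl (F z) (G z))"
proof (induction N arbitrary: k l F G)
  case 0
  then show ?case by (simp add: symb0_bilinear[OF bl])
next
  case (Suc N)
  have F: "symb N d k F" and G: "symb N d l G" using Suc.prems by (auto dest: symb_SucD simp del: symb.simps)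
  show ?case
  proof (rule symb_SucI[where F' = "\<lambda>z v. bl (F z) (dd v G z) + bl (dd v F z) (G z)"])
    show "symb0 d (k + l) (\<lambda>z. bl (F z) (G z))" using Suc.IH[OF F G] by (rule symb_0)
    show "((\<lambda>z. bl (F z) (G z)) has_derivative (\<lambda>v. bl (F z) (dd v G z) + bl (dd v F z) (G z))) (at z)"
      if "z \<in> cyl d" for z
      using Suc.prems that by (intro bounded_bilinear.FDERIV[OF bl] dd_works) auto
    show "symb N d (k + l) (\<lambda>z. bl (F z) (dd (1, 0) G z) + bl (dd (1, 0) F z) (G z))"
      using Suc.prems by (intro symb_add Suc.IH F G) auto
    show "symb N d (Suc (k + l)) (\<lambda>z. bl (F z) (dd (0, e) G z) + bl (dd (0, e) F z) (G z))" if "e \<in> Basis" for e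
      using Suc.prems that Suc.IH[OF F, of "Suc l" "dd (0, e) G"] Suc.IH[OF _ G, of "Suc k" "dd (0, e) F"]
      by (intro symb_add) auto
  qed
qed

lemmas symb_mult = symb_bilinear[OF bounded_bilinear_mult]
lemmas symb_scaleR = symb_bilinear[OF bounded_bilinear_scaleR]
lemmas symb_inner = symb_bilinear[OF bounded_bilinear_inner]

lemma symb_linear:
  assumes h: "bounded_linear h"
  shows "symb N d k F ==> symb N d k (\<lambda>z. h (F z))"
proof -
  have "bounded_bilinear (\<lambda>(c::real) b. c *\<^sub>R h b)"
    using h by (intro bounded_bilinear.comp[OF bounded_bilinear_scaleR bounded_linear_ident])
  from symb_bilinear[OF this symb_const[of N d 0 1]] show "symb N d k F ==> symb N d k (\<lambda>z. h (F z))"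
    by simp
qed

lemma symD: "symbol d k F ==> symb N d k F"
  by (simp add: symbol_def)

lemma sym_differentiable: "symbol d k F ==> z \<in> cyl d ==> F differentiable (at z)"
  using symD[of d k F "Suc 0"] by simp

lemma sym_continuous: "symbol d k F ==> continuous_on (cyl d) F"
  using symD[of d k F 0] by (simp add: symb0_def)

lemma sym_bound:
  assumes "symbol d k F"
  obtains C where "0 \<le> C" "\<And>z. z \<in> cyl d ==> norm (F z) \<le> C * inverse (norm (snd z)) ^ k"
  by (rule symb0E[OF symD[OF assms, of 0, unfolded symb.simps]]) (rule that)

lemma sym_dt:
  assumes "symbol d k F"
  shows "symbol d k (dd (1, 0) F)"
proof -
  have "symb N d k (dd (1, 0) F)" for N
    using symD[OF assms, of "Suc N"] by simp
  then show ?thesis by (simp add: symbol_def)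
qed

lemma sym_dx:
  assumes "symbol d k F" "e \<in> Basis"
  shows "symbol d (Suc k) (dd (0, e) F)"
proof -
  have "symb N d (Suc k) (dd (0, e) F)" for N
    using symD[OF assms(1), of "Suc N"] assms(2) by simp
  then show ?thesis by (simp add: symbol_def)
qed

lemma sym_cong: "symbol d k F ==> (\<And>z. z \<in> cyl d ==> F z = G z) ==> symbol d k G"
  unfolding symbol_def by (blast intro: symb_cong)

lemma sym_const [simp]: "symbol d k (\<lambda>z. c)"
  by (simp add: symbol_def symb_const)

lemma sym_mono: "symbol d k F ==> k \<le> l ==> symbol d l F"
  by (auto simp: symbol_def intro: symb_mono_weight)

lemma sym_add: "symbol d k F ==> symbol d k G ==> symbol d k (\<lambda>z. F z + G z)"
  by (simp add: symbol_def symb_add)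

lemma sym_bilinear:
  "bounded_bilinear bl ==> symbol d k F ==> symbol d l G ==> symbol d (k + l) (\<lambda>z. bl (F z) (G z))"
  by (simp add: symbol_def symb_bilinear)

lemmas sym_mult = sym_bilinear[OF bounded_bilinear_mult]
lemmas sym_scaleR = sym_bilinear[OF bounded_bilinear_scaleR]
lemmas sym_inner = sym_bilinear[OF bounded_bilinear_inner]

lemma sym_linear: "bounded_linear h ==> symbol d k F ==> symbol d k (\<lambda>z. h (F z))"
  by (simp add: symbol_def symb_linear)

lemma sym_minus: "symbol d k F ==> symbol d k (\<lambda>z. - F z)"
  using sym_linear[OF bounded_linear_minus[OF bounded_linear_ident]] by blast

lemma sym_diff: "symbol d k F ==> symbol d k G ==> symbol d k (\<lambda>z. F z - G z)"
  using sym_add[OF _ sym_minus, of d k F G] by simp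

lemma sym_cmult: "symbol d k F ==> symbol d k (\<lambda>z. c *\<^sub>R F z)"
  using sym_linear[OF bounded_linear_scaleR_right] by blast

lemma sym_sum: "(\<And>i. i \<in> I ==> symbol d k (F i)) ==> symbol d k (\<lambda>z. \<Sum>i\<in>I. F i z)"
  by (induction I rule: infinite_finite_induct) (auto intro: sym_add)

lemma sym_power:
  assumes "symbol d k F"
  shows "symbol d (m * k) (\<lambda>z. (F z :: real) ^ m)"
proof (induction m)
  case (Suc m)
  from sym_mult[OF assms Suc] show ?case by (simp add: add.commute)
qed simp

subsection \<open>Basic symbols\<close>

definition qq :: "real \<times> 'a::euclidean_space => real" where "qq z = inverse (norm (snd z))"
definition uu :: "real \<times> 'a::euclidean_space => 'a" where "uu z = sgn (snd z)"

lemma norm_uu: "z \<in> cyl d ==> uu z \<bullet> uu z = 1"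
  by (auto simp: uu_def norm_sgn dot_square_norm dest!: cylD)

lemma has_derivative_norm_snd:
  assumes "z \<in> cyl d"
  shows "((\<lambda>z. norm (snd z)) has_derivative (\<lambda>v. uu z \<bullet> snd v)) (at z)"
proof -
  have "(norm has_derivative (\<lambda>h. h \<bullet> sgn (snd z))) (at (snd z))"
    using cylD[OF assms] by (intro has_derivative_norm) auto
  from has_derivative_compose[OF has_derivative_snd[OF has_derivative_ident] this]
  show ?thesis by (simp add: uu_def inner_commute)
qed

lemma has_derivative_qq:
  assumes "z \<in> cyl d"
  shows "(qq has_derivative (\<lambda>v. - (qq z ^ 2 * (uu z \<bullet> snd v)))) (at z)"
proof -
  have "((\<lambda>z. inverse (norm (snd z))) has_derivative (\<lambda>v. - (qq z * (uu z \<bullet> snd v) * qq z))) (at z)"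
    unfolding qq_def by (rule Deriv.has_derivative_inverse[OF _ has_derivative_norm_snd[OF assms]])
      (use cylD[OF assms] in auto)
  then show ?thesis by (simp add: qq_def[abs_def] power2_eq_square ac_simps)
qed

lemma has_derivative_uu:
  assumes "z \<in> cyl d"
  shows "(uu has_derivative (\<lambda>v. qq z *\<^sub>R (snd v - (uu z \<bullet> snd v) *\<^sub>R uu z))) (at z)"
proof -
  have eq: "uu z = qq z *\<^sub>R snd z" for z :: "real \<times> 'a"
    by (simp add: uu_def qq_def sgn_div_norm)
  have "((\<lambda>z. qq z *\<^sub>R snd z) has_derivative (\<lambda>v. qq z *\<^sub>R snd v + - (qq z ^ 2 * (uu z \<bullet> snd v)) *\<^sub>R snd z)) (at z)"
    by (rule has_derivative_scaleR[OF has_derivative_qq[OF assms] has_derivative_snd[OF has_derivative_ident]])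
  then show ?thesis
    by (simp add: eq[abs_def] power2_eq_square scaleR_diff_right ac_simps)
qed

text \<open>The derivatives of $|x|^{-1}$ and $x/|x|$ are polynomials in the same two functions, with one
  more power of $|x|^{-1}$; hence the joint induction.\<close>

lemma symb_qq_uu: "symb N d 1 (qq :: real \<times> 'a::euclidean_space => real) \<and> symb N d 0 (uu :: real \<times> 'a => 'a)"
proof -
  have q0: "symb0 d (Suc 0) (qq :: real \<times> 'a => real)"
    by (rule symb0_differentiableI[where C = 1]) (auto simp: differentiable_def intro: has_derivative_qq simp: qq_def)
  have u0: "symb0 d 0 (uu :: real \<times> 'a => 'a)"
    by (rule symb0_differentiableI[where C = 1])
      (auto simp: differentiable_def intro: has_derivative_uu simp: uu_def norm_sgn)
  show ?thesis
  proof (induction N)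
    case (Suc N)
    then have q: "symb N d 1 (qq :: real \<times> 'a => real)" and u: "symb N d 0 (uu :: real \<times> 'a => 'a)" by auto
    have "symb N d 2 (\<lambda>z. - (qq z ^ 2 * (uu z \<bullet> e)))" for e :: 'a
      using symb_linear[OF bounded_linear_minus[OF bounded_linear_ident]
          symb_mult[OF symb_mult[OF q q] symb_inner[OF u symb_const[of N d 0 e]]]]
      by (simp add: power2_eq_square numeral_2_eq_2)
    moreover have "symb N d 1 (\<lambda>z. qq z *\<^sub>R (e - (uu z \<bullet> e) *\<^sub>R uu z))" for e :: 'a
    proof -
      have "symb N d 0 (\<lambda>z. e + (-1) *\<^sub>R ((uu z \<bullet> e) *\<^sub>R uu z))"
        using symb_add[OF symb_const symb_linear[OF bounded_linear_scaleR_right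
          symb_scaleR[OF symb_inner[OF u symb_const[of N d 0 e]] u]], of e "-1"] by simp
      from symb_scaleR[OF q this] show ?thesis by simp
    qed
    ultimately show ?case
      using symb_SucI[OF q0 has_derivative_qq, where N = N] symb_SucI[OF u0 has_derivative_uu, where N = N]
      by (simp add: symb_const numeral_2_eq_2 del: symb.simps)
  qed (use q0 u0 in simp_all)
qed

lemma sym_qq: "symbol d 1 qq" and sym_uu: "symbol d 0 uu"
  using symb_qq_uu by (auto simp: symbol_def)

lemma sym_qq_power: "symbol d m (\<lambda>z. qq z ^ m)"
  using sym_power[OF sym_qq, of d m] by simp

lemma symb_linearI:
  assumes "bounded_linear f" "\<And>v z. z \<in> cyl d ==> norm (f z) \<le> C"
  shows "symbol d 0 f"
  unfolding symbol_def
proof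
  fix N
  have d: "(f has_derivative f) (at z)" for z by (rule bounded_linear_imp_has_derivative[OF assms(1)])
  have "symb0 d 0 f"
    by (rule symb0_differentiableI[where C = C]) (use d assms in \<open>auto simp: differentiable_def\<close>)
  then show "symb N d 0 f"
    by (cases N) (auto intro!: symb_SucI[OF _ d] symb_const simp del: symb.simps(2))
qed

lemma sym_fst: "symbol d 0 (fst :: real \<times> 'a::euclidean_space => real)"
  by (rule symb_linearI[where C = d]) (auto simp: bounded_linear_fst cyl_def)

text \<open>Composition with a function that is bounded together with its derivatives; the inner function
  itself may be unbounded, as \<open>ln \<bar>x\<bar>\<close> is.\<close>

lemma sym_compose:
  fixes G :: "real \<times> 'a::euclidean_space => real"
  assumes h: "derivative_sequence h" "\<And>j s. \<bar>h j s\<bar> \<le> B j"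
    and G: "\<And>z. z \<in> cyl d ==> G differentiable (at z)" "symbol d 0 (dd (1, 0) G)"
      "\<And>e. e \<in> Basis ==> symbol d 1 (dd (0, e) G)"
  shows "symbol d 0 (\<lambda>z. h j (G z))"
  unfolding symbol_def
proof
  fix N
  have d: "((\<lambda>z. h j (G z)) has_derivative (\<lambda>v. h (Suc j) (G z) * dd v G z)) (at z)"
    if "z \<in> cyl d" for z j
    using has_derivative_compose[OF dd_works[OF G(1)[OF that]]
        derivative_sequenceD[OF h(1), unfolded has_field_derivative_def]]
    by simp
  have s0: "symb0 d 0 (\<lambda>z. h j (G z))" for j
    by (rule symb0_differentiableI[where C = "B j"]) (use d h(2) in \<open>auto simp: differentiable_def\<close>)
  show "symb N d 0 (\<lambda>z. h j (G z))"
  proof (induction N arbitrary: j)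
    case (Suc N)
    show ?case
    proof (rule symb_SucI[OF s0 d])
      show "symb N d 0 (\<lambda>z. h (Suc j) (G z) * dd (1, 0) G z)"
        using symb_mult[OF Suc symD[OF G(2)]] by simp
      show "symb N d (Suc 0) (\<lambda>z. h (Suc j) (G z) * dd (0, e) G z)" if "e \<in> Basis" for e
        using symb_mult[OF Suc symD[OF G(3)[OF that]]] by simp
    qed
  qed (simp add: s0)
qed

lemma sym_compose_sym:
  fixes G :: "real \<times> 'a::euclidean_space => real"
  assumes "derivative_sequence h" "\<And>j s. \<bar>h j s\<bar> \<le> B j" "symbol d 0 G"
  shows "symbol d 0 (\<lambda>z. h j (G z))"
  by (rule sym_compose[OF assms(1,2)])
    (use assms(3) sym_dt[OF assms(3)] sym_dx[OF assms(3)] in \<open>auto intro: sym_differentiable\<close>)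

lemma derivative_sequence_sin: "derivative_sequence (\<lambda>j s. sin (s + real j * pi / 2))"
  unfolding derivative_sequence_def
proof (intro allI)
  fix j :: nat and s :: real
  have "s + real (Suc j) * pi / 2 = (s + real j * pi / 2) + pi / 2" by (simp add: field_simps)
  then have "sin (s + real (Suc j) * pi / 2) = cos (s + real j * pi / 2)"
    by (simp only: sin_add) simp
  then show "((\<lambda>s. sin (s + real j * pi / 2)) has_real_derivative sin (s + real (Suc j) * pi / 2)) (at s)"
    by (auto intro!: derivative_eq_intros)
qed

lemma sym_sin_shift:
  assumes "symbol d 0 G"
  shows "symbol d 0 (\<lambda>z. sin (G z + real j * pi / 2))"
  by (rule sym_compose_sym[OF derivative_sequence_sin _ assms, of "\<lambda>_. 1"]) (rule abs_sin_le_one)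

lemma
  fixes G :: "real \<times> 'a::euclidean_space => real"
  shows sym_sin: "symbol d 0 G ==> symbol d 0 (\<lambda>z. sin (G z))"
  and sym_cos: "symbol d 0 G ==> symbol d 0 (\<lambda>z. cos (G z))"
  using sym_sin_shift[of d G 0] sym_sin_shift[of d G 1] by (simp_all add: sin_add)

text \<open>The map $y \mapsto |y|^{-1}$ has unbounded derivatives near 0. As \<open>Y\<close> stays away from 0, the
  derivative of the inverse norm is a polynomial in the inverse norm, \<open>Y\<close> and its derivatives, and
  induction on the order applies.\<close>

lemma sym_inverse_norm:
  fixes Y :: "real \<times> 'a::euclidean_space => 'b::euclidean_space"
  assumes Y: "symbol d 0 Y" and c: "0 < c" "\<And>z. z \<in> cyl d ==> c \<le> norm (Y z)"
  shows "symbol d 0 (\<lambda>z. inverse (norm (Y z)))"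
  unfolding symbol_def
proof
  fix N
  let ?r = "\<lambda>z. inverse (norm (Y z))"
  have d: "(?r has_derivative (\<lambda>v. - (?r z * (?r z * (?r z * (Y z \<bullet> dd v Y z)))))) (at z)" if z: "z \<in> cyl d" for z
  proof -
    have nz: "Y z \<noteq> 0" using c(1) c(2)[OF z] by auto
    have "(norm has_derivative (\<lambda>h. h \<bullet> sgn (Y z))) (at (Y z))"
      using nz by (intro has_derivative_norm) auto
    from has_derivative_compose[OF dd_works[OF sym_differentiable[OF Y z]] this]
    have "((\<lambda>z. norm (Y z)) has_derivative (\<lambda>v. dd v Y z \<bullet> sgn (Y z))) (at z)" .
    from Deriv.has_derivative_inverse[OF _ this] nz
    have "(?r has_derivative (\<lambda>v. - (?r z * (dd v Y z \<bullet> sgn (Y z)) * ?r z))) (at z)" by simp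
    then show ?thesis by (simp add: sgn_div_norm inner_commute ac_simps divide_inverse)
  qed
  have s0: "symb0 d 0 ?r"
  proof (rule symb0_differentiableI[where C = "inverse c"])
    show "norm (?r z) \<le> inverse c * inverse (norm (snd z)) ^ 0" if "z \<in> cyl d" for z
      using c(1) c(2)[OF that] by (simp add: le_imp_inverse_le)
  qed (use d in \<open>auto simp: differentiable_def\<close>)
  show "symb N d 0 ?r"
  proof (induction N)
    case (Suc N)
    show ?case
    proof (rule symb_SucI[OF s0 d])
      have *: "symb N d k (\<lambda>z. - (?r z * (?r z * (?r z * (Y z \<bullet> Z z)))))" if "symb N d k Z" for Z k
        using symb_linear[OF bounded_linear_minus[OF bounded_linear_ident] symb_mult[OF Suc symb_mult[OF Suc symb_mult[OF Suc symb_inner[OF symD[OF Y] that]]]]]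
        by simp
      show "symb N d 0 (\<lambda>z. - (?r z * (?r z * (?r z * (Y z \<bullet> dd (1, 0) Y z)))))"
        by (rule *[OF symD[OF sym_dt[OF Y]]])
      show "symb N d (Suc 0) (\<lambda>z. - (?r z * (?r z * (?r z * (Y z \<bullet> dd (0, e) Y z)))))" if "e \<in> Basis" for e
        by (rule *[OF symD[OF sym_dx[OF Y that]]])
    qed
  qed (simp add: s0)
qed

lemma sym_sgn:
  fixes Y :: "real \<times> 'a::euclidean_space => 'b::euclidean_space"
  assumes Y: "symbol d 0 Y" and c: "0 < c" "\<And>z. z \<in> cyl d ==> c \<le> norm (Y z)"
  shows "symbol d 0 (\<lambda>z. sgn (Y z))"
  using sym_scaleR[OF sym_inverse_norm[OF assms] Y] by (simp add: sgn_div_norm)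

lemma test_function_bounded:
  assumes "smooth \<eta>" shows "bounded (\<eta> ` ball 0 1)"
proof -
  have "continuous_on UNIV \<eta>" using assms C_k_continuous[of 0 \<eta>] unfolding smooth_def by blast
  then have "compact (\<eta> ` cball 0 1)"
    by (intro compact_continuous_image) (auto intro: continuous_on_subset)
  then show ?thesis
    by (rule compact_imp_bounded[THEN bounded_subset]) (intro image_mono ball_subset_cball)
qed

lemma symb0_smooth:
  assumes "smooth \<eta>" shows "symb0 d 0 (\<lambda>z. \<eta> (snd z))"
proof -
  obtain C where C: "\<forall>x\<in>ball 0 1. norm (\<eta> x) \<le> C"
    using test_function_bounded[OF assms] by (auto simp: bounded_iff)
  have "C_k 0 \<eta>" using assms by (simp only: smooth_def)
  then have "continuous_on UNIV \<eta>" by simp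
  then have "continuous_on (cyl d) (\<lambda>z. \<eta> (snd z))"
    by (intro continuous_on_compose2[of UNIV \<eta> _ snd] continuous_intros) auto
  then show ?thesis
    by (rule symb0I[where C = C]) (use C in \<open>auto simp: cyl_def\<close>)
qed

lemma symb_C_k:
  "(\<forall>k. C_k k \<eta>) ==> symb N d 0 (\<lambda>z. \<eta> (snd z))"
proof (induction N arbitrary: \<eta>)
  case (0 \<eta>)
  then show ?case by (simp add: symb0_smooth smooth_def)
next
  case (Suc N \<eta>)
  have s0: "symb0 d 0 (\<lambda>z. \<eta> (snd z))"
    using Suc.prems by (intro symb0_smooth) (simp add: smooth_def)
  have df: "\<eta> differentiable (at x)" for x using Suc.prems[rule_format, of 1] by simp
  have d: "((\<lambda>z. \<eta> (snd z)) has_derivative (\<lambda>v. dd (snd v) \<eta> (snd z))) (at z)" for z :: "real \<times> 'a"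
    by (rule has_derivative_compose[OF has_derivative_snd[OF has_derivative_ident] dd_works[OF df]])
  show ?case
  proof (rule symb_SucI[OF s0 d])
    have "dd 0 \<eta> x = 0" for x using dd_works[OF df] has_derivative_bounded_linear linear_simps(3) by blast
    then show "symb N d 0 (\<lambda>z. dd (snd (1, 0)) \<eta> (snd z))" by (simp add: symb_const)
    show "symb N d (Suc 0) (\<lambda>z. dd (snd (0, e)) \<eta> (snd z))" if "e \<in> Basis" for e
    proof -
      have "\<forall>k. C_k k (dd e \<eta>)" using Suc.prems that by (metis C_k.simps(2))
      from symb_Suc_weight[OF Suc.IH[OF this]] show ?thesis by simp
    qed
  qed
qed

lemma sym_smooth: "smooth \<eta> ==> symbol d 0 (\<lambda>z. \<eta> (snd z))"
  by (simp add: symbol_def smooth_def symb_C_k)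

subsection \<open>Symmetry of second derivatives\<close>

text \<open>A second difference is \<open>h\<^sup>2\<close> times a mixed second derivative at an intermediate point.\<close>

lemma second_difference:
  fixes f :: "'c::euclidean_space => real"
  assumes h: "0 < h"
    and sub: "\<And>s k. 0 \<le> s ==> s \<le> h ==> 0 \<le> k ==> k \<le> h ==> z + s *\<^sub>R v + k *\<^sub>R w \<in> S"
    and f: "\<And>y. y \<in> S ==> f differentiable (at y)"
    and fv: "\<And>y. y \<in> S ==> dd v f differentiable (at y)"
  shows "\<exists>s k. 0 < s \<and> s < h \<and> 0 < k \<and> k < h \<and>
    f (z + h *\<^sub>R v + h *\<^sub>R w) - f (z + h *\<^sub>R v) - f (z + h *\<^sub>R w) + f z
      = h * h * dd w (dd v f) (z + s *\<^sub>R v + k *\<^sub>R w)"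
proof -
  have dline: "((\<lambda>s. g (p + s *\<^sub>R a)) has_real_derivative dd a g (p + s *\<^sub>R a)) (at s)"
    if "g differentiable (at (p + s *\<^sub>R a))" for g :: "'c => real" and p a s
  proof -
    have l: "((\<lambda>s. p + s *\<^sub>R a) has_derivative (\<lambda>t. t *\<^sub>R a)) (at s)"
      by (auto intro!: derivative_eq_intros)
    have D: "(g has_derivative (\<lambda>v. dd v g (p + s *\<^sub>R a))) (at (p + s *\<^sub>R a))"
      using that by (rule dd_works)
    have "t * dd a g (p + s *\<^sub>R a) = dd (t *\<^sub>R a) g (p + s *\<^sub>R a)" for t
      using linear_scale[OF has_derivative_linear[OF D], of t a] by simp
    with has_derivative_compose[OF l D] show ?thesis
      by (auto intro!: has_derivative_imp_has_field_derivative)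
  qed
  define g where "g s = f (z + h *\<^sub>R w + s *\<^sub>R v) - f (z + s *\<^sub>R v)" for s
  have in1: "z + h *\<^sub>R w + s *\<^sub>R v \<in> S" if "0 \<le> s" "s \<le> h" for s
    using sub[of s h] that h by (simp add: ac_simps)
  have in2: "z + s *\<^sub>R v \<in> S" if "0 \<le> s" "s \<le> h" for s
    using sub[of s 0] that h by simp
  have "(g has_real_derivative dd v f (z + h *\<^sub>R w + s *\<^sub>R v) - dd v f (z + s *\<^sub>R v)) (at s)"
    if "0 \<le> s" "s \<le> h" for s
    unfolding g_def by (intro DERIV_diff dline f in1 in2 that)
  from MVT2[OF h this] obtain s where s: "0 < s" "s < h"
    "g h - g 0 = h * (dd v f (z + h *\<^sub>R w + s *\<^sub>R v) - dd v f (z + s *\<^sub>R v))" by auto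
  have in3: "z + s *\<^sub>R v + k *\<^sub>R w \<in> S" if "0 \<le> k" "k \<le> h" for k
    using sub[of s k] that s by simp
  have "((\<lambda>k. dd v f (z + s *\<^sub>R v + k *\<^sub>R w)) has_real_derivative
      dd w (dd v f) (z + s *\<^sub>R v + k *\<^sub>R w)) (at k)" if "0 \<le> k" "k \<le> h" for k
    by (intro dline fv in3 that)
  from MVT2[OF h this] obtain k where k: "0 < k" "k < h"
    "dd v f (z + s *\<^sub>R v + h *\<^sub>R w) - dd v f (z + s *\<^sub>R v + 0 *\<^sub>R w)
      = (h - 0) * dd w (dd v f) (z + s *\<^sub>R v + k *\<^sub>R w)" by auto
  have "f (z + h *\<^sub>R v + h *\<^sub>R w) - f (z + h *\<^sub>R v) - f (z + h *\<^sub>R w) + f z = g h - g 0"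
    by (simp add: g_def ac_simps)
  also have "\<dots> = h * (dd v f (z + s *\<^sub>R v + h *\<^sub>R w) - dd v f (z + s *\<^sub>R v + 0 *\<^sub>R w))"
    unfolding s(3) by (simp add: ac_simps)
  also have "\<dots> = h * h * dd w (dd v f) (z + s *\<^sub>R v + k *\<^sub>R w)"
    unfolding k(3) by simp
  finally show ?thesis using s k by blast
qed

text \<open>Both mixed derivatives are limits of the same second difference quotient.\<close>

lemma dd_commute_real:
  fixes f :: "'c::euclidean_space => real"
  assumes S: "open S" "z \<in> S"
    and f: "\<And>y. y \<in> S ==> f differentiable (at y)"
    and fv: "\<And>y. y \<in> S ==> dd v f differentiable (at y)"
    and fw: "\<And>y. y \<in> S ==> dd w f differentiable (at y)"
    and c: "continuous_on S (dd w (dd v f))" "continuous_on S (dd v (dd w f))"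
  shows "dd w (dd v f) z = dd v (dd w f) z"
proof (rule ccontr)
  let ?A = "dd w (dd v f)" and ?B = "dd v (dd w f)"
  assume ne: "?A z \<noteq> ?B z"
  define \<epsilon> where "\<epsilon> = \<bar>?A z - ?B z\<bar> / 2"
  have \<epsilon>: "0 < \<epsilon>" using ne by (simp add: \<epsilon>_def)
  have "isCont ?A z" "isCont ?B z"
    using c S by (auto simp: continuous_on_eq_continuous_at)
  then obtain d1 d2 where d: "0 < d1" "\<And>y. dist y z < d1 ==> dist (?A y) (?A z) < \<epsilon>"
    "0 < d2" "\<And>y. dist y z < d2 ==> dist (?B y) (?B z) < \<epsilon>"
    using \<epsilon> unfolding continuous_at_eps_delta by metis
  obtain d3 where d3: "0 < d3" "ball z d3 \<subseteq> S" using S openE by blast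
  define d where "d = Min {d1, d2, d3}"
  have dp: "0 < d" using d d3 by (simp add: d_def)
  define h where "h = d / 2 / (norm v + norm w + 1)"
  have np: "0 < norm v + norm w + 1" by (smt (verit) norm_ge_zero)
  have h: "0 < h" using dp np by (simp add: h_def)
  have near: "dist (z + s *\<^sub>R v + k *\<^sub>R w) z < d" if "0 \<le> s" "s \<le> h" "0 \<le> k" "k \<le> h" for s k
  proof -
    have "dist (z + s *\<^sub>R v + k *\<^sub>R w) z \<le> norm (s *\<^sub>R v) + norm (k *\<^sub>R w)"
      by (simp add: dist_norm add.assoc norm_triangle_ineq del: norm_scaleR)
    also have "\<dots> \<le> h * norm v + h * norm w"
      using that by (auto intro!: add_mono mult_right_mono)
    also have "\<dots> \<le> h * (norm v + norm w + 1)" using h by (simp add: algebra_simps)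
    also have "\<dots> = d / 2" using np unfolding h_def by (metis less_numeral_extra(3) nonzero_eq_divide_eq)
    also have "\<dots> < d" using dp by simp
    finally show ?thesis .
  qed
  have inS: "z + s *\<^sub>R v + k *\<^sub>R w \<in> S" if "0 \<le> s" "s \<le> h" "0 \<le> k" "k \<le> h" for s k
    using near[OF that] d3 by (auto simp: d_def dist_commute)
  have inS': "z + s *\<^sub>R w + k *\<^sub>R v \<in> S" if "0 \<le> s" "s \<le> h" "0 \<le> k" "k \<le> h" for s k
    using inS[OF that(3,4,1,2)] by (simp add: ac_simps)
  obtain s k where 1: "0 < s" "s < h" "0 < k" "k < h"
    "f (z + h *\<^sub>R v + h *\<^sub>R w) - f (z + h *\<^sub>R v) - f (z + h *\<^sub>R w) + f z = h * h * ?A (z + s *\<^sub>R v + k *\<^sub>R w)"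
    using second_difference[OF h inS f fv] by blast
  obtain s' k' where 2: "0 < s'" "s' < h" "0 < k'" "k' < h"
    "f (z + h *\<^sub>R w + h *\<^sub>R v) - f (z + h *\<^sub>R w) - f (z + h *\<^sub>R v) + f z = h * h * ?B (z + s' *\<^sub>R w + k' *\<^sub>R v)"
    using second_difference[OF h inS' f fw] by blast
  have "h * h * ?A (z + s *\<^sub>R v + k *\<^sub>R w) = h * h * ?B (z + s' *\<^sub>R w + k' *\<^sub>R v)"
    unfolding 1(5)[symmetric] 2(5)[symmetric] by (simp add: ac_simps)
  then have AB: "?A (z + s *\<^sub>R v + k *\<^sub>R w) = ?B (z + k' *\<^sub>R v + s' *\<^sub>R w)"
    using h by (simp add: ac_simps)
  have "dist (?A (z + s *\<^sub>R v + k *\<^sub>R w)) (?A z) < \<epsilon>"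
    using near[of s k] 1 by (intro d(2)) (auto simp: d_def)
  moreover have "dist (?B (z + k' *\<^sub>R v + s' *\<^sub>R w)) (?B z) < \<epsilon>"
    using near[of k' s'] 2 by (intro d(4)) (auto simp: d_def)
  ultimately show False
    unfolding AB \<epsilon>_def dist_real_def by (auto simp: abs_if split: if_splits)
qed

lemma dd_commute:
  fixes f :: "'c::euclidean_space => 'b::euclidean_space"
  assumes S: "open S" "z \<in> S"
    and f: "\<And>y. y \<in> S ==> f differentiable (at y)"
    and fv: "\<And>y. y \<in> S ==> dd v f differentiable (at y)"
    and fw: "\<And>y. y \<in> S ==> dd w f differentiable (at y)"
    and c: "continuous_on S (dd w (dd v f))" "continuous_on S (dd v (dd w f))"
  shows "dd w (dd v f) z = dd v (dd w f) z"
proof (rule euclidean_eqI)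
  fix b :: 'b assume "b \<in> Basis"
  let ?g = "\<lambda>y. f y \<bullet> b"
  have lin: "bounded_linear (\<lambda>x. x \<bullet> b)" by (rule bounded_linear_inner_left)
  have g1: "dd a ?g y = dd a f y \<bullet> b" if "y \<in> S" for a y
    by (rule dd_linear[OF lin f[OF that]])
  have g2: "dd a (dd a' ?g) y = dd a (dd a' f) y \<bullet> b" if "y \<in> S" "dd a' f differentiable (at y)" for a a' y
  proof -
    have "dd a (dd a' ?g) y = dd a (\<lambda>y. dd a' f y \<bullet> b) y"
      by (rule dd_cong[OF S(1) that(1) g1])
    also have "\<dots> = dd a (dd a' f) y \<bullet> b" by (rule dd_linear[OF lin that(2)])
    finally show ?thesis .
  qed
  have g3: "dd a ?g differentiable (at y)" if "y \<in> S" "dd a f differentiable (at y)" for a y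
  proof -
    have "((\<lambda>y. dd a f y \<bullet> b) has_derivative (\<lambda>v. dd v (dd a f) y \<bullet> b)) (at y)"
      by (rule bounded_linear.has_derivative[OF lin dd_works[OF that(2)]])
    from has_derivative_transform_within_open[OF this S(1) that(1) g1[symmetric]]
    show ?thesis by (auto simp: differentiable_def)
  qed
  have "dd w (dd v ?g) z = dd v (dd w ?g) z"
  proof (rule dd_commute_real[OF S])
    show "?g differentiable (at y)" if "y \<in> S" for y
      using bounded_linear.has_derivative[OF lin dd_works[OF f[OF that]]] by (auto simp: differentiable_def)
    show "continuous_on S (dd w (dd v ?g))"
      by (rule continuous_on_eq[OF continuous_on_inner[OF c(1) continuous_on_const]]) (simp add: g2 fv)
    show "continuous_on S (dd v (dd w ?g))"
      by (rule continuous_on_eq[OF continuous_on_inner[OF c(2) continuous_on_const]]) (simp add: g2 fw)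
  qed (use g3 fv fw in auto)
  then show "dd w (dd v f) z \<bullet> b = dd v (dd w f) z \<bullet> b"
    using S(2) by (simp add: g2 fv fw)
qed

definition dirs :: "(real \<times> 'a::euclidean_space) set" where
  "dirs = insert (1, 0) (Pair 0 ` Basis)"

lemma dirs_simps [simp]: "(1, 0) \<in> dirs" "(0, e) \<in> dirs \<longleftrightarrow> e \<in> Basis"
  by (auto simp: dirs_def)

lemma sym_dd: "symbol d k F ==> v \<in> dirs ==> symbol d (Suc k) (dd v F)"
  by (auto simp: dirs_def intro: sym_dx sym_mono[OF sym_dt])

lemma sym_dd_commute:
  assumes "symbol d k F" "v \<in> dirs" "w \<in> dirs" "z \<in> cyl d"
  shows "dd v (dd w F) z = dd w (dd v F) z"
  by (rule dd_commute[OF open_cyl assms(4)]; (rule sym_differentiable sym_continuous)?)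
    (rule assms sym_dd | assumption)+

section \<open>Integration of symbols\<close>

lemma AE_lebesgue_ball_nz: "AE x in lebesgue_on (unit_ball::'a::euclidean_space set). x \<noteq> 0 \<and> x \<in> unit_ball"
proof -
  have "AE x in lebesgue. (x::'a) \<noteq> 0"
    using AE_completion[OF AE_lborel_singleton[of "0::'a"]] .
  then show ?thesis by (auto simp: AE_restrict_space_iff elim!: eventually_mono)
qed

lemma AE_cyl: "\<bar>t\<bar> < d ==> AE x in lebesgue_on unit_ball. (t, x) \<in> cyl d"
  using AE_lebesgue_ball_nz by eventually_elim (auto simp: cyl_def)

lemma borel_measurable_AE_ball:
  fixes f g :: "'a::euclidean_space => 'b::euclidean_space"
  assumes f: "f \<in> borel_measurable (lebesgue_on unit_ball)"
    and ae: "AE x in lebesgue_on unit_ball. f x = g x"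
  shows "g \<in> borel_measurable (lebesgue_on unit_ball)"
proof -
  have "(\<lambda>x. indicator unit_ball x *\<^sub>R f x) \<in> borel_measurable lebesgue"
    using f by (simp add: borel_measurable_restrict_space_iff mult.commute)
  moreover have "AE x in lebesgue. indicator unit_ball x *\<^sub>R f x = indicator unit_ball x *\<^sub>R g x"
    using ae by (auto simp: AE_restrict_space_iff indicator_def)
  ultimately have "(\<lambda>x. indicator unit_ball x *\<^sub>R g x) \<in> borel_measurable lebesgue"
    by (rule borel_measurable_AE)
  then show ?thesis by (simp add: borel_measurable_restrict_space_iff mult.commute)
qed

lemma measurable_slice:
  fixes F :: "real \<times> 'a::euclidean_space => 'b::euclidean_space"
  assumes F: "symbol d k F" and t: "\<bar>t\<bar> < d"
  shows "(\<lambda>x. F (t, x)) \<in> borel_measurable (lebesgue_on unit_ball)"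
proof -
  let ?B = "unit_ball - {0::'a}"
  have c: "continuous_on ?B (\<lambda>x. F (t, x))"
    by (rule continuous_on_compose2[OF sym_continuous[OF F]])
      (use t in \<open>auto simp: cyl_def intro!: continuous_intros\<close>)
  have B: "?B \<in> sets borel" by (intro borel_open open_delete open_ball)
  have "(\<lambda>x. F (t, x)) \<in> borel_measurable (restrict_space borel ?B)"
    using c by (rule borel_measurable_continuous_on_restrict)
  then have "(\<lambda>x. indicator ?B x *\<^sub>R F (t, x)) \<in> borel_measurable borel"
    using B by (simp add: borel_measurable_restrict_space_iff)
  then have "(\<lambda>x. indicator ?B x *\<^sub>R F (t, x)) \<in> borel_measurable lebesgue"
    by (intro measurable_completion) simp
  then have m: "(\<lambda>x. indicator ?B x *\<^sub>R F (t, x)) \<in> borel_measurable (lebesgue_on unit_ball)"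
    by (rule measurable_restrict_space1)
  show ?thesis
    by (rule borel_measurable_AE_ball[OF m])
      (use AE_lebesgue_ball_nz in eventually_elim, simp add: indicator_def)
qed

lemma integrable_slice:
  fixes F :: "real \<times> 'a::euclidean_space => 'b::euclidean_space"
  assumes F: "symbol d k F" and t: "\<bar>t\<bar> < d" and k: "k < DIM('a)"
  shows "integrable (lebesgue_on unit_ball) (\<lambda>x. F (t, x))"
proof -
  obtain C where C: "0 \<le> C" "\<And>z. z \<in> cyl d ==> norm (F z) \<le> C * inverse (norm (snd z)) ^ k"
    using sym_bound[OF F] by blast
  show ?thesis
  proof (rule Bochner_Integration.integrable_bound)
    show "integrable (lebesgue_on unit_ball) (\<lambda>x::'a. C * inverse (norm x) ^ k)"
      using integrable_inverse_norm_power[OF k] by (rule integrable_mult_right)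
    show "(\<lambda>x. F (t, x)) \<in> borel_measurable (lebesgue_on unit_ball)" by (rule measurable_slice[OF F t])
    show "AE x in lebesgue_on unit_ball. norm (F (t, x)) \<le> norm (C * inverse (norm x) ^ k)"
      using AE_cyl[OF t] by eventually_elim (use C in force)
  qed
qed

lemma has_derivative_slice:
  assumes F: "symbol d k F" and z: "(t, x) \<in> cyl d"
  shows "((\<lambda>x. F (t, x)) has_derivative (\<lambda>h. dd (0, h) F (t, x))) (at x)"
proof -
  have "((\<lambda>x. (t, x)) has_derivative (\<lambda>h. (0, h))) (at x)"
    by (intro has_derivative_Pair has_derivative_const has_derivative_ident)
  from has_derivative_compose[OF this dd_works[OF sym_differentiable[OF F z]]] show ?thesis .
qed

lemma has_derivative_time:
  assumes F: "symbol d k F" and z: "(t, x) \<in> cyl d"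
  shows "((\<lambda>t. F (t, x)) has_derivative (\<lambda>h. dd (h, 0) F (t, x))) (at t)"
proof -
  have "((\<lambda>t. (t, x)) has_derivative (\<lambda>h. (h, 0))) (at t)"
    by (intro has_derivative_Pair has_derivative_const has_derivative_ident)
  from has_derivative_compose[OF this dd_works[OF sym_differentiable[OF F z]]] show ?thesis .
qed

lemma has_real_derivative_time:
  fixes F :: "real \<times> 'a::euclidean_space => real"
  assumes F: "symbol d k F" and z: "(t, x) \<in> cyl d"
  shows "((\<lambda>t. F (t, x)) has_real_derivative dd (1, 0) F (t, x)) (at t)"
proof (rule has_derivative_imp_has_field_derivative[OF has_derivative_time[OF assms]])
  fix h
  have "linear (\<lambda>v. dd v F (t, x))"
    using has_derivative_linear[OF dd_works[OF sym_differentiable[OF F z]]] .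
  from linear_scale[OF this, of h "(1, 0)"]
  show "h * dd (1, 0) F (t, x) = dd (h, 0) F (t, x)" by simp
qed

lemma dd_slice_cong:
  assumes F: "symbol d k F" and G: "symbol d l G" and eq: "\<And>x. (t, x) \<in> cyl d ==> F (t, x) = G (t, x)"
    and z: "(t, x) \<in> cyl d"
  shows "dd (0, e) F (t, x) = dd (0, e) G (t, x)"
proof -
  have "open (unit_ball - {0})" by (intro open_delete open_ball)
  moreover have "x \<in> unit_ball - {0}" using z by (auto simp: cyl_def)
  moreover have "F (t, y) = G (t, y)" if "y \<in> unit_ball - {0}" for y
    using that z by (intro eq) (auto simp: cyl_def)
  ultimately have "((\<lambda>x. G (t, x)) has_derivative (\<lambda>h. dd (0, h) F (t, x))) (at x)"
    by (intro has_derivative_transform_within_open[OF has_derivative_slice[OF F z]])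
  from fun_cong[OF has_derivative_unique[OF this has_derivative_slice[OF G z]], of e] show ?thesis .
qed

subsection \<open>Integrals of partial derivatives vanish\<close>

text \<open>The integral of \<open>f\<close> is invariant under translations, so the integral of a difference quotient is
  0; its limit is the integral of the derivative.\<close>

lemma integral_partial_C1_eq_0:
  fixes f :: "'a::euclidean_space => real"
  assumes d: "\<And>x. (f has_derivative f' x) (at x)" and c: "continuous_on UNIV (\<lambda>x. f' x e)"
    and K: "\<And>x. x \<notin> unit_ball ==> f x = 0"
  shows "(LINT x|lborel. f' x e) = 0"
proof -
  have cf: "continuous_on UNIV f"
    using has_derivative_continuous[OF d] by (simp add: continuous_on_eq_continuous_within)
  have f'0: "f' x e = 0" if "x \<notin> cball 0 1" for x
  proof -
    have "(f has_derivative (\<lambda>_. 0)) (at x)"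
    proof (rule has_derivative_transform_within_open[OF has_derivative_const[of 0]])
      show "open (- cball (0::'a) 1)" by (intro open_Compl closed_cball)
    qed (use that K in auto)
    from has_derivative_unique[OF d this] show ?thesis by simp
  qed
  have "compact ((\<lambda>x. f' x e) ` cball 0 1)"
    by (intro compact_continuous_image continuous_on_subset[OF c]) auto
  then have "bounded ((\<lambda>x. f' x e) ` cball 0 1)" by (rule compact_imp_bounded)
  then obtain M where M: "\<forall>x\<in>cball 0 1. norm (f' x e) \<le> M"
    unfolding bounded_iff by blast
  then have M0: "0 \<le> M" using order_trans[OF norm_ge_zero, of "f' 0 e" M] by simp
  have M': "\<bar>f' x e\<bar> \<le> M" for x using M M0 f'0[of x] by (cases "x \<in> cball 0 1") auto
  have fb: "integrable lborel f"
  proof -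
    have "integrable lborel (\<lambda>x. indicator (cball 0 1) x *\<^sub>R f x)"
      by (intro borel_integrable_compact[unfolded set_integrable_def] compact_cball continuous_on_subset[OF cf]) auto
    also have "(\<lambda>x. indicator (cball 0 1) x *\<^sub>R f x) = f"
      using K by (auto simp: indicator_def fun_eq_iff)
    finally show ?thesis .
  qed
  have tr: "integrable lborel (\<lambda>x. f (x + a))" "(LINT x|lborel. f (x + a)) = integral\<^sup>L lborel f" for a
  proof -
    have "integrable (distr lborel borel ((+) a)) f" using fb by (simp only: lborel_distr_plus)
    then show "integrable lborel (\<lambda>x. f (x + a))"
      by (subst (asm) integrable_distr_eq) (use cf in \<open>auto intro: borel_measurable_continuous_onI simp: add.commute\<close>)
    have "integral\<^sup>L lborel f = integral\<^sup>L (distr lborel borel ((+) a)) f" by (simp only: lborel_distr_plus)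
    also have "\<dots> = (LINT x|lborel. f (x + a))"
      by (subst integral_distr) (use cf in \<open>auto intro: borel_measurable_continuous_onI simp: add.commute\<close>)
    finally show "(LINT x|lborel. f (x + a)) = integral\<^sup>L lborel f" by simp
  qed
  \<comment> \<open>step sizes with \<open>\<tau> n * norm e \<le> 1\<close>, so that the translates stay supported in a fixed ball\<close>
  define \<tau> where "\<tau> n = inverse (real (Suc n)) / (norm e + 1)" for n
  have np: "0 < norm e + 1" by (smt (verit) norm_ge_zero)
  have \<tau>: "0 < \<tau> n" "\<tau> n * norm e \<le> 1" for n
  proof -
    show "0 < \<tau> n" using np by (simp add: \<tau>_def)
    have "\<tau> n * norm e \<le> \<tau> n * (norm e + 1)" using \<open>0 < \<tau> n\<close> by simp
    also have "\<dots> = inverse (real (Suc n))" using np unfolding \<tau>_def by (metis less_numeral_extra(3) nonzero_eq_divide_eq)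
    also have "\<dots> \<le> 1" by (simp add: inverse_le_1_iff)
    finally show "\<tau> n * norm e \<le> 1" .
  qed
  have \<tau>0: "\<tau> \<longlonglongrightarrow> 0"
    unfolding \<tau>_def using tendsto_divide[OF LIMSEQ_inverse_real_of_nat tendsto_const[of "norm e + 1"]] np by simp
  have dl: "((\<lambda>s. f (x + s *\<^sub>R e)) has_real_derivative f' (x + s *\<^sub>R e) e) (at s)" for x s
  proof -
    have l: "((\<lambda>s. x + s *\<^sub>R e) has_derivative (\<lambda>t. t *\<^sub>R e)) (at s)"
      by (auto intro!: derivative_eq_intros)
    have "t * f' (x + s *\<^sub>R e) e = f' (x + s *\<^sub>R e) (t *\<^sub>R e)" for t
      using linear_scale[OF has_derivative_linear[OF d], of "x + s *\<^sub>R e" t e] by simp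
    with has_derivative_compose[OF l d] show ?thesis
      by (auto intro!: has_derivative_imp_has_field_derivative)
  qed
  have "(\<lambda>n. LINT x|lborel. (f (x + \<tau> n *\<^sub>R e) - f x) / \<tau> n) \<longlonglongrightarrow> (LINT x|lborel. f' x e)"
  proof (rule integral_dominated_convergence[where w = "\<lambda>x. M * indicator (cball 0 2) x"])
    show "(\<lambda>x. f' x e) \<in> borel_measurable lborel" using c by (simp add: borel_measurable_continuous_onI)
    show "(\<lambda>x. (f (x + \<tau> n *\<^sub>R e) - f x) / \<tau> n) \<in> borel_measurable lborel" for n
      using borel_measurable_integrable[OF tr(1)] borel_measurable_integrable[OF fb] by simp
    show "integrable lborel (\<lambda>x::'a. M * indicator (cball 0 2) x)"
      using emeasure_bounded_finite[OF bounded_cball, of "0::'a" 2]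
      by (intro integrable_mult_right integrable_real_indicator) simp_all
    show "AE x in lborel. (\<lambda>n. (f (x + \<tau> n *\<^sub>R e) - f x) / \<tau> n) \<longlonglongrightarrow> f' x e"
    proof (rule AE_I2)
      fix x
      have "((\<lambda>h. (f (x + (0 + h) *\<^sub>R e) - f (x + 0 *\<^sub>R e)) / h) \<longlongrightarrow> f' x e) (at 0)"
        using dl[of x 0] by (simp add: DERIV_def)
      moreover have "filterlim \<tau> (at 0) sequentially"
        unfolding filterlim_at using \<tau>0 \<tau>(1) by (auto intro!: always_eventually simp: less_imp_neq[OF \<tau>(1), symmetric])
      ultimately show "(\<lambda>n. (f (x + \<tau> n *\<^sub>R e) - f x) / \<tau> n) \<longlonglongrightarrow> f' x e"
        using filterlim_compose[of "\<lambda>h. (f (x + h *\<^sub>R e) - f x) / h"] by simp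
    qed
    show "AE x in lborel. norm ((f (x + \<tau> n *\<^sub>R e) - f x) / \<tau> n) \<le> M * indicator (cball 0 2) x" for n
    proof (rule AE_I2)
      fix x
      obtain s where s: "f (x + \<tau> n *\<^sub>R e) - f (x + 0 *\<^sub>R e) = (\<tau> n - 0) * f' (x + s *\<^sub>R e) e"
        using MVT2[OF \<tau>(1)[of n] dl[of x]] by auto
      show "norm ((f (x + \<tau> n *\<^sub>R e) - f x) / \<tau> n) \<le> M * indicator (cball 0 2) x"
      proof (cases "x \<in> cball 0 2")
        case True
        have "(f (x + \<tau> n *\<^sub>R e) - f x) / \<tau> n = f' (x + s *\<^sub>R e) e"
          using s \<tau>(1)[of n] by simp
        with True M' show ?thesis by simp
      next
        case False
        then have "2 < norm x" by simp
        have "norm x \<le> norm (x + \<tau> n *\<^sub>R e) + norm (\<tau> n *\<^sub>R e)"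
          by (metis add_diff_cancel_right' norm_triangle_ineq4)
        then have "1 < norm (x + \<tau> n *\<^sub>R e)"
          using \<open>2 < norm x\<close> \<tau>[of n] by simp
        then have "f (x + \<tau> n *\<^sub>R e) = 0" "f x = 0" using \<open>2 < norm x\<close> by (auto intro!: K)
        with False show ?thesis by simp
      qed
    qed
  qed
  moreover have "(LINT x|lborel. (f (x + \<tau> n *\<^sub>R e) - f x) / \<tau> n) = 0" for n
    using tr fb by simp
  ultimately have "(\<lambda>n::nat. 0) \<longlonglongrightarrow> (LINT x|lborel. f' x e)" by (simp only:)
  then show ?thesis by (simp add: LIMSEQ_const_iff)
qed

text \<open>The cut-off \<open>exp_inv 0 (m\<^sup>2 \<bar>x\<bar>\<^sup>2 - 1)\<close> vanishes for \<open>\<bar>x\<bar> \<le> 1 / m\<close>, tends to 1, and its gradient is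
  bounded by a multiple of $|x|^{-1}$ uniformly in \<open>m\<close>.\<close>

definition hole :: "nat => 'a::euclidean_space => real" where
  "hole m x = exp_inv 0 ((real m)\<^sup>2 * (x \<bullet> x) - 1)"

definition hole' :: "nat => 'a::euclidean_space => 'a => real" where
  "hole' m x v = exp_inv 1 ((real m)\<^sup>2 * (x \<bullet> x) - 1) * ((real m)\<^sup>2 * (2 * (x \<bullet> v)))"

lemma has_derivative_hole: "(hole m has_derivative hole' m x) (at x)"
proof -
  have "((\<lambda>x. (real m)\<^sup>2 * (x \<bullet> x) - 1) has_derivative (\<lambda>v. (real m)\<^sup>2 * (2 * (x \<bullet> v)))) (at x)"
    by (auto intro!: derivative_eq_intros simp: inner_commute)
  from has_derivative_compose[OF this derivative_sequenceD[OF derivative_sequence_exp_inv, of 0, unfolded has_field_derivative_def]]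
  show ?thesis by (simp add: hole_def[abs_def] hole'_def[abs_def])
qed

lemma exp_inv_1_le:
  assumes "0 < y" shows "\<bar>exp_inv 1 y * (y + 1)\<bar> \<le> 3" "\<bar>exp_inv 1 y\<bar> \<le> 1 / y\<^sup>2"
proof -
  define w where "w = 1 / y"
  have w: "0 < w" "y = 1 / w" using assms by (auto simp: w_def)
  have e: "exp_inv 1 y = w\<^sup>2 * exp (- w)" using assms by (simp add: exp_inv_def poly_monom w_def)
  have "exp (- w) \<le> 1" using w by simp
  then have "w\<^sup>2 * exp (- w) \<le> w\<^sup>2" by (simp add: mult_left_le)
  then show "\<bar>exp_inv 1 y\<bar> \<le> 1 / y\<^sup>2" unfolding e by (simp add: w_def power_divide)
  have "w * y = 1" using w by simp
  moreover have "exp_inv 1 y * (y + 1) = (w * (w * y) + w\<^sup>2) * exp (- w)"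
    unfolding e by (simp add: algebra_simps power2_eq_square)
  ultimately have "exp_inv 1 y * (y + 1) = (w + w\<^sup>2) * exp (- w)" by simp
  also have "\<dots> \<le> 3 * exp w * exp (- w)"
  proof (rule mult_right_mono)
    have "1 + w + w\<^sup>2 / 2 \<le> exp w" using exp_lower_Taylor_quadratic[of w] w by simp
    moreover have "0 \<le> w\<^sup>2" by simp
    ultimately show "w + w\<^sup>2 \<le> 3 * exp w" using w(1) by linarith
  qed simp
  also have "\<dots> = 3" by (simp add: exp_minus)
  finally have "exp_inv 1 y * (y + 1) \<le> 3" .
  moreover have "0 \<le> exp_inv 1 y * (y + 1)" unfolding e using assms by simp
  ultimately show "\<bar>exp_inv 1 y * (y + 1)\<bar> \<le> 3" by simp
qed

lemma hole'_eq: "hole' m x v * (norm x)\<^sup>2 = exp_inv 1 ((real m)\<^sup>2 * (x \<bullet> x) - 1) * (((real m)\<^sup>2 * (x \<bullet> x) - 1) + 1) * (2 * (x \<bullet> v))"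
  by (simp add: hole'_def dot_square_norm)

lemma hole'_le:
  assumes "x \<noteq> 0" "norm v \<le> 1" shows "\<bar>hole' m x v\<bar> \<le> 6 * inverse (norm x)"
proof -
  let ?y = "(real m)\<^sup>2 * (x \<bullet> x) - 1"
  have "\<bar>exp_inv 1 ?y * (?y + 1)\<bar> \<le> 3"
    using exp_inv_1_le(1)[of ?y] by (cases "0 < ?y") (auto simp: exp_inv_def)
  moreover have "\<bar>2 * (x \<bullet> v)\<bar> \<le> 2 * norm x"
    using Cauchy_Schwarz_ineq2[of x v] assms(2) mult_left_le[of "norm v" "norm x"] by auto
  ultimately have "\<bar>hole' m x v * (norm x)\<^sup>2\<bar> \<le> 3 * (2 * norm x)"
    unfolding hole'_eq abs_mult[of _ "2 * (x \<bullet> v)"] by (intro mult_mono) auto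
  then have "\<bar>hole' m x v\<bar> * norm x * norm x \<le> 6 * norm x"
    by (simp add: abs_mult power2_eq_square)
  then have "\<bar>hole' m x v\<bar> * norm x \<le> 6" using assms(1) by simp
  then show ?thesis using assms(1) by (simp add: field_simps)
qed

lemma hole_tendsto:
  fixes x :: "'a::euclidean_space"
  assumes "x \<noteq> 0"
  shows "(\<lambda>m. hole m x) \<longlonglongrightarrow> 1" "(\<lambda>m. hole' m x v) \<longlonglongrightarrow> 0"
proof -
  have p: "0 < x \<bullet> x" using assms by simp
  have sq: "filterlim (\<lambda>m::nat. (real m)\<^sup>2) at_top sequentially"
    by (intro filterlim_pow_at_top filterlim_real_sequentially) simp
  then have "filterlim (\<lambda>m. - 1 + (x \<bullet> x) * (real m)\<^sup>2) at_top sequentially"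
    using p by (intro filterlim_tendsto_add_at_top[OF tendsto_const] filterlim_tendsto_pos_mult_at_top[OF tendsto_const])
  then have y: "filterlim (\<lambda>m. (real m)\<^sup>2 * (x \<bullet> x) - 1) at_top sequentially"
    by (simp add: algebra_simps)
  then have ev: "\<forall>\<^sub>F m in sequentially. 0 < (real m)\<^sup>2 * (x \<bullet> x) - 1"
    unfolding filterlim_at_top_dense by blast
  have i: "(\<lambda>m. inverse ((real m)\<^sup>2 * (x \<bullet> x) - 1)) \<longlonglongrightarrow> 0"
    by (rule tendsto_inverse_0_at_top[OF y])
  have "(\<lambda>m. exp (- inverse ((real m)\<^sup>2 * (x \<bullet> x) - 1))) \<longlonglongrightarrow> exp (- 0)"
    by (intro tendsto_intros i)
  then show "(\<lambda>m. hole m x) \<longlonglongrightarrow> 1"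
    by (rule Lim_transform_eventually[THEN tendsto_eq_rhs])
      (use ev in eventually_elim, auto simp: hole_def exp_inv_0 divide_inverse)
  have quot: "(1 / y\<^sup>2) * (y + 1) = (inverse y)\<^sup>2 + inverse y" if "0 < y" for y :: real
    using that by (simp add: field_simps power2_eq_square)
  show "(\<lambda>m. hole' m x v) \<longlonglongrightarrow> 0"
  proof (rule Lim_null_comparison)
    let ?y = "\<lambda>m. (real m)\<^sup>2 * (x \<bullet> x) - 1"
    show "\<forall>\<^sub>F m in sequentially. norm (hole' m x v) \<le> ((inverse (?y m))\<^sup>2 + inverse (?y m)) * (2 * \<bar>x \<bullet> v\<bar> / (x \<bullet> x))"
      using ev
    proof eventually_elim
      fix m assume m: "0 < ?y m"
      have "hole' m x v = exp_inv 1 (?y m) * (?y m + 1) * (2 * (x \<bullet> v) / (x \<bullet> x))"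
        using p by (simp add: hole'_def)
      then have "\<bar>hole' m x v\<bar> = \<bar>exp_inv 1 (?y m)\<bar> * \<bar>?y m + 1\<bar> * (2 * \<bar>x \<bullet> v\<bar> / (x \<bullet> x))"
        using p by (simp add: abs_mult)
      also have "\<dots> \<le> (1 / (?y m)\<^sup>2) * (?y m + 1) * (2 * \<bar>x \<bullet> v\<bar> / (x \<bullet> x))"
        using exp_inv_1_le(2)[OF m] m p by (intro mult_right_mono mult_mono) auto
      also have "(1 / (?y m)\<^sup>2) * (?y m + 1) = (inverse (?y m))\<^sup>2 + inverse (?y m)"
        using quot[OF m] .
      finally show "norm (hole' m x v) \<le> ((inverse (?y m))\<^sup>2 + inverse (?y m)) * (2 * \<bar>x \<bullet> v\<bar> / (x \<bullet> x))" by simp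
    qed
    have "(\<lambda>m. ((inverse (?y m))\<^sup>2 + inverse (?y m)) * (2 * \<bar>x \<bullet> v\<bar> / (x \<bullet> x))) \<longlonglongrightarrow> (0\<^sup>2 + 0) * (2 * \<bar>x \<bullet> v\<bar> / (x \<bullet> x))"
      by (intro tendsto_mult tendsto_add tendsto_power i tendsto_const)
    then show "(\<lambda>m. ((inverse (?y m))\<^sup>2 + inverse (?y m)) * (2 * \<bar>x \<bullet> v\<bar> / (x \<bullet> x))) \<longlonglongrightarrow> 0" by simp
  qed
qed

lemma hole_bounds: "0 \<le> hole m x" "hole m x \<le> 1"
  by (auto simp: hole_def exp_inv_0_bounds)

lemma hole_eq_0: "real m * norm x \<le> 1 ==> hole m x = 0"
proof -
  assume "real m * norm x \<le> 1"
  then have "(real m * norm x)\<^sup>2 \<le> 1" by (simp add: power_le_one)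
  then show ?thesis by (simp add: hole_def exp_inv_0 dot_square_norm power_mult_distrib)
qed

text \<open>The singularity at the origin is removed by the cut-offs \<open>hole\<close>. The term in which the cut-off is
  differentiated is dominated by an integrable power of $|x|^{-1}$ and tends to 0 pointwise, so the
  origin contributes nothing.\<close>

lemma integral_partial_symbol_real:
  fixes G :: "real \<times> 'a::euclidean_space => real"
  assumes G: "symbol d k G" and k: "Suc k < DIM('a)" and t: "\<bar>t\<bar> < d" and e: "e \<in> Basis"
    and K: "compact K" "K \<subseteq> unit_ball" "\<And>x. x \<notin> K ==> (t, x) \<in> cyl d ==> G (t, x) = 0"
  shows "(LINT x|lebesgue_on unit_ball. dd (0, e) G (t, x)) = 0"
proof -
  let ?M = "lebesgue_on (unit_ball :: 'a set)"
  let ?B = "unit_ball - {0::'a}"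
  have oB: "open ?B" by (intro open_delete open_ball)
  have inc: "(t, x) \<in> cyl d \<longleftrightarrow> x \<in> ?B" for x using t by (auto simp: cyl_def)
  have ne: "norm e \<le> 1" using e by simp
  have G': "symbol d (Suc k) (dd (0, e) G)" using G e by (rule sym_dx)
  define f where "f m x = (if x \<in> ?B then hole m x * G (t, x) else 0)" for m x
  define f' where "f' m x = (if x \<in> ?B then (\<lambda>h. hole m x * dd (0, h) G (t, x) + hole' m x h * G (t, x)) else (\<lambda>h. 0))" for m x
  have dK: "dd (0, h) G (t, x) = 0" if "x \<in> ?B" "x \<notin> K" for x h
  proof -
    have "((\<lambda>x. G (t, x)) has_derivative (\<lambda>_. 0)) (at x)"
    proof (rule has_derivative_transform_within_open[OF has_derivative_const[of 0]])
      show "open (?B - K)" using oB K(1) compact_imp_closed by (intro open_Diff) auto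
    qed (use that K inc in auto)
    from fun_cong[OF has_derivative_unique[OF has_derivative_slice[OF G] this], of h] that inc show ?thesis by auto
  qed
  have df: "(f m has_derivative f' m x) (at x)" for m x
  proof (cases "x \<in> ?B")
    case True
    have "((\<lambda>x. hole m x * G (t, x)) has_derivative (\<lambda>h. hole m x * dd (0, h) G (t, x) + hole' m x h * G (t, x))) (at x)"
      by (rule has_derivative_mult[OF has_derivative_hole has_derivative_slice[OF G]]) (use True inc in auto)
    then have "(f m has_derivative (\<lambda>h. hole m x * dd (0, h) G (t, x) + hole' m x h * G (t, x))) (at x)"
      by (rule has_derivative_transform_within_open[OF _ oB True]) (simp add: f_def)
    with True show ?thesis by (simp add: f'_def)
  next
    case False
    have "\<exists>S. open S \<and> x \<in> S \<and> (\<forall>y\<in>S. f m y = 0)"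
    proof (cases "x = 0")
      case True
      let ?S = "ball (0::'a) (1 / (real m + 1))"
      have "f m y = 0" if "y \<in> ?S" for y
      proof -
        have "norm y * (real m + 1) < 1" using that by (simp add: field_simps)
        moreover have "real m * norm y \<le> norm y * (real m + 1)" by (simp add: algebra_simps)
        ultimately show ?thesis by (simp add: f_def hole_eq_0)
      qed
      with True show ?thesis by (intro exI[of _ ?S]) auto
    next
      case F: False
      then have "x \<notin> K" using False K(2) by auto
      then show ?thesis using K inc by (intro exI[of _ "- K"]) (auto simp: f_def compact_imp_closed open_Compl)
    qed
    then obtain S where "open S" "x \<in> S" "\<And>y. y \<in> S ==> f m y = 0" by auto
    then have "(f m has_derivative (\<lambda>_. 0)) (at x)"
      using has_derivative_transform_within_open[OF has_derivative_const[of 0]] by metis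
    then show ?thesis unfolding f'_def if_not_P[OF False] .
  qed
  have cf': "continuous_on UNIV (\<lambda>x. f' m x e)" for m
  proof -
    have "isCont (\<lambda>x. f' m x e) x" for x
    proof (cases "x \<in> ?B")
      case True
      have cG: "continuous_on ?B (\<lambda>x. H (t, x))" if "symbol d j H" for H :: "real \<times> 'a => real" and j
      proof (rule continuous_on_compose2[OF sym_continuous[OF that]])
        show "continuous_on ?B (Pair t)" by (intro continuous_intros)
        show "Pair t ` ?B \<subseteq> cyl d" using inc by blast
      qed
      have "continuous_on ?B (\<lambda>x. hole m x * dd (0, e) G (t, x) + hole' m x e * G (t, x))"
        unfolding hole_def hole'_def
        by (intro continuous_on_add continuous_on_mult cG[OF G] cG[OF G']
            continuous_on_compose2[OF derivative_sequence_continuous[OF derivative_sequence_exp_inv, of UNIV]]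
            continuous_intros) auto
      then have "continuous_on ?B (\<lambda>x. f' m x e)"
        by (rule continuous_on_eq) (simp add: f'_def)
      with True oB show ?thesis by (simp add: continuous_on_eq_continuous_at)
    next
      case False
      have "\<exists>S. open S \<and> x \<in> S \<and> (\<forall>y\<in>S. f' m y e = 0)"
      proof (cases "x = 0")
        case True
        let ?S = "ball (0::'a) (1 / (real m + 1))"
        have "f' m y e = 0" if "y \<in> ?S" for y
        proof -
          have "norm y * (real m + 1) < 1" using that by (simp add: field_simps)
          moreover have "real m * norm y \<le> norm y * (real m + 1)" by (simp add: algebra_simps)
          ultimately have *: "real m * norm y \<le> 1" by linarith
          then have "(real m * norm y)\<^sup>2 \<le> 1" by (simp add: power_le_one)
          then have "hole' m y e = 0" by (simp add: hole'_def exp_inv_def dot_square_norm power_mult_distrib)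
          with * show ?thesis by (simp add: f'_def hole_eq_0)
        qed
        with True show ?thesis by (intro exI[of _ ?S]) auto
      next
        case F: False
        then have "x \<notin> K" using False K(2) by auto
        then show ?thesis using K inc dK
          by (intro exI[of _ "- K"]) (auto simp: f'_def compact_imp_closed open_Compl)
      qed
      then obtain S where S: "open S" "x \<in> S" "\<And>y. y \<in> S ==> f' m y e = 0" by auto
      have "continuous_on S (\<lambda>x. f' m x e)"
        by (rule continuous_on_eq[OF continuous_on_const[of _ 0]]) (simp add: S)
      then show ?thesis using continuous_on_eq_continuous_at[OF S(1)] S(2) by blast
    qed
    then show ?thesis by (simp add: continuous_on_eq_continuous_at)
  qed
  have z: "(LINT x|?M. f' m x e) = 0" for m
  proof -
    have "(LINT x|?M. f' m x e) = (LINT x|lebesgue. f' m x e)"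
      unfolding integral_lebesgue_on[OF lebesgue_ball]
      by (rule Bochner_Integration.integral_cong) (auto simp: f'_def indicator_def)
    also have "\<dots> = (LINT x|lborel. f' m x e)"
      by (rule integral_completion) (use cf' in \<open>simp add: borel_measurable_continuous_onI\<close>)
    also have "\<dots> = 0"
      by (rule integral_partial_C1_eq_0[OF df cf']) (simp add: f_def)
    finally show ?thesis .
  qed
  obtain C where C: "0 \<le> C" "\<And>z. z \<in> cyl d ==> norm (G z) \<le> C * inverse (norm (snd z)) ^ k"
    using sym_bound[OF G] by blast
  obtain D where D: "0 \<le> D" "\<And>z. z \<in> cyl d ==> norm (dd (0, e) G z) \<le> D * inverse (norm (snd z)) ^ Suc k"
    using sym_bound[OF G'] by blast
  have "(\<lambda>m. LINT x|?M. f' m x e) \<longlonglongrightarrow> (LINT x|?M. dd (0, e) G (t, x))"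
  \<comment> \<open>the bound \<open>6 / \<bar>x\<bar>\<close> for the gradient of the cut-off costs the same power as a derivative of \<open>G\<close>\<close>
  proof (rule integral_dominated_convergence[where w = "\<lambda>x. (D + 6 * C) * inverse (norm x) ^ Suc k"])
    show "(\<lambda>x. dd (0, e) G (t, x)) \<in> borel_measurable ?M" by (rule measurable_slice[OF G' t])
    show "(\<lambda>x. f' m x e) \<in> borel_measurable ?M" for m
      by (intro continuous_imp_measurable_on_sets_lebesgue continuous_on_subset[OF cf']) auto
    show "integrable ?M (\<lambda>x. (D + 6 * C) * inverse (norm x) ^ Suc k)"
      by (intro integrable_mult_right integrable_inverse_norm_power k)
    show "AE x in ?M. (\<lambda>m. f' m x e) \<longlonglongrightarrow> dd (0, e) G (t, x)"
      using AE_lebesgue_ball_nz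
    proof eventually_elim
      fix x :: 'a assume x: "x \<noteq> 0 \<and> x \<in> unit_ball"
      have "(\<lambda>m. hole m x * dd (0, e) G (t, x) + hole' m x e * G (t, x)) \<longlonglongrightarrow> 1 * dd (0, e) G (t, x) + 0 * G (t, x)"
        using x by (intro tendsto_add tendsto_mult hole_tendsto tendsto_const) auto
      with x show "(\<lambda>m. f' m x e) \<longlonglongrightarrow> dd (0, e) G (t, x)" by (simp add: f'_def)
    qed
    show "AE x in ?M. norm (f' m x e) \<le> (D + 6 * C) * inverse (norm x) ^ Suc k" for m
      using AE_lebesgue_ball_nz
    proof eventually_elim
      fix x :: 'a assume x: "x \<noteq> 0 \<and> x \<in> unit_ball"
      then have xc: "(t, x) \<in> cyl d" by (simp add: inc)
      have "\<bar>hole m x * dd (0, e) G (t, x)\<bar> \<le> 1 * (D * inverse (norm x) ^ Suc k)"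
        unfolding abs_mult using D(2)[OF xc] hole_bounds[of m x] by (intro mult_mono) auto
      moreover have "\<bar>hole' m x e * G (t, x)\<bar> \<le> (6 * inverse (norm x)) * (C * inverse (norm x) ^ k)"
        unfolding abs_mult using C(2)[OF xc] hole'_le[of x e m] ne x by (intro mult_mono) auto
      ultimately have "\<bar>hole m x * dd (0, e) G (t, x) + hole' m x e * G (t, x)\<bar> \<le>
          1 * (D * inverse (norm x) ^ Suc k) + (6 * inverse (norm x)) * (C * inverse (norm x) ^ k)"
        by (intro order_trans[OF abs_triangle_ineq] add_mono)
      with x show "norm (f' m x e) \<le> (D + 6 * C) * inverse (norm x) ^ Suc k"
        by (simp add: f'_def algebra_simps)
    qed
  qed
  then show ?thesis by (simp add: z LIMSEQ_const_iff)
qed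

lemma integral_partial_symbol:
  fixes G :: "real \<times> 'a::euclidean_space => 'b::euclidean_space"
  assumes G: "symbol d k G" and k: "Suc k < DIM('a)" and t: "\<bar>t\<bar> < d" and e: "e \<in> Basis"
    and K: "compact K" "K \<subseteq> unit_ball" "\<And>x. x \<notin> K ==> (t, x) \<in> cyl d ==> G (t, x) = 0"
  shows "(LINT x|lebesgue_on unit_ball. dd (0, e) G (t, x)) = 0"
proof (rule euclidean_eqI)
  fix b :: 'b assume "b \<in> Basis"
  have lin: "bounded_linear (\<lambda>x. x \<bullet> b)" by (rule bounded_linear_inner_left)
  have Gb: "symbol d k (\<lambda>z. G z \<bullet> b)" by (rule sym_linear[OF lin G])
  have i: "integrable (lebesgue_on unit_ball) (\<lambda>x. dd (0, e) G (t, x))"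
    by (rule integrable_slice[OF sym_dx[OF G e] t k])
  have "(LINT x|lebesgue_on unit_ball. dd (0, e) G (t, x)) \<bullet> b = (LINT x|lebesgue_on unit_ball. dd (0, e) G (t, x) \<bullet> b)"
    by (rule integral_inner_left[symmetric]) (rule i)
  also have "\<dots> = (LINT x|lebesgue_on unit_ball. dd (0, e) (\<lambda>z. G z \<bullet> b) (t, x))"
  proof (rule integral_cong_AE)
    show "(\<lambda>x. dd (0, e) G (t, x) \<bullet> b) \<in> borel_measurable (lebesgue_on unit_ball)"
      using borel_measurable_integrable[OF i] by simp
    show "(\<lambda>x. dd (0, e) (\<lambda>z. G z \<bullet> b) (t, x)) \<in> borel_measurable (lebesgue_on unit_ball)"
      by (rule measurable_slice[OF sym_dx[OF Gb e] t])
    show "AE x in lebesgue_on unit_ball. dd (0, e) G (t, x) \<bullet> b = dd (0, e) (\<lambda>z. G z \<bullet> b) (t, x)"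
      using AE_cyl[OF t] by eventually_elim (simp add: dd_linear[OF lin sym_differentiable[OF G]])
  qed
  also have "\<dots> = 0"
    by (rule integral_partial_symbol_real[OF Gb k t e K(1,2)]) (simp add: K(3))
  finally show "(LINT x|lebesgue_on unit_ball. dd (0, e) G (t, x)) \<bullet> b = 0 \<bullet> b" by simp
qed

text \<open>Differentiation under the integral sign; the difference quotients are dominated by the bound
  of the \<open>t\<close>-derivative.\<close>

lemma has_real_derivative_integral_symbol:
  fixes G :: "real \<times> 'a::euclidean_space => real"
  assumes G: "symbol d k G" and k: "k < DIM('a)" and t: "\<bar>t\<bar> < d"
  shows "((\<lambda>t. LINT x|lebesgue_on unit_ball. G (t, x)) has_real_derivative
    (LINT x|lebesgue_on unit_ball. dd (1, 0) G (t, x))) (at t)"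
proof -
  let ?M = "lebesgue_on (unit_ball :: 'a set)"
  let ?I = "\<lambda>t. LINT x|?M. G (t, x)"
  have G': "symbol d k (dd (1, 0) G)" by (rule sym_dt[OF G])
  obtain C where C: "0 \<le> C" "\<And>z. z \<in> cyl d ==> norm (dd (1, 0) G z) \<le> C * inverse (norm (snd z)) ^ k"
    using sym_bound[OF G'] by blast
  have "((\<lambda>h. (?I (t + h) - ?I t) / h) \<longlongrightarrow> (LINT x|?M. dd (1, 0) G (t, x))) (at 0)"
    unfolding tendsto_at_iff_sequentially
  proof (intro allI impI)
    fix X :: "nat => real"
    assume X0: "\<forall>i. X i \<in> UNIV - {0}" and X: "X \<longlonglongrightarrow> 0"
    have "\<forall>\<^sub>F i in sequentially. \<bar>X i\<bar> < d - \<bar>t\<bar>"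
      using tendstoD[OF X, of "d - \<bar>t\<bar>"] t by simp
    then obtain N where N: "\<And>i. N \<le> i ==> \<bar>X i\<bar> < d - \<bar>t\<bar>"
      by (auto simp: eventually_sequentially)
    define Y where "Y i = X (i + N)" for i
    have Y: "Y i \<noteq> 0" "\<bar>Y i\<bar> < d - \<bar>t\<bar>" "\<bar>t + Y i\<bar> < d" for i
      using X0 N[of "i + N"] by (auto simp: Y_def)
    have Ylim: "Y \<longlonglongrightarrow> 0" unfolding Y_def by (rule LIMSEQ_ignore_initial_segment[OF X])
    have "(\<lambda>i. LINT x|?M. (G (t + Y i, x) - G (t, x)) / Y i) \<longlonglongrightarrow> (LINT x|?M. dd (1, 0) G (t, x))"
    proof (rule integral_dominated_convergence[where w = "\<lambda>x. C * inverse (norm x) ^ k"])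
      show "(\<lambda>x. dd (1, 0) G (t, x)) \<in> borel_measurable ?M" by (rule measurable_slice[OF G' t])
      show "(\<lambda>x. (G (t + Y i, x) - G (t, x)) / Y i) \<in> borel_measurable ?M" for i
        using measurable_slice[OF G t] measurable_slice[OF G Y(3)] by (intro borel_measurable_divide borel_measurable_diff) auto
      show "integrable ?M (\<lambda>x. C * inverse (norm x) ^ k)"
        by (intro integrable_mult_right integrable_inverse_norm_power k)
      show "AE x in ?M. (\<lambda>i. (G (t + Y i, x) - G (t, x)) / Y i) \<longlonglongrightarrow> dd (1, 0) G (t, x)"
        using AE_cyl[OF t]
      proof eventually_elim
        fix x :: 'a assume x: "(t, x) \<in> cyl d"
        have "((\<lambda>h. (G (t + h, x) - G (t, x)) / h) \<longlongrightarrow> dd (1, 0) G (t, x)) (at 0)"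
          using has_real_derivative_time[OF G x] by (simp add: DERIV_def)
        moreover have "filterlim Y (at 0) sequentially"
          unfolding filterlim_at using Ylim Y(1) by simp
        ultimately show "(\<lambda>i. (G (t + Y i, x) - G (t, x)) / Y i) \<longlonglongrightarrow> dd (1, 0) G (t, x)"
          by (rule filterlim_compose)
      qed
      show "AE x in ?M. norm ((G (t + Y i, x) - G (t, x)) / Y i) \<le> C * inverse (norm x) ^ k" for i
        using AE_cyl[OF t]
      proof eventually_elim
        fix x :: 'a assume x: "(t, x) \<in> cyl d"
        have in_cyl: "(s, x) \<in> cyl d" if "s \<in> closed_segment t (t + Y i)" for s
          using that x Y(2)[of i] by (auto simp: cyl_def closed_segment_eq_real_ivl split: if_splits)
        have "norm (G (t + Y i, x) - G (t, x)) \<le> C * inverse (norm x) ^ k * norm (t + Y i - t)"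
        proof (rule field_differentiable_bound[where S = "closed_segment t (t + Y i)"])
          fix s assume s: "s \<in> closed_segment t (t + Y i)"
          show "((\<lambda>s. G (s, x)) has_field_derivative dd (1, 0) G (s, x)) (at s within closed_segment t (t + Y i))"
            using has_real_derivative_time[OF G in_cyl[OF s]] by (rule has_field_derivative_at_within)
          show "norm (dd (1, 0) G (s, x)) \<le> C * inverse (norm x) ^ k"
            using C(2)[OF in_cyl[OF s]] by simp
        qed auto
        then show "norm ((G (t + Y i, x) - G (t, x)) / Y i) \<le> C * inverse (norm x) ^ k"
          using Y(1)[of i] by (simp add: field_simps)
      qed
    qed
    moreover have "(LINT x|?M. (G (t + Y i, x) - G (t, x)) / Y i) = (?I (t + Y i) - ?I t) / Y i" for i
      using integrable_slice[OF G t k] integrable_slice[OF G Y(3) k] by simp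
    ultimately have "(\<lambda>i. (?I (t + Y i) - ?I t) / Y i) \<longlonglongrightarrow> (LINT x|?M. dd (1, 0) G (t, x))" by (simp only:)
    then have "(\<lambda>i. ((\<lambda>h. (?I (t + h) - ?I t) / h) \<circ> X) (i + N)) \<longlonglongrightarrow> (LINT x|?M. dd (1, 0) G (t, x))"
      by (simp add: Y_def)
    then show "((\<lambda>h. (?I (t + h) - ?I t) / h) \<circ> X) \<longlonglongrightarrow> (LINT x|?M. dd (1, 0) G (t, x))"
      by (rule LIMSEQ_offset)
  qed
  then show ?thesis by (simp add: DERIV_def)
qed

section \<open>Weak derivatives of symbols\<close>

text \<open>The energies are defined through weak derivatives of functions that matter only up to null sets,
  whereas computations use the classical derivatives of symbols away from the origin; this relation
  connects the two.\<close>

definition rep :: "real => (real \<times> 'a::euclidean_space => 'b::euclidean_space) => ('a => 'b) => bool" where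
  "rep t F f \<longleftrightarrow> (AE x in lebesgue_on unit_ball. f x = F (t, x))"

lemma repI:
  assumes "\<bar>t\<bar> < d" "\<And>x. (t, x) \<in> cyl d ==> f x = F (t, x)"
  shows "rep t F f"
  unfolding rep_def using AE_cyl[OF assms(1)] by eventually_elim (rule assms(2))

lemma rep_const: "rep t (\<lambda>z. c) (\<lambda>x. c)"
  by (simp add: rep_def)

lemma rep_bilinear:
  assumes "rep t F f" "rep t G g"
  shows "rep t (\<lambda>z. bl (F z) (G z)) (\<lambda>x. bl (f x) (g x))"
  using assms unfolding rep_def by eventually_elim simp

lemma rep_map:
  assumes "rep t F f"
  shows "rep t (\<lambda>z. h (F z)) (\<lambda>x. h (f x))"
  using assms unfolding rep_def by eventually_elim simp

lemma rep_sum: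
  assumes "finite I" "\<And>i. i \<in> I ==> rep t (F i) (f i)"
  shows "rep t (\<lambda>z. \<Sum>i\<in>I. F i z) (\<lambda>x. \<Sum>i\<in>I. f i x)"
  using assms
proof (induction I rule: finite_induct)
  case (insert i I)
  then have "rep t (\<lambda>z. F i z + (\<Sum>i\<in>I. F i z)) (\<lambda>x. f i x + (\<Sum>i\<in>I. f i x))"
    by (intro rep_bilinear[where bl = "(+)"]) auto
  with insert show ?case by simp
qed (simp add: rep_const)

lemma rep_measurable:
  assumes "symbol d k F" "\<bar>t\<bar> < d" "rep t F f"
  shows "f \<in> borel_measurable (lebesgue_on unit_ball)"
  using assms(3) unfolding rep_def
  by (intro borel_measurable_AE_ball[OF measurable_slice[OF assms(1,2)]]) (auto elim: eventually_mono)

lemma rep_integral: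
  assumes "symbol d k F" "\<bar>t\<bar> < d" "rep t F f"
  shows "(LINT x|lebesgue_on unit_ball. f x) = (LINT x|lebesgue_on unit_ball. F (t, x))"
  by (rule integral_cong_AE[OF rep_measurable[OF assms] measurable_slice[OF assms(1,2)]])
    (use assms(3) in \<open>simp add: rep_def\<close>)

lemma rep_integrable:
  assumes "symbol d k (F :: real \<times> 'a::euclidean_space => 'b::euclidean_space)" "\<bar>t\<bar> < d" "rep t F f" "k < DIM('a)"
  shows "integrable (lebesgue_on unit_ball) f"
  by (rule integrable_cong_AE_imp[OF integrable_slice[OF assms(1,2,4)] rep_measurable[OF assms(1-3)]])
    (use assms(3) in \<open>auto simp: rep_def elim: eventually_mono\<close>)

lemma integrable_imp_locally_integrable:
  assumes "integrable (lebesgue_on unit_ball) f"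
  shows "locally_integrable f"
  unfolding locally_integrable_def
proof (intro allI impI)
  fix K :: "'a set" assume K: "compact K \<and> K \<subseteq> unit_ball"
  then have Ks: "K \<in> sets lebesgue" by (simp add: borel_compact)
  have "integrable lebesgue (\<lambda>x. indicator unit_ball x *\<^sub>R f x)"
    using assms by (simp add: integrable_restrict_space)
  then have "integrable lebesgue (\<lambda>x. indicator K x *\<^sub>R indicator unit_ball x *\<^sub>R f x)"
    by (rule integrable_mult_indicator[OF Ks])
  also have "(\<lambda>x. indicator K x *\<^sub>R indicator unit_ball x *\<^sub>R f x) = (\<lambda>x. indicator K x *\<^sub>R f x)"
    using K by (auto simp: indicator_def fun_eq_iff)
  finally show "integrable (lebesgue_on K) f" using Ks by (simp add: integrable_restrict_space)
qed

text \<open>An integration by parts over the punctured ball; the weight condition excludes a contribution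
  of the origin. Thus classical derivatives off the origin are weak derivatives.\<close>

lemma rep_has_weak_partial:
  fixes F :: "real \<times> 'a::euclidean_space => 'b::euclidean_space"
  assumes F: "symbol d k F" and k: "Suc k < DIM('a)" and t: "\<bar>t\<bar> < d" and e: "e \<in> Basis" and f: "rep t F f"
  shows "has_weak_partial e f (\<lambda>x. dd (0, e) F (t, x))"
  unfolding has_weak_partial_def
proof (intro conjI allI impI)
  let ?M = "lebesgue_on (unit_ball :: 'a set)"
  have F': "symbol d (Suc k) (dd (0, e) F)" by (rule sym_dx[OF F e])
  show "locally_integrable f"
    by (intro integrable_imp_locally_integrable rep_integrable[OF F t f]) (use k in simp)
  show "locally_integrable (\<lambda>x. dd (0, e) F (t, x))"
    by (intro integrable_imp_locally_integrable integrable_slice[OF F' t]) (use k in simp)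
  fix \<eta> :: "'a => real" assume \<eta>: "test_function \<eta>"
  then have sm: "smooth \<eta>" by (simp add: test_function_def)
  let ?H = "\<lambda>z. \<eta> (snd z)" and ?K = "closure {x. \<eta> x \<noteq> 0}"
  have K: "compact ?K" "?K \<subseteq> unit_ball"
    using \<eta> by (auto simp: test_function_def compact_eq_bounded_closed intro: bounded_subset)
  have H: "symbol d 0 ?H" by (rule sym_smooth[OF sm])
  have H': "symbol d (Suc 0) (dd (0, e) ?H)" by (rule sym_dx[OF H e])
  have HF: "symbol d k (\<lambda>z. ?H z *\<^sub>R F z)" using sym_scaleR[OF H F] by simp
  have dH: "dd (0, e) ?H (t, x) = dd e \<eta> x" for x
  proof -
    have "C_k (Suc 0) \<eta>" using sm unfolding smooth_def by blast
    then have "\<eta> differentiable (at x)" by simp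
    then have "((\<lambda>z. \<eta> (snd z)) has_derivative (\<lambda>v. dd (snd v) \<eta> (snd (t, x)))) (at (t, x))"
      by (intro has_derivative_compose[OF has_derivative_snd[OF has_derivative_ident]]) (simp add: dd_works)
    from dd_eqI[OF this, of "(0, e)"] show ?thesis by simp
  qed
  have dHF: "dd (0, e) (\<lambda>z. ?H z *\<^sub>R F z) z = ?H z *\<^sub>R dd (0, e) F z + dd (0, e) ?H z *\<^sub>R F z" if "z \<in> cyl d" for z
    by (rule dd_bilinear[OF bounded_bilinear_scaleR sym_differentiable[OF H that] sym_differentiable[OF F that]])
  have 1: "symbol d (Suc k) (\<lambda>z. dd (0, e) ?H z *\<^sub>R F z)" "symbol d (Suc k) (\<lambda>z. ?H z *\<^sub>R dd (0, e) F z)"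
    using sym_scaleR[OF H' F] sym_scaleR[OF H F'] by simp_all
  have "0 = (LINT x|?M. dd (0, e) (\<lambda>z. ?H z *\<^sub>R F z) (t, x))"
  proof (rule integral_partial_symbol[OF HF k t e K, symmetric])
    fix x assume "x \<notin> ?K"
    then have "\<eta> x = 0" using closure_subset[of "{x. \<eta> x \<noteq> 0}"] by auto
    then show "?H (t, x) *\<^sub>R F (t, x) = 0" by simp
  qed
  also have "\<dots> = (LINT x|?M. ?H (t, x) *\<^sub>R dd (0, e) F (t, x) + dd (0, e) ?H (t, x) *\<^sub>R F (t, x))"
  proof (rule integral_cong_AE)
    show "AE x in ?M. dd (0, e) (\<lambda>z. ?H z *\<^sub>R F z) (t, x) = ?H (t, x) *\<^sub>R dd (0, e) F (t, x) + dd (0, e) ?H (t, x) *\<^sub>R F (t, x)"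
      using AE_cyl[OF t] by eventually_elim (rule dHF)
    show "(\<lambda>x. dd (0, e) (\<lambda>z. ?H z *\<^sub>R F z) (t, x)) \<in> borel_measurable ?M"
      by (rule measurable_slice[OF sym_dx[OF HF e] t])
    show "(\<lambda>x. ?H (t, x) *\<^sub>R dd (0, e) F (t, x) + dd (0, e) ?H (t, x) *\<^sub>R F (t, x)) \<in> borel_measurable ?M"
      using measurable_slice[OF 1(1) t] measurable_slice[OF 1(2) t] by (rule borel_measurable_add[rotated])
  qed
  also have "\<dots> = (LINT x|?M. ?H (t, x) *\<^sub>R dd (0, e) F (t, x)) + (LINT x|?M. dd (0, e) ?H (t, x) *\<^sub>R F (t, x))"
    by (rule Bochner_Integration.integral_add[OF integrable_slice[OF 1(2) t k] integrable_slice[OF 1(1) t k]])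
  also have "(LINT x|?M. dd (0, e) ?H (t, x) *\<^sub>R F (t, x)) = (LINT x|?M. dd e \<eta> x *\<^sub>R f x)"
  proof (rule rep_integral[OF 1(1) t, symmetric])
    show "rep t (\<lambda>z. dd (0, e) ?H z *\<^sub>R F z) (\<lambda>x. dd e \<eta> x *\<^sub>R f x)"
      using f unfolding rep_def by eventually_elim (simp add: dH)
  qed
  finally show "(LINT x|?M. dd e \<eta> x *\<^sub>R f x) = - (LINT x|?M. \<eta> x *\<^sub>R dd (0, e) F (t, x))"
    by (simp add: eq_neg_iff_add_eq_0 add.commute)
qed

lemma rep_weak_partial:
  fixes F :: "real \<times> 'a::euclidean_space => 'b::euclidean_space"
  assumes "symbol d k F" "Suc k < DIM('a)" "\<bar>t\<bar> < d" "e \<in> Basis" "rep t F f"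
  shows "rep t (dd (0, e) F) (weak_partial e f)"
  unfolding rep_def by (rule weak_partial_AE[OF rep_has_weak_partial[OF assms]])

lemma rep_L2:
  fixes F :: "real \<times> 'a::euclidean_space => 'b::euclidean_space"
  assumes F: "symbol d k F" and k: "2 * k < DIM('a)" and t: "\<bar>t\<bar> < d" and f: "rep t F f"
  shows "L2 f"
  unfolding L2_def
proof
  show "f \<in> borel_measurable (lebesgue_on unit_ball)" by (rule rep_measurable[OF F t f])
  have "symbol d (k + k) (\<lambda>z. F z \<bullet> F z)" by (rule sym_inner[OF F F])
  moreover have "rep t (\<lambda>z. F z \<bullet> F z) (\<lambda>x. (norm (f x))\<^sup>2)"
    using rep_map[OF f, of "\<lambda>y. y \<bullet> y"] by (simp add: dot_square_norm)
  ultimately show "integrable (lebesgue_on unit_ball) (\<lambda>x. (norm (f x))\<^sup>2)"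
    by (rule rep_integrable[OF _ t]) (use k in simp)
qed

text \<open>Membership in a Sobolev space is reduced to counting powers: a derivative of order \<open>N\<close> has weight
  \<open>k + N\<close>, whose square is integrable if \<open>2 * (k + N)\<close> is less than the dimension.\<close>

lemma rep_sobolev:
  fixes F :: "real \<times> 'a::euclidean_space => 'b::euclidean_space"
  shows "symbol d k F ==> 2 * (k + N) < DIM('a) ==> \<bar>t\<bar> < d ==> rep t F f ==> sobolev N f"
proof (induction N arbitrary: k F f)
  case 0
  then show ?case by (simp add: rep_L2)
next
  case (Suc N)
  have "L2 f" using Suc.prems by (intro rep_L2[of d k F t f]) auto
  moreover have "\<exists>g. has_weak_partial e f g" "sobolev N (weak_partial e f)" if "e \<in> Basis" for e
  proof -
    show "\<exists>g. has_weak_partial e f g"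
      using rep_has_weak_partial[OF Suc.prems(1) _ Suc.prems(3) that Suc.prems(4)] Suc.prems(2) by auto
    show "sobolev N (weak_partial e f)"
      by (rule Suc.IH[OF sym_dx[OF Suc.prems(1) that]])
        (use Suc.prems that in \<open>auto intro!: rep_weak_partial\<close>)
  qed
  ultimately show ?case by simp
qed

definition dds :: "'a::euclidean_space list => (real \<times> 'a => 'b::euclidean_space) => real \<times> 'a => 'b" where
  "dds es F = foldr (\<lambda>e. dd (0, e)) es F"

lemma dds_simps [simp]: "dds [] F = F" "dds (e # es) F = dd (0, e) (dds es F)"
  by (simp_all add: dds_def)

lemma sym_dds: "symbol d k F ==> set es \<subseteq> Basis ==> symbol d (k + length es) (dds es F)"
  by (induction es) (auto intro: sym_dx)

lemma rep_weak_partials: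
  fixes F :: "real \<times> 'a::euclidean_space => 'b::euclidean_space"
  assumes "symbol d k F" "\<bar>t\<bar> < d" "rep t F f"
  shows "set es \<subseteq> Basis ==> k + length es < DIM('a) ==> rep t (dds es F) (weak_partials es f)"
proof (induction es)
  case Nil
  then show ?case using assms by (simp add: weak_partials_def)
next
  case (Cons e es)
  have "rep t (dd (0, e) (dds es F)) (weak_partial e (weak_partials es f))"
    using Cons assms by (intro rep_weak_partial[OF sym_dds[OF assms(1), of es]]) auto
  then show ?case by (simp add: weak_partials_def)
qed

section \<open>Covariant calculus with classical derivatives\<close>

definition cv :: "('c::euclidean_space => 'b::euclidean_space) => 'c => ('c => 'b) => 'c => 'b" where
  "cv \<Phi> v W = (\<lambda>z. dd v W z - (dd v W z \<bullet> \<Phi> z) *\<^sub>R \<Phi> z)"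

definition tau :: "(real \<times> 'a::euclidean_space => 'b::euclidean_space) => real \<times> 'a => 'b" where
  "tau \<Phi> = (\<lambda>z. \<Sum>e\<in>Basis. cv \<Phi> (0, e) (dd (0, e) \<Phi>) z)"

definition rl ::
    "(real \<times> 'a::euclidean_space => 'b::euclidean_space) => (real \<times> 'a => 'b) => real \<times> 'a => 'b" where
  "rl \<Phi> W = (\<lambda>z. - (\<Sum>e\<in>Basis. cv \<Phi> (0, e) (cv \<Phi> (0, e) W) z))"

definition iter :: "(real \<times> 'a::euclidean_space => 'b::euclidean_space) => nat => real \<times> 'a => 'b" where
  "iter \<Phi> j = (rl \<Phi> ^^ j) (tau \<Phi>)"

lemma iter_simps [simp]: "iter \<Phi> 0 = tau \<Phi>" "iter \<Phi> (Suc j) = rl \<Phi> (iter \<Phi> j)"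
  by (simp_all add: iter_def)

lemma sym_proj:
  assumes "symbol d 0 \<Phi>" "symbol d k W"
  shows "symbol d k (\<lambda>z. W z - (W z \<bullet> \<Phi> z) *\<^sub>R \<Phi> z)"
  using sym_diff[OF assms(2) sym_scaleR[OF sym_inner[OF assms(2,1)] assms(1), simplified]] .

lemma sym_cv: "symbol d 0 \<Phi> ==> symbol d k W ==> e \<in> Basis ==> symbol d (Suc k) (cv \<Phi> (0, e) W)"
  unfolding cv_def by (intro sym_proj sym_dx)

lemma sym_cvt: "symbol d 0 \<Phi> ==> symbol d k W ==> symbol d k (cv \<Phi> (1, 0) W)"
  unfolding cv_def by (intro sym_proj sym_dt)

lemma sym_tau: "symbol d 0 \<Phi> ==> symbol d 2 (tau \<Phi>)"
  unfolding tau_def numeral_2_eq_2 by (intro sym_sum sym_cv sym_dx)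

lemma sym_rl: "symbol d 0 \<Phi> ==> symbol d k W ==> symbol d (Suc (Suc k)) (rl \<Phi> W)"
  unfolding rl_def by (intro sym_minus sym_sum sym_cv)

lemma sym_iter: "symbol d 0 \<Phi> ==> symbol d (2 * j + 2) (iter \<Phi> j)"
  by (induction j) (use sym_tau sym_rl in \<open>auto simp: numeral_2_eq_2\<close>)

lemma rep_cov:
  fixes \<Phi> :: "real \<times> 'a::euclidean_space => 'b::euclidean_space"
  assumes "rep t \<Phi> \<phi>" "symbol d k W" "Suc k < DIM('a)" "\<bar>t\<bar> < d" "e \<in> Basis" "rep t W V"
  shows "rep t (cv \<Phi> (0, e) W) (cov \<phi> e V)"
  using assms(1) rep_weak_partial[OF assms(2-6)] unfolding rep_def
  by eventually_elim (simp add: cv_def cov_def)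

lemma rep_tension:
  fixes \<Phi> :: "real \<times> 'a::euclidean_space => 'b::euclidean_space"
  assumes "symbol d 0 \<Phi>" "2 < DIM('a)" "\<bar>t\<bar> < d" "rep t \<Phi> \<phi>"
  shows "rep t (tau \<Phi>) (tension \<phi>)"
  unfolding tau_def tension_def
  by (intro rep_sum finite_Basis rep_cov[OF assms(4) sym_dx[OF assms(1)]] rep_weak_partial[OF assms(1)] assms)
    (use assms in auto)

lemma rep_rough_laplacian:
  fixes \<Phi> :: "real \<times> 'a::euclidean_space => 'b::euclidean_space"
  assumes "symbol d 0 \<Phi>" "rep t \<Phi> \<phi>" "symbol d k W" "Suc (Suc k) < DIM('a)" "\<bar>t\<bar> < d" "rep t W V"
  shows "rep t (rl \<Phi> W) (rough_laplacian \<phi> V)"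
  unfolding rl_def rough_laplacian_def
  by (intro rep_map[where h = uminus] rep_sum finite_Basis rep_cov[OF assms(2) sym_cv[OF assms(1,3)]]
      rep_cov[OF assms(2,3)] assms) (use assms in auto)

lemma rep_iter:
  fixes \<Phi> :: "real \<times> 'a::euclidean_space => 'b::euclidean_space"
  assumes "symbol d 0 \<Phi>" "rep t \<Phi> \<phi>" "\<bar>t\<bar> < d"
  shows "2 * j + 2 < DIM('a) ==> rep t (iter \<Phi> j) ((rough_laplacian \<phi> ^^ j) (tension \<phi>))"
proof (induction j)
  case 0
  then show ?case using assms by (auto intro: rep_tension)
next
  case (Suc j)
  then show ?case
    using assms by (auto intro!: rep_rough_laplacian[OF assms(1,2) sym_iter[OF assms(1), of j] _ assms(3)])
qed

lemma rep_norm2: "rep t F f ==> rep t (\<lambda>z. F z \<bullet> F z) (\<lambda>x. (norm (f x))\<^sup>2)"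
  using rep_map[of t F f "\<lambda>y. y \<bullet> y"] by (simp add: dot_square_norm)

subsection \<open>Densities of the energies\<close>

lemma r_energy_1:
  fixes \<Phi> :: "real \<times> 'a::euclidean_space => 'b::euclidean_space"
  assumes "symbol d 0 \<Phi>" "rep t \<Phi> \<phi>" "\<bar>t\<bar> < d" "1 < DIM('a)"
  shows "r_energy 1 \<phi> =
    1/2 * (LINT x|lebesgue_on unit_ball. (\<Sum>e\<in>Basis. dd (0, e) \<Phi> (t, x) \<bullet> dd (0, e) \<Phi> (t, x)))"
proof -
  have "symbol d 2 (\<lambda>z. \<Sum>e\<in>Basis. dd (0, e) \<Phi> z \<bullet> dd (0, e) \<Phi> z)"
    using sym_inner[OF sym_dx[OF assms(1)] sym_dx[OF assms(1)]] by (intro sym_sum) (simp add: numeral_2_eq_2)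
  moreover have "rep t (\<lambda>z. \<Sum>e\<in>Basis. dd (0, e) \<Phi> z \<bullet> dd (0, e) \<Phi> z) (\<lambda>x. \<Sum>e\<in>Basis. (norm (weak_partial e \<phi> x))\<^sup>2)"
    using assms by (intro rep_sum finite_Basis rep_norm2 rep_weak_partial[OF assms(1)]) auto
  ultimately show ?thesis
    using rep_integral assms(3) by (fastforce simp: r_energy_def)
qed

lemma r_energy_even:
  fixes \<Phi> :: "real \<times> 'a::euclidean_space => 'b::euclidean_space"
  assumes "symbol d 0 \<Phi>" "rep t \<Phi> \<phi>" "\<bar>t\<bar> < d" "2 * s + 2 < DIM('a)"
  shows "r_energy (2 * s + 2) \<phi> = 1/2 * (LINT x|lebesgue_on unit_ball. iter \<Phi> s (t, x) \<bullet> iter \<Phi> s (t, x))"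
  using rep_integral[OF sym_inner[OF sym_iter[OF assms(1)] sym_iter[OF assms(1)]] assms(3)
      rep_norm2[OF rep_iter[OF assms]]]
  by (simp add: r_energy_def)

lemma r_energy_odd:
  fixes \<Phi> :: "real \<times> 'a::euclidean_space => 'b::euclidean_space"
  assumes "symbol d 0 \<Phi>" "rep t \<Phi> \<phi>" "\<bar>t\<bar> < d" "2 * s + 3 < DIM('a)"
  shows "r_energy (2 * s + 3) \<phi> = 1/2 * (LINT x|lebesgue_on unit_ball.
    (\<Sum>e\<in>Basis. cv \<Phi> (0, e) (iter \<Phi> s) (t, x) \<bullet> cv \<Phi> (0, e) (iter \<Phi> s) (t, x)))"
proof -
  have "symbol d (Suc (2 * s + 2) + Suc (2 * s + 2)) (\<lambda>z. \<Sum>e\<in>Basis. cv \<Phi> (0, e) (iter \<Phi> s) z \<bullet> cv \<Phi> (0, e) (iter \<Phi> s) z)"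
    by (intro sym_sum sym_inner sym_cv sym_iter assms)
  moreover have "rep t (\<lambda>z. \<Sum>e\<in>Basis. cv \<Phi> (0, e) (iter \<Phi> s) z \<bullet> cv \<Phi> (0, e) (iter \<Phi> s) z)
      (\<lambda>x. \<Sum>e\<in>Basis. (norm (cov \<phi> e ((rough_laplacian \<phi> ^^ s) (tension \<phi>)) x))\<^sup>2)"
    using assms by (intro rep_sum finite_Basis rep_norm2 rep_cov[OF assms(2) sym_iter[OF assms(1)]] rep_iter) auto
  ultimately have "(LINT x|lebesgue_on unit_ball. (\<Sum>e\<in>Basis. (norm (cov \<phi> e ((rough_laplacian \<phi> ^^ s) (tension \<phi>)) x))\<^sup>2))
      = (LINT x|lebesgue_on unit_ball. (\<Sum>e\<in>Basis. cv \<Phi> (0, e) (iter \<Phi> s) (t, x) \<bullet> cv \<Phi> (0, e) (iter \<Phi> s) (t, x)))"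
    using rep_integral assms(3) by blast
  moreover have "(2 * s + 3) div 2 - 1 = s" "odd (2 * s + 3)" "2 * s + 3 \<noteq> 1" by presburger+
  ultimately show ?thesis by (simp add: r_energy_def)
qed

text \<open>The operator $d^* + d$ on forms whose components are symbols.\<close>

definition HD :: "(real \<times> 'a::euclidean_space => 'b::euclidean_space) => ('a list => real \<times> 'a => 'b) =>
    'a list => real \<times> 'a => 'b" where
  "HD \<Phi> \<Omega> = (\<lambda>es z. - (\<Sum>e\<in>Basis. cv \<Phi> (0, e) (\<Omega> (e # es)) z) +
    (\<Sum>k<length es. (-1) ^ k *\<^sub>R cv \<Phi> (0, es ! k) (\<Omega> (take k es @ drop (Suc k) es)) z))"

definition section_form :: "(real \<times> 'a => 'b::euclidean_space) => 'a list => real \<times> 'a => 'b" where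
  "section_form V = (\<lambda>es. if es = [] then V else (\<lambda>_. 0))"

lemma take_drop_Basis: "set es \<subseteq> B ==> set (take k es @ drop (Suc k) es) \<subseteq> B"
  using set_take_subset[of k es] set_drop_subset[of "Suc k" es] by auto

lemma sym_HD:
  assumes "symbol d 0 \<Phi>" "\<And>es. set es \<subseteq> Basis ==> symbol d k (\<Omega> es)" "set es \<subseteq> Basis"
  shows "symbol d (Suc k) (HD \<Phi> \<Omega> es)"
  unfolding HD_def
proof (intro sym_add sym_minus sym_sum sym_cmult sym_cv assms(1) assms(2))
  fix i assume "i \<in> {..<length es}"
  then have "es ! i \<in> set es" by simp
  then show "es ! i \<in> Basis" using assms(3) by blast
qed (use assms(3) take_drop_Basis[OF assms(3)] in simp_all)

lemma rep_HD:
  fixes \<Phi> :: "real \<times> 'a::euclidean_space => 'b::euclidean_space"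
  assumes "rep t \<Phi> \<phi>" "\<bar>t\<bar> < d" "Suc k < DIM('a)"
    and \<Omega>: "\<And>es. set es \<subseteq> Basis ==> symbol d k (\<Omega> es)" "\<And>es. set es \<subseteq> Basis ==> rep t (\<Omega> es) (\<omega> es)"
    and es: "set es \<subseteq> Basis"
  shows "rep t (HD \<Phi> \<Omega> es) (hodge_dirac \<phi> \<omega> es)"
  unfolding HD_def hodge_dirac_def codiff_def ext_d_def
proof (intro rep_bilinear[where bl = "(+)"] rep_map[where h = uminus] rep_sum finite_Basis finite_lessThan)
  fix e :: 'a assume "e \<in> Basis"
  with es show "rep t (cv \<Phi> (0, e) (\<Omega> (e # es))) (cov \<phi> e (\<omega> (e # es)))"
    by (intro rep_cov[OF assms(1) \<Omega>(1) assms(3,2)] \<Omega>(2)) auto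
next
  fix i assume "i \<in> {..<length es}"
  then have "es ! i \<in> set es" by simp
  then have "es ! i \<in> Basis" using es by blast
  then have "rep t (cv \<Phi> (0, es ! i) (\<Omega> (take i es @ drop (Suc i) es))) (cov \<phi> (es ! i) (\<omega> (take i es @ drop (Suc i) es)))"
    using take_drop_Basis[OF es] by (intro rep_cov[OF assms(1) \<Omega>(1) assms(3,2)] \<Omega>(2)) auto
  then show "rep t (\<lambda>z. (-1) ^ i *\<^sub>R cv \<Phi> (0, es ! i) (\<Omega> (take i es @ drop (Suc i) es)) z)
      (\<lambda>x. (-1) ^ i *\<^sub>R cov \<phi> (es ! i) (\<omega> (take i es @ drop (Suc i) es)) x)"
    by (rule rep_map)
qed

lemma sym_HD_power:
  assumes "symbol d 0 \<Phi>" "set es \<subseteq> Basis"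
  shows "symbol d (m + 2) ((HD \<Phi> ^^ m) (section_form (tau \<Phi>)) es)"
  using assms(2)
proof (induction m arbitrary: es)
  case 0
  then show ?case using sym_tau[OF assms(1)] by (simp add: section_form_def numeral_2_eq_2)
next
  case (Suc m)
  then show ?case using sym_HD[OF assms(1) Suc.IH] by simp
qed

lemma rep_HD_power:
  fixes \<Phi> :: "real \<times> 'a::euclidean_space => 'b::euclidean_space"
  assumes "symbol d 0 \<Phi>" "rep t \<Phi> \<phi>" "\<bar>t\<bar> < d" "m + 2 < DIM('a)" "set es \<subseteq> Basis"
  shows "rep t ((HD \<Phi> ^^ m) (section_form (tau \<Phi>)) es)
    ((hodge_dirac \<phi> ^^ m) (form_of_section (tension \<phi>)) es)"
  using assms(4,5)
proof (induction m arbitrary: es)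
  case 0
  then show ?case using rep_tension[OF assms(1) _ assms(3,2)]
    by (simp add: section_form_def form_of_section_def rep_const)
next
  case (Suc m)
  have "rep t (HD \<Phi> ((HD \<Phi> ^^ m) (section_form (tau \<Phi>))) es)
      (hodge_dirac \<phi> ((hodge_dirac \<phi> ^^ m) (form_of_section (tension \<phi>))) es)"
    by (rule rep_HD[OF assms(2,3) _ sym_HD_power[OF assms(1)] Suc.IH]) (use Suc.prems in auto)
  then show ?case by simp
qed

definition form_density :: "('a::euclidean_space list => real \<times> 'a => 'b::euclidean_space) => real \<times> 'a => real" where
  "form_density \<Omega> z = (\<Sum>p\<le>DIM('a). (1 / fact p) *\<^sub>R
     (\<Sum>es | set es \<subseteq> Basis \<and> length es = p. \<Omega> es z \<bullet> \<Omega> es z))"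

text \<open>The weak operator $d^*+d$ is applied to representatives; at each step the components remain
  symbols, with the weight raised by one.\<close>

lemma ES_energy_density:
  fixes \<Phi> :: "real \<times> 'a::euclidean_space => 'b::euclidean_space"
  assumes "symbol d 0 \<Phi>" "rep t \<Phi> \<phi>" "\<bar>t\<bar> < d" "m + 2 < DIM('a)"
  shows "ES_energy (m + 2) \<phi> = 1/2 * (LINT x|lebesgue_on unit_ball.
    form_density ((HD \<Phi> ^^ m) (section_form (tau \<Phi>))) (t, x))"
proof -
  let ?\<Omega> = "(HD \<Phi> ^^ m) (section_form (tau \<Phi>))"
  let ?\<omega> = "(hodge_dirac \<phi> ^^ m) (form_of_section (tension \<phi>))"
  have fin: "finite {es::'a list. set es \<subseteq> Basis \<and> length es = p}" for p
    by (rule finite_lists_length_eq) simp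
  have "symbol d ((m + 2) + (m + 2)) (form_density ?\<Omega>)"
    unfolding form_density_def[abs_def]
    by (intro sym_sum sym_cmult sym_inner sym_HD_power assms) auto
  moreover have "rep t (form_density ?\<Omega>) (form_norm_sq (ES_form (m + 2) \<phi>))"
  proof -
    have "rep t (form_density ?\<Omega>) (\<lambda>x. \<Sum>p\<le>DIM('a). (1 / fact p) *\<^sub>R
        (\<Sum>es | set es \<subseteq> Basis \<and> length es = p. (norm (?\<omega> es x))\<^sup>2))"
      unfolding form_density_def[abs_def]
      by (intro rep_sum fin finite_atMost rep_map[where h = "\<lambda>y. c *\<^sub>R y" for c] rep_norm2 rep_HD_power[OF assms]) auto
    then show ?thesis by (simp add: form_norm_sq_def[abs_def] ES_form_def)
  qed
  ultimately show ?thesis unfolding ES_energy_def using rep_integral[OF _ assms(3)] by metis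
qed

lemma sum_lists_Suc:
  assumes "finite A"
  shows "(\<Sum>es | set es \<subseteq> A \<and> length es = Suc p. f es) = (\<Sum>e\<in>A. \<Sum>es | set es \<subseteq> A \<and> length es = p. f (e # es))"
proof -
  have "{es. set es \<subseteq> A \<and> length es = Suc p} = (\<lambda>(e, es). e # es) ` (A \<times> {es. set es \<subseteq> A \<and> length es = p})"
    by (auto simp: length_Suc_conv image_iff)
  moreover have "inj_on (\<lambda>(e, es). e # es) (A \<times> {es. set es \<subseteq> A \<and> length es = p})"
    by (auto simp: inj_on_def)
  ultimately show ?thesis
    by (simp add: sum.reindex sum.cartesian_product case_prod_unfold)
qed

lemma sum_lists_0: "(\<Sum>es | set es \<subseteq> A \<and> length es = 0. f es) = f []"
proof -
  have "{es. set es \<subseteq> A \<and> length es = 0} = {[]}" by auto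
  then show ?thesis by simp
qed

lemma cv_0 [simp]: "cv \<Phi> v (\<lambda>z. 0) = (\<lambda>z. 0)"
  by (simp add: cv_def)

text \<open>The forms $d\tau$, $(d^* + d)d\tau$ and $(d^* + d)^2 d\tau$, by degree. \<open>curv V e f\<close> is the
  component of $d^2 V$.\<close>

definition curv :: "(real \<times> 'a::euclidean_space => 'b::euclidean_space) => (real \<times> 'a => 'b) => 'a => 'a => real \<times> 'a => 'b" where
  "curv \<Phi> V e f = (\<lambda>z. cv \<Phi> (0, e) (cv \<Phi> (0, f) V) z - cv \<Phi> (0, f) (cv \<Phi> (0, e) V) z)"

definition tri :: "(real \<times> 'a::euclidean_space => 'b::euclidean_space) => (real \<times> 'a => 'b) => 'a => 'a => 'a => real \<times> 'a => 'b" where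
  "tri \<Phi> V e f g = (\<lambda>z. cv \<Phi> (0, e) (curv \<Phi> V f g) z - cv \<Phi> (0, f) (curv \<Phi> V e g) z + cv \<Phi> (0, g) (curv \<Phi> V e f) z)"

definition lin3 :: "(real \<times> 'a::euclidean_space => 'b::euclidean_space) => (real \<times> 'a => 'b) => 'a => real \<times> 'a => 'b" where
  "lin3 \<Phi> V e = (\<lambda>z. cv \<Phi> (0, e) (rl \<Phi> V) z - (\<Sum>f\<in>Basis. cv \<Phi> (0, f) (curv \<Phi> V f e) z))"

lemma HD_1:
  fixes \<Phi> :: "real \<times> 'a::euclidean_space => 'b::euclidean_space"
  shows "HD \<Phi> (section_form V) = (\<lambda>es. if length es = 1 then cv \<Phi> (0, hd es) V else (\<lambda>z. 0))"
proof (intro ext)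
  fix es :: "'a list" and z
  consider "es = []" | e where "es = [e]" | e f gs where "es = e # f # gs"
    by (cases es rule: remdups_adj.cases) auto
  then show "HD \<Phi> (section_form V) es z = (if length es = 1 then cv \<Phi> (0, hd es) V else (\<lambda>z. 0)) z"
  proof cases
    case 3
    have "take k es @ drop (Suc k) es \<noteq> []" for k using 3 by (cases k) auto
    then show ?thesis using 3 by (simp add: HD_def section_form_def)
  qed (simp_all add: HD_def section_form_def)
qed

lemma HD_2:
  fixes \<Phi> :: "real \<times> 'a::euclidean_space => 'b::euclidean_space"
  shows "HD \<Phi> (HD \<Phi> (section_form V)) = (\<lambda>es. if es = [] then rl \<Phi> V
    else if length es = 2 then curv \<Phi> V (es ! 0) (es ! 1) else (\<lambda>z. 0))"
proof (intro ext)
  fix es :: "'a list" and z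
  consider "es = []" | e where "es = [e]" | e f where "es = [e, f]" | e f g gs where "es = e # f # g # gs"
    by (cases es; cases "tl es"; cases "tl (tl es)") auto
  then show "HD \<Phi> (HD \<Phi> (section_form V)) es z = (if es = [] then rl \<Phi> V
    else if length es = 2 then curv \<Phi> V (es ! 0) (es ! 1) else (\<lambda>z. 0)) z"
  proof cases
    case 4
    have "length (take k es @ drop (Suc k) es) \<noteq> 1" if "k < length es" for k using 4 that by simp
    then have "(\<Sum>k<length es. (-1) ^ k *\<^sub>R cv \<Phi> (0, es ! k) (HD \<Phi> (section_form V) (take k es @ drop (Suc k) es)) z) = 0"
      unfolding HD_1 by (intro sum.neutral ballI) (simp del: length_append)
    then show ?thesis using 4 unfolding HD_def[of \<Phi> "HD \<Phi> (section_form V)"] by (simp add: HD_1)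
  qed (unfold HD_1, simp_all add: HD_def rl_def curv_def lessThan_Suc numeral_2_eq_2)
qed

text \<open>Besides the gradient of the Laplacian in degree 1, the curvature form $d^2 V$ contributes its
  divergence in degree 1 and its exterior derivative in degree 3. This is where the Eells--Sampson
  energy of order 5 differs from the plain one.\<close>

lemma HD_3:
  fixes \<Phi> :: "real \<times> 'a::euclidean_space => 'b::euclidean_space"
  shows "HD \<Phi> (HD \<Phi> (HD \<Phi> (section_form V))) = (\<lambda>es. if length es = 1 then lin3 \<Phi> V (es ! 0)
    else if length es = 3 then tri \<Phi> V (es ! 0) (es ! 1) (es ! 2) else (\<lambda>z. 0))"
proof (intro ext)
  fix es :: "'a list" and z
  consider "es = []" | e where "es = [e]" | e f where "es = [e, f]" | e f g where "es = [e, f, g]"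
    | e f g h gs where "es = e # f # g # h # gs"
    by (cases es; cases "tl es"; cases "tl (tl es)"; cases "tl (tl (tl es))") auto
  then show "HD \<Phi> (HD \<Phi> (HD \<Phi> (section_form V))) es z = (if length es = 1 then lin3 \<Phi> V (es ! 0)
    else if length es = 3 then tri \<Phi> V (es ! 0) (es ! 1) (es ! 2) else (\<lambda>z. 0)) z"
  proof cases
    case 5
    have *: "length (take k es @ drop (Suc k) es) \<noteq> 2 \<and> take k es @ drop (Suc k) es \<noteq> []" if "k < length es" for k
      using 5 that by (cases k) auto
    have "HD \<Phi> (HD \<Phi> (section_form V)) (take k es @ drop (Suc k) es) = (\<lambda>z. 0)" if "k < length es" for k
      unfolding HD_2 using *[OF that] by (simp only: if_False simp_thms)
    then have "(\<Sum>k<length es. (-1) ^ k *\<^sub>R cv \<Phi> (0, es ! k) (HD \<Phi> (HD \<Phi> (section_form V)) (take k es @ drop (Suc k) es)) z) = 0"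
      by (intro sum.neutral ballI) (simp only: lessThan_iff cv_0 scaleR_zero_right)
    then show ?thesis using 5 unfolding HD_def[of \<Phi> "HD \<Phi> (HD \<Phi> (section_form V))"] by (simp add: HD_2)
  qed (unfold HD_2, simp_all add: HD_def lin3_def tri_def lessThan_Suc numeral_2_eq_2 numeral_3_eq_3)
qed

lemma sum_atMost_supported:
  fixes h :: "nat => real"
  assumes "\<And>p. p \<le> n ==> p \<notin> S ==> h p = 0" "S \<subseteq> {..n}"
  shows "(\<Sum>p\<le>n. h p) = sum h S"
  by (rule sum.mono_neutral_right) (use assms in auto)

lemma form_density_HD_1:
  fixes \<Phi> :: "real \<times> 'a::euclidean_space => 'b::euclidean_space"
  assumes "1 \<le> DIM('a)"
  shows "form_density (HD \<Phi> (section_form V)) z = (\<Sum>e\<in>Basis. cv \<Phi> (0, e) V z \<bullet> cv \<Phi> (0, e) V z)"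
proof -
  have "form_density (HD \<Phi> (section_form V)) z = (\<Sum>p\<in>{Suc 0}. (1 / fact p) *\<^sub>R
     (\<Sum>es | set es \<subseteq> Basis \<and> length es = p. HD \<Phi> (section_form V) es z \<bullet> HD \<Phi> (section_form V) es z))"
    unfolding form_density_def by (rule sum_atMost_supported) (use assms in \<open>auto simp: HD_1 Suc_le_eq\<close>)
  then show ?thesis by (simp add: sum_lists_Suc sum_lists_0[simplified]) (simp add: HD_1)
qed

lemma form_density_HD_2:
  fixes \<Phi> :: "real \<times> 'a::euclidean_space => 'b::euclidean_space"
  assumes "2 \<le> DIM('a)"
  shows "form_density (HD \<Phi> (HD \<Phi> (section_form V))) z = rl \<Phi> V z \<bullet> rl \<Phi> V z +
    1/2 * (\<Sum>e\<in>Basis. \<Sum>f\<in>Basis. curv \<Phi> V e f z \<bullet> curv \<Phi> V e f z)"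
proof -
  have "form_density (HD \<Phi> (HD \<Phi> (section_form V))) z = (\<Sum>p\<in>{0, Suc (Suc 0)}. (1 / fact p) *\<^sub>R
     (\<Sum>es | set es \<subseteq> Basis \<and> length es = p. HD \<Phi> (HD \<Phi> (section_form V)) es z \<bullet> HD \<Phi> (HD \<Phi> (section_form V)) es z))"
    unfolding form_density_def by (rule sum_atMost_supported) (use assms in \<open>auto simp: HD_2 numeral_2_eq_2 intro!: sum.neutral\<close>)
  then show ?thesis
    by (simp add: sum_lists_Suc sum_lists_0[simplified] del: One_nat_def) (simp add: HD_2)
qed

lemma form_density_HD_3:
  fixes \<Phi> :: "real \<times> 'a::euclidean_space => 'b::euclidean_space"
  assumes "3 \<le> DIM('a)"
  shows "form_density (HD \<Phi> (HD \<Phi> (HD \<Phi> (section_form V)))) z =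
    (\<Sum>e\<in>Basis. lin3 \<Phi> V e z \<bullet> lin3 \<Phi> V e z) +
    1/6 * (\<Sum>e\<in>Basis. \<Sum>f\<in>Basis. \<Sum>g\<in>Basis. tri \<Phi> V e f g z \<bullet> tri \<Phi> V e f g z)"
proof -
  have "form_density (HD \<Phi> (HD \<Phi> (HD \<Phi> (section_form V)))) z = (\<Sum>p\<in>{Suc 0, Suc (Suc (Suc 0))}. (1 / fact p) *\<^sub>R
     (\<Sum>es | set es \<subseteq> Basis \<and> length es = p. HD \<Phi> (HD \<Phi> (HD \<Phi> (section_form V))) es z \<bullet> HD \<Phi> (HD \<Phi> (HD \<Phi> (section_form V))) es z))"
    unfolding form_density_def by (rule sum_atMost_supported) (use assms in \<open>auto simp: HD_3 numeral_3_eq_3\<close>)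
  then show ?thesis
    by (simp add: sum_lists_Suc sum_lists_0[simplified] del: One_nat_def) (simp add: HD_3 numeral_3_eq_3)
qed

section \<open>First variation\<close>

definition ball_int :: "(real \<times> 'a::euclidean_space => real) => real" where
  "ball_int G = (LINT x|lebesgue_on unit_ball. G (0, x))"

lemma ball_int_cong:
  fixes F G :: "real \<times> 'a::euclidean_space => real"
  assumes "0 < d" "symbol d k F" "symbol d l G" "\<And>x. (0, x) \<in> cyl d ==> F (0, x) = G (0, x)"
  shows "ball_int F = ball_int G"
  unfolding ball_int_def
  by (rule integral_cong_AE[OF measurable_slice[OF assms(2)] measurable_slice[OF assms(3)]])
    (use assms(1) AE_cyl[of 0 d, where ?'a = 'a] assms(4) in \<open>auto elim!: eventually_mono\<close>)

lemma ball_int_add: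
  fixes F G :: "real \<times> 'a::euclidean_space => real"
  assumes "0 < d" "symbol d k F" "symbol d k G" "k < DIM('a)"
  shows "ball_int (\<lambda>z. F z + G z) = ball_int F + ball_int G"
  unfolding ball_int_def using assms
  by (intro Bochner_Integration.integral_add integrable_slice[of d k]) auto

lemma ball_int_cmult: "ball_int (\<lambda>z. c * F z) = c * ball_int F"
  by (simp add: ball_int_def)

lemma ball_int_minus: "ball_int (\<lambda>z. - F z) = - ball_int F"
  by (simp add: ball_int_def)

lemma ball_int_diff:
  fixes F G :: "real \<times> 'a::euclidean_space => real"
  assumes "0 < d" "symbol d k F" "symbol d k G" "k < DIM('a)"
  shows "ball_int (\<lambda>z. F z - G z) = ball_int F - ball_int G"
  using ball_int_add[OF assms(1,2) sym_minus[OF assms(3)] assms(4)] by (simp add: ball_int_minus)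

lemma ball_int_sum:
  fixes F :: "'i => real \<times> 'a::euclidean_space => real"
  assumes "0 < d" "\<And>i. i \<in> I ==> symbol d k (F i)" "k < DIM('a)"
  shows "ball_int (\<lambda>z. \<Sum>i\<in>I. F i z) = (\<Sum>i\<in>I. ball_int (F i))"
  unfolding ball_int_def using assms
  by (intro Bochner_Integration.integral_sum integrable_slice[of d k]) auto

locale sphere_family =
  fixes d :: real and \<Phi> :: "real \<times> 'a::euclidean_space => 'b::euclidean_space"
  assumes d_pos: "0 < d" and sym_Phi: "symbol d 0 \<Phi>" and unit: "z \<in> cyl d ==> \<Phi> z \<bullet> \<Phi> z = 1"
begin

definition tangential :: "(real \<times> 'a => 'b) => bool" where
  "tangential W \<longleftrightarrow> (\<forall>z\<in>cyl d. W z \<bullet> \<Phi> z = 0)"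

lemma tangentialD: "tangential W ==> z \<in> cyl d ==> W z \<bullet> \<Phi> z = 0"
  by (simp add: tangential_def)

lemma dd_inner:
  assumes "symbol d k F" "symbol d l G" "z \<in> cyl d"
  shows "dd v (\<lambda>z. F z \<bullet> G z) z = F z \<bullet> dd v G z + dd v F z \<bullet> G z"
  by (rule dd_bilinear[OF bounded_bilinear_inner sym_differentiable[OF assms(1,3)] sym_differentiable[OF assms(2,3)]])

lemma dd_inner_const:
  assumes "symbol d k F" "symbol d l G" "z \<in> cyl d" "\<And>z. z \<in> cyl d ==> F z \<bullet> G z = c"
  shows "F z \<bullet> dd v G z + dd v F z \<bullet> G z = 0"
proof -
  have "dd v (\<lambda>z. F z \<bullet> G z) z = dd v (\<lambda>z. c) z"
    by (rule dd_cong[OF open_cyl assms(3,4)])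
  with dd_inner[OF assms(1-3), of v] show ?thesis by simp
qed

lemma dd_Phi_orth: "z \<in> cyl d ==> dd v \<Phi> z \<bullet> \<Phi> z = 0"
  using dd_inner_const[OF sym_Phi sym_Phi _ unit, of z v] by (simp add: inner_commute)

lemma tangential_dd_Phi: "tangential (dd v \<Phi>)"
  by (simp add: tangential_def dd_Phi_orth)

lemma dd_tangential:
  assumes "symbol d k W" "tangential W" "z \<in> cyl d"
  shows "dd v W z \<bullet> \<Phi> z = - (W z \<bullet> dd v \<Phi> z)"
  using dd_inner_const[OF assms(1) sym_Phi assms(3) tangentialD[OF assms(2)], of v] by simp

lemma tangential_cv: "tangential (cv \<Phi> v W)"
  by (simp add: tangential_def cv_def inner_diff_left unit)

lemma inner_cv: "tangential X ==> z \<in> cyl d ==> X z \<bullet> cv \<Phi> v W z = X z \<bullet> dd v W z"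
  by (simp add: cv_def inner_diff_right tangentialD)

lemma cv_inner: "tangential X ==> z \<in> cyl d ==> cv \<Phi> v W z \<bullet> X z = dd v W z \<bullet> X z"
  by (metis inner_cv inner_commute)

lemma dd_inner_cv:
  assumes "symbol d k X" "symbol d l Y" "tangential X" "tangential Y" "z \<in> cyl d"
  shows "dd v (\<lambda>z. X z \<bullet> Y z) z = X z \<bullet> cv \<Phi> v Y z + cv \<Phi> v X z \<bullet> Y z"
  using dd_inner[OF assms(1,2,5)] inner_cv[OF assms(3,5)] cv_inner[OF assms(4,5)] by simp

lemma cv_eq:
  assumes "symbol d k W" "tangential W" "z \<in> cyl d"
  shows "cv \<Phi> v W z = dd v W z + (W z \<bullet> dd v \<Phi> z) *\<^sub>R \<Phi> z"
  using dd_tangential[OF assms] by (simp add: cv_def)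

lemma cv_cv:
  assumes W: "symbol d k W" "tangential W" and v: "v \<in> dirs" "w \<in> dirs" and z: "z \<in> cyl d"
  shows "cv \<Phi> v (cv \<Phi> w W) z =
    dd v (dd w W) z - (dd v (dd w W) z \<bullet> \<Phi> z) *\<^sub>R \<Phi> z + (W z \<bullet> dd w \<Phi> z) *\<^sub>R dd v \<Phi> z"
proof -
  have s: "symbol d (k + 1) (\<lambda>z. W z \<bullet> dd w \<Phi> z)"
    using sym_inner[OF W(1) sym_dd[OF sym_Phi v(2)]] by simp
  let ?c = "dd v (\<lambda>z. W z \<bullet> dd w \<Phi> z) z"
  have "dd v (cv \<Phi> w W) z = dd v (\<lambda>z. dd w W z + (W z \<bullet> dd w \<Phi> z) *\<^sub>R \<Phi> z) z"
    by (rule dd_cong[OF open_cyl z cv_eq[OF W]])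
  also have "\<dots> = dd v (dd w W) z + dd v (\<lambda>z. (W z \<bullet> dd w \<Phi> z) *\<^sub>R \<Phi> z) z"
    by (rule dd_add[OF sym_differentiable[OF sym_dd[OF W(1) v(2)] z]
        sym_differentiable[OF sym_scaleR[OF s sym_Phi] z]])
  also have "dd v (\<lambda>z. (W z \<bullet> dd w \<Phi> z) *\<^sub>R \<Phi> z) z = (W z \<bullet> dd w \<Phi> z) *\<^sub>R dd v \<Phi> z + ?c *\<^sub>R \<Phi> z"
    by (rule dd_bilinear[OF bounded_bilinear_scaleR sym_differentiable[OF s z] sym_differentiable[OF sym_Phi z]])
  finally show ?thesis
    using unit[OF z] dd_Phi_orth[OF z, of v]
    by (simp add: cv_def inner_add_left scaleR_add_left)
qed

text \<open>The commutator of two covariant derivatives is the curvature of the unit sphere, whose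
  curvature tensor is an explicit expression in the metric.\<close>

lemma cv_commutator:
  assumes W: "symbol d k W" "tangential W" and v: "v \<in> dirs" "w \<in> dirs" and z: "z \<in> cyl d"
  shows "cv \<Phi> v (cv \<Phi> w W) z =
    cv \<Phi> w (cv \<Phi> v W) z + (W z \<bullet> dd w \<Phi> z) *\<^sub>R dd v \<Phi> z - (W z \<bullet> dd v \<Phi> z) *\<^sub>R dd w \<Phi> z"
  using cv_cv[OF W v z] cv_cv[OF W v(2,1) z] sym_dd_commute[OF W(1) v z] by simp

lemma cv_dd_Phi_commute:
  assumes "v \<in> dirs" "w \<in> dirs" "z \<in> cyl d"
  shows "cv \<Phi> v (dd w \<Phi>) z = cv \<Phi> w (dd v \<Phi>) z"
  using sym_dd_commute[OF sym_Phi assms] by (simp add: cv_def)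

text \<open>Metric compatibility turns the derivative of an inner product into covariant derivatives; the
  projections drop out because both fields are tangential.\<close>

lemma cv_parts:
  assumes X: "symbol d k X" "tangential X" and Y: "symbol d l Y" "tangential Y"
    and kl: "Suc (k + l) < DIM('a)" and e: "e \<in> Basis"
    and K: "compact K" "K \<subseteq> unit_ball" "\<And>x. x \<notin> K ==> (0, x) \<in> cyl d ==> Y (0, x) = 0"
  shows "ball_int (\<lambda>z. X z \<bullet> cv \<Phi> (0, e) Y z) = - ball_int (\<lambda>z. cv \<Phi> (0, e) X z \<bullet> Y z)"
proof -
  have s: "symbol d (k + l) (\<lambda>z. X z \<bullet> Y z)" by (rule sym_inner[OF X(1) Y(1)])
  have 1: "symbol d (Suc (k + l)) (\<lambda>z. X z \<bullet> cv \<Phi> (0, e) Y z)"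
    using sym_inner[OF X(1) sym_cv[OF sym_Phi Y(1) e]] by simp
  have 2: "symbol d (Suc (k + l)) (\<lambda>z. cv \<Phi> (0, e) X z \<bullet> Y z)"
    using sym_inner[OF sym_cv[OF sym_Phi X(1) e] Y(1)] by simp
  have "0 = ball_int (dd (0, e) (\<lambda>z. X z \<bullet> Y z))"
    unfolding ball_int_def
    by (rule integral_partial_symbol[OF s kl _ e K(1,2), symmetric]) (use d_pos K(3) in auto)
  also have "\<dots> = ball_int (\<lambda>z. X z \<bullet> cv \<Phi> (0, e) Y z + cv \<Phi> (0, e) X z \<bullet> Y z)"
    by (rule ball_int_cong[OF d_pos sym_dx[OF s e] sym_add[OF 1 2]]) (rule dd_inner_cv[OF X(1) Y(1) X(2) Y(2)])
  also have "\<dots> = ball_int (\<lambda>z. X z \<bullet> cv \<Phi> (0, e) Y z) + ball_int (\<lambda>z. cv \<Phi> (0, e) X z \<bullet> Y z)"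
    by (rule ball_int_add[OF d_pos 1 2 kl])
  finally show ?thesis by simp
qed

text \<open>Integrations by parts below produce no boundary terms because one factor is a \<open>t\<close>-derivative
  that vanishes off a compact subset of the ball.\<close>

definition still :: "'a set => (real \<times> 'a => 'c::euclidean_space) => bool" where
  "still K F \<longleftrightarrow> (\<forall>z\<in>cyl d. snd z \<notin> K --> dd (1, 0) F z = 0)"

lemma still_dd:
  assumes "still K F" "closed K" "symbol d k F" "e \<in> Basis"
  shows "still K (dd (0, e) F)"
  unfolding still_def
proof (intro ballI impI)
  fix z assume z: "z \<in> cyl d" "snd z \<notin> K"
  let ?S = "cyl d \<inter> (UNIV \<times> (- K))"
  have S: "open ?S" using assms(2) by (intro open_Int open_cyl open_Times) (auto simp: open_Compl)
  have "dd (1, 0) (dd (0, e) F) z = dd (0, e) (dd (1, 0) F) z"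
    using assms z by (intro sym_dd_commute[OF assms(3)]) auto
  also have "\<dots> = dd (0, e) (\<lambda>z. 0) z"
    by (rule dd_cong[OF S]) (use assms(1) z in \<open>auto simp: still_def mem_Times_iff\<close>)
  finally show "dd (1, 0) (dd (0, e) F) z = 0" by simp
qed

lemma still_bilinear:
  assumes "bounded_bilinear bl" "still K F" "still K G" "symbol d k F" "symbol d l G"
  shows "still K (\<lambda>z. bl (F z) (G z))"
  unfolding still_def
proof (intro ballI impI)
  fix z assume z: "z \<in> cyl d" "snd z \<notin> K"
  show "dd (1, 0) (\<lambda>z. bl (F z) (G z)) z = 0"
    using assms(2,3) z
    by (simp add: dd_bilinear[OF assms(1) sym_differentiable[OF assms(4) z(1)] sym_differentiable[OF assms(5) z(1)]]
        still_def bounded_bilinear.zero_left[OF assms(1)] bounded_bilinear.zero_right[OF assms(1)])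
qed

lemma still_add:
  assumes "still K F" "still K G" "symbol d k F" "symbol d l G"
  shows "still K (\<lambda>z. F z + G z)"
  using assms by (auto simp: still_def dd_add[OF sym_differentiable[OF assms(3)] sym_differentiable[OF assms(4)]])

lemma still_minus:
  assumes "still K F" "symbol d k F"
  shows "still K (\<lambda>z. - F z)"
  using assms by (auto simp: still_def
      dd_linear[OF bounded_linear_minus[OF bounded_linear_ident] sym_differentiable[OF assms(2)]])

lemma still_sum:
  assumes "\<And>i. i \<in> I ==> still K (F i)" "\<And>i. i \<in> I ==> symbol d k (F i)"
  shows "still K (\<lambda>z. \<Sum>i\<in>I. F i z)"
  using assms
proof (induction I rule: infinite_finite_induct)
  case (insert i I)
  then have "still K (\<lambda>z. F i z + (\<Sum>i\<in>I. F i z))"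
    by (intro still_add[of K _ _ k k] sym_sum) auto
  with insert show ?case by simp
qed (simp_all add: still_def)

lemma still_cv:
  assumes "still K \<Phi>" "still K W" "closed K" "symbol d k W" "e \<in> Basis"
  shows "still K (cv \<Phi> (0, e) W)"
proof -
  have W': "symbol d (Suc k) (dd (0, e) W)" "still K (dd (0, e) W)"
    using assms by (auto intro: sym_dx still_dd)
  have i: "symbol d (Suc k) (\<lambda>z. dd (0, e) W z \<bullet> \<Phi> z)" using sym_inner[OF W'(1) sym_Phi] by simp
  have "still K (\<lambda>z. (dd (0, e) W z \<bullet> \<Phi> z) *\<^sub>R \<Phi> z)"
    by (rule still_bilinear[OF bounded_bilinear_scaleR still_bilinear[OF bounded_bilinear_inner W'(2) assms(1) W'(1) sym_Phi] assms(1) i sym_Phi])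
  then have "still K (\<lambda>z. dd (0, e) W z + - ((dd (0, e) W z \<bullet> \<Phi> z) *\<^sub>R \<Phi> z))"
    using sym_scaleR[OF i sym_Phi] W' by (intro still_add[of K _ _ "Suc k" "Suc k + 0"] still_minus sym_minus) auto
  then show ?thesis by (simp add: cv_def)
qed

lemma still_tau: "still K \<Phi> ==> closed K ==> still K (tau \<Phi>)"
  unfolding tau_def
  by (rule still_sum[where k = 2]) (auto intro!: still_cv[where k = "Suc 0"] still_dd[OF _ _ sym_Phi] sym_dx sym_Phi
      sym_cv[where k = "Suc 0", simplified] simp: numeral_2_eq_2)

lemma still_rl:
  assumes "still K \<Phi>" "still K W" "closed K" "symbol d k W"
  shows "still K (rl \<Phi> W)"
  unfolding rl_def
  by (intro still_minus[where k = "Suc (Suc k)"] still_sum[where k = "Suc (Suc k)"] sym_sum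
      still_cv[OF assms(1) still_cv[OF assms] assms(3) sym_cv[OF sym_Phi assms(4)]] sym_cv sym_Phi assms(4))

lemma still_iter: "still K \<Phi> ==> closed K ==> still K (iter \<Phi> j)"
proof (induction j)
  case (Suc j)
  then show ?case using still_rl[OF _ _ _ sym_iter[OF sym_Phi]] by simp
qed (simp add: still_tau)

lemma cvt_eq_0: "still K W ==> (t, x) \<in> cyl d ==> x \<notin> K ==> cv \<Phi> (1, 0) W (t, x) = 0"
  by (auto simp: cv_def still_def)

lemma tangential_sum: "(\<And>i. i \<in> I ==> tangential (F i)) ==> tangential (\<lambda>z. \<Sum>i\<in>I. F i z)"
  by (auto simp: tangential_def inner_sum_left)

lemma tangential_tau: "tangential (tau \<Phi>)"
  unfolding tau_def by (intro tangential_sum tangential_cv)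

lemma tangential_rl: "tangential (rl \<Phi> W)"
  using tangential_sum[of Basis "\<lambda>e. cv \<Phi> (0, e) (cv \<Phi> (0, e) W)", OF tangential_cv]
  by (simp add: rl_def tangential_def)

lemma tangential_iter: "tangential (iter \<Phi> j)"
  by (cases j) (auto simp: tangential_tau tangential_rl)

lemma cv_sum:
  assumes "\<And>i. i \<in> I ==> symbol d k (F i)" "z \<in> cyl d"
  shows "cv \<Phi> v (\<lambda>z. \<Sum>i\<in>I. F i z) z = (\<Sum>i\<in>I. cv \<Phi> v (F i) z)"
proof -
  have "dd v (\<lambda>z. \<Sum>i\<in>I. F i z) z = (\<Sum>i\<in>I. dd v (F i) z)"
    by (rule dd_eqI) (intro has_derivative_sum dd_works sym_differentiable[OF assms])
  then show ?thesis
    by (simp add: cv_def inner_sum_left scaleR_sum_left sum_subtractf)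
qed

lemma cv_minus:
  assumes "symbol d k F" "z \<in> cyl d"
  shows "cv \<Phi> v (\<lambda>z. - F z) z = - cv \<Phi> v F z"
  using dd_linear[OF bounded_linear_minus[OF bounded_linear_ident] sym_differentiable[OF assms], of v]
  by (simp add: cv_def)

lemma cv_add:
  assumes "symbol d k F" "symbol d l G" "z \<in> cyl d"
  shows "cv \<Phi> v (\<lambda>z. F z + G z) z = cv \<Phi> v F z + cv \<Phi> v G z"
  using dd_add[OF sym_differentiable[OF assms(1,3)] sym_differentiable[OF assms(2,3)], of v]
  by (simp add: cv_def inner_add_left scaleR_add_left)

lemma cv_scale:
  assumes "symbol d k f" "symbol d l F" "z \<in> cyl d"
  shows "cv \<Phi> v (\<lambda>z. f z *\<^sub>R F z) z = f z *\<^sub>R cv \<Phi> v F z + dd v f z *\<^sub>R (F z - (F z \<bullet> \<Phi> z) *\<^sub>R \<Phi> z)"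
  using dd_bilinear[OF bounded_bilinear_scaleR sym_differentiable[OF assms(1,3)] sym_differentiable[OF assms(2,3)], of v]
  by (simp add: cv_def inner_add_left algebra_simps)

lemma cv_cong: "z \<in> cyl d ==> (\<And>z. z \<in> cyl d ==> F z = G z) ==> cv \<Phi> v F z = cv \<Phi> v G z"
  using dd_cong[OF open_cyl, of z d F G v] by (simp add: cv_def)

abbreviation "cve e \<equiv> cv \<Phi> (0, e)"
abbreviation "cvt \<equiv> cv \<Phi> (1, 0)"
abbreviation "phid e \<equiv> dd (0, e) \<Phi>"
abbreviation "vel \<equiv> dd (1, 0) \<Phi>"

lemma cvt_cve:
  assumes "symbol d k W" "tangential W" "e \<in> Basis" "z \<in> cyl d"
  shows "cvt (cve e W) z = cve e (cvt W) z + (W z \<bullet> phid e z) *\<^sub>R vel z - (W z \<bullet> vel z) *\<^sub>R phid e z"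
  using cv_commutator[OF assms(1,2) _ _ assms(4), of "(1, 0)" "(0, e)"] assms(3) by simp

text \<open>Integrating \<open>\<langle>X, D\<^sub>t (rough Laplacian of Y)\<rangle>\<close> by parts twice moves the rough Laplacian to
  \<open>X\<close>; the commutators of \<open>D\<^sub>t\<close> with the two derivatives leave the curvature terms.\<close>

lemma first_variation_rl:
  assumes X: "symbol d k X" "tangential X" and Y: "symbol d l Y" "tangential Y" "still K Y"
    and kl: "k + l + 2 < DIM('a)" and K: "compact K" "K \<subseteq> unit_ball" and \<Phi>: "still K \<Phi>"
  shows "ball_int (\<lambda>z. X z \<bullet> cvt (rl \<Phi> Y) z) = ball_int (\<lambda>z. rl \<Phi> X z \<bullet> cvt Y z) +
    ball_int (\<lambda>z. \<Sum>e\<in>Basis. cve e X z \<bullet> ((Y z \<bullet> phid e z) *\<^sub>R vel z - (Y z \<bullet> vel z) *\<^sub>R phid e z)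
      - X z \<bullet> ((cve e Y z \<bullet> phid e z) *\<^sub>R vel z - (cve e Y z \<bullet> vel z) *\<^sub>R phid e z))"
proof -
  let ?n = "DIM('a)"
  have cK: "closed K" using K by (simp add: compact_imp_closed)
  \<comment> \<open>the curvature term of the commutator of \<open>D\<^sub>t\<close> and the derivative in the direction \<open>e\<close>\<close>
  let ?R = "\<lambda>e W z. (W z \<bullet> phid e z) *\<^sub>R vel z - (W z \<bullet> vel z) *\<^sub>R phid e z"
  have sR: "symbol d (Suc m) (?R e W)" if "symbol d m W" "e \<in> Basis" for e W m
  proof -
    have "symbol d (Suc m) (\<lambda>z. (W z \<bullet> phid e z) *\<^sub>R vel z)"
      using sym_scaleR[OF sym_inner[OF that(1) sym_dx[OF sym_Phi that(2)]] sym_dt[OF sym_Phi]] by simp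
    moreover have "symbol d (Suc m) (\<lambda>z. (W z \<bullet> vel z) *\<^sub>R phid e z)"
      using sym_scaleR[OF sym_inner[OF that(1) sym_dt[OF sym_Phi]] sym_dx[OF sym_Phi that(2)]] by simp
    ultimately show ?thesis by (rule sym_diff)
  qed
  have one: "ball_int (\<lambda>z. X z \<bullet> cvt (cve e (cve e Y)) z) =
      ball_int (\<lambda>z. cve e (cve e X) z \<bullet> cvt Y z) +
      ball_int (\<lambda>z. X z \<bullet> ?R e (cve e Y) z - cve e X z \<bullet> ?R e Y z)" if e: "e \<in> Basis" for e
  proof -
    have sX: "symbol d (Suc k) (cve e X)" and sY: "symbol d (Suc l) (cve e Y)"
      using sym_cv[OF sym_Phi _ e] X Y by auto
    have st: "still K (cve e Y)" by (rule still_cv[OF \<Phi> Y(3) cK Y(1) e])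
    have s1: "symbol d (k + l + 2) (\<lambda>z. X z \<bullet> cve e (cvt (cve e Y)) z)"
      using sym_inner[OF X(1) sym_cv[OF sym_Phi sym_cvt[OF sym_Phi sY] e]] by simp
    have s2: "symbol d (k + l + 2) (\<lambda>z. X z \<bullet> ?R e (cve e Y) z)"
      using sym_inner[OF X(1) sR[OF sY e]] by simp
    have s3: "symbol d (k + l + 2) (\<lambda>z. cve e X z \<bullet> ?R e Y z)"
      using sym_inner[OF sX sR[OF Y(1) e]] by simp
    have s4: "symbol d (k + l + 2) (\<lambda>z. cve e X z \<bullet> cve e (cvt Y) z)"
      using sym_inner[OF sX sym_cv[OF sym_Phi sym_cvt[OF sym_Phi Y(1)] e]] by simp
    have "ball_int (\<lambda>z. X z \<bullet> cvt (cve e (cve e Y)) z) =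
        ball_int (\<lambda>z. X z \<bullet> cve e (cvt (cve e Y)) z + X z \<bullet> ?R e (cve e Y) z)"
      by (rule ball_int_cong[OF d_pos sym_inner[OF X(1) sym_cvt[OF sym_Phi sym_cv[OF sym_Phi sY e]]] sym_add[OF s1 s2]])
        (simp add: cvt_cve[OF sY tangential_cv e] inner_add_right inner_diff_right)
    also have "\<dots> = ball_int (\<lambda>z. X z \<bullet> cve e (cvt (cve e Y)) z) + ball_int (\<lambda>z. X z \<bullet> ?R e (cve e Y) z)"
      by (rule ball_int_add[OF d_pos s1 s2 kl])
    also have "ball_int (\<lambda>z. X z \<bullet> cve e (cvt (cve e Y)) z) = - ball_int (\<lambda>z. cve e X z \<bullet> cvt (cve e Y) z)"
      by (rule cv_parts[OF X sym_cvt[OF sym_Phi sY] tangential_cv _ e K])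
        (use kl cvt_eq_0[OF st] in auto)
    also have "ball_int (\<lambda>z. cve e X z \<bullet> cvt (cve e Y) z) = ball_int (\<lambda>z. cve e X z \<bullet> cve e (cvt Y) z + cve e X z \<bullet> ?R e Y z)"
      by (rule ball_int_cong[OF d_pos sym_inner[OF sX sym_cvt[OF sym_Phi sY]] sym_add[OF s4 s3]])
        (simp add: cvt_cve[OF Y(1,2) e] inner_add_right inner_diff_right)
    also have "\<dots> = ball_int (\<lambda>z. cve e X z \<bullet> cve e (cvt Y) z) + ball_int (\<lambda>z. cve e X z \<bullet> ?R e Y z)"
      by (rule ball_int_add[OF d_pos s4 s3 kl])
    also have "ball_int (\<lambda>z. cve e X z \<bullet> cve e (cvt Y) z) = - ball_int (\<lambda>z. cve e (cve e X) z \<bullet> cvt Y z)"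
      by (rule cv_parts[OF sX tangential_cv sym_cvt[OF sym_Phi Y(1)] tangential_cv _ e K])
        (use kl cvt_eq_0[OF Y(3)] in auto)
    finally show ?thesis using ball_int_diff[OF d_pos s2 s3 kl] by simp
  qed
  have sYY: "symbol d (l + 2) (cve e (cve e Y))" and sXX: "symbol d (k + 2) (cve e (cve e X))" if "e \<in> Basis" for e
    using sym_cv[OF sym_Phi sym_cv[OF sym_Phi X(1) that] that] sym_cv[OF sym_Phi sym_cv[OF sym_Phi Y(1) that] that] by auto
  have i1: "symbol d (k + l + 2) (\<lambda>z. X z \<bullet> cvt (cve e (cve e Y)) z)" if "e \<in> Basis" for e
    using sym_inner[OF X(1) sym_cvt[OF sym_Phi sYY[OF that]]] by (simp add: add.assoc)
  have i2: "symbol d (k + l + 2) (\<lambda>z. cve e (cve e X) z \<bullet> cvt Y z)" if "e \<in> Basis" for e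
    using sym_inner[OF sXX[OF that] sym_cvt[OF sym_Phi Y(1)]] by (simp add: add_ac)
  have i3: "symbol d (k + l + 2) (\<lambda>z. X z \<bullet> ?R e (cve e Y) z - cve e X z \<bullet> ?R e Y z)" if "e \<in> Basis" for e
    using sym_diff[OF sym_inner[OF X(1) sR[OF sym_cv[OF sym_Phi Y(1) that] that]]
        sym_inner[OF sym_cv[OF sym_Phi X(1) that] sR[OF Y(1) that], simplified, THEN sym_mono[of d _ _ "k + Suc (Suc l)"]]] by simp
  have "ball_int (\<lambda>z. X z \<bullet> cvt (rl \<Phi> Y) z) = ball_int (\<lambda>z. - (\<Sum>e\<in>Basis. X z \<bullet> cvt (cve e (cve e Y)) z))"
  proof (rule ball_int_cong[OF d_pos])
    show "symbol d (k + (l + 2)) (\<lambda>z. X z \<bullet> cvt (rl \<Phi> Y) z)"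
      using sym_inner[OF X(1) sym_cvt[OF sym_Phi sym_rl[OF sym_Phi Y(1)]]] by simp
    show "symbol d (k + l + 2) (\<lambda>z. - (\<Sum>e\<in>Basis. X z \<bullet> cvt (cve e (cve e Y)) z))"
      by (intro sym_minus sym_sum i1)
    show "X (0, x) \<bullet> cvt (rl \<Phi> Y) (0, x) = - (\<Sum>e\<in>Basis. X (0, x) \<bullet> cvt (cve e (cve e Y)) (0, x))" if "(0, x) \<in> cyl d" for x
    proof -
      have "cvt (\<lambda>z. \<Sum>e\<in>Basis. cve e (cve e Y) z) (0, x) = (\<Sum>e\<in>Basis. cvt (cve e (cve e Y)) (0, x))"
        by (rule cv_sum[OF sYY that])
      moreover have "symbol d (l + 2) (\<lambda>z. \<Sum>e\<in>Basis. cve e (cve e Y) z)" by (rule sym_sum[OF sYY])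
      ultimately show ?thesis
        unfolding rl_def by (simp add: cv_minus[OF _ that] inner_sum_right)
    qed
  qed
  also have "\<dots> = - (\<Sum>e\<in>Basis. ball_int (\<lambda>z. X z \<bullet> cvt (cve e (cve e Y)) z))"
    unfolding ball_int_minus by (subst ball_int_sum[OF d_pos i1 kl]) auto
  also have "\<dots> = - (\<Sum>e\<in>Basis. ball_int (\<lambda>z. cve e (cve e X) z \<bullet> cvt Y z)) -
      (\<Sum>e\<in>Basis. ball_int (\<lambda>z. X z \<bullet> ?R e (cve e Y) z - cve e X z \<bullet> ?R e Y z))"
    by (simp add: one sum.distrib)
  also have "(\<Sum>e\<in>Basis. ball_int (\<lambda>z. cve e (cve e X) z \<bullet> cvt Y z)) = ball_int (\<lambda>z. \<Sum>e\<in>Basis. cve e (cve e X) z \<bullet> cvt Y z)"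
    by (rule ball_int_sum[OF d_pos i2 kl, symmetric])
  also have "- \<dots> = ball_int (\<lambda>z. rl \<Phi> X z \<bullet> cvt Y z)"
    unfolding ball_int_minus[symmetric] by (simp add: rl_def inner_sum_left)
  also have "(\<Sum>e\<in>Basis. ball_int (\<lambda>z. X z \<bullet> ?R e (cve e Y) z - cve e X z \<bullet> ?R e Y z)) =
      ball_int (\<lambda>z. \<Sum>e\<in>Basis. X z \<bullet> ?R e (cve e Y) z - cve e X z \<bullet> ?R e Y z)"
    by (rule ball_int_sum[OF d_pos i3 kl, symmetric])
  finally show ?thesis
    using ball_int_minus[of "\<lambda>z. \<Sum>e\<in>Basis. X z \<bullet> ?R e (cve e Y) z - cve e X z \<bullet> ?R e Y z"]
    by (simp flip: sum_negf)
qed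

text \<open>The velocity is the variation of the map itself, so that two integrations by parts move the
  rough Laplacian to \<open>X\<close>; the remaining terms are the curvature terms of the Jacobi operator.\<close>

lemma first_variation_tau:
  assumes X: "symbol d k X" "tangential X"
    and kl: "k + 2 < DIM('a)" and K: "compact K" "K \<subseteq> unit_ball" and \<Phi>: "still K \<Phi>"
  shows "ball_int (\<lambda>z. X z \<bullet> cvt (tau \<Phi>) z) = - ball_int (\<lambda>z. rl \<Phi> X z \<bullet> vel z) +
    ball_int (\<lambda>z. \<Sum>e\<in>Basis. (phid e z \<bullet> phid e z) * (vel z \<bullet> X z) - (vel z \<bullet> phid e z) * (phid e z \<bullet> X z))"
proof -
  have cK: "closed K" using K by (simp add: compact_imp_closed)
  let ?R = "\<lambda>e z. (phid e z \<bullet> phid e z) * (vel z \<bullet> X z) - (vel z \<bullet> phid e z) * (phid e z \<bullet> X z)"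
  have sp: "symbol d (Suc 0) (phid e)" if "e \<in> Basis" for e by (rule sym_dx[OF sym_Phi that])
  have sv: "symbol d 0 vel" by (rule sym_dt[OF sym_Phi])
  have v0: "vel (0, x) = 0" if "x \<notin> K" "(0, x) \<in> cyl d" for x using \<Phi> that by (auto simp: still_def)
  have sR: "symbol d (k + 2) (?R e)" if "e \<in> Basis" for e
  proof -
    have "symbol d (k + 2) (\<lambda>z. (phid e z \<bullet> phid e z) * (vel z \<bullet> X z))"
      using sym_mult[OF sym_inner[OF sp[OF that] sp[OF that]] sym_inner[OF sv X(1)]] by (simp add: add.commute)
    moreover have "symbol d (k + 2) (\<lambda>z. (vel z \<bullet> phid e z) * (phid e z \<bullet> X z))"
      using sym_mult[OF sym_inner[OF sv sp[OF that]] sym_inner[OF sp[OF that] X(1)]] by (simp add: add.commute)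
    ultimately show ?thesis by (rule sym_diff)
  qed
  have one: "ball_int (\<lambda>z. X z \<bullet> cvt (cve e (phid e)) z) =
      ball_int (\<lambda>z. cve e (cve e X) z \<bullet> vel z) + ball_int (?R e)" if e: "e \<in> Basis" for e
  proof -
    have sX: "symbol d (Suc k) (cve e X)" by (rule sym_cv[OF sym_Phi X(1) e])
    have sV: "symbol d (Suc 0) (cve e vel)" by (rule sym_cv[OF sym_Phi sv e])
    have s1: "symbol d (k + 2) (\<lambda>z. X z \<bullet> cve e (cve e vel) z)"
      using sym_inner[OF X(1) sym_cv[OF sym_Phi sV e]] by simp
    have "ball_int (\<lambda>z. X z \<bullet> cvt (cve e (phid e)) z) = ball_int (\<lambda>z. X z \<bullet> cve e (cve e vel) z + ?R e z)"
    proof (rule ball_int_cong[OF d_pos sym_inner[OF X(1) sym_cvt[OF sym_Phi sym_cv[OF sym_Phi sp[OF e] e]]] sym_add[OF s1 sR[OF e]]])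
      fix x :: 'a assume z: "(0, x) \<in> cyl d"
      have "cve e (cvt (phid e)) (0, x) = cve e (cve e vel) (0, x)"
        by (rule cv_cong[OF z]) (use e in \<open>auto intro!: cv_dd_Phi_commute\<close>)
      then show "X (0, x) \<bullet> cvt (cve e (phid e)) (0, x) = X (0, x) \<bullet> cve e (cve e vel) (0, x) + ?R e (0, x)"
        by (simp add: cvt_cve[OF sp[OF e] tangential_dd_Phi e z] inner_add_right inner_diff_right inner_commute)
    qed
    also have "\<dots> = ball_int (\<lambda>z. X z \<bullet> cve e (cve e vel) z) + ball_int (?R e)"
      by (rule ball_int_add[OF d_pos s1 sR[OF e] kl])
    also have "ball_int (\<lambda>z. X z \<bullet> cve e (cve e vel) z) = - ball_int (\<lambda>z. cve e X z \<bullet> cve e vel z)"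
    proof (rule cv_parts[OF X sV tangential_cv _ e K])
      fix x :: 'a assume x: "x \<notin> K" "(0, x) \<in> cyl d"
      have "still K (phid e)" by (rule still_dd[OF \<Phi> cK sym_Phi e])
      then have "cvt (phid e) (0, x) = 0" using x by (rule_tac cvt_eq_0)
      then show "cve e vel (0, x) = 0"
        using cv_dd_Phi_commute[of "(1, 0)" "(0, e)" "(0, x)"] e x by simp
    qed (use kl in simp)
    also have "ball_int (\<lambda>z. cve e X z \<bullet> cve e vel z) = - ball_int (\<lambda>z. cve e (cve e X) z \<bullet> vel z)"
      by (rule cv_parts[OF sX tangential_cv sv tangential_dd_Phi _ e K]) (use kl v0 in auto)
    finally show ?thesis by simp
  qed
  have sT: "symbol d 2 (cve e (phid e))" if "e \<in> Basis" for e
    using sym_cv[OF sym_Phi sp[OF that] that] by (simp add: numeral_2_eq_2)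
  have i1: "symbol d (k + 2) (\<lambda>z. X z \<bullet> cvt (cve e (phid e)) z)" if "e \<in> Basis" for e
    using sym_inner[OF X(1) sym_cvt[OF sym_Phi sT[OF that]]] by simp
  have i2: "symbol d (k + 2) (\<lambda>z. cve e (cve e X) z \<bullet> vel z)" if "e \<in> Basis" for e
    using sym_inner[OF sym_cv[OF sym_Phi sym_cv[OF sym_Phi X(1) that] that] sv] by simp
  have "ball_int (\<lambda>z. X z \<bullet> cvt (tau \<Phi>) z) = ball_int (\<lambda>z. \<Sum>e\<in>Basis. X z \<bullet> cvt (cve e (phid e)) z)"
  proof (rule ball_int_cong[OF d_pos sym_inner[OF X(1) sym_cvt[OF sym_Phi sym_tau[OF sym_Phi]]] sym_sum[OF i1]])
    show "X (0, x) \<bullet> cvt (tau \<Phi>) (0, x) = (\<Sum>e\<in>Basis. X (0, x) \<bullet> cvt (cve e (phid e)) (0, x))" if "(0, x) \<in> cyl d" for x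
    proof -
      have "cvt (\<lambda>z. \<Sum>e\<in>Basis. cve e (phid e) z) (0, x) = (\<Sum>e\<in>Basis. cvt (cve e (phid e)) (0, x))"
        by (rule cv_sum[OF sT that])
      then show ?thesis unfolding tau_def by (simp add: inner_sum_right)
    qed
  qed
  also have "\<dots> = (\<Sum>e\<in>Basis. ball_int (\<lambda>z. X z \<bullet> cvt (cve e (phid e)) z))"
    by (rule ball_int_sum[OF d_pos i1 kl])
  also have "\<dots> = (\<Sum>e\<in>Basis. ball_int (\<lambda>z. cve e (cve e X) z \<bullet> vel z)) + (\<Sum>e\<in>Basis. ball_int (?R e))"
    by (simp add: one sum.distrib)
  also have "(\<Sum>e\<in>Basis. ball_int (?R e)) = ball_int (\<lambda>z. \<Sum>e\<in>Basis. ?R e z)"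
    by (rule ball_int_sum[OF d_pos sR kl, symmetric])
  also have "(\<Sum>e\<in>Basis. ball_int (\<lambda>z. cve e (cve e X) z \<bullet> vel z)) = ball_int (\<lambda>z. \<Sum>e\<in>Basis. cve e (cve e X) z \<bullet> vel z)"
    by (rule ball_int_sum[OF d_pos i2 kl, symmetric])
  also have "\<dots> = - ball_int (\<lambda>z. rl \<Phi> X z \<bullet> vel z)"
    by (simp add: rl_def inner_sum_left ball_int_minus)
  finally show ?thesis .
qed

end

section \<open>Rotationally equivariant families\<close>

lemma dd_sum:
  assumes "\<And>i. i \<in> I ==> symbol d k (F i)" "z \<in> cyl d"
  shows "dd v (\<lambda>z. \<Sum>i\<in>I. F i z) z = (\<Sum>i\<in>I. dd v (F i) z)"
  by (rule dd_eqI) (intro has_derivative_sum dd_works sym_differentiable[OF assms])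

text \<open>\<open>A\<close> depends on \<open>x\<close> only through $|x|$, and \<open>A'\<close> is its derivative with respect to $\ln |x|$.\<close>

definition rad :: "real => (real \<times> 'a::euclidean_space => real) => (real \<times> 'a => real) => bool" where
  "rad d A A' \<longleftrightarrow> symbol d 0 A \<and> symbol d 0 A' \<and>
     (\<forall>z\<in>cyl d. \<forall>e. dd (0, e) A z = qq z * (uu z \<bullet> e) * A' z)"

lemma radD: "rad d A A' ==> z \<in> cyl d ==> dd (0, e) A z = qq z * (uu z \<bullet> e) * A' z"
  by (simp add: rad_def)

lemma rad_sym: "rad d A A' ==> symbol d 0 A" "rad d A A' ==> symbol d 0 A'"
  by (simp_all add: rad_def)

lemma rad_cong: "rad d A A' ==> (\<And>z. A' z = B z) ==> rad d A B"
  by (metis ext)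

lemma rad_const: "rad d (\<lambda>z. c) (\<lambda>z. 0)"
  by (simp add: rad_def)

lemma rad_fst: "rad d fst (\<lambda>z. 0)"
proof -
  have "dd (0, e) fst z = 0" for z :: "real \<times> 'a" and e :: 'a
    using dd_eqI[OF has_derivative_fst[OF has_derivative_ident], where v = "(0, e)" and z = z] by simp
  then show ?thesis by (simp add: rad_def sym_fst)
qed

lemma rad_add: "rad d A A' ==> rad d B B' ==> rad d (\<lambda>z. A z + B z) (\<lambda>z. A' z + B' z)"
  by (auto simp: rad_def sym_add dd_add[OF sym_differentiable sym_differentiable] algebra_simps)

lemma rad_mult: "rad d A A' ==> rad d B B' ==> rad d (\<lambda>z. A z * B z) (\<lambda>z. A z * B' z + A' z * B z)"
proof -
  assume A: "rad d A A'" and B: "rad d B B'"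
  have "symbol d 0 (\<lambda>z. X z * Y z)" if "symbol d 0 X" "symbol d 0 Y" for X Y :: "real \<times> 'a => real"
    using sym_mult[OF that] by simp
  moreover have "dd (0, e) (\<lambda>z. A z * B z) z = qq z * (uu z \<bullet> e) * (A z * B' z + A' z * B z)" if "z \<in> cyl d" for z e
    using dd_bilinear[OF bounded_bilinear_mult sym_differentiable[OF rad_sym(1)[OF A] that] sym_differentiable[OF rad_sym(1)[OF B] that], where v = "(0, e)"]
    by (simp add: radD[OF A that] radD[OF B that] algebra_simps)
  ultimately show ?thesis using A B by (auto simp: rad_def intro: sym_add)
qed

lemma rad_minus: "rad d A A' ==> rad d (\<lambda>z. - A z) (\<lambda>z. - A' z)"
  using rad_mult[OF rad_const[of d "-1"], of A A'] by simp

lemma rad_diff: "rad d A A' ==> rad d B B' ==> rad d (\<lambda>z. A z - B z) (\<lambda>z. A' z - B' z)"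
  using rad_add[OF _ rad_minus, of d A A' B B'] by simp

lemma rad_cmult: "rad d A A' ==> rad d (\<lambda>z. c * A z) (\<lambda>z. c * A' z)"
  using rad_mult[OF rad_const[of d c], of A A'] by simp

lemma rad_power2: "rad d A A' ==> rad d (\<lambda>z. (A z)\<^sup>2) (\<lambda>z. 2 * A z * A' z)"
  using rad_mult[of d A A' A A'] by (simp add: power2_eq_square algebra_simps)

lemma rad_sin: "rad d A A' ==> rad d (\<lambda>z. sin (A z)) (\<lambda>z. cos (A z) * A' z)"
  and rad_cos: "rad d A A' ==> rad d (\<lambda>z. cos (A z)) (\<lambda>z. - sin (A z) * A' z)"
proof -
  assume A: "rad d A A'"
  have m: "symbol d 0 (\<lambda>z. X z * A' z)" if "symbol d 0 X" for X :: "real \<times> 'a => real"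
    using sym_mult[OF that rad_sym(2)[OF A]] by simp
  have "((\<lambda>z. sin (A z)) has_derivative (\<lambda>v. dd v A z * cos (A z))) (at z)" 
    "((\<lambda>z. cos (A z)) has_derivative (\<lambda>v. dd v A z * - sin (A z))) (at z)" if "z \<in> cyl d" for z
    using has_derivative_sin[OF dd_works[OF sym_differentiable[OF rad_sym(1)[OF A] that]]]
      has_derivative_cos[OF dd_works[OF sym_differentiable[OF rad_sym(1)[OF A] that]]] by simp_all
  then have "dd v (\<lambda>z. sin (A z)) z = dd v A z * cos (A z)" "dd v (\<lambda>z. cos (A z)) z = dd v A z * - sin (A z)"
    if "z \<in> cyl d" for z v
    using dd_eqI that by blast+
  then show "rad d (\<lambda>z. sin (A z)) (\<lambda>z. cos (A z) * A' z)" "rad d (\<lambda>z. cos (A z)) (\<lambda>z. - sin (A z) * A' z)"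
    using rad_sym[OF A] radD[OF A] m[OF sym_cos[OF rad_sym(1)[OF A]]] sym_minus[OF m[OF sym_sin[OF rad_sym(1)[OF A]]]]
    by (auto simp: rad_def sym_sin sym_cos)
qed

definition eqv :: "(real \<times> 'a::euclidean_space => real) => real \<times> 'a => 'a \<times> real" where
  "eqv \<alpha> z = (sin (\<alpha> z) *\<^sub>R uu z, cos (\<alpha> z))"

text \<open>The normal of the parallel through \<open>eqv \<alpha> z\<close> inside the sphere, and the frame of its tangent
  space.\<close>

definition nrm :: "(real \<times> 'a::euclidean_space => real) => real \<times> 'a => 'a \<times> real" where
  "nrm \<alpha> z = (cos (\<alpha> z) *\<^sub>R uu z, - sin (\<alpha> z))"

definition tng :: "'a::euclidean_space => real \<times> 'a => 'a \<times> real" where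
  "tng e z = (e - (uu z \<bullet> e) *\<^sub>R uu z, 0)"

lemma sum_uu2: "z \<in> cyl d ==> (\<Sum>e\<in>Basis. (uu z \<bullet> e) * (uu z \<bullet> e)) = 1"
  using norm_uu[of z d] by (simp flip: euclidean_inner)

lemma sum_uu_tng: "z \<in> cyl d ==> (\<Sum>e\<in>Basis. (uu z \<bullet> e) *\<^sub>R tng e z) = 0"
proof -
  assume z: "z \<in> cyl d"
  have "(\<Sum>e\<in>Basis. (uu z \<bullet> e) *\<^sub>R (e - (uu z \<bullet> e) *\<^sub>R uu z)) = uu z - (\<Sum>e\<in>Basis. (uu z \<bullet> e) * (uu z \<bullet> e)) *\<^sub>R uu z"
    by (simp add: scaleR_diff_right sum_subtractf euclidean_representation scaleR_sum_left)
  then have "(\<Sum>e\<in>Basis. (uu z \<bullet> e) *\<^sub>R (e - (uu z \<bullet> e) *\<^sub>R uu z)) = 0"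
    by (simp add: sum_uu2[OF z])
  then show ?thesis by (simp add: tng_def prod_eq_iff fst_sum snd_sum)
qed

lemma frame_products:
  assumes "z \<in> cyl d"
  shows "eqv \<alpha> z \<bullet> eqv \<alpha> z = 1" "nrm \<alpha> z \<bullet> nrm \<alpha> z = 1" "nrm \<alpha> z \<bullet> eqv \<alpha> z = 0" "eqv \<alpha> z \<bullet> nrm \<alpha> z = 0"
    "tng e z \<bullet> eqv \<alpha> z = 0" "tng e z \<bullet> nrm \<alpha> z = 0" "eqv \<alpha> z \<bullet> tng e z = 0" "nrm \<alpha> z \<bullet> tng e z = 0"
    "tng e z \<bullet> tng f z = e \<bullet> f - (uu z \<bullet> e) * (uu z \<bullet> f)"
  using norm_uu[OF assms] sin_cos_squared_add[of "\<alpha> z"]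
  by (simp_all add: eqv_def nrm_def tng_def inner_diff_left inner_diff_right inner_commute power2_eq_square algebra_simps)

lemma sum_tng_tng:
  fixes z :: "real \<times> 'a::euclidean_space"
  assumes "z \<in> cyl d"
  shows "(\<Sum>e\<in>Basis. tng e z \<bullet> tng e z) = real DIM('a) - 1"
  by (simp add: frame_products[OF assms] sum_subtractf sum_uu2[OF assms] inner_same_Basis)

lemma
  assumes z: "z \<in> cyl d"
  shows dd_qq: "dd (0, e) qq z = - ((qq z)\<^sup>2 * (uu z \<bullet> e))"
    and dd_uu: "dd (0, e) uu z = qq z *\<^sub>R (e - (uu z \<bullet> e) *\<^sub>R uu z)"
    and dd_uu_inner: "dd (0, e) (\<lambda>z. uu z \<bullet> f) z = qq z * (e \<bullet> f - (uu z \<bullet> e) * (uu z \<bullet> f))"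
proof -
  show "dd (0, e) qq z = - ((qq z)\<^sup>2 * (uu z \<bullet> e))"
    using dd_eqI[OF has_derivative_qq[OF z], where v = "(0, e)"] by simp
  show u: "dd (0, e) uu z = qq z *\<^sub>R (e - (uu z \<bullet> e) *\<^sub>R uu z)"
    using dd_eqI[OF has_derivative_uu[OF z], where v = "(0, e)"] by simp
  show "dd (0, e) (\<lambda>z. uu z \<bullet> f) z = qq z * (e \<bullet> f - (uu z \<bullet> e) * (uu z \<bullet> f))"
    using dd_linear[OF bounded_linear_inner_left sym_differentiable[OF sym_uu z], where v = "(0, e)"]
    by (simp add: u inner_diff_left)
qed

lemma dd_qq_power:
  assumes "z \<in> cyl d"
  shows "dd (0, e) (\<lambda>z. qq z ^ m) z = - (real m * qq z ^ Suc m * (uu z \<bullet> e))"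
proof -
  have "((\<lambda>z. qq z ^ m) has_derivative (\<lambda>v. of_nat m * (- (qq z ^ 2 * (uu z \<bullet> snd v))) * qq z ^ (m - 1))) (at z)"
    by (rule has_derivative_power[OF has_derivative_qq[OF assms]])
  from dd_eqI[OF this, where v = "(0, e)"] show ?thesis
    by (cases m) (simp_all add: power2_eq_square algebra_simps)
qed

lemma sym_pair:
  assumes "symbol d k F" "symbol d k (g :: real \<times> 'a::euclidean_space => real)"
  shows "symbol d k (\<lambda>z. (F z, g z))"
proof -
  have "symbol d k (\<lambda>z. (F z, 0))" "symbol d k (\<lambda>z. (0, g z))"
    using sym_linear[OF bounded_linear_Pair[OF bounded_linear_ident bounded_linear_zero] assms(1)]
      sym_linear[OF bounded_linear_Pair[OF bounded_linear_zero bounded_linear_ident] assms(2)] by simp_all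
  then have "symbol d k (\<lambda>z. (F z, 0) + (0, g z))" by (rule sym_add)
  then show ?thesis by simp
qed

lemma dd_pair:
  assumes "F differentiable (at z)" "g differentiable (at z)"
  shows "dd v (\<lambda>z. (F z, g z)) z = (dd v F z, dd v g z)"
  by (rule dd_eqI[OF has_derivative_Pair[OF dd_works[OF assms(1)] dd_works[OF assms(2)]]])

lemma sym_tng: "symbol d 0 (tng e)"
proof -
  have "symbol d 0 (\<lambda>z. (uu z \<bullet> e) *\<^sub>R uu z)"
    using sym_scaleR[OF sym_inner[OF sym_uu sym_const[of d 0 e]] sym_uu] by simp
  from sym_pair[OF sym_diff[OF sym_const[of d 0 e] this] sym_const[of d 0 0]]
  show ?thesis by (simp add: tng_def[abs_def])
qed

lemma sym_uu_inner: "symbol d 0 (\<lambda>z. uu z \<bullet> e)"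
  using sym_inner[OF sym_uu sym_const[of d 0 e]] by simp

locale equivariant =
  fixes d :: real and \<alpha> \<alpha>' :: "real \<times> 'a::euclidean_space => real"
  assumes pos: "0 < d" and rad_alpha: "rad d \<alpha> \<alpha>'"
begin

lemma sym_alpha: "symbol d 0 \<alpha>" "symbol d 0 \<alpha>'"
  using rad_alpha by (simp_all add: rad_sym)

lemma sym_sin_cos: "symbol d 0 (\<lambda>z. sin (\<alpha> z))" "symbol d 0 (\<lambda>z. cos (\<alpha> z))"
  using sym_alpha by (auto intro: sym_sin sym_cos)

lemma sym_eqv: "symbol d 0 (eqv \<alpha>)"
  unfolding eqv_def[abs_def] using sym_scaleR[OF sym_sin_cos(1) sym_uu] sym_sin_cos by (intro sym_pair) auto

lemma sym_nrm: "symbol d 0 (nrm \<alpha>)"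
  unfolding nrm_def[abs_def] using sym_scaleR[OF sym_sin_cos(2) sym_uu] sym_minus[OF sym_sin_cos(1)]
  by (intro sym_pair) auto

sublocale sphere_family d "eqv \<alpha>"
  by standard (use pos sym_eqv frame_products in auto)

abbreviation "S z \<equiv> sin (\<alpha> z)"
abbreviation "C z \<equiv> cos (\<alpha> z)"
abbreviation "NN \<equiv> nrm \<alpha>"

lemma dd_eqv:
  assumes z: "z \<in> cyl d"
  shows "dd (0, e) (eqv \<alpha>) z = (qq z * (uu z \<bullet> e) * \<alpha>' z) *\<^sub>R NN z + (qq z * S z) *\<^sub>R tng e z"
  unfolding eqv_def[abs_def]
  by (subst dd_pair[OF sym_differentiable[OF sym_scaleR[OF sym_sin_cos(1) sym_uu] z] sym_differentiable[OF sym_sin_cos(2) z]])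
    (simp add: dd_bilinear[OF bounded_bilinear_scaleR sym_differentiable[OF sym_sin_cos(1) z] sym_differentiable[OF sym_uu z]]
      radD[OF rad_sin[OF rad_alpha] z] radD[OF rad_cos[OF rad_alpha] z] dd_uu[OF z] nrm_def tng_def algebra_simps)

lemma dd_nrm:
  assumes z: "z \<in> cyl d"
  shows "dd (0, e) NN z = - (qq z * (uu z \<bullet> e) * \<alpha>' z) *\<^sub>R eqv \<alpha> z + (qq z * C z) *\<^sub>R tng e z"
proof -
  have m: "dd (0, e) (\<lambda>z. - S z) z = - dd (0, e) (\<lambda>z. S z) z"
    by (rule dd_linear[OF bounded_linear_minus[OF bounded_linear_ident] sym_differentiable[OF sym_sin_cos(1) z]])
  show ?thesis
    unfolding nrm_def[abs_def]
    by (subst dd_pair[OF sym_differentiable[OF sym_scaleR[OF sym_sin_cos(2) sym_uu] z] sym_differentiable[OF sym_minus[OF sym_sin_cos(1)] z]])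
      (simp add: m dd_bilinear[OF bounded_bilinear_scaleR sym_differentiable[OF sym_sin_cos(2) z] sym_differentiable[OF sym_uu z]]
        radD[OF rad_sin[OF rad_alpha] z] radD[OF rad_cos[OF rad_alpha] z] dd_uu[OF z] eqv_def tng_def algebra_simps)
qed

lemma cv_nrm:
  assumes z: "z \<in> cyl d"
  shows "cve e NN z = (qq z * C z) *\<^sub>R tng e z"
  by (simp add: cv_def dd_nrm[OF z] inner_diff_left inner_add_left frame_products[OF z])

lemma uu_split: "(uu z, 0) = S z *\<^sub>R eqv \<alpha> z + C z *\<^sub>R NN z"
  using sin_cos_squared_add[of "\<alpha> z"]
  by (simp add: eqv_def nrm_def power2_eq_square flip: scaleR_add_left)

lemma dd_tng:
  assumes z: "z \<in> cyl d"
  shows "dd (0, e) (tng f) z = - (qq z *\<^sub>R ((e \<bullet> f - (uu z \<bullet> e) * (uu z \<bullet> f)) *\<^sub>R (uu z, 0) + (uu z \<bullet> f) *\<^sub>R tng e z))"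
proof -
  let ?F = "\<lambda>z. (uu z \<bullet> f) *\<^sub>R uu z"
  have sF: "symbol d (0 + 0) ?F" by (rule sym_scaleR[OF sym_uu_inner sym_uu])
  have 1: "dd (0, e) ?F z = (uu z \<bullet> f) *\<^sub>R dd (0, e) uu z + dd (0, e) (\<lambda>z. uu z \<bullet> f) z *\<^sub>R uu z"
    by (rule dd_bilinear[OF bounded_bilinear_scaleR sym_differentiable[OF sym_uu_inner z] sym_differentiable[OF sym_uu z]])
  have 2: "dd (0, e) (\<lambda>z. f - ?F z) z = - dd (0, e) ?F z"
    using dd_add[OF sym_differentiable[OF sym_const[of d 0 f] z] sym_differentiable[OF sym_minus[OF sF] z], where v = "(0, e)"]
      dd_linear[OF bounded_linear_minus[OF bounded_linear_ident] sym_differentiable[OF sF z], where v = "(0, e)"] by simp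
  have "dd (0, e) (tng f) z = (dd (0, e) (\<lambda>z. f - ?F z) z, 0)"
    unfolding tng_def[abs_def]
    using dd_pair[OF sym_differentiable[OF sym_diff[OF sym_const[of d "0 + 0" f] sF] z] sym_differentiable[OF sym_const[of d 0 0] z], where v = "(0, e)"]
    by simp
  then show ?thesis
    unfolding 2 1 by (simp add: dd_uu[OF z] dd_uu_inner[OF z] tng_def algebra_simps)
qed

lemma cv_tng:
  assumes z: "z \<in> cyl d"
  shows "cve e (tng f) z = - (qq z *\<^sub>R (((e \<bullet> f - (uu z \<bullet> e) * (uu z \<bullet> f)) * C z) *\<^sub>R NN z + (uu z \<bullet> f) *\<^sub>R tng e z))"
  by (simp add: cv_def dd_tng[OF z] uu_split inner_add_left frame_products[OF z] algebra_simps)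

lemma cv_scale_nrm:
  assumes "symbol d k s" and z: "z \<in> cyl d"
  shows "cve e (\<lambda>z. s z *\<^sub>R NN z) z = dd (0, e) s z *\<^sub>R NN z + (s z * qq z * C z) *\<^sub>R tng e z"
  using cv_scale[OF assms(1) sym_nrm z, where v = "(0, e)"]
  by (simp add: cv_nrm[OF z] frame_products[OF z] algebra_simps)

lemma cv_scale_tng:
  assumes "symbol d k s" and z: "z \<in> cyl d"
  shows "cve e (\<lambda>z. s z *\<^sub>R tng f z) z = dd (0, e) s z *\<^sub>R tng f z
    - (s z * qq z) *\<^sub>R (((e \<bullet> f - (uu z \<bullet> e) * (uu z \<bullet> f)) * C z) *\<^sub>R NN z + (uu z \<bullet> f) *\<^sub>R tng e z)"
  using cv_scale[OF assms(1) sym_tng z, where v = "(0, e)"]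
  by (simp add: cv_tng[OF z] frame_products[OF z] algebra_simps)

lemma sym_qA: "rad d A A' ==> symbol d m (\<lambda>z. qq z ^ m * A z)"
  using sym_mult[OF sym_qq_power rad_sym(1)] by fastforce

lemma sym_qAu: "rad d A A' ==> symbol d m (\<lambda>z. qq z ^ m * A z * (uu z \<bullet> g))"
  using sym_mult[OF sym_qA sym_uu_inner, of A A' m g] by simp

lemma dd_qA:
  assumes "rad d A A'" and z: "z \<in> cyl d"
  shows "dd (0, e) (\<lambda>z. qq z ^ m * A z) z = qq z ^ Suc m * ((A' z - real m * A z) * (uu z \<bullet> e))"
  unfolding dd_bilinear[OF bounded_bilinear_mult sym_differentiable[OF sym_qq_power z]
      sym_differentiable[OF rad_sym(1)[OF assms(1)] z]] dd_qq_power[OF z] radD[OF assms]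
  by (simp add: algebra_simps)

lemma dd_qAu:
  assumes "rad d A A'" and z: "z \<in> cyl d"
  shows "dd (0, e) (\<lambda>z. qq z ^ m * A z * (uu z \<bullet> g)) z =
    qq z ^ Suc m * ((A' z - real m * A z) * (uu z \<bullet> e) * (uu z \<bullet> g) + A z * (e \<bullet> g - (uu z \<bullet> e) * (uu z \<bullet> g)))"
  unfolding dd_bilinear[OF bounded_bilinear_mult sym_differentiable[OF sym_qA[OF assms(1)] z]
      sym_differentiable[OF sym_uu_inner z]] dd_qA[OF assms] dd_uu_inner[OF z]
  by (simp add: algebra_simps)

lemma cv_qA_nrm:
  assumes "rad d A A'" and z: "z \<in> cyl d"
  shows "cve e (\<lambda>z. (qq z ^ m * A z) *\<^sub>R NN z) z =
    qq z ^ Suc m *\<^sub>R (((A' z - real m * A z) * (uu z \<bullet> e)) *\<^sub>R NN z + (A z * C z) *\<^sub>R tng e z)"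
  unfolding cv_scale_nrm[OF sym_qA[OF assms(1)] z] dd_qA[OF assms] by (simp add: algebra_simps)

lemma sum_cv_radial:
  assumes B: "rad d B B'" and z: "z \<in> cyl d"
  shows "(\<Sum>e\<in>Basis. cve e (\<lambda>z. (qq z ^ m * B z * (uu z \<bullet> e)) *\<^sub>R NN z) z) =
    (qq z ^ Suc m * (B' z - real m * B z + (real DIM('a) - 1) * B z)) *\<^sub>R NN z"
proof -
  have "cve e (\<lambda>z. (qq z ^ m * B z * (uu z \<bullet> e)) *\<^sub>R NN z) z =
      (qq z ^ Suc m * (B' z - real m * B z)) *\<^sub>R (((uu z \<bullet> e) * (uu z \<bullet> e)) *\<^sub>R NN z) +
      (qq z ^ Suc m * B z) *\<^sub>R ((tng e z \<bullet> tng e z) *\<^sub>R NN z) +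
      (qq z ^ Suc m * B z * C z) *\<^sub>R ((uu z \<bullet> e) *\<^sub>R tng e z)" for e
    unfolding cv_scale_nrm[OF sym_qAu[OF B] z] dd_qAu[OF B z] frame_products[OF z] by (simp add: algebra_simps)
  then have "(\<Sum>e\<in>Basis. cve e (\<lambda>z. (qq z ^ m * B z * (uu z \<bullet> e)) *\<^sub>R NN z) z) =
      (qq z ^ Suc m * (B' z - real m * B z)) *\<^sub>R ((\<Sum>e\<in>Basis. (uu z \<bullet> e) * (uu z \<bullet> e)) *\<^sub>R NN z) +
      (qq z ^ Suc m * B z) *\<^sub>R ((\<Sum>e\<in>Basis. tng e z \<bullet> tng e z) *\<^sub>R NN z) +
      (qq z ^ Suc m * B z * C z) *\<^sub>R (\<Sum>e\<in>Basis. (uu z \<bullet> e) *\<^sub>R tng e z)"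
    by (simp only: sum.distrib scaleR_sum_left scaleR_sum_right)
  then show ?thesis
    by (simp only: sum_uu2[OF z] sum_tng_tng[OF z] sum_uu_tng[OF z]) (simp add: algebra_simps)
qed

lemma sum_cv_angular:
  assumes B: "rad d B B'" and z: "z \<in> cyl d"
  shows "(\<Sum>e\<in>Basis. cve e (\<lambda>z. (qq z ^ m * B z) *\<^sub>R tng e z) z) = - (qq z ^ Suc m * (real DIM('a) - 1) * B z * C z) *\<^sub>R NN z"
proof -
  have "cve e (\<lambda>z. (qq z ^ m * B z) *\<^sub>R tng e z) z =
      (qq z ^ Suc m * (B' z - real m * B z) - qq z ^ Suc m * B z) *\<^sub>R ((uu z \<bullet> e) *\<^sub>R tng e z) +
      (- (qq z ^ Suc m * B z * C z)) *\<^sub>R ((tng e z \<bullet> tng e z) *\<^sub>R NN z)" for e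
    unfolding cv_scale_tng[OF sym_qA[OF B] z] dd_qA[OF B z] frame_products[OF z] by (simp add: algebra_simps)
  then have "(\<Sum>e\<in>Basis. cve e (\<lambda>z. (qq z ^ m * B z) *\<^sub>R tng e z) z) =
      (qq z ^ Suc m * (B' z - real m * B z) - qq z ^ Suc m * B z) *\<^sub>R (\<Sum>e\<in>Basis. (uu z \<bullet> e) *\<^sub>R tng e z) +
      (- (qq z ^ Suc m * B z * C z)) *\<^sub>R ((\<Sum>e\<in>Basis. tng e z \<bullet> tng e z) *\<^sub>R NN z)"
    by (simp only: sum.distrib scaleR_sum_left scaleR_sum_right)
  then show ?thesis
    by (simp only: sum_tng_tng[OF z] sum_uu_tng[OF z]) (simp add: algebra_simps)
qed

text \<open>In polar coordinates the map has latitude \<open>\<alpha>\<close>; the Laplacian of the radial part gives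
  \<open>\<alpha>'' + (n - 2) * \<alpha>'\<close> in the variable $\ln |x|$, and the spheres, which are mapped to parallels,
  contribute the last term.\<close>

lemma tau_eqv:
  assumes \<alpha>'': "rad d \<alpha>' \<alpha>''" and z: "z \<in> cyl d"
  shows "tau (eqv \<alpha>) z = ((qq z)\<^sup>2 * (\<alpha>'' z + (real DIM('a) - 2) * \<alpha>' z - (real DIM('a) - 1) * S z * C z)) *\<^sub>R NN z"
proof -
  have s1: "symbol d 1 (\<lambda>z. (qq z ^ 1 * \<alpha>' z * (uu z \<bullet> e)) *\<^sub>R NN z)" for e
    using sym_scaleR[OF sym_qAu[OF \<alpha>'', of 1] sym_nrm] by simp
  have s2: "symbol d 1 (\<lambda>z. (qq z ^ 1 * S z) *\<^sub>R tng e z)" for e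
    using sym_scaleR[OF sym_qA[OF rad_sin[OF rad_alpha], of 1] sym_tng] by simp
  have "cve e (phid e) z = cve e (\<lambda>z. (qq z ^ 1 * \<alpha>' z * (uu z \<bullet> e)) *\<^sub>R NN z) z + cve e (\<lambda>z. (qq z ^ 1 * S z) *\<^sub>R tng e z) z" for e
  proof -
    have "cve e (phid e) z = cve e (\<lambda>z. (qq z ^ 1 * \<alpha>' z * (uu z \<bullet> e)) *\<^sub>R NN z + (qq z ^ 1 * S z) *\<^sub>R tng e z) z"
      by (rule cv_cong[OF z]) (simp add: dd_eqv algebra_simps)
    also have "\<dots> = cve e (\<lambda>z. (qq z ^ 1 * \<alpha>' z * (uu z \<bullet> e)) *\<^sub>R NN z) z + cve e (\<lambda>z. (qq z ^ 1 * S z) *\<^sub>R tng e z) z"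
      by (rule cv_add[OF s1 s2 z])
    finally show ?thesis .
  qed
  then have "tau (eqv \<alpha>) z = (\<Sum>e\<in>Basis. cve e (\<lambda>z. (qq z ^ 1 * \<alpha>' z * (uu z \<bullet> e)) *\<^sub>R NN z) z) + (\<Sum>e\<in>Basis. cve e (\<lambda>z. (qq z ^ 1 * S z) *\<^sub>R tng e z) z)"
    by (simp add: tau_def sum.distrib del: power_one_right)
  then show ?thesis
    unfolding sum_cv_radial[OF \<alpha>'' z] sum_cv_angular[OF rad_sin[OF rad_alpha] z]
    by (simp add: power2_eq_square algebra_simps)
qed

text \<open>The field keeps its shape under the rough Laplacian: along the radial direction it is parallel up
  to a scalar factor, and in the spherical directions its derivatives are tangent to the parallel
  and contribute only through $\cos^2$. Therefore all iterates reduce to functions of $\ln |x|$.\<close>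

lemma rl_eqv:
  assumes A: "rad d A A'" and A': "rad d A' A''" and z: "z \<in> cyl d"
  shows "rl (eqv \<alpha>) (\<lambda>z. (qq z ^ k * A z) *\<^sub>R NN z) z = (qq z ^ (k + 2) *
    - (A'' z + (real DIM('a) - 2 - 2 * real k) * A' z + (real k ^ 2 - (real DIM('a) - 2) * real k - (real DIM('a) - 1) * (C z)\<^sup>2) * A z)) *\<^sub>R NN z"
proof -
  let ?m = "Suc k"
  let ?B = "\<lambda>z. A' z - real k * A z" and ?B' = "\<lambda>z. A'' z - real k * A' z"
  have B: "rad d ?B ?B'" by (intro rad_diff A' rad_cmult A)
  have D: "rad d (\<lambda>z. A z * C z) (\<lambda>z. A z * (- S z * \<alpha>' z) + A' z * C z)"
    by (intro rad_mult A rad_cos rad_alpha)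
  have s1: "symbol d ?m (\<lambda>z. (qq z ^ ?m * ?B z * (uu z \<bullet> e)) *\<^sub>R NN z)" for e
    using sym_scaleR[OF sym_qAu[OF B, of ?m] sym_nrm] by simp
  have s2: "symbol d ?m (\<lambda>z. (qq z ^ ?m * (A z * C z)) *\<^sub>R tng e z)" for e
    using sym_scaleR[OF sym_qA[OF D, of ?m] sym_tng] by simp
  have "cve e (cve e (\<lambda>z. (qq z ^ k * A z) *\<^sub>R NN z)) z =
      cve e (\<lambda>z. (qq z ^ ?m * ?B z * (uu z \<bullet> e)) *\<^sub>R NN z) z + cve e (\<lambda>z. (qq z ^ ?m * (A z * C z)) *\<^sub>R tng e z) z" for e
  proof -
    have "cve e (cve e (\<lambda>z. (qq z ^ k * A z) *\<^sub>R NN z)) z =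
        cve e (\<lambda>z. (qq z ^ ?m * ?B z * (uu z \<bullet> e)) *\<^sub>R NN z + (qq z ^ ?m * (A z * C z)) *\<^sub>R tng e z) z"
      by (rule cv_cong[OF z]) (subst cv_qA_nrm[OF A], assumption, simp add: algebra_simps)
    also have "\<dots> = cve e (\<lambda>z. (qq z ^ ?m * ?B z * (uu z \<bullet> e)) *\<^sub>R NN z) z + cve e (\<lambda>z. (qq z ^ ?m * (A z * C z)) *\<^sub>R tng e z) z"
      by (rule cv_add[OF s1 s2 z])
    finally show ?thesis .
  qed
  then have "rl (eqv \<alpha>) (\<lambda>z. (qq z ^ k * A z) *\<^sub>R NN z) z =
      - ((\<Sum>e\<in>Basis. cve e (\<lambda>z. (qq z ^ ?m * ?B z * (uu z \<bullet> e)) *\<^sub>R NN z) z) +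
         (\<Sum>e\<in>Basis. cve e (\<lambda>z. (qq z ^ ?m * (A z * C z)) *\<^sub>R tng e z) z))"
    by (simp add: rl_def sum.distrib del: power_Suc)
  also have "\<dots> = (qq z ^ (k + 2) *
    - (A'' z + (real DIM('a) - 2 - 2 * real k) * A' z + (real k ^ 2 - (real DIM('a) - 2) * real k - (real DIM('a) - 1) * (C z)\<^sup>2) * A z)) *\<^sub>R NN z"
    unfolding sum_cv_radial[OF B z] sum_cv_angular[OF D z]
    by (simp add: power2_eq_square flip: scaleR_add_left scaleR_minus_left) (simp add: algebra_simps)
  finally show ?thesis .
qed

lemma sum_norm_cv_qA:
  assumes A: "rad d A A'" and z: "z \<in> cyl d"
    and W: "\<And>e. e \<in> Basis ==> W e = qq z ^ m *\<^sub>R ((X * (uu z \<bullet> e)) *\<^sub>R NN z + Y *\<^sub>R tng e z)"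
  shows "(\<Sum>e\<in>Basis. W e \<bullet> W e) = qq z ^ (2 * m) * (X\<^sup>2 + (real DIM('a) - 1) * Y\<^sup>2)"
proof -
  have "W e \<bullet> W e = qq z ^ (2 * m) * X\<^sup>2 * ((uu z \<bullet> e) * (uu z \<bullet> e)) + qq z ^ (2 * m) * Y\<^sup>2 * (tng e z \<bullet> tng e z)" if "e \<in> Basis" for e
    unfolding W[OF that] mult_2 power_add
    by (simp add: inner_add_left inner_add_right frame_products(2,6,8)[OF z] power2_eq_square algebra_simps)
  then have "(\<Sum>e\<in>Basis. W e \<bullet> W e) = qq z ^ (2 * m) * X\<^sup>2 * (\<Sum>e\<in>Basis. (uu z \<bullet> e) * (uu z \<bullet> e)) +
      qq z ^ (2 * m) * Y\<^sup>2 * (\<Sum>e\<in>Basis. tng e z \<bullet> tng e z)"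
    by (simp add: sum.distrib sum_distrib_left)
  then show ?thesis by (simp only: sum_uu2[OF z] sum_tng_tng[OF z]) (simp add: algebra_simps)
qed

end

section \<open>The maps \<open>phi a\<close> are critical\<close>

lemma ball_int_cong_slice:
  fixes F G :: "real \<times> 'a::euclidean_space => real"
  assumes "0 < d" "symbol d k G" "\<And>x. (0, x) \<in> cyl d ==> F (0, x) = G (0, x)"
  shows "ball_int F = ball_int G"
proof -
  have t: "\<bar>0\<bar> < d" using assms(1) by simp
  have r: "rep 0 G (\<lambda>x. F (0, x))" by (rule repI[OF t]) (rule assms(3))
  show ?thesis unfolding ball_int_def by (rule rep_integral[OF assms(2) t r])
qed

lemma ball_int_sum2:
  fixes F :: "'i => 'j => real \<times> 'a::euclidean_space => real"
  assumes "0 < d" "\<And>i j. i \<in> I ==> j \<in> J ==> symbol d k (F i j)" "k < DIM('a)"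
  shows "ball_int (\<lambda>z. \<Sum>i\<in>I. \<Sum>j\<in>J. F i j z) = (\<Sum>i\<in>I. \<Sum>j\<in>J. ball_int (F i j))"
proof -
  have "ball_int (\<lambda>z. \<Sum>i\<in>I. \<Sum>j\<in>J. F i j z) = (\<Sum>i\<in>I. ball_int (\<lambda>z. \<Sum>j\<in>J. F i j z))"
    by (rule ball_int_sum[OF assms(1) _ assms(3)]) (intro sym_sum assms(2))
  also have "\<dots> = (\<Sum>i\<in>I. \<Sum>j\<in>J. ball_int (F i j))"
    by (intro sum.cong refl ball_int_sum[OF assms(1) _ assms(3)] assms(2))
  finally show ?thesis .
qed

text \<open>For the map \<open>phi a\<close> the iterated rough Laplacians of the tension field are multiples of
  $|x|^{-2j-2}$ times the normal of the parallel; these are the factors.\<close>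

primrec factor :: "real => real => nat => real" where
  "factor n a 0 = - ((n - 1) * sin a * cos a)"
| "factor n a (Suc j) = - ((real (2 * j + 2))\<^sup>2 - (n - 2) * real (2 * j + 2) - (n - 1) * (cos a)\<^sup>2) * factor n a j"

context equivariant
begin

lemma rl_cong: "z \<in> cyl d ==> (\<And>z. z \<in> cyl d ==> F z = G z) ==> rl (eqv \<alpha>) F z = rl (eqv \<alpha>) G z"
  unfolding rl_def by (intro arg_cong[where f = uminus] sum.cong cv_cong refl) auto

end

lemma equivariant_const: "0 < d ==> equivariant d (\<lambda>_::real \<times> 'a::euclidean_space. a) (\<lambda>_. 0)"
  by (simp add: equivariant_def rad_const)

lemma iter_const:
  fixes z :: "real \<times> 'a::euclidean_space"
  assumes d: "0 < d"
  shows "z \<in> cyl d ==> iter (eqv (\<lambda>_. a)) j z = (qq z ^ (2 * j + 2) * factor (real DIM('a)) a j) *\<^sub>R nrm (\<lambda>_. a) z"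
proof (induction j arbitrary: z)
  interpret equivariant d "\<lambda>_::real \<times> 'a. a" "\<lambda>_. 0" by (rule equivariant_const[OF d])
  {
    case 0
    then show ?case using tau_eqv[OF rad_const 0] by (simp add: power2_eq_square algebra_simps)
  next
    case (Suc j)
    have "iter (eqv (\<lambda>_. a)) (Suc j) z = rl (eqv (\<lambda>_. a)) (\<lambda>z. (qq z ^ (2 * j + 2) * factor (real DIM('a)) a j) *\<^sub>R nrm (\<lambda>_. a) z) z"
      unfolding iter_simps by (rule rl_cong[OF Suc.prems Suc.IH])
    also have "\<dots> = (qq z ^ (2 * Suc j + 2) * factor (real DIM('a)) a (Suc j)) *\<^sub>R nrm (\<lambda>_. a) z"
      unfolding rl_eqv[OF rad_const rad_const Suc.prems]
      by (rule arg_cong[where f = "\<lambda>c. c *\<^sub>R nrm (\<lambda>_. a) z"]) (simp add: algebra_simps)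
    finally show ?case .
  }
qed

context sphere_family
begin

lemma dd_inner_self:
  assumes "symbol d k X" "tangential X" "z \<in> cyl d"
  shows "dd v (\<lambda>z. X z \<bullet> X z) z = 2 * (X z \<bullet> cv \<Phi> v X z)"
  using dd_inner_cv[OF assms(1,1,2,2,3), of v] by (simp add: inner_commute)

text \<open>One commutation of \<open>D\<^sub>t\<close> with the gradient leaves a curvature term; the integration by parts of
  the remaining term produces the rough Laplacian.\<close>

lemma first_variation_gradient:
  assumes X: "symbol d k X" "tangential X" "still K X"
    and k: "2 * k + 2 < DIM('a)" and K: "compact K" "K \<subseteq> unit_ball"
  shows "ball_int (\<lambda>z. \<Sum>e\<in>Basis. cve e X z \<bullet> cvt (cve e X) z) = ball_int (\<lambda>z. rl \<Phi> X z \<bullet> cvt X z) +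
    ball_int (\<lambda>z. \<Sum>e\<in>Basis. cve e X z \<bullet> ((X z \<bullet> phid e z) *\<^sub>R vel z - (X z \<bullet> vel z) *\<^sub>R phid e z))"
proof -
  let ?R = "\<lambda>e z. (X z \<bullet> phid e z) *\<^sub>R vel z - (X z \<bullet> vel z) *\<^sub>R phid e z"
  have sX: "symbol d (Suc k) (cve e X)" if "e \<in> Basis" for e by (rule sym_cv[OF sym_Phi X(1) that])
  have sR: "symbol d (Suc k) (?R e)" if "e \<in> Basis" for e
  proof -
    have "symbol d (Suc k) (\<lambda>z. (X z \<bullet> phid e z) *\<^sub>R vel z)"
      using sym_scaleR[OF sym_inner[OF X(1) sym_dx[OF sym_Phi that]] sym_dt[OF sym_Phi]] by simp
    moreover have "symbol d (Suc k) (\<lambda>z. (X z \<bullet> vel z) *\<^sub>R phid e z)"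
      using sym_scaleR[OF sym_inner[OF X(1) sym_dt[OF sym_Phi]] sym_dx[OF sym_Phi that]] by simp
    ultimately show ?thesis by (rule sym_diff)
  qed
  have s1: "symbol d (2 * k + 2) (\<lambda>z. cve e X z \<bullet> cve e (cvt X) z)" if "e \<in> Basis" for e
    using sym_inner[OF sX[OF that] sym_cv[OF sym_Phi sym_cvt[OF sym_Phi X(1)] that]] by (simp add: mult_2)
  have s2: "symbol d (2 * k + 2) (\<lambda>z. cve e X z \<bullet> ?R e z)" if "e \<in> Basis" for e
    using sym_inner[OF sX[OF that] sR[OF that]] by (simp add: mult_2)
  have s3: "symbol d (2 * k + 2) (\<lambda>z. cve e (cve e X) z \<bullet> cvt X z)" if "e \<in> Basis" for e
    using sym_inner[OF sym_cv[OF sym_Phi sX[OF that] that] sym_cvt[OF sym_Phi X(1)]] by (simp add: mult_2)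
  have "ball_int (\<lambda>z. \<Sum>e\<in>Basis. cve e X z \<bullet> cvt (cve e X) z) =
      ball_int (\<lambda>z. (\<Sum>e\<in>Basis. cve e X z \<bullet> cve e (cvt X) z) + (\<Sum>e\<in>Basis. cve e X z \<bullet> ?R e z))"
    by (rule ball_int_cong_slice[OF d_pos sym_add[OF sym_sum[OF s1] sym_sum[OF s2]]])
      (simp_all add: cvt_cve[OF X(1,2)] inner_add_right inner_diff_right sum.distrib sum_subtractf)
  also have "\<dots> = (\<Sum>e\<in>Basis. ball_int (\<lambda>z. cve e X z \<bullet> cve e (cvt X) z)) + ball_int (\<lambda>z. \<Sum>e\<in>Basis. cve e X z \<bullet> ?R e z)"
  proof -
    have "symbol d (2 * k + 2) (\<lambda>z. \<Sum>e\<in>Basis. cve e X z \<bullet> cve e (cvt X) z)" by (rule sym_sum[OF s1])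
    moreover have "symbol d (2 * k + 2) (\<lambda>z. \<Sum>e\<in>Basis. cve e X z \<bullet> ?R e z)" by (rule sym_sum[OF s2])
    ultimately show ?thesis by (simp only: ball_int_add[OF d_pos _ _ k] ball_int_sum[OF d_pos s1 k])
  qed
  also have "(\<Sum>e\<in>Basis. ball_int (\<lambda>z. cve e X z \<bullet> cve e (cvt X) z)) = (\<Sum>e\<in>Basis. - ball_int (\<lambda>z. cve e (cve e X) z \<bullet> cvt X z))"
  proof (rule sum.cong[OF refl])
    fix e :: 'a assume e: "e \<in> Basis"
    show "ball_int (\<lambda>z. cve e X z \<bullet> cve e (cvt X) z) = - ball_int (\<lambda>z. cve e (cve e X) z \<bullet> cvt X z)"
      by (rule cv_parts[OF sX[OF e] tangential_cv sym_cvt[OF sym_Phi X(1)] tangential_cv _ e K])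
        (use k cvt_eq_0[OF X(3)] in auto)
  qed
  also have "\<dots> = - ball_int (\<lambda>z. \<Sum>e\<in>Basis. cve e (cve e X) z \<bullet> cvt X z)"
    by (simp add: ball_int_sum[OF d_pos s3 k] sum_negf)
  also have "\<dots> = ball_int (\<lambda>z. rl \<Phi> X z \<bullet> cvt X z)"
    by (simp add: rl_def inner_sum_left ball_int_minus)
  finally show ?thesis .
qed

lemma curv_eq:
  assumes "symbol d k W" "tangential W" "e \<in> Basis" "f \<in> Basis" "z \<in> cyl d"
  shows "curv \<Phi> W e f z = (W z \<bullet> phid f z) *\<^sub>R phid e z - (W z \<bullet> phid e z) *\<^sub>R phid f z"
  using cv_commutator[OF assms(1,2) _ _ assms(5), of "(0, e)" "(0, f)"] assms(3,4)
  by (simp add: curv_def)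

lemma sym_curv: "symbol d k W ==> e \<in> Basis ==> f \<in> Basis ==> symbol d (Suc (Suc k)) (curv \<Phi> W e f)"
  unfolding curv_def by (intro sym_diff sym_cv sym_Phi)

lemma tangential_curv: "tangential (curv \<Phi> W e f)"
  using tangential_cv unfolding curv_def tangential_def by (simp add: inner_diff_left)

lemma still_curv:
  assumes "still K \<Phi>" "still K W" "closed K" "symbol d k W" "e \<in> Basis" "f \<in> Basis"
  shows "still K (curv \<Phi> W e f)"
proof -
  have s: "symbol d (Suc (Suc k)) (cve e (cve f W))" if "e \<in> Basis" "f \<in> Basis" for e f
    using that assms(4) by (intro sym_cv sym_Phi)
  have st: "still K (cve e (cve f W))" if "e \<in> Basis" "f \<in> Basis" for e f
    using that assms by (intro still_cv[where k = "Suc k"] still_cv[where k = k] sym_cv sym_Phi)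
  have "still K (\<lambda>z. cve e (cve f W) z + - cve f (cve e W) z)"
    by (intro still_add[where k = "Suc (Suc k)" and l = "Suc (Suc k)"] still_minus[where k = "Suc (Suc k)"] sym_minus s st assms(5,6))
  then show ?thesis by (simp add: curv_def)
qed

end

locale perturbed_family = sphere_family d \<Phi>
  for d :: real and \<Phi> :: "real \<times> 'a::euclidean_space => 'a \<times> real" +
  fixes a :: real and K :: "'a set"
  assumes slice: "(0, x) \<in> cyl d ==> \<Phi> (0, x) = eqv (\<lambda>_. a) (0, x)"
    and K: "compact K" "K \<subseteq> unit_ball" and still_Phi: "still K \<Phi>"
begin

sublocale st: equivariant d "\<lambda>_::real \<times> 'a. a" "\<lambda>_. 0"
  by (rule equivariant_const[OF d_pos])

abbreviation "nu \<equiv> nrm (\<lambda>_::real \<times> 'a. a)"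

lemma closed_K: "closed K" using K by (simp add: compact_imp_closed)

lemma phid_slice: "(0, x) \<in> cyl d ==> phid e (0, x) = (qq (0, x) * sin a) *\<^sub>R tng e (0, x)"
  using dd_slice_cong[OF sym_Phi st.sym_eqv slice] st.dd_eqv[of "(0, x)" e] by simp

lemma cv_slice:
  assumes "symbol d k W" "symbol d l X" "\<And>x. (0, x) \<in> cyl d ==> W (0, x) = X (0, x)" "(0, x) \<in> cyl d"
  shows "cve e W (0, x) = st.cve e X (0, x)"
  using dd_slice_cong[OF assms] slice[OF assms(4)] by (simp add: cv_def)

lemma iter_slice: "(0, x) \<in> cyl d ==> iter \<Phi> j (0, x) = iter (eqv (\<lambda>_. a)) j (0, x)"
proof (induction j arbitrary: x)
  case 0
  have "cve e (phid e) (0, x) = st.cve e (st.phid e) (0, x)" if "e \<in> Basis" for e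
    by (rule cv_slice[OF sym_dx[OF sym_Phi that] sym_dx[OF st.sym_eqv that] dd_slice_cong[OF sym_Phi st.sym_eqv slice] 0])
  then show ?case by (simp add: tau_def)
next
  case (Suc j)
  have "cve e (cve e (iter \<Phi> j)) (0, x) = st.cve e (st.cve e (iter (eqv (\<lambda>_. a)) j)) (0, x)" if "e \<in> Basis" for e
    by (rule cv_slice[OF sym_cv[OF sym_Phi sym_iter[OF sym_Phi] that] sym_cv[OF st.sym_eqv sym_iter[OF st.sym_eqv] that]
          cv_slice[OF sym_iter[OF sym_Phi] sym_iter[OF st.sym_eqv] Suc.IH] Suc.prems])
  then show ?case by (simp add: rl_def)
qed

lemma iter_nu: "(0, x) \<in> cyl d ==> iter \<Phi> j (0, x) = (qq (0, x) ^ (2 * j + 2) * factor (real DIM('a)) a j) *\<^sub>R nu (0, x)"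
  by (simp only: iter_slice iter_const[OF d_pos])

lemma cve_iter:
  assumes "(0, x) \<in> cyl d"
  shows "cve e (iter \<Phi> j) (0, x) = qq (0, x) ^ (2 * j + 3) *\<^sub>R
    ((- real (2 * j + 2) * factor (real DIM('a)) a j * (uu (0, x) \<bullet> e)) *\<^sub>R nu (0, x) + (factor (real DIM('a)) a j * cos a) *\<^sub>R tng e (0, x))"
proof -
  have "symbol d (2 * j + 2 + 0) (\<lambda>z. (qq z ^ (2 * j + 2) * factor (real DIM('a)) a j) *\<^sub>R nu z)"
    by (rule sym_scaleR[OF st.sym_qA[OF rad_const] st.sym_nrm])
  then have "cve e (iter \<Phi> j) (0, x) = st.cve e (\<lambda>z. (qq z ^ (2 * j + 2) * factor (real DIM('a)) a j) *\<^sub>R nu z) (0, x)"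
    by (rule cv_slice[OF sym_iter[OF sym_Phi] _ iter_nu assms])
  then show ?thesis
    unfolding st.cv_qA_nrm[OF rad_const assms] by (simp add: eval_nat_numeral algebra_simps)
qed

definition J :: "nat => real" where
  "J p = ball_int (\<lambda>z. qq z ^ p * (vel z \<bullet> nu z))"

lemma sym_J: "symbol d p (\<lambda>z. qq z ^ p * (vel z \<bullet> nu z))"
  using sym_mult[OF sym_qq_power sym_inner[OF sym_dt[OF sym_Phi] st.sym_nrm], of p] by simp

lemma J_cong:
  assumes "\<And>x. (0, x) \<in> cyl d ==> F (0, x) = c * (qq (0, x) ^ p * (vel (0, x) \<bullet> nu (0, x)))"
  shows "ball_int F = c * J p"
proof -
  have "symbol d p (\<lambda>z. c * (qq z ^ p * (vel z \<bullet> nu z)))"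
    using sym_cmult[OF sym_J, where c = c] by simp
  from ball_int_cong_slice[OF d_pos this assms] show ?thesis
    by (simp add: J_def ball_int_cmult)
qed

lemma iter_phid: "(0, x) \<in> cyl d ==> iter \<Phi> j (0, x) \<bullet> phid e (0, x) = 0"
  by (simp add: iter_nu phid_slice frame_products[of _ d])

lemma cve_iter_phid:
  assumes "(0, x) \<in> cyl d"
  shows "(\<Sum>e\<in>Basis. cve e (iter \<Phi> j) (0, x) \<bullet> phid e (0, x)) =
    qq (0, x) ^ (2 * j + 4) * (factor (real DIM('a)) a j * sin a * cos a * (real DIM('a) - 1))"
proof -
  have "cve e (iter \<Phi> j) (0, x) \<bullet> phid e (0, x) =
      qq (0, x) ^ (2 * j + 4) * (factor (real DIM('a)) a j * sin a * cos a) * (tng e (0, x) \<bullet> tng e (0, x))" for e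
    unfolding cve_iter[OF assms] phid_slice[OF assms]
    by (simp add: inner_add_left frame_products(8)[OF assms] eval_nat_numeral algebra_simps)
  then have "(\<Sum>e\<in>Basis. cve e (iter \<Phi> j) (0, x) \<bullet> phid e (0, x)) =
      qq (0, x) ^ (2 * j + 4) * (factor (real DIM('a)) a j * sin a * cos a) * (\<Sum>e\<in>Basis. tng e (0, x) \<bullet> tng e (0, x))"
    by (simp only: sum_distrib_left)
  then show ?thesis by (simp only: sum_tng_tng[OF assms] mult.assoc)
qed

lemma iter_vel: "(0, x) \<in> cyl d ==> iter \<Phi> j (0, x) \<bullet> vel (0, x) = qq (0, x) ^ (2 * j + 2) * factor (real DIM('a)) a j * (vel (0, x) \<bullet> nu (0, x))"
  by (simp add: iter_nu inner_commute)

text \<open>The part of the gradient residual that survives is the one in which the curvature pairs the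
  velocity with the tension field.\<close>

lemma residual_gradient:
  "ball_int (\<lambda>z. \<Sum>e\<in>Basis. cve e (iter \<Phi> m) z \<bullet>
      ((iter \<Phi> j z \<bullet> phid e z) *\<^sub>R vel z - (iter \<Phi> j z \<bullet> vel z) *\<^sub>R phid e z)) =
    - (factor (real DIM('a)) a m * factor (real DIM('a)) a j * sin a * cos a * (real DIM('a) - 1)) * J (2 * m + 2 * j + 6)"
proof (rule J_cong)
  fix x :: 'a assume z: "(0, x) \<in> cyl d"
  have "(\<Sum>e\<in>Basis. cve e (iter \<Phi> m) (0, x) \<bullet>
      ((iter \<Phi> j (0, x) \<bullet> phid e (0, x)) *\<^sub>R vel (0, x) - (iter \<Phi> j (0, x) \<bullet> vel (0, x)) *\<^sub>R phid e (0, x)))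
    = - (iter \<Phi> j (0, x) \<bullet> vel (0, x)) * (\<Sum>e\<in>Basis. cve e (iter \<Phi> m) (0, x) \<bullet> phid e (0, x))"
    by (simp add: iter_phid[OF z] sum_distrib_left sum_negf)
  then show "(\<Sum>e\<in>Basis. cve e (iter \<Phi> m) (0, x) \<bullet>
      ((iter \<Phi> j (0, x) \<bullet> phid e (0, x)) *\<^sub>R vel (0, x) - (iter \<Phi> j (0, x) \<bullet> vel (0, x)) *\<^sub>R phid e (0, x))) =
    - (factor (real DIM('a)) a m * factor (real DIM('a)) a j * sin a * cos a * (real DIM('a) - 1)) *
      (qq (0, x) ^ (2 * m + 2 * j + 6) * (vel (0, x) \<bullet> nu (0, x)))"
    unfolding cve_iter_phid[OF z] iter_vel[OF z]
    by (simp add: power_add eval_nat_numeral algebra_simps)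
qed

text \<open>At \<open>phi a\<close> all iterated Laplacians are radial multiples of one normal field, so the curvature
  terms reduce to the single functional \<open>J\<close>. Repeated use moves all Laplacians to one side.\<close>

lemma variation_rl:
  assumes "2 * (m + j) + 6 < DIM('a)"
  shows "ball_int (\<lambda>z. iter \<Phi> m z \<bullet> cvt (iter \<Phi> (Suc j)) z) = ball_int (\<lambda>z. iter \<Phi> (Suc m) z \<bullet> cvt (iter \<Phi> j) z)
    - 2 * (factor (real DIM('a)) a m * factor (real DIM('a)) a j * sin a * cos a * (real DIM('a) - 1)) * J (2 * m + 2 * j + 6)"
proof -
  let ?c = "factor (real DIM('a)) a m * factor (real DIM('a)) a j * sin a * cos a * (real DIM('a) - 1)"
  have "ball_int (\<lambda>z. iter \<Phi> m z \<bullet> cvt (rl \<Phi> (iter \<Phi> j)) z) = ball_int (\<lambda>z. rl \<Phi> (iter \<Phi> m) z \<bullet> cvt (iter \<Phi> j) z) +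
    ball_int (\<lambda>z. \<Sum>e\<in>Basis. cve e (iter \<Phi> m) z \<bullet> ((iter \<Phi> j z \<bullet> phid e z) *\<^sub>R vel z - (iter \<Phi> j z \<bullet> vel z) *\<^sub>R phid e z)
      - iter \<Phi> m z \<bullet> ((cve e (iter \<Phi> j) z \<bullet> phid e z) *\<^sub>R vel z - (cve e (iter \<Phi> j) z \<bullet> vel z) *\<^sub>R phid e z))"
    by (rule first_variation_rl[OF sym_iter[OF sym_Phi] tangential_iter sym_iter[OF sym_Phi] tangential_iter
          still_iter[OF still_Phi closed_K] _ K still_Phi]) (use assms in simp)
  also have "ball_int (\<lambda>z. \<Sum>e\<in>Basis. cve e (iter \<Phi> m) z \<bullet> ((iter \<Phi> j z \<bullet> phid e z) *\<^sub>R vel z - (iter \<Phi> j z \<bullet> vel z) *\<^sub>R phid e z)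
      - iter \<Phi> m z \<bullet> ((cve e (iter \<Phi> j) z \<bullet> phid e z) *\<^sub>R vel z - (cve e (iter \<Phi> j) z \<bullet> vel z) *\<^sub>R phid e z))
    = (- 2 * ?c) * J (2 * m + 2 * j + 6)"
  proof (rule J_cong)
    fix x :: 'a assume z: "(0, x) \<in> cyl d"
    have "(\<Sum>e\<in>Basis. cve e (iter \<Phi> m) (0, x) \<bullet> ((iter \<Phi> j (0, x) \<bullet> phid e (0, x)) *\<^sub>R vel (0, x) - (iter \<Phi> j (0, x) \<bullet> vel (0, x)) *\<^sub>R phid e (0, x))
      - iter \<Phi> m (0, x) \<bullet> ((cve e (iter \<Phi> j) (0, x) \<bullet> phid e (0, x)) *\<^sub>R vel (0, x) - (cve e (iter \<Phi> j) (0, x) \<bullet> vel (0, x)) *\<^sub>R phid e (0, x)))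
      = - (iter \<Phi> j (0, x) \<bullet> vel (0, x)) * (\<Sum>e\<in>Basis. cve e (iter \<Phi> m) (0, x) \<bullet> phid e (0, x))
        - (iter \<Phi> m (0, x) \<bullet> vel (0, x)) * (\<Sum>e\<in>Basis. cve e (iter \<Phi> j) (0, x) \<bullet> phid e (0, x))"
      by (simp add: iter_phid[OF z] inner_diff_right sum_subtractf sum_distrib_left sum_negf mult.commute)
    then show "(\<Sum>e\<in>Basis. cve e (iter \<Phi> m) (0, x) \<bullet> ((iter \<Phi> j (0, x) \<bullet> phid e (0, x)) *\<^sub>R vel (0, x) - (iter \<Phi> j (0, x) \<bullet> vel (0, x)) *\<^sub>R phid e (0, x))
      - iter \<Phi> m (0, x) \<bullet> ((cve e (iter \<Phi> j) (0, x) \<bullet> phid e (0, x)) *\<^sub>R vel (0, x) - (cve e (iter \<Phi> j) (0, x) \<bullet> vel (0, x)) *\<^sub>R phid e (0, x)))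
      = (- 2 * ?c) * (qq (0, x) ^ (2 * m + 2 * j + 6) * (vel (0, x) \<bullet> nu (0, x)))"
      unfolding cve_iter_phid[OF z] iter_vel[OF z]
      by (simp add: power_add eval_nat_numeral algebra_simps)
  qed
  finally show ?thesis by simp
qed

text \<open>The last step of the reduction, in which the variation of the tension field itself yields
  \<open>J\<close>: a Laplacian of the radial field and its curvature term.\<close>

lemma variation_tau:
  assumes "2 * m + 4 < DIM('a)"
  shows "ball_int (\<lambda>z. iter \<Phi> m z \<bullet> cvt (tau \<Phi>) z) =
    (- factor (real DIM('a)) a (Suc m) + (real DIM('a) - 1) * (sin a)\<^sup>2 * factor (real DIM('a)) a m) * J (2 * m + 4)"
proof -
  have "ball_int (\<lambda>z. iter \<Phi> m z \<bullet> cvt (tau \<Phi>) z) = - ball_int (\<lambda>z. rl \<Phi> (iter \<Phi> m) z \<bullet> vel z) +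
    ball_int (\<lambda>z. \<Sum>e\<in>Basis. (phid e z \<bullet> phid e z) * (vel z \<bullet> iter \<Phi> m z) - (vel z \<bullet> phid e z) * (phid e z \<bullet> iter \<Phi> m z))"
    by (rule first_variation_tau[OF sym_iter[OF sym_Phi] tangential_iter _ K still_Phi]) (use assms in simp)
  also have "ball_int (\<lambda>z. rl \<Phi> (iter \<Phi> m) z \<bullet> vel z) = factor (real DIM('a)) a (Suc m) * J (2 * m + 4)"
  proof (rule J_cong)
    fix x :: 'a assume z: "(0, x) \<in> cyl d"
    have "2 * Suc m + 2 = 2 * m + 4" by simp
    with iter_vel[OF z, of "Suc m"]
    show "rl \<Phi> (iter \<Phi> m) (0, x) \<bullet> vel (0, x) =
        factor (real DIM('a)) a (Suc m) * (qq (0, x) ^ (2 * m + 4) * (vel (0, x) \<bullet> nu (0, x)))"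
      by (simp only: iter_simps mult_ac)
  qed
  also have "ball_int (\<lambda>z. \<Sum>e\<in>Basis. (phid e z \<bullet> phid e z) * (vel z \<bullet> iter \<Phi> m z) - (vel z \<bullet> phid e z) * (phid e z \<bullet> iter \<Phi> m z))
    = ((real DIM('a) - 1) * (sin a)\<^sup>2 * factor (real DIM('a)) a m) * J (2 * m + 4)"
  proof (rule J_cong)
    fix x :: 'a assume z: "(0, x) \<in> cyl d"
    have "(\<Sum>e\<in>Basis. (phid e (0, x) \<bullet> phid e (0, x)) * (vel (0, x) \<bullet> iter \<Phi> m (0, x)) - (vel (0, x) \<bullet> phid e (0, x)) * (phid e (0, x) \<bullet> iter \<Phi> m (0, x)))
      = (qq (0, x) * sin a)\<^sup>2 * (vel (0, x) \<bullet> iter \<Phi> m (0, x)) * (\<Sum>e\<in>Basis. tng e (0, x) \<bullet> tng e (0, x))"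
    proof -
      have 0: "phid e (0, x) \<bullet> iter \<Phi> m (0, x) = 0" for e
        using iter_phid[OF z] by (metis inner_commute)
      show ?thesis unfolding 0 unfolding phid_slice[OF z] by (simp add: sum_distrib_left sum_distrib_right power2_eq_square mult_ac)
    qed
    then show "(\<Sum>e\<in>Basis. (phid e (0, x) \<bullet> phid e (0, x)) * (vel (0, x) \<bullet> iter \<Phi> m (0, x)) - (vel (0, x) \<bullet> phid e (0, x)) * (phid e (0, x) \<bullet> iter \<Phi> m (0, x)))
      = ((real DIM('a) - 1) * (sin a)\<^sup>2 * factor (real DIM('a)) a m) * (qq (0, x) ^ (2 * m + 4) * (vel (0, x) \<bullet> nu (0, x)))"
      unfolding sum_tng_tng[OF z] inner_commute[of "vel (0, x)" "iter \<Phi> m (0, x)"] iter_vel[OF z]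
      by (simp add: eval_nat_numeral algebra_simps)
  qed
  finally show ?thesis by (simp add: algebra_simps)
qed

lemma variation_gradient:
  assumes "4 * s + 6 < DIM('a)"
  shows "ball_int (\<lambda>z. \<Sum>e\<in>Basis. cve e (iter \<Phi> s) z \<bullet> cvt (cve e (iter \<Phi> s)) z) =
    ball_int (\<lambda>z. iter \<Phi> (Suc s) z \<bullet> cvt (iter \<Phi> s) z)
    - (factor (real DIM('a)) a s * factor (real DIM('a)) a s * sin a * cos a * (real DIM('a) - 1)) * J (4 * s + 6)"
proof -
  have "2 * s + 2 * s + 6 = 4 * s + 6" by simp
  then show ?thesis
    using first_variation_gradient[OF sym_iter[OF sym_Phi] tangential_iter still_iter[OF still_Phi closed_K] _ K, of s]
      residual_gradient[of s s] assms by simp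
qed

text \<open>The curvature terms of the energies of Eells--Sampson type vanish to first order, because
  $d\varphi$ is orthogonal to the tension field and to its Laplacian.\<close>

lemma curv_slice:
  assumes "e \<in> Basis" "f \<in> Basis" "(0, x) \<in> cyl d"
  shows "curv \<Phi> (iter \<Phi> j) e f (0, x) = 0"
  using curv_eq[OF sym_iter[OF sym_Phi] tangential_iter assms] by (simp add: iter_phid[OF assms(3)])

lemma cve_curv_slice:
  assumes "e \<in> Basis" "f \<in> Basis" "g \<in> Basis" "(0, x) \<in> cyl d"
  shows "cve g (curv \<Phi> (iter \<Phi> j) e f) (0, x) = 0"
  using cv_slice[OF sym_curv[OF sym_iter[OF sym_Phi] assms(1,2)] sym_const[of d 0 0] curv_slice[OF assms(1,2)] assms(4)] by simp

lemma variation_lin3: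
  assumes dim: "10 < DIM('a)"
  shows "ball_int (\<lambda>z. \<Sum>e\<in>Basis. cve e (iter \<Phi> 1) z \<bullet> cvt (\<lambda>z. \<Sum>f\<in>Basis. cve f (curv \<Phi> (tau \<Phi>) f e) z) z) = 0"
proof -
  let ?W = "iter \<Phi> 1" and ?Q = "curv \<Phi> (iter \<Phi> 0)"
  have sW: "symbol d 4 ?W" using sym_iter[OF sym_Phi, of 1] by simp
  have sWe: "symbol d 5 (cve e ?W)" if "e \<in> Basis" for e using sym_cv[OF sym_Phi sW that] by simp
  have sWfe: "symbol d 6 (cve f (cve e ?W))" if "e \<in> Basis" "f \<in> Basis" for e f
    using sym_cv[OF sym_Phi sWe[OF that(1)] that(2)] by simp
  have sQ: "symbol d 4 (?Q f e)" if "e \<in> Basis" "f \<in> Basis" for e f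
    using sym_curv[OF sym_iter[OF sym_Phi, of 0] that(2,1)] by (simp add: eval_nat_numeral)
  have sQe: "symbol d 5 (cve f (?Q f e))" if "e \<in> Basis" "f \<in> Basis" for e f
    using sym_cv[OF sym_Phi sQ[OF that] that(2)] by simp
  have s1: "symbol d 10 (\<lambda>z. cve e ?W z \<bullet> cve f (cvt (?Q f e)) z)" if "e \<in> Basis" "f \<in> Basis" for e f
    using sym_inner[OF sWe[OF that(1)] sym_cv[OF sym_Phi sym_cvt[OF sym_Phi sQ[OF that]] that(2)]] by simp
  have s2: "symbol d 10 (\<lambda>z. cve f (cve e ?W) z \<bullet> cvt (?Q f e) z)" if "e \<in> Basis" "f \<in> Basis" for e f
    using sym_inner[OF sWfe[OF that] sym_cvt[OF sym_Phi sQ[OF that]]] by simp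
  have "ball_int (\<lambda>z. \<Sum>e\<in>Basis. cve e ?W z \<bullet> cvt (\<lambda>z. \<Sum>f\<in>Basis. cve f (?Q f e) z) z) =
      ball_int (\<lambda>z. \<Sum>e\<in>Basis. \<Sum>f\<in>Basis. cve e ?W z \<bullet> cve f (cvt (?Q f e)) z)"
  proof (rule ball_int_cong_slice[OF d_pos sym_sum[OF sym_sum[OF s1]]])
    fix x :: 'a assume z: "(0, x) \<in> cyl d"
    have "cvt (\<lambda>z. \<Sum>f\<in>Basis. cve f (?Q f e) z) (0, x) = (\<Sum>f\<in>Basis. cve f (cvt (?Q f e)) (0, x))" if e: "e \<in> Basis" for e
    proof -
      have "cvt (\<lambda>z. \<Sum>f\<in>Basis. cve f (?Q f e) z) (0, x) = (\<Sum>f\<in>Basis. cvt (cve f (?Q f e)) (0, x))"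
        by (rule cv_sum[OF sQe[OF e] z])
      also have "\<dots> = (\<Sum>f\<in>Basis. cve f (cvt (?Q f e)) (0, x))"
        by (rule sum.cong[OF refl]) (use e in \<open>simp add: cvt_cve[OF sQ tangential_curv _ z] curv_slice[OF _ _ z] del: iter_simps\<close>)
      finally show ?thesis .
    qed
    then show "(\<Sum>e\<in>Basis. cve e ?W (0, x) \<bullet> cvt (\<lambda>z. \<Sum>f\<in>Basis. cve f (?Q f e) z) (0, x)) =
        (\<Sum>e\<in>Basis. \<Sum>f\<in>Basis. cve e ?W (0, x) \<bullet> cve f (cvt (?Q f e)) (0, x))"
      by (simp add: inner_sum_right del: iter_simps)
  qed
  also have "\<dots> = (\<Sum>e\<in>Basis. \<Sum>f\<in>Basis. ball_int (\<lambda>z. cve e ?W z \<bullet> cve f (cvt (?Q f e)) z))"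
    by (rule ball_int_sum2[OF d_pos s1 dim])
  also have "\<dots> = (\<Sum>e\<in>Basis. \<Sum>f\<in>Basis. - ball_int (\<lambda>z. cve f (cve e ?W) z \<bullet> cvt (?Q f e) z))"
  proof (intro sum.cong refl)
    fix e f :: 'a assume e: "e \<in> Basis" and f: "f \<in> Basis"
    show "ball_int (\<lambda>z. cve e ?W z \<bullet> cve f (cvt (?Q f e)) z) = - ball_int (\<lambda>z. cve f (cve e ?W) z \<bullet> cvt (?Q f e) z)"
      by (rule cv_parts[OF sWe[OF e] tangential_cv sym_cvt[OF sym_Phi sQ[OF e f]] tangential_cv _ f K])
        (use dim cvt_eq_0[OF still_curv[OF still_Phi still_iter[OF still_Phi closed_K, of 0] closed_K sym_iter[OF sym_Phi, of 0] f e]] in \<open>auto simp del: iter_simps\<close>)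
  qed
  also have "\<dots> = - ball_int (\<lambda>z. \<Sum>e\<in>Basis. \<Sum>f\<in>Basis. cve f (cve e ?W) z \<bullet> cvt (?Q f e) z)"
    by (simp only: sum_negf ball_int_sum2[OF d_pos s2 dim])
  also have "ball_int (\<lambda>z. \<Sum>e\<in>Basis. \<Sum>f\<in>Basis. cve f (cve e ?W) z \<bullet> cvt (?Q f e) z) = ball_int (\<lambda>z::real \<times> 'a. 0)"
  proof (rule ball_int_cong_slice[OF d_pos sym_const[of d 0 0]])
    fix x :: 'a assume z: "(0, x) \<in> cyl d"
    let ?G = "\<lambda>e f. cve f (cve e ?W) (0, x) \<bullet> cvt (?Q f e) (0, x)"
    \<comment> \<open>antisymmetry of the curvature form makes the double sum equal to its own negative\<close>
    have G: "?G f e = - ?G e f" if "e \<in> Basis" "f \<in> Basis" for e f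
    proof -
      have "cve e (cve f ?W) (0, x) = cve f (cve e ?W) (0, x)"
        using curv_slice[OF that z, of 1] by (simp add: curv_def del: iter_simps)
      moreover have "cvt (?Q e f) (0, x) = - cvt (?Q f e) (0, x)"
      proof -
        have "cvt (?Q e f) (0, x) = cvt (\<lambda>z. - ?Q f e z) (0, x)"
          by (rule cv_cong[OF z]) (simp add: curv_def)
        then show ?thesis using cv_minus[OF sQ[OF that] z] by simp
      qed
      ultimately show ?thesis by (simp del: iter_simps)
    qed
    have "(\<Sum>e\<in>Basis. \<Sum>f\<in>Basis. ?G e f) = (\<Sum>f\<in>Basis. \<Sum>e\<in>Basis. ?G e f)" by (rule sum.swap)
    also have "\<dots> = (\<Sum>f\<in>Basis. \<Sum>e\<in>Basis. - ?G f e)" by (intro sum.cong refl) (rule G)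
    also have "\<dots> = - (\<Sum>e\<in>Basis. \<Sum>f\<in>Basis. ?G e f)" by (simp only: sum_negf)
    finally show "(\<Sum>e\<in>Basis. \<Sum>f\<in>Basis. ?G e f) = 0" by simp
  qed
  finally show ?thesis by (simp add: ball_int_def)
qed

end

subsection \<open>Energy densities\<close>

definition dens_odd :: "nat => (real \<times> 'a::euclidean_space => 'b::euclidean_space) => real \<times> 'a => real" where
  "dens_odd s \<Phi> z = (\<Sum>e\<in>Basis. cv \<Phi> (0, e) (iter \<Phi> s) z \<bullet> cv \<Phi> (0, e) (iter \<Phi> s) z)"

definition dens_even :: "nat => (real \<times> 'a::euclidean_space => 'b::euclidean_space) => real \<times> 'a => real" where
  "dens_even s \<Phi> z = iter \<Phi> s z \<bullet> iter \<Phi> s z"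

definition dens_ES4 :: "(real \<times> 'a::euclidean_space => 'b::euclidean_space) => real \<times> 'a => real" where
  "dens_ES4 \<Phi> z = iter \<Phi> 1 z \<bullet> iter \<Phi> 1 z +
    1/2 * (\<Sum>e\<in>Basis. \<Sum>f\<in>Basis. curv \<Phi> (tau \<Phi>) e f z \<bullet> curv \<Phi> (tau \<Phi>) e f z)"

definition dens_ES5 :: "(real \<times> 'a::euclidean_space => 'b::euclidean_space) => real \<times> 'a => real" where
  "dens_ES5 \<Phi> z = (\<Sum>e\<in>Basis. lin3 \<Phi> (tau \<Phi>) e z \<bullet> lin3 \<Phi> (tau \<Phi>) e z) +
    1/6 * (\<Sum>e\<in>Basis. \<Sum>f\<in>Basis. \<Sum>g\<in>Basis. tri \<Phi> (tau \<Phi>) e f g z \<bullet> tri \<Phi> (tau \<Phi>) e f g z)"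

text \<open>Common form of all energies in question. The density is a square of an expression of total order
  \<open>r\<close> in the derivatives, which explains the weight; the energy and its variations converge as soon
  as the dimension exceeds \<open>2 * r\<close>.\<close>

definition energy_density ::
    "(('a::euclidean_space => 'b::euclidean_space) => real) => nat => ((real \<times> 'a => 'b) => real \<times> 'a => real) => bool" where
  "energy_density F r D \<longleftrightarrow> (\<forall>d \<Phi>. symbol d 0 \<Phi> --> symbol d (2 * r) (D \<Phi>) \<and>
     (\<forall>t \<phi>. \<bar>t\<bar> < d --> rep t \<Phi> \<phi> --> F \<phi> = 1/2 * (LINT x|lebesgue_on unit_ball. D \<Phi> (t, x))))"

lemma sym_curv_tau:
  assumes "symbol d 0 \<Phi>" "e \<in> Basis" "f \<in> Basis"
  shows "symbol d 4 (curv \<Phi> (tau \<Phi>) e f)"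
  unfolding curv_def using sym_cv[OF assms(1) sym_cv[OF assms(1) sym_tau[OF assms(1)]]] assms
  by (intro sym_diff) (auto simp: eval_nat_numeral)

lemma sym_tri:
  assumes "symbol d 0 \<Phi>" "e \<in> Basis" "f \<in> Basis" "g \<in> Basis"
  shows "symbol d 5 (tri \<Phi> (tau \<Phi>) e f g)"
  unfolding tri_def
  using sym_cv[OF assms(1) sym_curv_tau[OF assms(1)]] assms by (intro sym_add sym_diff) auto

lemma sym_lin3:
  assumes "symbol d 0 \<Phi>" "e \<in> Basis"
  shows "symbol d 5 (lin3 \<Phi> (tau \<Phi>) e)"
  unfolding lin3_def
  using sym_cv[OF assms(1) sym_curv_tau[OF assms(1)]] assms sym_cv[OF assms(1) sym_iter[OF assms(1), of 1] assms(2)]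
  by (intro sym_diff sym_sum) auto

lemma energy_density_odd:
  assumes "2 * s + 3 < DIM('a)"
  shows "energy_density (r_energy (2 * s + 3)) (2 * s + 3) (dens_odd s :: (real \<times> 'a::euclidean_space => 'b::euclidean_space) => _)"
  unfolding energy_density_def
proof (intro allI impI conjI)
  fix d and \<Phi> :: "real \<times> 'a => 'b" assume \<Phi>: "symbol d 0 \<Phi>"
  have "symbol d (Suc (2 * s + 2) + Suc (2 * s + 2)) (\<lambda>z. \<Sum>e\<in>Basis. cv \<Phi> (0, e) (iter \<Phi> s) z \<bullet> cv \<Phi> (0, e) (iter \<Phi> s) z)"
    by (intro sym_sum sym_inner sym_cv sym_iter \<Phi>)
  then show "symbol d (2 * (2 * s + 3)) (dens_odd s \<Phi>)"
    by (simp add: dens_odd_def[abs_def] eval_nat_numeral)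
  fix t and \<phi> :: "'a => 'b" assume "\<bar>t\<bar> < d" "rep t \<Phi> \<phi>"
  then show "r_energy (2 * s + 3) \<phi> = 1/2 * (LINT x|lebesgue_on unit_ball. dens_odd s \<Phi> (t, x))"
    unfolding dens_odd_def using r_energy_odd[OF \<Phi> _ _ assms] by blast
qed

lemma energy_density_even:
  assumes "2 * s + 2 < DIM('a)"
  shows "energy_density (r_energy (2 * s + 2)) (2 * s + 2) (dens_even s :: (real \<times> 'a::euclidean_space => 'b::euclidean_space) => _)"
  unfolding energy_density_def
proof (intro allI impI conjI)
  fix d and \<Phi> :: "real \<times> 'a => 'b" assume \<Phi>: "symbol d 0 \<Phi>"
  show "symbol d (2 * (2 * s + 2)) (dens_even s \<Phi>)"
    using sym_inner[OF sym_iter[OF \<Phi>, of s] sym_iter[OF \<Phi>, of s]]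
    by (simp add: dens_even_def[abs_def] mult_2)
  fix t and \<phi> :: "'a => 'b" assume "\<bar>t\<bar> < d" "rep t \<Phi> \<phi>"
  then show "r_energy (2 * s + 2) \<phi> = 1/2 * (LINT x|lebesgue_on unit_ball. dens_even s \<Phi> (t, x))"
    unfolding dens_even_def using r_energy_even[OF \<Phi> _ _ assms] by blast
qed

lemma energy_density_ES3:
  assumes "3 < DIM('a)"
  shows "energy_density (ES_energy 3) 3 (dens_odd 0 :: (real \<times> 'a::euclidean_space => 'b::euclidean_space) => _)"
  unfolding energy_density_def
proof (intro allI impI conjI)
  fix d and \<Phi> :: "real \<times> 'a => 'b" assume \<Phi>: "symbol d 0 \<Phi>"
  show "symbol d (2 * 3) (dens_odd 0 \<Phi>)"
    using energy_density_odd[of 0, where ?'a = 'a and ?'b = 'b] assms \<Phi> by (simp add: energy_density_def)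
  fix t and \<phi> :: "'a => 'b" assume "\<bar>t\<bar> < d" "rep t \<Phi> \<phi>"
  then show "ES_energy 3 \<phi> = 1/2 * (LINT x|lebesgue_on unit_ball. dens_odd 0 \<Phi> (t, x))"
    using ES_energy_density[OF \<Phi>, of t \<phi> 1] form_density_HD_1[of \<Phi> "tau \<Phi>"] assms
    by (simp add: dens_odd_def numeral_3_eq_3)
qed

lemma energy_density_ES4:
  assumes "4 < DIM('a)"
  shows "energy_density (ES_energy 4) 4 (dens_ES4 :: (real \<times> 'a::euclidean_space => 'b::euclidean_space) => _)"
  unfolding energy_density_def
proof (intro allI impI conjI)
  fix d and \<Phi> :: "real \<times> 'a => 'b" assume \<Phi>: "symbol d 0 \<Phi>"
  have "symbol d 8 (\<lambda>z. iter \<Phi> 1 z \<bullet> iter \<Phi> 1 z)"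
    using sym_inner[OF sym_iter[OF \<Phi>, of 1] sym_iter[OF \<Phi>, of 1]] by simp
  moreover have "symbol d 8 (\<lambda>z. \<Sum>e\<in>Basis. \<Sum>f\<in>Basis. curv \<Phi> (tau \<Phi>) e f z \<bullet> curv \<Phi> (tau \<Phi>) e f z)"
    using sym_inner[OF sym_curv_tau[OF \<Phi>] sym_curv_tau[OF \<Phi>]] by (intro sym_sum) simp
  ultimately show "symbol d (2 * 4) (dens_ES4 \<Phi>)"
    unfolding dens_ES4_def[abs_def] using sym_add sym_cmult[where c = "1/2"] by fastforce
  fix t and \<phi> :: "'a => 'b" assume "\<bar>t\<bar> < d" "rep t \<Phi> \<phi>"
  then show "ES_energy 4 \<phi> = 1/2 * (LINT x|lebesgue_on unit_ball. dens_ES4 \<Phi> (t, x))"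
    using ES_energy_density[OF \<Phi>, of t \<phi> 2] form_density_HD_2[of \<Phi> "tau \<Phi>"] assms
    by (simp add: dens_ES4_def eval_nat_numeral)
qed

lemma energy_density_ES5:
  assumes "5 < DIM('a)"
  shows "energy_density (ES_energy 5) 5 (dens_ES5 :: (real \<times> 'a::euclidean_space => 'b::euclidean_space) => _)"
  unfolding energy_density_def
proof (intro allI impI conjI)
  fix d and \<Phi> :: "real \<times> 'a => 'b" assume \<Phi>: "symbol d 0 \<Phi>"
  have "symbol d 10 (\<lambda>z. \<Sum>e\<in>Basis. lin3 \<Phi> (tau \<Phi>) e z \<bullet> lin3 \<Phi> (tau \<Phi>) e z)"
    using sym_inner[OF sym_lin3[OF \<Phi>] sym_lin3[OF \<Phi>]] by (intro sym_sum) simp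
  moreover have "symbol d 10 (\<lambda>z. \<Sum>e\<in>Basis. \<Sum>f\<in>Basis. \<Sum>g\<in>Basis. tri \<Phi> (tau \<Phi>) e f g z \<bullet> tri \<Phi> (tau \<Phi>) e f g z)"
    using sym_inner[OF sym_tri[OF \<Phi>] sym_tri[OF \<Phi>]] by (intro sym_sum) simp
  ultimately show "symbol d (2 * 5) (dens_ES5 \<Phi>)"
    unfolding dens_ES5_def[abs_def] using sym_add sym_cmult[where c = "1/6"] by fastforce
  fix t and \<phi> :: "'a => 'b" assume "\<bar>t\<bar> < d" "rep t \<Phi> \<phi>"
  then show "ES_energy 5 \<phi> = 1/2 * (LINT x|lebesgue_on unit_ball. dens_ES5 \<Phi> (t, x))"
    using ES_energy_density[OF \<Phi>, of t \<phi> 3] form_density_HD_3[of \<Phi> "tau \<Phi>"] assms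
    by (simp add: dens_ES5_def eval_nat_numeral)
qed

lemma energy_density_1:
  assumes "1 < DIM('a)"
  shows "energy_density (r_energy 1) 1 ((\<lambda>\<Phi> z. \<Sum>e\<in>Basis. dd (0, e) \<Phi> z \<bullet> dd (0, e) \<Phi> z) :: (real \<times> 'a::euclidean_space => 'b::euclidean_space) => _)"
  unfolding energy_density_def
proof (intro allI impI conjI)
  fix d and \<Phi> :: "real \<times> 'a => 'b" assume \<Phi>: "symbol d 0 \<Phi>"
  show "symbol d (2 * 1) (\<lambda>z. \<Sum>e\<in>Basis. dd (0, e) \<Phi> z \<bullet> dd (0, e) \<Phi> z)"
    using sym_inner[OF sym_dx[OF \<Phi>] sym_dx[OF \<Phi>]] by (intro sym_sum) (simp add: numeral_2_eq_2)
  fix t and \<phi> :: "'a => 'b" assume "\<bar>t\<bar> < d" "rep t \<Phi> \<phi>"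
  then show "r_energy 1 \<phi> = 1/2 * (LINT x|lebesgue_on unit_ball. (\<Sum>e\<in>Basis. dd (0, e) \<Phi> (t, x) \<bullet> dd (0, e) \<Phi> (t, x)))"
    using r_energy_1[OF \<Phi> _ _ assms] by blast
qed

subsection \<open>Variations by test functions\<close>

definition cone_map :: "real => 'a::euclidean_space => 'a \<times> real" where
  "cone_map a x = (sin a *\<^sub>R sgn x, cos a)"

lemma eqv_const: "eqv (\<lambda>_. a) (t, x) = cone_map a x"
  by (simp add: eqv_def cone_map_def uu_def)

lemma rep_cone_map: "rep t (eqv (\<lambda>_. a)) (cone_map a)"
  by (simp add: rep_def eqv_const)

lemma sobolev_sphere_rep:
  fixes \<Phi> :: "real \<times> 'a::euclidean_space => 'b::euclidean_space"
  assumes "sphere_family d \<Phi>" "\<bar>t\<bar> < d" "rep t \<Phi> \<phi>" "2 * r < DIM('a)"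
  shows "sobolev_sphere r \<phi>"
proof -
  interpret sphere_family d \<Phi> by (rule assms(1))
  have "sobolev r \<phi>" by (rule rep_sobolev[OF sym_Phi _ assms(2,3)]) (use assms(4) in simp)
  moreover have "AE x in lebesgue_on unit_ball. \<phi> x \<in> sphere 0 1"
    using AE_cyl[OF assms(2)] assms(3) unfolding rep_def
  proof eventually_elim
    fix x assume "(t, x) \<in> cyl d" "\<phi> x = \<Phi> (t, x)"
    then show "\<phi> x \<in> sphere 0 1" using unit by (simp add: norm_eq_1)
  qed
  ultimately show ?thesis by (simp add: sobolev_sphere_def)
qed

lemma dd_time_0:
  assumes "symbol d k F" "(t, x) \<in> cyl d" "\<And>s. F (s, x) = c"
  shows "dd (1, 0) F (t, x) = 0"
proof -
  have "((\<lambda>s. F (s, x)) has_derivative (\<lambda>h. 0)) (at t)" by (simp add: assms(3))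
  from fun_cong[OF has_derivative_unique[OF has_derivative_time[OF assms(1,2)] this], of 1] show ?thesis .
qed

text \<open>The perturbation has norm at most one half for small \<open>t\<close>, so the projection to the sphere
  is smooth there, and its first order effect is the tangential part of the test field.\<close>

lemma perturbed_family_exists:
  fixes \<eta> :: "'a::euclidean_space => 'a \<times> real"
  assumes \<eta>: "test_function \<eta>"
  obtains d where "perturbed_family d (\<lambda>z. sgn (eqv (\<lambda>_. a) z + fst z *\<^sub>R \<eta> (snd z))) a (closure {x. \<eta> x \<noteq> 0})"
    "\<And>x. (0, x) \<in> cyl d ==> dd (1, 0) (\<lambda>z. sgn (eqv (\<lambda>_. a) z + fst z *\<^sub>R \<eta> (snd z))) (0, x) \<bullet> nrm (\<lambda>_. a) (0, x)
      = \<eta> x \<bullet> nrm (\<lambda>_. a) (0, x)"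
proof -
  let ?K = "closure {x. \<eta> x \<noteq> 0}"
  have sm: "smooth \<eta>" using \<eta> by (simp add: test_function_def)
  have K: "compact ?K" "?K \<subseteq> unit_ball"
    using \<eta> by (auto simp: test_function_def compact_eq_bounded_closed intro: bounded_subset)
  obtain B where B: "\<forall>x\<in>ball 0 1. norm (\<eta> x) \<le> B"
    using test_function_bounded[OF sm] by (auto simp: bounded_iff)
  have B0: "0 \<le> B" using order_trans[OF norm_ge_zero, of "\<eta> 0" B] B by simp
  \<comment> \<open>small enough that the perturbation has norm at most \<open>1/2\<close>\<close>
  define d where "d = 1 / (2 * (B + 1))"
  have d: "0 < d" using B0 by (simp add: d_def)
  interpret st: equivariant d "\<lambda>_::real \<times> 'a. a" "\<lambda>_. 0" by (rule equivariant_const[OF d])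
  let ?Y = "\<lambda>z. eqv (\<lambda>_. a) z + fst z *\<^sub>R \<eta> (snd z)"
  let ?\<Phi> = "\<lambda>z. sgn (?Y z)"
  have sY: "symbol d 0 ?Y"
    using sym_add[OF st.sym_eqv sym_scaleR[OF sym_fst sym_smooth[OF sm], simplified]] .
  have lower: "1 / 2 \<le> norm (?Y z)" if z: "z \<in> cyl d" for z
  proof -
    have "norm (fst z *\<^sub>R \<eta> (snd z)) \<le> d * (B + 1)"
    proof -
      have "\<bar>fst z\<bar> \<le> d" "norm (\<eta> (snd z)) \<le> B + 1" using z B by (force simp: cyl_def)+
      then show ?thesis unfolding norm_scaleR by (intro mult_mono) (use d in auto)
    qed
    also have "\<dots> = 1 / 2" using B0 by (simp add: d_def)
    finally have "norm (fst z *\<^sub>R \<eta> (snd z)) \<le> 1 / 2" .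
    moreover have "norm (eqv (\<lambda>_. a) z) = 1" using frame_products(1)[OF z] by (simp add: norm_eq_1)
    moreover have "norm (eqv (\<lambda>_. a) z) \<le> norm (?Y z) + norm (fst z *\<^sub>R \<eta> (snd z))"
      by (metis add_diff_cancel_right' norm_triangle_ineq4)
    ultimately show ?thesis by linarith
  qed
  have s\<Phi>: "symbol d 0 ?\<Phi>" by (rule sym_sgn[OF sY _ lower]) simp
  have sf: "sphere_family d ?\<Phi>"
  proof
    show "?\<Phi> z \<bullet> ?\<Phi> z = 1" if "z \<in> cyl d" for z
      using lower[OF that] by (auto simp: dot_square_norm norm_sgn)
  qed (use d s\<Phi> in auto)
  have "sgn (eqv (\<lambda>_. a) z) = eqv (\<lambda>_. a) z" if "z \<in> cyl d" for z :: "real \<times> 'a"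
  proof -
    have "norm (eqv (\<lambda>_. a) z) = 1" using frame_products(1)[OF that] by (simp add: norm_eq_1)
    then show ?thesis by (simp add: sgn_div_norm)
  qed
  note sgn1 = this
  have "perturbed_family d ?\<Phi> a ?K"
  proof (intro perturbed_family.intro sf perturbed_family_axioms.intro K)
    show "?\<Phi> (0, x) = eqv (\<lambda>_. a) (0, x)" if "(0, x) \<in> cyl d" for x using sgn1[OF that] by simp
    show "sphere_family.still d ?K ?\<Phi>"
      unfolding sphere_family.still_def[OF sf]
    proof (intro ballI impI)
      fix z :: "real \<times> 'a" assume z: "z \<in> cyl d" "snd z \<notin> ?K"
      have "dd (1, 0) ?\<Phi> z = dd (1, 0) (eqv (\<lambda>_. a)) z"
      proof (rule dd_cong)
        show "open (cyl d \<inter> UNIV \<times> (- ?K))"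
          by (intro open_Int open_cyl open_Times open_Compl) auto
        show "z \<in> cyl d \<inter> UNIV \<times> (- ?K)" using z by (auto simp: mem_Times_iff)
        show "?\<Phi> y = eqv (\<lambda>_. a) y" if "y \<in> cyl d \<inter> UNIV \<times> (- ?K)" for y
        proof -
          have "\<eta> (snd y) = 0" using that closure_subset[of "{x. \<eta> x \<noteq> 0}"] by (auto simp: mem_Times_iff)
          then show ?thesis using sgn1 that by simp
        qed
      qed
      also have "\<dots> = 0"
        using dd_time_0[OF st.sym_eqv, of "fst z" "snd z"] z(1) by (simp add: eqv_const)
      finally show "dd (1, 0) ?\<Phi> z = 0" .
    qed
  qed
  moreover have "dd (1, 0) ?\<Phi> (0, x) \<bullet> nrm (\<lambda>_. a) (0, x) = \<eta> x \<bullet> nrm (\<lambda>_. a) (0, x)" if z: "(0, x) \<in> cyl d" for x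
  proof -
    let ?r = "\<lambda>z. inverse (norm (?Y z))"
    have sr: "symbol d 0 ?r" by (rule sym_inverse_norm[OF sY _ lower]) simp
    have "dd (1, 0) ?\<Phi> (0, x) = ?r (0, x) *\<^sub>R dd (1, 0) ?Y (0, x) + dd (1, 0) ?r (0, x) *\<^sub>R ?Y (0, x)"
      unfolding sgn_div_norm
      by (rule dd_bilinear[OF bounded_bilinear_scaleR sym_differentiable[OF sr z] sym_differentiable[OF sY z]])
    moreover have "?r (0, x) = 1" using frame_products(1)[OF z, of "\<lambda>_. a"] by (simp add: norm_eq_1)
    moreover have "dd (1, 0) ?Y (0, x) = \<eta> x"
    proof -
      have "((\<lambda>s. ?Y (s, x)) has_derivative (\<lambda>h. h *\<^sub>R \<eta> x)) (at 0)"
        by (auto simp: eqv_const intro!: derivative_eq_intros)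
      from fun_cong[OF has_derivative_unique[OF has_derivative_time[OF sY z] this], of 1] show ?thesis by simp
    qed
    ultimately show ?thesis by (simp add: inner_add_left frame_products[OF z])
  qed
  ultimately show thesis by (rule that)
qed

lemma dd_sum_0:
  assumes "\<And>i. i \<in> I ==> symbol d k (F i)" "z \<in> cyl d" "\<And>i. i \<in> I ==> dd v (F i) z = 0"
  shows "dd v (\<lambda>z. \<Sum>i\<in>I. F i z) z = 0"
  using dd_sum[OF assms(1,2), where v = v and I = I] assms(3) by simp

lemma energy_derivative:
  fixes F :: "('a::euclidean_space => 'b::euclidean_space) => real"
  assumes F: "energy_density F r D" and r: "2 * r < DIM('a)" and \<Phi>: "symbol d 0 \<Phi>"
    and rep: "\<And>t. \<bar>t\<bar> < d ==> rep t \<Phi> (\<phi> t)" and t: "\<bar>t\<bar> < d"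
  shows "((\<lambda>t. F (\<phi> t)) has_real_derivative 1/2 * (LINT x|lebesgue_on unit_ball. dd (1, 0) (D \<Phi>) (t, x))) (at t)"
proof -
  have D: "symbol d (2 * r) (D \<Phi>)" and e: "\<And>t. \<bar>t\<bar> < d ==> F (\<phi> t) = 1/2 * (LINT x|lebesgue_on unit_ball. D \<Phi> (t, x))"
    using F \<Phi> rep unfolding energy_density_def by blast+
  have "((\<lambda>t. 1/2 * (LINT x|lebesgue_on unit_ball. D \<Phi> (t, x))) has_real_derivative
      1/2 * (LINT x|lebesgue_on unit_ball. dd (1, 0) (D \<Phi>) (t, x))) (at t)"
    by (intro DERIV_cmult has_real_derivative_integral_symbol[OF D r t])
  then show ?thesis
    by (rule has_field_derivative_transform_within_open[where S = "{-d<..<d}"]) (use t e in auto)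
qed

text \<open>Every test field produces a family to which the integrated first variation formulas apply, so that
  the Euler--Lagrange equation becomes an identity for families of symbols.\<close>

lemma cone_map_weakly_critical:
  fixes F :: "('a::euclidean_space => 'a \<times> real) => real"
  assumes F: "energy_density F r D" and r: "2 * r < DIM('a)"
    and var: "\<And>d \<Phi> K. perturbed_family d \<Phi> a K ==> ball_int (dd (1, 0) (D \<Phi>)) = 0"
  shows "weakly_critical F r (cone_map a)"
  unfolding weakly_critical_def
proof (intro conjI allI impI)
  interpret base: equivariant 1 "\<lambda>_::real \<times> 'a. a" "\<lambda>_. 0" by (rule equivariant_const) simp
  show "sobolev_sphere r (cone_map a :: 'a => 'a \<times> real)"
    by (rule sobolev_sphere_rep[OF base.sphere_family_axioms _ rep_cone_map[of 0] r]) simp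
  fix \<eta> :: "'a => 'a \<times> real" assume "test_function \<eta>"
  then obtain d where d: "perturbed_family d (\<lambda>z. sgn (eqv (\<lambda>_. a) z + fst z *\<^sub>R \<eta> (snd z))) a (closure {x. \<eta> x \<noteq> 0})"
    (is "perturbed_family d ?\<Phi> a ?K")
    by (rule perturbed_family_exists)
  interpret pf: perturbed_family d ?\<Phi> a ?K by (rule d)
  have "((\<lambda>t. F (\<lambda>x. sgn (cone_map a x + t *\<^sub>R \<eta> x))) has_real_derivative
      1/2 * (LINT x|lebesgue_on unit_ball. dd (1, 0) (D ?\<Phi>) (0, x))) (at 0)"
    by (rule energy_derivative[OF F r pf.sym_Phi]) (use pf.d_pos in \<open>simp_all add: rep_def eqv_const\<close>)
  then show "((\<lambda>t. F (\<lambda>x. sgn (cone_map a x + t *\<^sub>R \<eta> x))) has_real_derivative 0) (at 0)"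
    using var[OF d] by (simp add: ball_int_def)
qed

context perturbed_family
begin

lemma variation_dens_even:
  assumes "4 * s + 4 < DIM('a)"
  shows "ball_int (dd (1, 0) (dens_even s \<Phi>)) = 2 * ball_int (\<lambda>z. iter \<Phi> s z \<bullet> cvt (iter \<Phi> s) z)"
  unfolding ball_int_cmult[symmetric] dens_even_def[abs_def]
  by (rule ball_int_cong_slice[OF d_pos sym_cmult[OF sym_inner[OF sym_iter[OF sym_Phi] sym_cvt[OF sym_Phi sym_iter[OF sym_Phi]]], where c = 2, simplified]])
    (rule dd_inner_self[OF sym_iter[OF sym_Phi] tangential_iter])

lemma variation_dens_odd:
  "ball_int (dd (1, 0) (dens_odd s \<Phi>)) = 2 * ball_int (\<lambda>z. \<Sum>e\<in>Basis. cve e (iter \<Phi> s) z \<bullet> cvt (cve e (iter \<Phi> s)) z)"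
  unfolding ball_int_cmult[symmetric]
proof (rule ball_int_cong_slice[OF d_pos])
  have sX: "symbol d (2 * s + 3) (cve e (iter \<Phi> s))" if "e \<in> Basis" for e
    using sym_cv[OF sym_Phi sym_iter[OF sym_Phi] that, of s] by (simp add: eval_nat_numeral)
  have "symbol d (2 * s + 3 + (2 * s + 3)) (\<lambda>z. 2 *\<^sub>R (\<Sum>e\<in>Basis. cve e (iter \<Phi> s) z \<bullet> cvt (cve e (iter \<Phi> s)) z))"
    by (intro sym_cmult sym_sum sym_inner sym_cvt sX sym_Phi)
  then show "symbol d (2 * s + 3 + (2 * s + 3)) (\<lambda>z. 2 * (\<Sum>e\<in>Basis. cve e (iter \<Phi> s) z \<bullet> cvt (cve e (iter \<Phi> s)) z))" by simp
  fix x :: 'a assume z: "(0, x) \<in> cyl d"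
  have sXX: "symbol d (2 * s + 3 + (2 * s + 3)) (\<lambda>z. cve e (iter \<Phi> s) z \<bullet> cve e (iter \<Phi> s) z)" if "e \<in> Basis" for e
    by (intro sym_inner sX that)
  have "dd (1, 0) (dens_odd s \<Phi>) (0, x) = (\<Sum>e\<in>Basis. dd (1, 0) (\<lambda>z. cve e (iter \<Phi> s) z \<bullet> cve e (iter \<Phi> s) z) (0, x))"
    unfolding dens_odd_def[abs_def] by (rule dd_sum[OF sXX z])
  also have "\<dots> = (\<Sum>e\<in>Basis. 2 * (cve e (iter \<Phi> s) (0, x) \<bullet> cvt (cve e (iter \<Phi> s)) (0, x)))"
    by (intro sum.cong refl dd_inner_self[OF sX tangential_cv z])
  finally show "dd (1, 0) (dens_odd s \<Phi>) (0, x) = 2 * (\<Sum>e\<in>Basis. cve e (iter \<Phi> s) (0, x) \<bullet> cvt (cve e (iter \<Phi> s)) (0, x))"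
    by (simp add: sum_distrib_left)
qed

text \<open>The curvature form vanishes at \<open>phi a\<close>, so its square does not enter the first variation.\<close>

lemma variation_dens_ES4:
  "ball_int (dd (1, 0) (dens_ES4 \<Phi>)) = 2 * ball_int (\<lambda>z. iter \<Phi> 1 z \<bullet> cvt (iter \<Phi> 1) z)"
  unfolding ball_int_cmult[symmetric]
proof (rule ball_int_cong_slice[OF d_pos])
  have sI: "symbol d 4 (iter \<Phi> 1)" using sym_iter[OF sym_Phi, of 1] by simp
  show "symbol d (4 + 4) (\<lambda>z. 2 * (iter \<Phi> 1 z \<bullet> cvt (iter \<Phi> 1) z))"
    using sym_cmult[OF sym_inner[OF sI sym_cvt[OF sym_Phi sI]], where c = 2] by simp
  fix x :: 'a assume z: "(0, x) \<in> cyl d"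
  let ?c = "\<lambda>e f z. curv \<Phi> (tau \<Phi>) e f z \<bullet> curv \<Phi> (tau \<Phi>) e f z"
  have sc: "symbol d (4 + 4) (?c e f)" if "e \<in> Basis" "f \<in> Basis" for e f
    by (intro sym_inner sym_curv_tau sym_Phi that)
  have s1: "symbol d (4 + 4) (\<lambda>z. \<Sum>f\<in>Basis. ?c e f z)" if "e \<in> Basis" for e by (intro sym_sum sc that)
  have s2: "symbol d (4 + 4) (\<lambda>z. \<Sum>e\<in>Basis. \<Sum>f\<in>Basis. ?c e f z)" by (intro sym_sum s1)
  have dc: "dd (1, 0) (?c e f) (0, x) = 0" if "e \<in> Basis" "f \<in> Basis" for e f
    using dd_inner_self[OF sym_curv_tau[OF sym_Phi that] tangential_curv z] curv_slice[OF that z, of 0] by simp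
  have 0: "dd (1, 0) (\<lambda>z. \<Sum>e\<in>Basis. \<Sum>f\<in>Basis. ?c e f z) (0, x) = 0"
    by (intro dd_sum_0[OF s1 z] dd_sum_0[OF sc z] dc)
  have "dd (1, 0) (\<lambda>z. (1/2) *\<^sub>R (\<Sum>e\<in>Basis. \<Sum>f\<in>Basis. ?c e f z)) (0, x) = 0"
    using dd_linear[OF bounded_linear_scaleR_right[of "1/2"] sym_differentiable[OF s2 z], where v = "(1, 0)"] 0 by simp
  moreover have "dd (1, 0) (\<lambda>z. iter \<Phi> 1 z \<bullet> iter \<Phi> 1 z) (0, x) = 2 * (iter \<Phi> 1 (0, x) \<bullet> cvt (iter \<Phi> 1) (0, x))"
    by (rule dd_inner_self[OF sI tangential_iter z])
  ultimately show "dd (1, 0) (dens_ES4 \<Phi>) (0, x) = 2 * (iter \<Phi> 1 (0, x) \<bullet> cvt (iter \<Phi> 1) (0, x))"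
    unfolding dens_ES4_def[abs_def]
    using dd_add[OF sym_differentiable[OF sym_inner[OF sI sI] z] sym_differentiable[OF sym_cmult[OF s2, where c = "1/2"] z], where v = "(1, 0)"] by simp
qed

text \<open>The part of degree 3 vanishes at \<open>phi a\<close>, so its square contributes nothing; the correction to the part of degree
  1 pairs with the gradient to an expression whose integral is 0.\<close>

lemma variation_dens_ES5:
  assumes dim: "10 < DIM('a)"
  shows "ball_int (dd (1, 0) (dens_ES5 \<Phi>)) = ball_int (dd (1, 0) (dens_odd 1 \<Phi>))"
proof -
  let ?W = "iter \<Phi> 1"
  let ?Z = "\<lambda>e z. \<Sum>f\<in>Basis. cve f (curv \<Phi> (tau \<Phi>) f e) z"
  have sW: "symbol d 5 (cve e ?W)" if "e \<in> Basis" for e using sym_cv[OF sym_Phi sym_iter[OF sym_Phi, of 1] that] by simp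
  have sQ: "symbol d 5 (cve f (curv \<Phi> (tau \<Phi>) f e))" if "e \<in> Basis" "f \<in> Basis" for e f
    using sym_cv[OF sym_Phi sym_curv_tau[OF sym_Phi that(2,1)] that(2)] by simp
  have sZ: "symbol d 5 (?Z e)" if "e \<in> Basis" for e by (intro sym_sum sQ that)
  let ?P = "\<lambda>z. \<Sum>e\<in>Basis. cve e ?W z \<bullet> cvt (cve e ?W) z" and ?N = "\<lambda>z. \<Sum>e\<in>Basis. cve e ?W z \<bullet> cvt (?Z e) z"
  have sP: "symbol d (5 + 5) ?P" and sN: "symbol d (5 + 5) ?N"
    by (intro sym_sum sym_inner sym_cvt sW sZ sym_Phi; assumption)+
  have "ball_int (dd (1, 0) (dens_ES5 \<Phi>)) = ball_int (\<lambda>z. 2 * (?P z - ?N z))"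
  proof (rule ball_int_cong_slice[OF d_pos])
    show "symbol d (5 + 5) (\<lambda>z. 2 * (?P z - ?N z))"
      using sym_cmult[OF sym_diff[OF sP sN], where c = 2] by simp
    fix x :: 'a assume z: "(0, x) \<in> cyl d"
    let ?l = "\<lambda>e z. lin3 \<Phi> (tau \<Phi>) e z \<bullet> lin3 \<Phi> (tau \<Phi>) e z"
    let ?t = "\<lambda>e f g z. tri \<Phi> (tau \<Phi>) e f g z \<bullet> tri \<Phi> (tau \<Phi>) e f g z"
    have sl: "symbol d (5 + 5) (?l e)" if "e \<in> Basis" for e by (intro sym_inner sym_lin3 sym_Phi that)
    have st: "symbol d (5 + 5) (?t e f g)" if "e \<in> Basis" "f \<in> Basis" "g \<in> Basis" for e f g
      by (intro sym_inner sym_tri sym_Phi that)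
    have st1: "symbol d (5 + 5) (\<lambda>z. \<Sum>g\<in>Basis. ?t e f g z)" if "e \<in> Basis" "f \<in> Basis" for e f by (intro sym_sum st that)
    have st2: "symbol d (5 + 5) (\<lambda>z. \<Sum>f\<in>Basis. \<Sum>g\<in>Basis. ?t e f g z)" if "e \<in> Basis" for e by (intro sym_sum st1 that)
    have st3: "symbol d (5 + 5) (\<lambda>z. \<Sum>e\<in>Basis. \<Sum>f\<in>Basis. \<Sum>g\<in>Basis. ?t e f g z)" by (intro sym_sum st2)
    have sL: "symbol d (5 + 5) (\<lambda>z. \<Sum>e\<in>Basis. ?l e z)" by (intro sym_sum sl)
    have tt: "tangential (tri \<Phi> (tau \<Phi>) e f g)" for e f g
      using tangential_cv unfolding tangential_def tri_def by (simp add: inner_diff_left inner_add_left)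
    have tl: "tangential (lin3 \<Phi> (tau \<Phi>) e)" for e
      using tangential_cv unfolding tangential_def lin3_def by (simp add: inner_diff_left inner_sum_left)
    have dt: "dd (1, 0) (?t e f g) (0, x) = 0" if "e \<in> Basis" "f \<in> Basis" "g \<in> Basis" for e f g
    proof -
      have "tri \<Phi> (tau \<Phi>) e f g (0, x) = 0"
        using cve_curv_slice[OF that(2,3,1) z, of 0] cve_curv_slice[OF that(1,3,2) z, of 0] cve_curv_slice[OF that(1,2,3) z, of 0]
        by (simp add: tri_def)
      then show ?thesis using dd_inner_self[OF sym_tri[OF sym_Phi that] tt z] by simp
    qed
    have T1: "dd (1, 0) (\<lambda>z. \<Sum>g\<in>Basis. ?t e f g z) (0, x) = 0" if "e \<in> Basis" "f \<in> Basis" for e f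
      by (intro dd_sum_0[OF st[OF that] z] dt that)
    have T2: "dd (1, 0) (\<lambda>z. \<Sum>f\<in>Basis. \<Sum>g\<in>Basis. ?t e f g z) (0, x) = 0" if "e \<in> Basis" for e
      by (intro dd_sum_0[OF st1[OF that] z] T1 that)
    have T3: "dd (1, 0) (\<lambda>z. \<Sum>e\<in>Basis. \<Sum>f\<in>Basis. \<Sum>g\<in>Basis. ?t e f g z) (0, x) = 0"
      by (intro dd_sum_0[OF st2 z] T2)
    have dl: "dd (1, 0) (?l e) (0, x) = 2 * (cve e ?W (0, x) \<bullet> cvt (cve e ?W) (0, x) - cve e ?W (0, x) \<bullet> cvt (?Z e) (0, x))"
      if e: "e \<in> Basis" for e
    proof -
      have 0: "?Z e (0, x) = 0"
        by (rule sum.neutral) (use cve_curv_slice[OF _ e _ z, of _ _ 0] in simp)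
      have "cvt (lin3 \<Phi> (tau \<Phi>) e) (0, x) = cvt (\<lambda>z. cve e ?W z + - ?Z e z) (0, x)"
        by (rule cv_cong[OF z]) (simp add: lin3_def)
      also have "\<dots> = cvt (cve e ?W) (0, x) - cvt (?Z e) (0, x)"
        using cv_add[OF sW[OF e] sym_minus[OF sZ[OF e]] z] cv_minus[OF sZ[OF e] z] by simp
      finally have 1: "cvt (lin3 \<Phi> (tau \<Phi>) e) (0, x) = cvt (cve e ?W) (0, x) - cvt (?Z e) (0, x)" .
      have 2: "lin3 \<Phi> (tau \<Phi>) e (0, x) = cve e ?W (0, x)"
        using 0 by (simp add: lin3_def)
      have "dd (1, 0) (?l e) (0, x) = 2 * (lin3 \<Phi> (tau \<Phi>) e (0, x) \<bullet> cvt (lin3 \<Phi> (tau \<Phi>) e) (0, x))"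
        by (rule dd_inner_self[OF sym_lin3[OF sym_Phi e] tl z])
      then show ?thesis unfolding 1 2 by (simp only: inner_diff_right)
    qed
    have L: "dd (1, 0) (\<lambda>z. \<Sum>e\<in>Basis. ?l e z) (0, x) = 2 * (?P (0, x) - ?N (0, x))"
    proof -
      have "dd (1, 0) (\<lambda>z. \<Sum>e\<in>Basis. ?l e z) (0, x) = (\<Sum>e\<in>Basis. dd (1, 0) (?l e) (0, x))"
        by (rule dd_sum[OF sl z])
      then show ?thesis by (simp add: dl sum_distrib_left sum_subtractf right_diff_distrib del: iter_simps)
    qed
    have "dd (1, 0) (\<lambda>z. (1/6) *\<^sub>R (\<Sum>e\<in>Basis. \<Sum>f\<in>Basis. \<Sum>g\<in>Basis. ?t e f g z)) (0, x) = 0"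
      using dd_linear[OF bounded_linear_scaleR_right[of "1/6"] sym_differentiable[OF st3 z], where v = "(1, 0)"] T3 by simp
    then show "dd (1, 0) (dens_ES5 \<Phi>) (0, x) = 2 * (?P (0, x) - ?N (0, x))"
      unfolding dens_ES5_def[abs_def]
      using dd_add[OF sym_differentiable[OF sL z] sym_differentiable[OF sym_cmult[OF st3, where c = "1/6"] z], where v = "(1, 0)"] L
      by simp
  qed
  also have "\<dots> = 2 * (ball_int ?P - ball_int ?N)"
    unfolding ball_int_cmult using ball_int_diff[OF d_pos sP sN] dim by simp
  also have "ball_int ?N = 0" by (rule variation_lin3[OF dim])
  finally show ?thesis unfolding variation_dens_odd by simp
qed

end

subsection \<open>The critical latitudes\<close>

lemma factor_values:
  assumes "f0 = factor n a 0" "w = (cos a)\<^sup>2"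
  shows "factor n a 1 = - (4 - (n - 2) * 2 - (n - 1) * w) * f0"
    "factor n a 2 = - (16 - (n - 2) * 4 - (n - 1) * w) * (- (4 - (n - 2) * 2 - (n - 1) * w) * f0)"
    "factor n a 3 = - (36 - (n - 2) * 6 - (n - 1) * w) *
      (- (16 - (n - 2) * 4 - (n - 1) * w) * (- (4 - (n - 2) * 2 - (n - 1) * w) * f0))"
    "factor n a 4 = - (64 - (n - 2) * 8 - (n - 1) * w) * (- (36 - (n - 2) * 6 - (n - 1) * w) *
      (- (16 - (n - 2) * 4 - (n - 1) * w) * (- (4 - (n - 2) * 2 - (n - 1) * w) * f0)))"
proof -
  have s: "factor n a (Suc j) = - ((real (2 * j + 2))\<^sup>2 - (n - 2) * real (2 * j + 2) - (n - 1) * w) * factor n a j" for j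
    by (simp add: assms(2))
  show 1: "factor n a 1 = - (4 - (n - 2) * 2 - (n - 1) * w) * f0"
    using s[of 0] by (simp del: factor.simps add: assms(1))
  show 2: "factor n a 2 = - (16 - (n - 2) * 4 - (n - 1) * w) * (- (4 - (n - 2) * 2 - (n - 1) * w) * f0)"
    using s[of 1, unfolded Suc_1 1] by simp
  show 3: "factor n a 3 = - (36 - (n - 2) * 6 - (n - 1) * w) *
      (- (16 - (n - 2) * 4 - (n - 1) * w) * (- (4 - (n - 2) * 2 - (n - 1) * w) * f0))"
    using s[of 2, unfolded 2] by simp
  show "factor n a 4 = - (64 - (n - 2) * 8 - (n - 1) * w) * (- (36 - (n - 2) * 6 - (n - 1) * w) *
      (- (16 - (n - 2) * 4 - (n - 1) * w) * (- (4 - (n - 2) * 2 - (n - 1) * w) * f0)))"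
    using s[of 3, unfolded 3] by simp
qed

text \<open>The left-hand sides are the coefficients of \<open>J (2 * r)\<close> in the first variation at \<open>phi a\<close>. In each
  case the polynomial in the hypothesis is a factor.\<close>

lemma balance_3:
  assumes "9 * ((cos a)\<^sup>2)\<^sup>2 + 2 * (cos a)\<^sup>2 - 1 = 0"
  shows "(- factor 7 a 2 + 6 * (sin a)\<^sup>2 * factor 7 a 1) - factor 7 a 0 * factor 7 a 0 * sin a * cos a * 6 = 0"
proof -
  define w f0 where wf: "w = (cos a)\<^sup>2" "f0 = factor 7 a 0"
  have s: "(sin a)\<^sup>2 = 1 - w" by (simp add: wf sin_squared_eq)
  have f00: "f0 * f0 = 36 * (w * (1 - w))"
    by (simp add: wf power2_eq_square flip: s[unfolded power2_eq_square wf])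
  have sc: "sin a * cos a * 6 = - f0" by (simp add: wf)
  have "(- factor 7 a 2 + 6 * (sin a)\<^sup>2 * factor 7 a 1) - f0 * f0 * (sin a * cos a * 6) =
      f0 * (- 12) * (9 * w\<^sup>2 + 2 * w - 1)"
    unfolding sc f00 s factor_values[OF wf(2,1)] by (simp add: algebra_simps power2_eq_square)
  also have "\<dots> = 0" using assms by (simp add: wf)
  finally show ?thesis by (simp add: wf mult.assoc)
qed

lemma balance_4:
  assumes "32 * ((cos a)\<^sup>2)\<^sup>2 + 6 * (cos a)\<^sup>2 - 3 = 0"
  shows "(- factor 9 a 3 + 8 * (sin a)\<^sup>2 * factor 9 a 2) - 2 * (factor 9 a 1 * factor 9 a 0 * sin a * cos a * 8) = 0"
proof -
  define w f0 where wf: "w = (cos a)\<^sup>2" "f0 = factor 9 a 0"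
  have s: "(sin a)\<^sup>2 = 1 - w" by (simp add: wf sin_squared_eq)
  have f00: "f0 * f0 = 64 * (w * (1 - w))"
    by (simp add: wf power2_eq_square flip: s[unfolded power2_eq_square wf])
  have sc: "sin a * cos a * 8 = - f0" by (simp add: wf)
  have "(- factor 9 a 3 + 8 * (sin a)\<^sup>2 * factor 9 a 2) - 2 * (factor 9 a 1 * (f0 * (sin a * cos a * 8))) =
      (- factor 9 a 3 + 8 * (sin a)\<^sup>2 * factor 9 a 2) + 2 * (- (4 - (9 - 2) * 2 - (9 - 1) * w) * f0 * (f0 * f0))"
    unfolding sc factor_values(1)[OF wf(2,1)] by (simp add: algebra_simps)
  also have "\<dots> = f0 * (- 80 - 64 * w) * (32 * w\<^sup>2 + 6 * w - 3)"
    unfolding f00 s factor_values[OF wf(2,1)] by (simp add: algebra_simps power2_eq_square)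
  also have "\<dots> = 0" using assms by (simp add: wf)
  finally show ?thesis by (simp add: wf mult.assoc)
qed

lemma balance_5:
  assumes "25 * ((cos a)\<^sup>2)\<^sup>2 + 4 * (cos a)\<^sup>2 - 2 = 0"
  shows "(- factor 11 a 4 + 10 * (sin a)\<^sup>2 * factor 11 a 3) - 2 * (factor 11 a 2 * factor 11 a 0 * sin a * cos a * 10)
    - factor 11 a 1 * factor 11 a 1 * sin a * cos a * 10 = 0"
proof -
  define w f0 where wf: "w = (cos a)\<^sup>2" "f0 = factor 11 a 0"
  have s: "(sin a)\<^sup>2 = 1 - w" by (simp add: wf sin_squared_eq)
  have f00: "f0 * f0 = 100 * (w * (1 - w))"
    by (simp add: wf power2_eq_square flip: s[unfolded power2_eq_square wf])
  have sc: "sin a * cos a * 10 = - f0" by (simp add: wf)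
  let ?g1 = "- (4 - (11 - 2) * 2 - (11 - 1) * w)" and ?g2 = "- (16 - (11 - 2) * 4 - (11 - 1) * w)"
  have "(- factor 11 a 4 + 10 * (sin a)\<^sup>2 * factor 11 a 3) - 2 * (factor 11 a 2 * (f0 * (sin a * cos a * 10)))
      - factor 11 a 1 * (factor 11 a 1 * (sin a * cos a * 10)) =
      (- factor 11 a 4 + 10 * (sin a)\<^sup>2 * factor 11 a 3) + f0 * (2 * (?g2 * ?g1) + ?g1 * ?g1) * (f0 * f0)"
    unfolding sc factor_values(1,2)[OF wf(2,1)] by (simp add: algebra_simps)
  also have "\<dots> = f0 * (- 5040 - 6400 * w - 2000 * w\<^sup>2) * (25 * w\<^sup>2 + 4 * w - 2)"
    unfolding f00 s factor_values[OF wf(2,1)] by (simp add: algebra_simps power2_eq_square)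
  also have "\<dots> = 0" using assms by (simp add: wf)
  finally show ?thesis by (simp add: wf mult.assoc)
qed

context perturbed_family
begin

lemma variation_3:
  assumes "DIM('a) = 7" "9 * ((cos a)\<^sup>2)\<^sup>2 + 2 * (cos a)\<^sup>2 - 1 = 0"
  shows "ball_int (dd (1, 0) (dens_odd 0 \<Phi>)) = 0"
proof -
  have "ball_int (\<lambda>z. \<Sum>e\<in>Basis. cve e (iter \<Phi> 0) z \<bullet> cvt (cve e (iter \<Phi> 0)) z) =
      ((- factor 7 a 2 + 6 * (sin a)\<^sup>2 * factor 7 a 1) - factor 7 a 0 * factor 7 a 0 * sin a * cos a * 6) * J 6"
    using variation_gradient[of 0] variation_tau[of 1] assms(1)
    by (simp del: iter_simps(2) factor.simps add: numeral_2_eq_2 left_diff_distrib)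
  then show ?thesis unfolding variation_dens_odd by (simp only: balance_3[OF assms(2)] mult_zero_left mult_zero_right)
qed

lemma variation_4:
  assumes "DIM('a) = 9" "32 * ((cos a)\<^sup>2)\<^sup>2 + 6 * (cos a)\<^sup>2 - 3 = 0"
  shows "ball_int (\<lambda>z. iter \<Phi> 1 z \<bullet> cvt (iter \<Phi> 1) z) = 0"
proof -
  have "ball_int (\<lambda>z. iter \<Phi> 1 z \<bullet> cvt (iter \<Phi> 1) z) =
      ((- factor 9 a 3 + 8 * (sin a)\<^sup>2 * factor 9 a 2) - 2 * (factor 9 a 1 * factor 9 a 0 * sin a * cos a * 8)) * J 8"
    using variation_rl[of 1 0] variation_tau[of 2] assms(1)
    by (simp del: iter_simps(2) factor.simps add: eval_nat_numeral left_diff_distrib)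
  then show ?thesis by (simp only: balance_4[OF assms(2)] mult_zero_left)
qed

lemma variation_5:
  assumes "DIM('a) = 11" "25 * ((cos a)\<^sup>2)\<^sup>2 + 4 * (cos a)\<^sup>2 - 2 = 0"
  shows "ball_int (dd (1, 0) (dens_odd 1 \<Phi>)) = 0"
proof -
  have "ball_int (\<lambda>z. \<Sum>e\<in>Basis. cve e (iter \<Phi> 1) z \<bullet> cvt (cve e (iter \<Phi> 1)) z) =
      ((- factor 11 a 4 + 10 * (sin a)\<^sup>2 * factor 11 a 3) - 2 * (factor 11 a 2 * factor 11 a 0 * sin a * cos a * 10)
       - factor 11 a 1 * factor 11 a 1 * sin a * cos a * 10) * J 10"
    using variation_gradient[of 1] variation_rl[of 2 0] variation_tau[of 3] assms(1)
    by (simp del: iter_simps(2) factor.simps add: eval_nat_numeral left_diff_distrib)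
  then show ?thesis unfolding variation_dens_odd by (simp only: balance_5[OF assms(2)] mult_zero_left mult_zero_right)
qed

end

definition critical_latitude :: "nat => nat => real => bool" where
  "critical_latitude r n a \<longleftrightarrow>
    r = 3 \<and> n = 7 \<and> 9 * ((cos a)\<^sup>2)\<^sup>2 + 2 * (cos a)\<^sup>2 - 1 = 0 \<or>
    r = 4 \<and> n = 9 \<and> 32 * ((cos a)\<^sup>2)\<^sup>2 + 6 * (cos a)\<^sup>2 - 3 = 0 \<or>
    r = 5 \<and> n = 11 \<and> 25 * ((cos a)\<^sup>2)\<^sup>2 + 4 * (cos a)\<^sup>2 - 2 = 0"

definition r_density :: "nat => (real \<times> 'a::euclidean_space => 'b::euclidean_space) => real \<times> 'a => real" where
  "r_density r = (if r = 3 then dens_odd 0 else if r = 4 then dens_even 1 else dens_odd 1)"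

definition ES_density :: "nat => (real \<times> 'a::euclidean_space => 'b::euclidean_space) => real \<times> 'a => real" where
  "ES_density r = (if r = 3 then dens_odd 0 else if r = 4 then dens_ES4 else dens_ES5)"

lemma energy_density_r:
  assumes "critical_latitude r DIM('a) a"
  shows "energy_density (r_energy r) r (r_density r :: (real \<times> 'a::euclidean_space => 'b::euclidean_space) => _)"
    "energy_density (ES_energy r) r (ES_density r :: (real \<times> 'a::euclidean_space => 'b::euclidean_space) => _)"
proof -
  have o3: "energy_density (r_energy 3) 3 (dens_odd 0 :: (real \<times> 'a => 'b) => _)" if "DIM('a) = 7"
    using energy_density_odd[of 0, where ?'a = 'a and ?'b = 'b] that by simp
  have e4: "energy_density (r_energy 4) 4 (dens_even 1 :: (real \<times> 'a => 'b) => _)" if "DIM('a) = 9"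
    using energy_density_even[of 1, where ?'a = 'a and ?'b = 'b] that by simp
  have o5: "energy_density (r_energy 5) 5 (dens_odd 1 :: (real \<times> 'a => 'b) => _)" if "DIM('a) = 11"
    using energy_density_odd[of 1, where ?'a = 'a and ?'b = 'b] that by simp
  show "energy_density (r_energy r) r (r_density r :: (real \<times> 'a => 'b) => _)"
    using assms o3 e4 o5 by (auto simp: critical_latitude_def r_density_def)
  show "energy_density (ES_energy r) r (ES_density r :: (real \<times> 'a => 'b) => _)"
    using assms energy_density_ES3[where ?'a = 'a and ?'b = 'b] energy_density_ES4[where ?'a = 'a and ?'b = 'b]
      energy_density_ES5[where ?'a = 'a and ?'b = 'b]
    by (auto simp: critical_latitude_def ES_density_def)
qed

lemma cone_map_critical:
  fixes a :: real
  assumes "critical_latitude r DIM('a::euclidean_space) a"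
  shows "weakly_critical (r_energy r) r (cone_map a :: 'a => 'a \<times> real)"
    "weakly_critical (ES_energy r) r (cone_map a :: 'a => 'a \<times> real)"
proof -
  have r: "2 * r < DIM('a)" using assms by (auto simp: critical_latitude_def)
  have v: "ball_int (dd (1, 0) (r_density r \<Phi>)) = 0" "ball_int (dd (1, 0) (ES_density r \<Phi>)) = 0"
    if "perturbed_family d \<Phi> a K" for d and \<Phi> :: "real \<times> 'a => 'a \<times> real" and K
  proof -
    interpret perturbed_family d \<Phi> a K by (rule that)
    show "ball_int (dd (1, 0) (r_density r \<Phi>)) = 0" "ball_int (dd (1, 0) (ES_density r \<Phi>)) = 0"
      using assms variation_3 variation_4 variation_5 variation_dens_even[of 1] variation_dens_ES4 variation_dens_ES5
      by (auto simp: critical_latitude_def r_density_def ES_density_def simp del: iter_simps One_nat_def)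
  qed
  show "weakly_critical (r_energy r) r (cone_map a :: 'a => 'a \<times> real)"
    by (rule cone_map_weakly_critical[OF energy_density_r(1)[OF assms] r v(1)])
  show "weakly_critical (ES_energy r) r (cone_map a :: 'a => 'a \<times> real)"
    by (rule cone_map_weakly_critical[OF energy_density_r(2)[OF assms] r v(2)])
qed

subsection \<open>Properness\<close>

context perturbed_family
begin

text \<open>The first variation of the Dirichlet energy is minus twice the pairing of the velocity with the
  tension field.\<close>

lemma variation_1:
  assumes "2 < DIM('a)"
  shows "ball_int (dd (1, 0) (\<lambda>z. \<Sum>e\<in>Basis. phid e z \<bullet> phid e z)) = - 2 * (factor (real DIM('a)) a 0 * J 2)"
proof -
  have sp: "symbol d (Suc 0) (phid e)" if "e \<in> Basis" for e by (rule sym_dx[OF sym_Phi that])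
  have sv: "symbol d 0 vel" by (rule sym_dt[OF sym_Phi])
  have s1: "symbol d (Suc 0 + Suc 0) (\<lambda>z. phid e z \<bullet> phid e z)" if "e \<in> Basis" for e by (intro sym_inner sp that)
  have s2: "symbol d (Suc 0 + Suc 0) (\<lambda>z. phid e z \<bullet> cve e vel z)" if "e \<in> Basis" for e
    by (intro sym_inner sp sym_cv sym_Phi sv that)
  have s3: "symbol d (Suc (Suc 0) + 0) (\<lambda>z. cve e (phid e) z \<bullet> vel z)" if "e \<in> Basis" for e
    by (intro sym_inner sym_cv sym_Phi sp sv that)
  have v0: "vel (0, x) = 0" if "x \<notin> K" "(0, x) \<in> cyl d" for x
    using still_Phi that by (auto simp: still_def)
  have "ball_int (dd (1, 0) (\<lambda>z. \<Sum>e\<in>Basis. phid e z \<bullet> phid e z)) = ball_int (\<lambda>z. 2 * (\<Sum>e\<in>Basis. phid e z \<bullet> cve e vel z))"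
  proof (rule ball_int_cong_slice[OF d_pos])
    show "symbol d (Suc 0 + Suc 0) (\<lambda>z. 2 * (\<Sum>e\<in>Basis. phid e z \<bullet> cve e vel z))"
      using sym_cmult[OF sym_sum[OF s2], where c = 2] by simp
    fix x :: 'a assume z: "(0, x) \<in> cyl d"
    have "dd (1, 0) (\<lambda>z. \<Sum>e\<in>Basis. phid e z \<bullet> phid e z) (0, x) = (\<Sum>e\<in>Basis. dd (1, 0) (\<lambda>z. phid e z \<bullet> phid e z) (0, x))"
      by (rule dd_sum[OF s1 z])
    also have "\<dots> = (\<Sum>e\<in>Basis. 2 * (phid e (0, x) \<bullet> cve e vel (0, x)))"
      using dd_inner_self[OF sp tangential_dd_Phi z] cv_dd_Phi_commute[of "(1, 0)" _ "(0, x)"] z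
      by (intro sum.cong refl) simp
    finally show "dd (1, 0) (\<lambda>z. \<Sum>e\<in>Basis. phid e z \<bullet> phid e z) (0, x) = 2 * (\<Sum>e\<in>Basis. phid e (0, x) \<bullet> cve e vel (0, x))"
      by (simp add: sum_distrib_left)
  qed
  also have "\<dots> = 2 * (\<Sum>e\<in>Basis. ball_int (\<lambda>z. phid e z \<bullet> cve e vel z))"
    unfolding ball_int_cmult using assms by (subst ball_int_sum[OF d_pos s2]) auto
  also have "(\<Sum>e\<in>Basis. ball_int (\<lambda>z. phid e z \<bullet> cve e vel z)) = (\<Sum>e\<in>Basis. - ball_int (\<lambda>z. cve e (phid e) z \<bullet> vel z))"
  proof (rule sum.cong[OF refl])
    fix e :: 'a assume e: "e \<in> Basis"
    show "ball_int (\<lambda>z. phid e z \<bullet> cve e vel z) = - ball_int (\<lambda>z. cve e (phid e) z \<bullet> vel z)"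
      by (rule cv_parts[OF sp[OF e] tangential_dd_Phi sv tangential_dd_Phi _ e K]) (use assms v0 in auto)
  qed
  also have "\<dots> = - ball_int (\<lambda>z. \<Sum>e\<in>Basis. cve e (phid e) z \<bullet> vel z)"
    unfolding sum_negf using assms by (subst ball_int_sum[OF d_pos s3]) auto
  also have "ball_int (\<lambda>z. \<Sum>e\<in>Basis. cve e (phid e) z \<bullet> vel z) = factor (real DIM('a)) a 0 * J 2"
    by (rule J_cong) (use iter_vel[of _ 0] in \<open>simp add: tau_def inner_sum_left mult_ac power2_eq_square\<close>)
  finally show ?thesis by simp
qed

end

text \<open>The tension field of \<open>phi a\<close> is a nonzero multiple of $|x|^{-2}$ times the normal of the parallel,
  so a bump moving the latitude changes the Dirichlet energy to first order.\<close>

lemma cone_map_not_harmonic: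
  assumes dim: "2 < DIM('a::euclidean_space)" and a: "0 < sin a" "0 < cos a"
  shows "\<not> weakly_r_harmonic 1 (cone_map a :: 'a => 'a \<times> real)"
proof
  assume harm: "weakly_r_harmonic 1 (cone_map a :: 'a => 'a \<times> real)"
  define \<zeta> :: "'a => real" where "\<zeta> = box_bump (- (\<Sum>Basis)) (\<Sum>Basis) (1/2) 1"
  \<comment> \<open>the direction \<open>(0, - 1)\<close> has inner product \<open>sin a\<close> with the normal of the parallel\<close>
  define \<eta> :: "'a => 'a \<times> real" where "\<eta> x = \<zeta> x *\<^sub>R (0, - 1)" for x
  have \<zeta>: "test_function \<zeta>" unfolding \<zeta>_def by (rule test_function_box_bump) auto
  have "C_k k \<eta>" for k
    unfolding \<eta>_def[abs_def] using \<zeta>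
    by (intro C_k_bilinear[OF bounded_bilinear_scaleR] C_k_const) (simp add: test_function_def smooth_def)
  moreover have "{x. \<eta> x \<noteq> 0} = {x. \<zeta> x \<noteq> 0}" by (auto simp: \<eta>_def zero_prod_def)
  ultimately have \<eta>: "test_function \<eta>" using \<zeta> by (simp add: test_function_def smooth_def)
  let ?\<Phi> = "\<lambda>z. sgn (eqv (\<lambda>_. a) z + fst z *\<^sub>R \<eta> (snd z))" and ?K = "closure {x. \<eta> x \<noteq> 0}"
  obtain d where d: "perturbed_family d ?\<Phi> a ?K"
    and vel: "\<And>x. (0, x) \<in> cyl d ==> dd (1, 0) ?\<Phi> (0, x) \<bullet> nrm (\<lambda>_. a) (0, x) = \<eta> x \<bullet> nrm (\<lambda>_. a) (0, x)"
    by (rule perturbed_family_exists[OF \<eta>], rule that)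
  interpret pf: perturbed_family d ?\<Phi> a ?K by (rule d)
  have "((\<lambda>t. r_energy 1 (\<lambda>x. sgn (cone_map a x + t *\<^sub>R \<eta> x))) has_real_derivative
      1/2 * (LINT x|lebesgue_on unit_ball. dd (1, 0) (\<lambda>z. \<Sum>e\<in>Basis. dd (0, e) ?\<Phi> z \<bullet> dd (0, e) ?\<Phi> z) (0, x))) (at 0)"
    by (rule energy_derivative[OF energy_density_1 _ pf.sym_Phi]) (use dim pf.d_pos in \<open>simp_all add: rep_def eqv_const\<close>)
  moreover have "((\<lambda>t. r_energy 1 (\<lambda>x. sgn (cone_map a x + t *\<^sub>R \<eta> x))) has_real_derivative 0) (at 0)"
    using harm \<eta> by (simp add: weakly_r_harmonic_def weakly_critical_def)
  ultimately have "1/2 * ball_int (dd (1, 0) (\<lambda>z. \<Sum>e\<in>Basis. dd (0, e) ?\<Phi> z \<bullet> dd (0, e) ?\<Phi> z)) = 0"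
    unfolding ball_int_def by (rule DERIV_unique)
  then have "factor (real DIM('a)) a 0 * pf.J 2 = 0"
    unfolding pf.variation_1[OF dim] by simp
  then have J0: "pf.J 2 = 0" using dim a by simp
  have s: "symbol d 2 (\<lambda>z::real \<times> 'a. qq z ^ 2 * (\<zeta> (snd z) * sin a))"
  proof -
    have "symbol d 0 (\<lambda>z::real \<times> 'a. \<zeta> (snd z))" using \<zeta> by (intro sym_smooth) (simp add: test_function_def)
    from sym_mult[OF sym_qq_power[of d 2] sym_mult[OF this sym_const[of d 0 "sin a"]]] show ?thesis by simp
  qed
  have "pf.J 2 = ball_int (\<lambda>z::real \<times> 'a. qq z ^ 2 * (\<zeta> (snd z) * sin a))"
    unfolding pf.J_def
  proof (rule ball_int_cong_slice[OF pf.d_pos s])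
    fix x :: 'a assume "(0, x) \<in> cyl d"
    then show "qq (0, x) ^ 2 * (dd (1, 0) ?\<Phi> (0, x) \<bullet> nrm (\<lambda>_. a) (0, x)) = qq (0, x) ^ 2 * (\<zeta> (snd (0, x)) * sin a)"
      by (simp add: vel) (simp add: \<eta>_def nrm_def)
  qed
  then have z: "(LINT x|lebesgue_on unit_ball. inverse (norm x) ^ 2 * (\<zeta> x * sin a)) = 0"
    using J0 by (simp add: ball_int_def qq_def)
  have int: "integrable (lebesgue_on unit_ball) (\<lambda>x::'a. inverse (norm x) ^ 2 * (\<zeta> x * sin a))"
    using integrable_slice[OF s, of 0] pf.d_pos dim by (simp add: qq_def)
  \<comment> \<open>a nonnegative integrand with integral 0 vanishes a.e., although the bump is positive on a ball\<close>
  have nn: "0 \<le> inverse (norm x) ^ 2 * (\<zeta> x * sin a)" for x :: 'a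
    using a box_bump_nonneg[of "- (\<Sum>Basis)" "\<Sum>Basis" "1/2" 1 x] by (simp add: \<zeta>_def)
  have "AE x in lebesgue_on unit_ball. inverse (norm x) ^ 2 * (\<zeta> x * sin a) = 0"
    using integral_nonneg_eq_0_iff_AE[OF int] nn z by blast
  then have "AE x in lebesgue_on unit_ball. x \<notin> ball (0::'a) (1/2)"
    using AE_lebesgue_ball_nz
  proof eventually_elim
    fix x :: 'a assume 0: "inverse (norm x) ^ 2 * (\<zeta> x * sin a) = 0" and x: "x \<noteq> 0 \<and> x \<in> unit_ball"
    show "x \<notin> ball 0 (1/2)"
    proof
      assume xb: "x \<in> ball 0 (1/2)"
      have "\<bar>x \<bullet> i\<bar> < 1/2" if "i \<in> Basis" for i
        using Basis_le_norm[OF that, of x] xb by simp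
      then have "0 < x \<bullet> i + 1" "0 < 1 - x \<bullet> i" if "i \<in> Basis" for i
        using that by force+
      then have "0 < exp_inv 0 (x \<bullet> i + 1)" "0 < exp_inv 0 (1 - x \<bullet> i)" if "i \<in> Basis" for i
        using that by (auto simp: exp_inv_0 not_le)
      moreover have "x \<bullet> x < (1/2)\<^sup>2"
        unfolding dot_square_norm using xb by (intro power_strict_mono) auto
      then have "0 < exp_inv 0 ((1/2)\<^sup>2 - x \<bullet> x)" by (simp only: exp_inv_0) simp
      ultimately have "0 < \<zeta> x" unfolding \<zeta>_def box_bump_def by (intro mult_pos_pos prod_pos) auto
      with 0 x a show False by simp
    qed
  qed
  then have "AE x in lebesgue. x \<notin> ball (0::'a) (1/2)"
    by (auto simp: AE_restrict_space_iff elim!: eventually_mono)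
  then have "ball (0::'a) (1/2) \<in> null_sets lebesgue" by (subst (asm) AE_iff_null_sets[symmetric]) auto
  then have "negligible (ball (0::'a) (1/2))" by (simp add: negligible_iff_null_sets)
  then show False using open_not_negligible[of "ball (0::'a) (1/2)"] by simp
qed

section \<open>Rotationally equivariant variations\<close>

definition prof :: "(nat => real => real) => real \<times> 'a::euclidean_space => nat => real" where
  "prof \<beta> z j = \<beta> j (ln (norm (snd z)))"

text \<open>Although $\ln |x|$ itself is unbounded, the profile and its derivatives are bounded, and each
  derivative in \<open>x\<close> produces one factor $|x|^{-1}$.\<close>

lemma rad_prof:
  assumes \<beta>: "derivative_sequence \<beta>" "\<And>j s. \<bar>\<beta> j s\<bar> \<le> B j"
  shows "rad d (\<lambda>z. prof \<beta> z j) (\<lambda>z. prof \<beta> z (Suc j))"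
proof -
  let ?G = "\<lambda>z::real \<times> 'a. ln (norm (snd z))"
  have G: "(?G has_derivative (\<lambda>v. qq z * (uu z \<bullet> snd v))) (at z)" if z: "z \<in> cyl d" for z
  proof -
    have "0 < norm (snd z)" using cylD[OF z] by simp
    from has_derivative_ln[OF this has_derivative_norm_snd[OF z]] show ?thesis
      by (simp add: qq_def mult.commute)
  qed
  have dG: "dd v ?G z = qq z * (uu z \<bullet> snd v)" if "z \<in> cyl d" for v z
    by (rule dd_eqI[OF G[OF that]])
  have s: "symbol d 0 (\<lambda>z::real \<times> 'a. prof \<beta> z j)" for j
    unfolding prof_def
  proof (rule sym_compose[OF \<beta>])
    show "?G differentiable (at z)" if "z \<in> cyl d" for z using G[OF that] by (auto simp: differentiable_def)
    show "symbol d 0 (dd (1, 0) ?G)"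
      by (rule sym_cong[OF sym_const[of d 0 0]]) (simp add: dG)
    show "symbol d 1 (dd (0, e) ?G)" for e
      by (rule sym_cong[of d 1 "\<lambda>z. qq z * (uu z \<bullet> e)"]) (use sym_mult[OF sym_qq sym_uu_inner, of d e] in \<open>simp_all add: dG\<close>)
  qed
  have "dd (0, e) (\<lambda>z. prof \<beta> z j) z = qq z * (uu z \<bullet> e) * prof \<beta> z (Suc j)" if z: "z \<in> cyl d" for z :: "real \<times> 'a" and e
  proof -
    have "((\<lambda>z. \<beta> j (?G z)) has_derivative (\<lambda>v. \<beta> (Suc j) (?G z) * (qq z * (uu z \<bullet> snd v)))) (at z)"
      using has_derivative_compose[OF G[OF z] derivative_sequenceD[OF \<beta>(1), unfolded has_field_derivative_def]] by simp
    from dd_eqI[OF this, where v = "(0, e)"] show ?thesis by (simp add: prof_def)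
  qed
  with s show ?thesis by (simp add: rad_def)
qed

text \<open>The tension field of the map with latitude \<open>a + t * b 0\<close> is \<open>tens n a b t\<close> times $|x|^{-2}$
  times the normal, where \<open>b j\<close> is the \<open>j\<close>-th derivative of the variation with respect to $\ln |x|$;
  \<open>tens1\<close>, \<open>tens2\<close>, \<open>tens3\<close> are its derivatives. The next two functions belong in the same way
  to the rough Laplacian of the tension field.\<close>

definition tens :: "real => real => (nat => real) => real => real" where
  "tens n a b t = t * b 2 + (n - 2) * (t * b 1) - (n - 1) * (sin (a + t * b 0) * cos (a + t * b 0))"

definition tens1 :: "real => real => (nat => real) => real => real" where
  "tens1 n a b t = t * b 3 + (n - 2) * (t * b 2) -
    (n - 1) * (((cos (a + t * b 0))\<^sup>2 - (sin (a + t * b 0))\<^sup>2) * (t * b 1))"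

definition tens2 :: "real => real => (nat => real) => real => real" where
  "tens2 n a b t = t * b 4 + (n - 2) * (t * b 3) -
    (n - 1) * (((cos (a + t * b 0))\<^sup>2 - (sin (a + t * b 0))\<^sup>2) * (t * b 2) -
      4 * (sin (a + t * b 0) * cos (a + t * b 0) * (t * b 1)\<^sup>2))"

definition tens3 :: "real => real => (nat => real) => real => real" where
  "tens3 n a b t = t * b 5 + (n - 2) * (t * b 4) -
    (n - 1) * (((cos (a + t * b 0))\<^sup>2 - (sin (a + t * b 0))\<^sup>2) * (t * b 3 - 4 * ((t * b 1)\<^sup>2 * (t * b 1))) -
      12 * (sin (a + t * b 0) * cos (a + t * b 0) * ((t * b 1) * (t * b 2))))"

definition lap :: "real => real => (nat => real) => real => real" where
  "lap n a b t = - (tens2 n a b t + (n - 6) * tens1 n a b t +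
    (8 - 2 * n - (n - 1) * (cos (a + t * b 0))\<^sup>2) * tens n a b t)"

definition lap1 :: "real => real => (nat => real) => real => real" where
  "lap1 n a b t = - (tens3 n a b t + (n - 6) * tens2 n a b t +
    (8 - 2 * n - (n - 1) * (cos (a + t * b 0))\<^sup>2) * tens1 n a b t +
    2 * ((n - 1) * (sin (a + t * b 0) * cos (a + t * b 0) * (t * b 1) * tens n a b t)))"

text \<open>The coefficient of the curvature form $d^2 \tau$, and its derivative.\<close>

definition curvc :: "real => real => (nat => real) => real => real" where
  "curvc n a b t = tens n a b t * (sin (a + t * b 0) * (t * b 1))"

definition curvc1 :: "real => real => (nat => real) => real => real" where
  "curvc1 n a b t = tens1 n a b t * (sin (a + t * b 0) * (t * b 1)) +
    tens n a b t * (cos (a + t * b 0) * (t * b 1)\<^sup>2 + sin (a + t * b 0) * (t * b 2))"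

locale profile =
  fixes a :: real and \<beta> :: "nat => real => real" and B :: "nat => real" and d :: real
    and T :: "'a::euclidean_space itself"
  assumes \<beta>: "derivative_sequence \<beta>" "\<bar>\<beta> j s\<bar> \<le> B j" and dpos: "0 < d"
begin

abbreviation lat :: "real \<times> 'a => real" where
  "lat z \<equiv> a + fst z * prof \<beta> z 0"

abbreviation ev :: "(real => real => (nat => real) => real => real) => real \<times> 'a => real" where
  "ev f z \<equiv> f (real DIM('a)) a (prof \<beta> z) (fst z)"

lemma rad_tb: "rad d (\<lambda>z::real \<times> 'a. fst z * prof \<beta> z j) (\<lambda>z. fst z * prof \<beta> z (Suc j))"
  using rad_mult[OF rad_fst rad_prof[OF \<beta>], of d j] by simp

lemma rad_lat: "rad d lat (\<lambda>z. fst z * prof \<beta> z 1)"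
  using rad_add[OF rad_const[of d a] rad_tb[of 0]] by simp

sublocale equivariant d lat "\<lambda>z. fst z * prof \<beta> z 1"
  by standard (rule dpos, rule rad_lat)

lemma rad_S: "rad d (\<lambda>z. sin (lat z)) (\<lambda>z. cos (lat z) * (fst z * prof \<beta> z 1))"
  by (rule rad_sin[OF rad_lat])

lemma rad_C: "rad d (\<lambda>z. cos (lat z)) (\<lambda>z. - sin (lat z) * (fst z * prof \<beta> z 1))"
  by (rule rad_cos[OF rad_lat])

lemma rad_tens: "rad d (ev tens) (ev tens1)"
  unfolding tens_def
  by (rule rad_cong[OF rad_diff[OF rad_add[OF rad_tb rad_cmult[OF rad_tb]] rad_cmult[OF rad_mult[OF rad_S rad_C]]]])
    (simp add: tens1_def eval_nat_numeral algebra_simps)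

lemma rad_tens1: "rad d (ev tens1) (ev tens2)"
  unfolding tens1_def
  by (rule rad_cong[OF rad_diff[OF rad_add[OF rad_tb rad_cmult[OF rad_tb]]
      rad_cmult[OF rad_mult[OF rad_diff[OF rad_power2[OF rad_C] rad_power2[OF rad_S]] rad_tb]]]])
    (simp add: tens2_def eval_nat_numeral algebra_simps)

lemma rad_tens2: "rad d (ev tens2) (ev tens3)"
  unfolding tens2_def
  by (rule rad_cong[OF rad_diff[OF rad_add[OF rad_tb rad_cmult[OF rad_tb]]
      rad_cmult[OF rad_diff[OF rad_mult[OF rad_diff[OF rad_power2[OF rad_C] rad_power2[OF rad_S]] rad_tb]
        rad_cmult[OF rad_mult[OF rad_mult[OF rad_S rad_C] rad_power2[OF rad_tb]]]]]]])
    (simp add: tens3_def eval_nat_numeral algebra_simps)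

lemma rad_lap: "rad d (ev lap) (ev lap1)"
  unfolding lap_def
  by (rule rad_cong[OF rad_minus[OF rad_add[OF rad_add[OF rad_tens2 rad_cmult[OF rad_tens1]]
      rad_mult[OF rad_diff[OF rad_const rad_cmult[OF rad_power2[OF rad_C]]] rad_tens]]]])
    (simp add: lap1_def eval_nat_numeral algebra_simps)

lemma rad_curvc: "rad d (ev curvc) (ev curvc1)"
  unfolding curvc_def
  by (rule rad_cong[OF rad_mult[OF rad_tens rad_mult[OF rad_S rad_tb]]])
    (simp add: curvc1_def eval_nat_numeral algebra_simps)

lemma tau_profile: "z \<in> cyl d ==> tau (eqv lat) z = (qq z ^ 2 * ev tens z) *\<^sub>R NN z"
  using tau_eqv[OF rad_tb] by (simp add: tens_def numeral_2_eq_2 mult.assoc)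

lemma lap_profile: "z \<in> cyl d ==> rl (eqv lat) (tau (eqv lat)) z = (qq z ^ 4 * ev lap z) *\<^sub>R NN z"
proof -
  assume z: "z \<in> cyl d"
  have "rl (eqv lat) (tau (eqv lat)) z = rl (eqv lat) (\<lambda>z. (qq z ^ 2 * ev tens z) *\<^sub>R NN z) z"
    by (rule rl_cong[OF z tau_profile])
  also have "\<dots> = (qq z ^ (2 + 2) * ev lap z) *\<^sub>R NN z"
    unfolding rl_eqv[OF rad_tens rad_tens1 z]
    by (rule arg_cong[where f = "\<lambda>c. (qq z ^ (2 + 2) * c) *\<^sub>R NN z"]) (simp add: lap_def)
  finally show ?thesis by simp
qed

lemma cve_tau_profile:
  assumes z: "z \<in> cyl d"
  shows "cve e (tau (eqv lat)) z = qq z ^ 3 *\<^sub>R (((ev tens1 z - 2 * ev tens z) * (uu z \<bullet> e)) *\<^sub>R NN z + (ev tens z * C z) *\<^sub>R tng e z)"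
  using cv_cong[OF z tau_profile, where v = "(0, e)"] cv_qA_nrm[OF rad_tens z, where m = 2 and e = e]
  by (simp add: eval_nat_numeral)

lemma cve_lap_profile:
  assumes z: "z \<in> cyl d"
  shows "cve e (rl (eqv lat) (tau (eqv lat))) z = qq z ^ 5 *\<^sub>R (((ev lap1 z - 4 * ev lap z) * (uu z \<bullet> e)) *\<^sub>R NN z + (ev lap z * C z) *\<^sub>R tng e z)"
  using cv_cong[OF z lap_profile, where v = "(0, e)"] cv_qA_nrm[OF rad_lap z, where m = 4 and e = e]
  by (simp add: eval_nat_numeral)

lemma dens_odd_0_profile:
  assumes z: "z \<in> cyl d"
  shows "dens_odd 0 (eqv lat) z = qq z ^ 6 *
    ((ev tens1 z - 2 * ev tens z)\<^sup>2 + (real DIM('a) - 1) * (ev tens z * C z)\<^sup>2)"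
  unfolding dens_odd_def using sum_norm_cv_qA[OF rad_tens z cve_tau_profile[OF z]] by simp

lemma dens_even_1_profile:
  assumes z: "z \<in> cyl d"
  shows "dens_even 1 (eqv lat) z = qq z ^ 8 * (ev lap z)\<^sup>2"
  unfolding dens_even_def using lap_profile[OF z]
  by (simp add: frame_products[OF z] power2_eq_square eval_nat_numeral)

lemma dens_odd_1_profile:
  assumes z: "z \<in> cyl d"
  shows "dens_odd 1 (eqv lat) z = qq z ^ 10 *
    ((ev lap1 z - 4 * ev lap z)\<^sup>2 + (real DIM('a) - 1) * (ev lap z * C z)\<^sup>2)"
  unfolding dens_odd_def using sum_norm_cv_qA[OF rad_tens z cve_lap_profile[OF z]] by simp

lemma curv_profile:
  assumes e: "e \<in> Basis" "f \<in> Basis" and z: "z \<in> cyl d"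
  shows "curv (eqv lat) (tau (eqv lat)) e f z = (qq z ^ 4 * ev curvc z) *\<^sub>R ((uu z \<bullet> f) *\<^sub>R tng e z - (uu z \<bullet> e) *\<^sub>R tng f z)"
proof -
  have p: "tau (eqv lat) z \<bullet> phid g z = qq z ^ 3 * (ev tens z * (fst z * prof \<beta> z 1) * (uu z \<bullet> g))" for g
    unfolding tau_profile[OF z] dd_eqv[OF z] by (simp add: inner_add_right frame_products[OF z] eval_nat_numeral)
  show ?thesis
    unfolding curv_eq[OF sym_tau[OF sym_eqv] tangential_tau e z] p
    unfolding dd_eqv[OF z] curvc_def
    by (simp add: scaleR_add_right scaleR_diff_right eval_nat_numeral mult_ac)
qed

lemma sum_curv_profile:
  assumes z: "z \<in> cyl d"
  shows "(\<Sum>e\<in>Basis. \<Sum>f\<in>Basis. curv (eqv lat) (tau (eqv lat)) e f z \<bullet> curv (eqv lat) (tau (eqv lat)) e f z) =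
    qq z ^ 8 * (2 * (real DIM('a) - 1) * (ev curvc z)\<^sup>2)"
proof -
  let ?k = "qq z ^ 8 * (ev curvc z)\<^sup>2"
  have "curv (eqv lat) (tau (eqv lat)) e f z \<bullet> curv (eqv lat) (tau (eqv lat)) e f z =
      ?k * (((uu z \<bullet> f) * (uu z \<bullet> f)) * (tng e z \<bullet> tng e z)) + ?k * (((uu z \<bullet> e) * (uu z \<bullet> e)) * (tng f z \<bullet> tng f z))
      - 2 * ?k * ((uu z \<bullet> e) * (tng e z \<bullet> ((uu z \<bullet> f) *\<^sub>R tng f z)))" if "e \<in> Basis" "f \<in> Basis" for e f
    unfolding curv_profile[OF that z]
    by (simp add: inner_diff_left inner_diff_right inner_commute power2_eq_square eval_nat_numeral algebra_simps)
  then have "(\<Sum>e\<in>Basis. \<Sum>f\<in>Basis. curv (eqv lat) (tau (eqv lat)) e f z \<bullet> curv (eqv lat) (tau (eqv lat)) e f z) =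
      (\<Sum>e\<in>Basis. \<Sum>f\<in>Basis. ?k * (((uu z \<bullet> f) * (uu z \<bullet> f)) * (tng e z \<bullet> tng e z)) + ?k * (((uu z \<bullet> e) * (uu z \<bullet> e)) * (tng f z \<bullet> tng f z))
      - 2 * ?k * ((uu z \<bullet> e) * (tng e z \<bullet> ((uu z \<bullet> f) *\<^sub>R tng f z))))"
    by (intro sum.cong refl)
  also have "\<dots> = ?k * (\<Sum>e\<in>Basis. (\<Sum>f\<in>Basis. (uu z \<bullet> f) * (uu z \<bullet> f)) * (tng e z \<bullet> tng e z))
      + ?k * (\<Sum>e\<in>Basis. ((uu z \<bullet> e) * (uu z \<bullet> e)) * (\<Sum>f\<in>Basis. tng f z \<bullet> tng f z))
      - 2 * ?k * (\<Sum>e\<in>Basis. (uu z \<bullet> e) * (tng e z \<bullet> (\<Sum>f\<in>Basis. (uu z \<bullet> f) *\<^sub>R tng f z)))"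
    by (simp only: sum.distrib sum_subtractf sum_distrib_left sum_distrib_right inner_sum_right mult.assoc)
  also have "\<dots> = ?k * (real DIM('a) - 1) + ?k * (real DIM('a) - 1)"
    unfolding sum_uu2[OF z] sum_tng_tng[OF z] sum_uu_tng[OF z]
    by (simp add: sum_tng_tng[OF z] sum_uu2[OF z] flip: sum_distrib_right)
  finally show ?thesis by simp
qed

lemma dens_ES4_profile:
  assumes z: "z \<in> cyl d"
  shows "dens_ES4 (eqv lat) z = qq z ^ 8 * ((ev lap z)\<^sup>2 + (real DIM('a) - 1) * (ev curvc z)\<^sup>2)"
  unfolding dens_ES4_def sum_curv_profile[OF z] using dens_even_1_profile[OF z]
  by (simp add: dens_even_def algebra_simps)

lemma cv_curv_profile:
  assumes "e \<in> Basis" "f \<in> Basis" and z: "z \<in> cyl d"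
  shows "cve g (curv (eqv lat) (tau (eqv lat)) e f) z = qq z ^ 5 *\<^sub>R
    (((ev curvc1 z - 4 * ev curvc z) * (uu z \<bullet> g)) *\<^sub>R ((uu z \<bullet> f) *\<^sub>R tng e z - (uu z \<bullet> e) *\<^sub>R tng f z) +
     ev curvc z *\<^sub>R ((g \<bullet> f) *\<^sub>R tng e z - (g \<bullet> e) *\<^sub>R tng f z
       - ((uu z \<bullet> g) * (uu z \<bullet> f)) *\<^sub>R tng e z + ((uu z \<bullet> g) * (uu z \<bullet> e)) *\<^sub>R tng f z
       - (((g \<bullet> e) * (uu z \<bullet> f) - (g \<bullet> f) * (uu z \<bullet> e)) * C z) *\<^sub>R NN z))"
proof -
  let ?m = "\<lambda>f z. qq z ^ 4 * ev curvc z * (uu z \<bullet> f)"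
  have s: "symbol d (4 + 0) (\<lambda>z. ?m f z *\<^sub>R tng e z)" for e f
    by (rule sym_scaleR[OF sym_qAu[OF rad_curvc] sym_tng])
  have "cve g (curv (eqv lat) (tau (eqv lat)) e f) z = cve g (\<lambda>z. ?m f z *\<^sub>R tng e z + - (?m e z *\<^sub>R tng f z)) z"
    by (rule cv_cong[OF z]) (simp add: curv_profile[OF assms(1,2)] scaleR_diff_right)
  also have "\<dots> = cve g (\<lambda>z. ?m f z *\<^sub>R tng e z) z - cve g (\<lambda>z. ?m e z *\<^sub>R tng f z) z"
    using cv_add[OF s sym_minus[OF s] z] cv_minus[OF s z] by simp
  finally have eq: "cve g (curv (eqv lat) (tau (eqv lat)) e f) z =
      cve g (\<lambda>z. ?m f z *\<^sub>R tng e z) z - cve g (\<lambda>z. ?m e z *\<^sub>R tng f z) z" .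
  have five: "5 * x = 4 * x + x" for x :: real by simp
  show ?thesis
    unfolding eq cv_scale_tng[OF sym_qAu[OF rad_curvc] z] dd_qAu[OF rad_curvc z]
    by (simp add: eval_nat_numeral algebra_simps) (simp only: five distrib_left scaleR_add_left add_ac)
qed

lemma tri_profile:
  assumes "e \<in> Basis" "f \<in> Basis" "g \<in> Basis" and z: "z \<in> cyl d"
  shows "tri (eqv lat) (tau (eqv lat)) e f g z = 0"
  unfolding tri_def cv_curv_profile[OF assms(2,3) z] cv_curv_profile[OF assms(1,3) z] cv_curv_profile[OF assms(1,2) z]
  by (simp add: inner_commute[of f e] inner_commute[of g e] inner_commute[of g f] algebra_simps)

text \<open>The divergence of the curvature form has a normal and a tangential part; both are again given by
  functions of $\ln |x|$, so that no new kind of field arises.\<close>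

lemma lin3_profile:
  assumes e: "e \<in> Basis" and z: "z \<in> cyl d"
  shows "lin3 (eqv lat) (tau (eqv lat)) e z = qq z ^ 5 *\<^sub>R
    (((ev lap1 z - 4 * ev lap z + (real DIM('a) - 1) * (ev curvc z * C z)) * (uu z \<bullet> e)) *\<^sub>R NN z +
     (ev lap z * C z + ev curvc1 z + (real DIM('a) - 6) * ev curvc z) *\<^sub>R tng e z)"
proof -
  let ?x = "ev curvc1 z - 4 * ev curvc z" and ?h = "ev curvc z"
  have c: "cve f (curv (eqv lat) (tau (eqv lat)) f e) z = qq z ^ 5 *\<^sub>R
      ((?x * (uu z \<bullet> e)) *\<^sub>R ((uu z \<bullet> f) *\<^sub>R tng f z) - (?x * ((uu z \<bullet> f) * (uu z \<bullet> f))) *\<^sub>R tng e z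
       + ?h *\<^sub>R ((f \<bullet> e) *\<^sub>R tng f z) - (?h * (f \<bullet> f - (uu z \<bullet> f) * (uu z \<bullet> f))) *\<^sub>R tng e z
       - (?h * (uu z \<bullet> e)) *\<^sub>R ((uu z \<bullet> f) *\<^sub>R tng f z)
       - (?h * ((f \<bullet> f) * (uu z \<bullet> e) - (f \<bullet> e) * (uu z \<bullet> f)) * C z) *\<^sub>R NN z)" if "f \<in> Basis" for f
    unfolding cv_curv_profile[OF that e z] by (simp add: algebra_simps)
  have ef: "(\<Sum>f\<in>Basis. (f \<bullet> e) *\<^sub>R tng f z) = tng e z"
  proof -
    have "(\<Sum>f\<in>Basis. (f \<bullet> e) *\<^sub>R tng f z) = (\<Sum>f\<in>Basis. if f = e then tng e z else 0)"
      by (rule sum.cong) (use e in \<open>auto simp: inner_Basis\<close>)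
    then show ?thesis using e by simp
  qed
  have fe: "(\<Sum>f\<in>Basis. (f \<bullet> e) * (uu z \<bullet> f)) = uu z \<bullet> e"
  proof -
    have "(\<Sum>f\<in>Basis. (f \<bullet> e) * (uu z \<bullet> f)) = (\<Sum>f\<in>Basis. if f = e then uu z \<bullet> e else 0)"
      by (rule sum.cong) (use e in \<open>auto simp: inner_Basis\<close>)
    then show ?thesis using e by simp
  qed
  have ff: "(\<Sum>f\<in>(Basis::'a set). f \<bullet> f) = real DIM('a)" by (simp add: inner_same_Basis)
  have "(\<Sum>f\<in>Basis. cve f (curv (eqv lat) (tau (eqv lat)) f e) z) = qq z ^ 5 *\<^sub>R
      ((?x * (uu z \<bullet> e)) *\<^sub>R (\<Sum>f\<in>Basis. (uu z \<bullet> f) *\<^sub>R tng f z) - (?x * (\<Sum>f\<in>Basis. (uu z \<bullet> f) * (uu z \<bullet> f))) *\<^sub>R tng e z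
       + ?h *\<^sub>R (\<Sum>f\<in>Basis. (f \<bullet> e) *\<^sub>R tng f z)
       - (?h * ((\<Sum>f\<in>(Basis::'a set). f \<bullet> f) - (\<Sum>f\<in>Basis. (uu z \<bullet> f) * (uu z \<bullet> f)))) *\<^sub>R tng e z
       - (?h * (uu z \<bullet> e)) *\<^sub>R (\<Sum>f\<in>Basis. (uu z \<bullet> f) *\<^sub>R tng f z)
       - (?h * ((\<Sum>f\<in>(Basis::'a set). f \<bullet> f) * (uu z \<bullet> e) - (\<Sum>f\<in>Basis. (f \<bullet> e) * (uu z \<bullet> f))) * C z) *\<^sub>R NN z)"
    by (subst sum.cong[OF refl c], assumption)
      (simp only: right_diff_distrib left_diff_distrib scaleR_diff_left scaleR_diff_right scaleR_add_right sum.distrib sum_subtractf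
        scaleR_sum_left scaleR_sum_right sum_distrib_left sum_distrib_right)
  then have "(\<Sum>f\<in>Basis. cve f (curv (eqv lat) (tau (eqv lat)) f e) z) = - (qq z ^ 5 *\<^sub>R
      ((ev curvc1 z + (real DIM('a) - 6) * ?h) *\<^sub>R tng e z + ((real DIM('a) - 1) * (?h * C z) * (uu z \<bullet> e)) *\<^sub>R NN z))"
    unfolding sum_uu_tng[OF z] sum_uu2[OF z] ef fe ff
    by (simp flip: scaleR_add_left scaleR_diff_left scaleR_minus_left scaleR_minus_right)
      (simp add: algebra_simps)
  then show ?thesis
    unfolding lin3_def cve_lap_profile[OF z] by (simp add: algebra_simps)
qed

text \<open>The part of degree 3 vanishes for maps of this symmetry; the square of the part of degree 1
  splits into its radial and its \<open>n - 1\<close> spherical directions.\<close>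

lemma dens_ES5_profile:
  assumes z: "z \<in> cyl d"
  shows "dens_ES5 (eqv lat) z = qq z ^ 10 *
    ((ev lap1 z - 4 * ev lap z + (real DIM('a) - 1) * (ev curvc z * C z))\<^sup>2 +
     (real DIM('a) - 1) * (ev lap z * C z + ev curvc1 z + (real DIM('a) - 6) * ev curvc z)\<^sup>2)"
proof -
  have "(\<Sum>e\<in>Basis. \<Sum>f\<in>Basis. \<Sum>g\<in>Basis. tri (eqv lat) (tau (eqv lat)) e f g z \<bullet> tri (eqv lat) (tau (eqv lat)) e f g z) = 0"
    by (simp add: tri_profile z)
  then show ?thesis
    unfolding dens_ES5_def using sum_norm_cv_qA[OF rad_tens z lin3_profile[OF _ z]] by simp
qed

end

subsection \<open>Second derivatives along a family\<close>

text \<open>Taylor data of order two at 0. They obey product and chain rules, so the second variation of a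
  density can be assembled without differentiating the whole expression twice.\<close>

definition jet2 :: "(real => real) => real => real => real => bool" where
  "jet2 f x0 x1 x2 \<longleftrightarrow> f 0 = x0 \<and> (\<exists>f'. (\<forall>t. (f has_real_derivative f' t) (at t)) \<and> f' 0 = x1 \<and>
     (f' has_real_derivative x2) (at 0))"

lemma jet2_const: "jet2 (\<lambda>t. c) c 0 0"
  unfolding jet2_def by (intro conjI exI[of _ "\<lambda>_. 0"]) auto

lemma jet2_times: "jet2 (\<lambda>t. t * c) 0 c 0"
  unfolding jet2_def by (intro conjI exI[of _ "\<lambda>_. c"]) (auto intro!: derivative_eq_intros)

lemma jet2_add: "jet2 f x0 x1 x2 ==> jet2 g y0 y1 y2 ==> jet2 (\<lambda>t. f t + g t) (x0 + y0) (x1 + y1) (x2 + y2)"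
  unfolding jet2_def
proof (elim conjE exE, intro conjI)
  fix f' g' assume *: "\<forall>t. (f has_real_derivative f' t) (at t)" "f' 0 = x1" "(f' has_real_derivative x2) (at 0)"
    "\<forall>t. (g has_real_derivative g' t) (at t)" "g' 0 = y1" "(g' has_real_derivative y2) (at 0)"
  show "\<exists>h. (\<forall>t. ((\<lambda>t. f t + g t) has_real_derivative h t) (at t)) \<and> h 0 = x1 + y1 \<and> (h has_real_derivative x2 + y2) (at 0)"
    by (intro exI[of _ "\<lambda>t. f' t + g' t"]) (use * in \<open>auto intro!: DERIV_add\<close>)
qed auto

lemma jet2_mult:
  "jet2 f x0 x1 x2 ==> jet2 g y0 y1 y2 ==>
    jet2 (\<lambda>t. f t * g t) (x0 * y0) (x1 * y0 + y1 * x0) (x2 * y0 + 2 * x1 * y1 + y2 * x0)"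
  unfolding jet2_def
proof (elim conjE exE, intro conjI)
  fix f' g' assume *: "\<forall>t. (f has_real_derivative f' t) (at t)" "f' 0 = x1" "(f' has_real_derivative x2) (at 0)"
    "\<forall>t. (g has_real_derivative g' t) (at t)" "g' 0 = y1" "(g' has_real_derivative y2) (at 0)" "f 0 = x0" "g 0 = y0"
  have "((\<lambda>t. f' t * g t + g' t * f t) has_real_derivative (x2 * g 0 + g' 0 * f' 0) + (y2 * f 0 + f' 0 * g' 0)) (at 0)"
    using * by (intro DERIV_add DERIV_mult) auto
  then show "\<exists>h. (\<forall>t. ((\<lambda>t. f t * g t) has_real_derivative h t) (at t)) \<and> h 0 = x1 * y0 + y1 * x0 \<and>
      (h has_real_derivative x2 * y0 + 2 * x1 * y1 + y2 * x0) (at 0)"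
  proof (intro exI[of _ "\<lambda>t. f' t * g t + g' t * f t"] conjI allI)
    show "((\<lambda>t. f t * g t) has_real_derivative f' t * g t + g' t * f t) (at t)" for t using * by (intro DERIV_mult) auto
  qed (use * in \<open>simp_all add: algebra_simps\<close>)
qed auto

lemma jet2_cmult: "jet2 f x0 x1 x2 ==> jet2 (\<lambda>t. c * f t) (c * x0) (c * x1) (c * x2)"
  using jet2_mult[OF jet2_const[of c], of f x0 x1 x2] by (simp add: mult.commute)

lemma jet2_minus: "jet2 f x0 x1 x2 ==> jet2 (\<lambda>t. - f t) (- x0) (- x1) (- x2)"
  using jet2_cmult[of f x0 x1 x2 "-1"] by simp

lemma jet2_diff: "jet2 f x0 x1 x2 ==> jet2 g y0 y1 y2 ==> jet2 (\<lambda>t. f t - g t) (x0 - y0) (x1 - y1) (x2 - y2)"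
  using jet2_add[of f x0 x1 x2 "\<lambda>t. - g t" "- y0" "- y1" "- y2"] jet2_minus[of g y0 y1 y2] by simp

lemma jet2_power2: "jet2 f x0 x1 x2 ==> jet2 (\<lambda>t. (f t)\<^sup>2) (x0\<^sup>2) (2 * x0 * x1) (2 * x1\<^sup>2 + 2 * x0 * x2)"
  using jet2_mult[of f x0 x1 x2 f x0 x1 x2] by (simp add: power2_eq_square algebra_simps)

lemma jet2_sin: "jet2 (\<lambda>t. sin (a + t * b)) (sin a) (b * cos a) (- (b\<^sup>2 * sin a))"
  unfolding jet2_def
  by (intro conjI exI[of _ "\<lambda>t. b * cos (a + t * b)"]) (auto intro!: derivative_eq_intros simp: power2_eq_square)

lemma jet2_cos: "jet2 (\<lambda>t. cos (a + t * b)) (cos a) (- (b * sin a)) (- (b\<^sup>2 * cos a))"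
  unfolding jet2_def
  by (intro conjI exI[of _ "\<lambda>t. - (b * sin (a + t * b))"]) (auto intro!: derivative_eq_intros simp: power2_eq_square)

lemma jet2_eqI: "jet2 f y0 y1 y2 ==> y0 = x0 ==> y1 = x1 ==> y2 = x2 ==> jet2 f x0 x1 x2"
  by simp

text \<open>At a fixed point \<open>x\<close> the densities are a power of $|x|^{-1}$ times a function of \<open>t\<close> alone.\<close>

lemma dd_time_jet2:
  fixes G :: "real \<times> 'a::euclidean_space => real"
  assumes G: "symbol d k G" and z: "(0, x) \<in> cyl d" and h: "jet2 h x0 x1 x2"
    and eq: "\<And>t. (t, x) \<in> cyl d ==> G (t, x) = c * h t"
  shows "dd (1, 0) (dd (1, 0) G) (0, x) = c * x2"
proof -
  obtain h' where h': "\<And>t. (h has_real_derivative h' t) (at t)" "(h' has_real_derivative x2) (at 0)"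
    using h by (auto simp: jet2_def)
  have d: "0 < d" and inc: "(t, x) \<in> cyl d \<longleftrightarrow> \<bar>t\<bar> < d" for t using z by (auto simp: cyl_def)
  have 1: "dd (1, 0) G (t, x) = c * h' t" if t: "\<bar>t\<bar> < d" for t
  proof -
    have "((\<lambda>t. G (t, x)) has_real_derivative c * h' t) (at t)"
    proof (rule has_field_derivative_transform_within_open[where f = "\<lambda>t. c * h t" and S = "{-d<..<d}"])
      show "((\<lambda>t. c * h t) has_real_derivative c * h' t) (at t)" by (intro DERIV_cmult h'(1))
    qed (use t eq inc in auto)
    moreover have "((\<lambda>t. G (t, x)) has_real_derivative dd (1, 0) G (t, x)) (at t)"
      by (rule has_real_derivative_time[OF G]) (use t inc in simp)
    ultimately show ?thesis by (metis DERIV_unique)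
  qed
  have "((\<lambda>t. dd (1, 0) G (t, x)) has_real_derivative c * x2) (at 0)"
  proof (rule has_field_derivative_transform_within_open[where f = "\<lambda>t. c * h' t" and S = "{-d<..<d}"])
    show "((\<lambda>t. c * h' t) has_real_derivative c * x2) (at 0)" by (intro DERIV_cmult h'(2))
  qed (use d 1 in auto)
  moreover have "((\<lambda>t. dd (1, 0) G (t, x)) has_real_derivative dd (1, 0) (dd (1, 0) G) (0, x)) (at 0)"
    by (rule has_real_derivative_time[OF sym_dt[OF G] z])
  ultimately show ?thesis by (metis DERIV_unique)
qed

subsection \<open>Families of symbols as curves in Sobolev spaces\<close>

definition freeze :: "real => (real \<times> 'a::euclidean_space => 'b::euclidean_space) => real \<times> 'a => 'b" where
  "freeze s F z = F (s, snd z)"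

lemma has_derivative_freeze:
  assumes "symbol d k F" "\<bar>s\<bar> < d" "z \<in> cyl d"
  shows "(freeze s F has_derivative (\<lambda>v. dd (0, snd v) F (s, snd z))) (at z)"
proof -
  have "(s, snd z) \<in> cyl d" using assms(2,3) by (auto simp: cyl_def)
  from has_derivative_compose[OF has_derivative_snd[OF has_derivative_ident] has_derivative_slice[OF assms(1) this]]
  show ?thesis by (simp add: freeze_def[abs_def])
qed

lemma sym_freeze:
  fixes F :: "real \<times> 'a::euclidean_space => 'b::euclidean_space"
  assumes "symbol d k F" "\<bar>s\<bar> < d"
  shows "symbol d k (freeze s F)"
proof -
  have "symb N d k (freeze s F)" if "symbol d k F" for N k and F :: "real \<times> 'a => 'b"
    using that
  proof (induction N arbitrary: k F)
    case (0 k F)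
    obtain C where C: "\<And>z. z \<in> cyl d ==> norm (F z) \<le> C * inverse (norm (snd z)) ^ k" using sym_bound[OF 0] by blast
    have "symb0 d k (freeze s F)"
    proof (rule symb0_differentiableI[where C = C])
      fix z :: "real \<times> 'a" assume z: "z \<in> cyl d"
      then show "freeze s F differentiable (at z)"
        using has_derivative_freeze[OF 0 assms(2) z] by (auto simp only: differentiable_def)
      show "norm (freeze s F z) \<le> C * inverse (norm (snd z)) ^ k"
        using C[of "(s, snd z)"] z assms(2) by (auto simp: freeze_def cyl_def mem_Times_iff abs_less_iff)
    qed
    then show ?case by simp
  next
    case (Suc N k F)
    have 0: "dd 0 F z = 0" if "z \<in> cyl d" for z :: "real \<times> 'a"
      using dd_works[OF sym_differentiable[OF Suc.prems that]] has_derivative_linear linear_0 by blast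
    show ?case
    proof (rule symb_SucI[OF symb_0[OF Suc.IH[OF Suc.prems]] has_derivative_freeze[OF Suc.prems assms(2)]])
      have "dd (0, snd (1, 0)) F (s, snd z) = 0" if "z \<in> cyl d" for z :: "real \<times> 'a"
        using 0[of "(s, snd z)"] that assms(2) by (auto simp: cyl_def zero_prod_def mem_Times_iff abs_less_iff)
      then show "symb N d k (\<lambda>z. dd (0, snd (1, 0)) F (s, snd z))"
        by (intro symb_cong[OF symb_const[of N d k 0]]) auto
      show "symb N d (Suc k) (\<lambda>z. dd (0, snd (0, e)) F (s, snd z))" if "e \<in> Basis" for e
        using Suc.IH[OF sym_dx[OF Suc.prems that]] by (simp add: freeze_def[abs_def])
    qed
  qed
  with assms(1) show ?thesis by (simp add: symbol_def)
qed

lemma dds_freeze: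
  assumes F: "symbol d k F" and s: "\<bar>s\<bar> < d"
  shows "set es \<subseteq> Basis ==> z \<in> cyl d ==> dds es (freeze s F) z = dds es F (s, snd z)"
proof (induction es arbitrary: z)
  case (Cons e es)
  have "dd (0, e) (dds es (freeze s F)) z = dd (0, e) (freeze s (dds es F)) z"
    by (rule dd_cong[OF open_cyl Cons.prems(2)]) (use Cons in \<open>simp add: freeze_def[of _ "dds es F"]\<close>)
  also have "\<dots> = dd (0, e) (dds es F) (s, snd z)"
    using dd_eqI[OF has_derivative_freeze[OF sym_dds[OF F, of es] s Cons.prems(2)], where v = "(0, e)"] Cons.prems(1) by simp
  finally show ?case by simp
qed (simp add: freeze_def)

lemma dds_add:
  assumes F: "symbol d k F" and G: "symbol d k G"
  shows "set es \<subseteq> Basis ==> z \<in> cyl d ==> dds es (\<lambda>z. F z + G z) z = dds es F z + dds es G z"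
proof (induction es arbitrary: z)
  case (Cons e es)
  have "dd (0, e) (dds es (\<lambda>z. F z + G z)) z = dd (0, e) (\<lambda>z. dds es F z + dds es G z) z"
    by (rule dd_cong[OF open_cyl Cons.prems(2)]) (use Cons in simp)
  also have "\<dots> = dd (0, e) (dds es F) z + dd (0, e) (dds es G) z"
    using Cons.prems by (intro dd_add sym_differentiable[OF sym_dds[OF F]] sym_differentiable[OF sym_dds[OF G]]) auto
  finally show ?case by simp
qed simp

lemma dds_scaleR:
  assumes F: "symbol d k F"
  shows "set es \<subseteq> Basis ==> z \<in> cyl d ==> dds es (\<lambda>z. c *\<^sub>R F z) z = c *\<^sub>R dds es F z"
proof (induction es arbitrary: z)
  case (Cons e es)
  have "dd (0, e) (dds es (\<lambda>z. c *\<^sub>R F z)) z = dd (0, e) (\<lambda>z. c *\<^sub>R dds es F z) z"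
    by (rule dd_cong[OF open_cyl Cons.prems(2)]) (use Cons in simp)
  also have "\<dots> = c *\<^sub>R dd (0, e) (dds es F) z"
    using Cons.prems by (intro dd_linear[OF bounded_linear_scaleR_right] sym_differentiable[OF sym_dds[OF F]]) auto
  finally show ?case by simp
qed simp

lemma dds_dt:
  assumes F: "symbol d k F"
  shows "set es \<subseteq> Basis ==> z \<in> cyl d ==> dds es (dd (1, 0) F) z = dd (1, 0) (dds es F) z"
proof (induction es arbitrary: z)
  case (Cons e es)
  have "dd (0, e) (dds es (dd (1, 0) F)) z = dd (0, e) (dd (1, 0) (dds es F)) z"
    by (rule dd_cong[OF open_cyl Cons.prems(2)]) (use Cons in simp)
  also have "\<dots> = dd (1, 0) (dd (0, e) (dds es F)) z"
    using Cons.prems by (intro sym_dd_commute[OF sym_dds[OF F]]) auto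
  finally show ?case by simp
qed simp

text \<open>Taylor's formula with the second time derivative bounded by the weight of \<open>F\<close>, applied to each
  coordinate.\<close>

lemma taylor_time:
  fixes F :: "real \<times> 'a::euclidean_space => 'b::euclidean_space"
  assumes F: "symbol d k F"
  obtains C where "0 \<le> C" "\<And>s t x. (s, x) \<in> cyl d ==> (t, x) \<in> cyl d ==>
    norm (F (t, x) - F (s, x) - (t - s) *\<^sub>R dd (1, 0) F (s, x)) \<le> C * inverse (norm x) ^ k * (t - s)\<^sup>2"
proof -
  obtain C where C: "0 \<le> C" "\<And>z. z \<in> cyl d ==> norm (dd (1, 0) (dd (1, 0) F) z) \<le> C * inverse (norm (snd z)) ^ k"
    using sym_bound[OF sym_dt[OF sym_dt[OF F]]] by blast
  have "norm (F (t, x) - F (s, x) - (t - s) *\<^sub>R dd (1, 0) F (s, x)) \<le> (real DIM('b) * C) * inverse (norm x) ^ k * (t - s)\<^sup>2"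
    if z: "(s, x) \<in> cyl d" "(t, x) \<in> cyl d" for s t x
  proof -
    let ?M = "C * inverse (norm x) ^ k"
    have in_cyl: "(\<tau>, x) \<in> cyl d" if "\<tau> \<in> closed_segment s t" for \<tau>
      using that z by (auto simp: cyl_def closed_segment_eq_real_ivl split: if_splits)
    have comp: "\<bar>(F (t, x) - F (s, x) - (t - s) *\<^sub>R dd (1, 0) F (s, x)) \<bullet> b\<bar> \<le> ?M * (t - s)\<^sup>2" if b: "b \<in> Basis" for b
    proof -
      have lin: "bounded_linear (\<lambda>y. y \<bullet> b)" by (rule bounded_linear_inner_left)
      have Fb: "symbol d k (\<lambda>z. F z \<bullet> b)" "symbol d k (\<lambda>z. dd (1, 0) F z \<bullet> b)"
        by (intro sym_linear[OF lin] F sym_dt)+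
      have d1: "((\<lambda>\<tau>. F (\<tau>, x) \<bullet> b) has_real_derivative dd (1, 0) F (\<tau>, x) \<bullet> b) (at \<tau>)" if "\<tau> \<in> closed_segment s t" for \<tau>
        using has_real_derivative_time[OF Fb(1) in_cyl[OF that]] dd_linear[OF lin sym_differentiable[OF F in_cyl[OF that]]] by simp
      have d2: "((\<lambda>\<tau>. dd (1, 0) F (\<tau>, x) \<bullet> b) has_real_derivative dd (1, 0) (dd (1, 0) F) (\<tau>, x) \<bullet> b) (at \<tau>)" if "\<tau> \<in> closed_segment s t" for \<tau>
        using has_real_derivative_time[OF Fb(2) in_cyl[OF that]] dd_linear[OF lin sym_differentiable[OF sym_dt[OF F] in_cyl[OF that]]] by simp
      have bd: "\<bar>dd (1, 0) F (\<tau>, x) \<bullet> b - dd (1, 0) F (s, x) \<bullet> b\<bar> \<le> ?M * \<bar>t - s\<bar>" if \<tau>: "\<tau> \<in> closed_segment s t" for \<tau>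
      proof -
        have "norm (dd (1, 0) F (\<tau>, x) \<bullet> b - dd (1, 0) F (s, x) \<bullet> b) \<le> ?M * norm (\<tau> - s)"
        proof (rule field_differentiable_bound[where S = "closed_segment s t"])
          fix u assume u: "u \<in> closed_segment s t"
          show "((\<lambda>\<tau>. dd (1, 0) F (\<tau>, x) \<bullet> b) has_field_derivative dd (1, 0) (dd (1, 0) F) (u, x) \<bullet> b) (at u within closed_segment s t)"
            by (rule has_field_derivative_at_within[OF d2[OF u]])
          show "norm (dd (1, 0) (dd (1, 0) F) (u, x) \<bullet> b) \<le> ?M"
            using C(2)[OF in_cyl[OF u]] Basis_le_norm[OF b, of "dd (1, 0) (dd (1, 0) F) (u, x)"] by simp
        qed (use \<tau> in auto)
        also have "\<dots> \<le> ?M * \<bar>t - s\<bar>"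
          using \<tau> C(1) by (intro mult_left_mono) (auto simp: closed_segment_eq_real_ivl split: if_splits)
        finally show ?thesis by simp
      qed
      \<comment> \<open>subtracting the linear part leaves a function with derivative of size \<open>\<bar>t - s\<bar>\<close>\<close>
      let ?h = "\<lambda>\<tau>. F (\<tau>, x) \<bullet> b - \<tau> * (dd (1, 0) F (s, x) \<bullet> b)"
      have "norm (?h t - ?h s) \<le> (?M * \<bar>t - s\<bar>) * norm (t - s)"
      proof (rule field_differentiable_bound[where S = "closed_segment s t"])
        fix u assume u: "u \<in> closed_segment s t"
        show "(?h has_field_derivative dd (1, 0) F (u, x) \<bullet> b - dd (1, 0) F (s, x) \<bullet> b) (at u within closed_segment s t)"
          by (rule has_field_derivative_at_within) (auto intro!: derivative_eq_intros d1[OF u])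
        show "norm (dd (1, 0) F (u, x) \<bullet> b - dd (1, 0) F (s, x) \<bullet> b) \<le> ?M * \<bar>t - s\<bar>" using bd[OF u] by simp
      qed auto
      also have "(?M * \<bar>t - s\<bar>) * norm (t - s) = ?M * (t - s)\<^sup>2" by (simp add: power2_eq_square abs_mult_self_eq mult.assoc)
      also have "?h t - ?h s = (F (t, x) - F (s, x) - (t - s) *\<^sub>R dd (1, 0) F (s, x)) \<bullet> b"
        by (simp add: inner_diff_left algebra_simps)
      finally show ?thesis by simp
    qed
    have "norm (F (t, x) - F (s, x) - (t - s) *\<^sub>R dd (1, 0) F (s, x)) \<le>
        (\<Sum>b\<in>Basis. \<bar>(F (t, x) - F (s, x) - (t - s) *\<^sub>R dd (1, 0) F (s, x)) \<bullet> b\<bar>)" by (rule norm_le_l1)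
    also have "\<dots> \<le> (\<Sum>b\<in>(Basis::'b set). ?M * (t - s)\<^sup>2)" by (intro sum_mono comp)
    finally show ?thesis by (simp add: mult.assoc)
  qed
  with C(1) show thesis by (intro that[of "real DIM('b) * C"]) auto
qed

text \<open>All spatial derivatives of a symbol are again differentiable in time, with a remainder of second
  order whose singularity has the weight of that derivative; the weights up to \<open>r\<close> are square
  integrable.\<close>

lemma sobolev_norm_difference_quotient:
  fixes F :: "real \<times> 'a::euclidean_space => 'b::euclidean_space"
  assumes F: "symbol d 0 F" and r: "2 * r < DIM('a)" and s: "\<bar>s\<bar> < d" and A: "A \<subseteq> {-d<..<d}"
  shows "((\<lambda>t. sobolev_norm r (\<lambda>x. (F (t, x) - F (s, x)) /\<^sub>R (t - s) - dd (1, 0) F (s, x))) \<longlongrightarrow> 0) (at s within A)"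
proof -
  let ?E = "{es::'a list. set es \<subseteq> Basis \<and> length es \<le> r}"
  define P where "P es c \<longleftrightarrow> (\<forall>s t x. (s, x) \<in> cyl d --> (t, x) \<in> cyl d -->
    norm (dds es F (t, x) - dds es F (s, x) - (t - s) *\<^sub>R dd (1, 0) (dds es F) (s, x)) \<le> c * inverse (norm x) ^ length es * (t - s)\<^sup>2)"
    for es c
  have "\<exists>c. P es c" if "es \<in> ?E" for es
  proof -
    have "set es \<subseteq> Basis" using that by simp
    from sym_dds[OF F this] have "symbol d (length es) (dds es F)" by simp
    show ?thesis
    proof (rule taylor_time[OF \<open>symbol d (length es) (dds es F)\<close>], goal_cases)
      case (1 C)
      show ?case unfolding P_def by (intro exI[of _ C] allI impI 1(2))
    qed
  qed
  then obtain C where C0: "\<And>es. es \<in> ?E ==> P es (C es)" by metis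
  have C: "norm (dds es F (t, x) - dds es F (s, x) - (t - s) *\<^sub>R dd (1, 0) (dds es F) (s, x)) \<le> C es * inverse (norm x) ^ length es * (t - s)\<^sup>2"
    if "es \<in> ?E" "(s, x) \<in> cyl d" "(t, x) \<in> cyl d" for es s t x
    using C0[OF that(1)] that(2,3) unfolding P_def by blast
  define M where "M = (\<Sum>es\<in>?E. (LINT x|lebesgue_on unit_ball. (C es)\<^sup>2 * inverse (norm (x::'a)) ^ (2 * length es)))"
  have M0: "0 \<le> M" unfolding M_def by (intro sum_nonneg Bochner_Integration.integral_nonneg) auto
  have bound: "sobolev_norm r (\<lambda>x. (F (t, x) - F (s, x)) /\<^sub>R (t - s) - dd (1, 0) F (s, x)) \<le> \<bar>t - s\<bar> * sqrt M"
    if t: "\<bar>t\<bar> < d" "t \<noteq> s" for t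
  proof -
    let ?f = "\<lambda>x. (F (t, x) - F (s, x)) /\<^sub>R (t - s) - dd (1, 0) F (s, x)"
    let ?D = "\<lambda>z. freeze t F z + (- 1) *\<^sub>R freeze s F z"
    let ?G = "\<lambda>z. inverse (t - s) *\<^sub>R ?D z + (- 1) *\<^sub>R freeze s (dd (1, 0) F) z"
    have s1: "symbol d 0 (freeze t F)" "symbol d 0 (freeze s F)" "symbol d 0 (freeze s (dd (1, 0) F))"
      by (intro sym_freeze F sym_dt s t)+
    have s2: "symbol d 0 (\<lambda>z. (- 1) *\<^sub>R freeze s F z)" "symbol d 0 (\<lambda>z. (- 1) *\<^sub>R freeze s (dd (1, 0) F) z)"
      by (intro sym_cmult s1)+
    have s3: "symbol d 0 ?D" by (intro sym_add s1 s2)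
    have s4: "symbol d 0 (\<lambda>z. inverse (t - s) *\<^sub>R ?D z)" by (intro sym_cmult s3)
    have sG: "symbol d 0 ?G" by (intro sym_add s4 s2)
    have rG: "rep 0 ?G ?f" by (simp add: rep_def freeze_def)
    have dG: "dds es ?G (0, x) = inverse (t - s) *\<^sub>R (dds es F (t, x) - dds es F (s, x) - (t - s) *\<^sub>R dd (1, 0) (dds es F) (s, x))"
      if es: "set es \<subseteq> Basis" and z: "(0, x) \<in> cyl d" for es x
    proof -
      have sx: "(s, x) \<in> cyl d" using z s by (auto simp: cyl_def)
      have "dds es ?G (0, x) = inverse (t - s) *\<^sub>R (dds es (freeze t F) (0, x) + (- 1) *\<^sub>R dds es (freeze s F) (0, x))
          + (- 1) *\<^sub>R dds es (freeze s (dd (1, 0) F)) (0, x)"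
        by (simp only: dds_add[OF s4 s2(2) es z] dds_scaleR[OF s3 es z] dds_add[OF s1(1) s2(1) es z]
            dds_scaleR[OF s1(2) es z] dds_scaleR[OF s1(3) es z])
      also have "\<dots> = inverse (t - s) *\<^sub>R (dds es F (t, x) - dds es F (s, x)) - dd (1, 0) (dds es F) (s, x)"
        by (simp add: dds_freeze[OF F t(1) es z] dds_freeze[OF F s es z] dds_freeze[OF sym_dt[OF F] s es z] dds_dt[OF F es sx])
      also have "\<dots> = inverse (t - s) *\<^sub>R (dds es F (t, x) - dds es F (s, x) - (t - s) *\<^sub>R dd (1, 0) (dds es F) (s, x))"
        using t(2) by (simp add: scaleR_diff_right)
      finally show ?thesis .
    qed
    have d0: "\<bar>0\<bar> < d" using s by simp
    have "(\<Sum>es\<in>?E. LINT x|lebesgue_on unit_ball. (norm (weak_partials es ?f x))\<^sup>2) \<le>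
        (\<Sum>es\<in>?E. (t - s)\<^sup>2 * (LINT x|lebesgue_on unit_ball. (C es)\<^sup>2 * inverse (norm (x::'a)) ^ (2 * length es)))"
    proof (rule sum_mono)
      fix es assume es: "es \<in> ?E"
      have len: "2 * length es < DIM('a)" using es r by auto
      have int: "integrable (lebesgue_on unit_ball) (\<lambda>x::'a. (t - s)\<^sup>2 * ((C es)\<^sup>2 * inverse (norm x) ^ (2 * length es)))"
        by (intro integrable_mult_right integrable_inverse_norm_power len)
      have "rep 0 (dds es ?G) (weak_partials es ?f)"
        by (rule rep_weak_partials[OF sG d0 rG]) (use es len in auto)
      then have ae: "AE x in lebesgue_on unit_ball. (norm (weak_partials es ?f x))\<^sup>2 \<le> (t - s)\<^sup>2 * ((C es)\<^sup>2 * inverse (norm x) ^ (2 * length es))"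
        unfolding rep_def using AE_cyl[OF d0]
      proof eventually_elim
        fix x :: 'a assume w: "weak_partials es ?f x = dds es ?G (0, x)" and z: "(0, x) \<in> cyl d"
        have sx: "(s, x) \<in> cyl d" "(t, x) \<in> cyl d" using z s t by (auto simp: cyl_def)
        have "norm (weak_partials es ?f x) \<le> \<bar>inverse (t - s)\<bar> * (C es * inverse (norm x) ^ length es * (t - s)\<^sup>2)"
          unfolding w dG[OF conjunct1[OF es[unfolded mem_Collect_eq]] z] norm_scaleR
          by (intro mult_left_mono C[OF es sx]) simp
        also have "\<dots> = \<bar>t - s\<bar> * (C es * inverse (norm x) ^ length es)"
        proof -
          have "\<bar>inverse (t - s)\<bar> * (t - s)\<^sup>2 = \<bar>t - s\<bar>"
          proof -
            have "\<bar>inverse (t - s)\<bar> * (t - s)\<^sup>2 = \<bar>inverse (t - s) * (t - s)\<^sup>2\<bar>" by (simp add: abs_mult)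
            also have "inverse (t - s) * (t - s)\<^sup>2 = t - s" using t(2) by (simp add: power2_eq_square)
            finally show ?thesis .
          qed
          then show ?thesis by (metis (no_types, opaque_lifting) mult.assoc mult.commute)
        qed
        finally have "(norm (weak_partials es ?f x))\<^sup>2 \<le> (\<bar>t - s\<bar> * (C es * inverse (norm x) ^ length es))\<^sup>2"
          by (intro power_mono) auto
        then show "(norm (weak_partials es ?f x))\<^sup>2 \<le> (t - s)\<^sup>2 * ((C es)\<^sup>2 * inverse (norm x) ^ (2 * length es))"
          by (simp add: power_mult_distrib mult.commute[of 2] power_mult)
      qed
      have "(LINT x|lebesgue_on unit_ball. (norm (weak_partials es ?f x))\<^sup>2) \<le>
          (LINT x|lebesgue_on unit_ball. (t - s)\<^sup>2 * ((C es)\<^sup>2 * inverse (norm (x::'a)) ^ (2 * length es)))"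
        by (rule integral_mono_AE'[OF int ae]) auto
      then show "(LINT x|lebesgue_on unit_ball. (norm (weak_partials es ?f x))\<^sup>2) \<le>
          (t - s)\<^sup>2 * (LINT x|lebesgue_on unit_ball. (C es)\<^sup>2 * inverse (norm (x::'a)) ^ (2 * length es))"
        by simp
    qed
    also have "\<dots> = (t - s)\<^sup>2 * M" by (simp add: M_def sum_distrib_left)
    finally have "sobolev_norm r ?f \<le> sqrt ((t - s)\<^sup>2 * M)" unfolding sobolev_norm_def by (rule real_sqrt_le_mono)
    then show ?thesis by (simp add: real_sqrt_mult)
  qed
  show ?thesis
  proof (rule Lim_null_comparison)
    show "\<forall>\<^sub>F t in at s within A. norm (sobolev_norm r (\<lambda>x. (F (t, x) - F (s, x)) /\<^sub>R (t - s) - dd (1, 0) F (s, x))) \<le> \<bar>t - s\<bar> * sqrt M"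
      unfolding eventually_at_filter
    proof (intro always_eventually allI impI)
      fix t assume "t \<noteq> s" "t \<in> A"
      then have "t \<in> {-d<..<d}" using A by blast
      then have "\<bar>t\<bar> < d" by auto
      moreover have "0 \<le> sobolev_norm r f" for f :: "'a => 'b"
        unfolding sobolev_norm_def by (intro real_sqrt_ge_zero sum_nonneg Bochner_Integration.integral_nonneg) auto
      ultimately show "norm (sobolev_norm r (\<lambda>x. (F (t, x) - F (s, x)) /\<^sub>R (t - s) - dd (1, 0) F (s, x))) \<le> \<bar>t - s\<bar> * sqrt M"
        using bound \<open>t \<noteq> s\<close> by simp
    qed
    have "((\<lambda>t. \<bar>t - s\<bar> * sqrt M) \<longlongrightarrow> \<bar>s - s\<bar> * sqrt M) (at s within A)" by (intro tendsto_intros)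
    then show "((\<lambda>t. \<bar>t - s\<bar> * sqrt M) \<longlongrightarrow> 0) (at s within A)" by simp
  qed
qed

subsection \<open>Traces\<close>

lemma symbol_annulus_dx:
  assumes F: "symbol d k F" and d: "0 < d"
    and van: "\<And>x. (0, x) \<in> cyl d ==> norm x < r1 \<or> r2 < norm x ==> F (0, x) = 0"
    and z: "(0, x) \<in> cyl d" "norm x < r1 \<or> r2 < norm x"
  shows "dd (0, e) F (0, x) = 0"
proof -
  let ?S = "(unit_ball - {0}) \<inter> ({x. norm x < r1} \<union> {x. r2 < norm x})"
  have "open ?S" by (intro open_Int open_Un open_delete open_ball open_Collect_less continuous_intros)
  moreover have "x \<in> ?S" using z by (auto simp: cyl_def)
  moreover have "F (0, y) = 0" if "y \<in> ?S" for y using that d by (intro van) (auto simp: cyl_def)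
  ultimately have "((\<lambda>x. F (0, x)) has_derivative (\<lambda>_. 0)) (at x)"
    using has_derivative_transform_within_open[OF has_derivative_const[of 0]] by metis
  from fun_cong[OF has_derivative_unique[OF has_derivative_slice[OF F z(1)] this], of e] show ?thesis .
qed

text \<open>A symbol supported in a closed annulus inside the punctured ball extends by 0, as do all its
  derivatives.\<close>

lemma C_k_extension:
  assumes d: "0 < d" and r: "0 < r1" "r2 < 1"
  shows "symbol d k F ==> (\<And>x. (0, x) \<in> cyl d ==> norm x < r1 \<or> r2 < norm x ==> F (0, x) = 0) ==>
    C_k N (\<lambda>x. if x \<in> unit_ball - {0} then F (0, x) else 0)"
proof (induction N arbitrary: k F)
  have ext: "((\<lambda>x. if x \<in> unit_ball - {0} then F (0, x) else 0) has_derivative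
      (if x \<in> unit_ball - {0} then (\<lambda>h. dd (0, h) F (0, x)) else (\<lambda>h. 0))) (at x)"
    if F: "symbol d k F" and van: "\<And>x. (0, x) \<in> cyl d ==> norm x < r1 \<or> r2 < norm x ==> F (0, x) = 0"
    for k x and F :: "real \<times> 'a => 'b"
  proof (cases "x \<in> unit_ball - {0}")
    case True
    have "open (unit_ball - {0::'a})" by (intro open_delete open_ball)
    from has_derivative_transform_within_open[OF has_derivative_slice[OF F] this True] True d
    show ?thesis by (auto simp: cyl_def)
  next
    case False
    let ?S = "{x::'a. norm x < r1} \<union> {x. r2 < norm x}"
    have "open ?S" by (intro open_Un open_Collect_less continuous_intros)
    moreover have "x \<in> ?S" using False r by auto
    moreover have "0 = (if y \<in> unit_ball - {0} then F (0, y) else 0)" if "y \<in> ?S" for y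
      using that van[of y] d by (auto simp: cyl_def)
    ultimately have "((\<lambda>x. if x \<in> unit_ball - {0} then F (0, x) else 0) has_derivative (\<lambda>_. 0)) (at x)"
      by (rule has_derivative_transform_within_open[OF has_derivative_const[of 0]])
    then show ?thesis unfolding if_not_P[OF False] .
  qed
  {
    case (0 k F)
    show ?case
      using has_derivative_continuous[OF ext[OF 0]] by (simp add: continuous_on_eq_continuous_within)
  next
    case (Suc N k F)
    let ?f = "\<lambda>x. if x \<in> unit_ball - {0} then F (0, x) else 0"
    have "?f differentiable (at x)" for x using ext[OF Suc.prems, of x] unfolding differentiable_def by blast
    moreover have "C_k N (\<lambda>x. frechet_derivative ?f (at x) e)" if e: "e \<in> Basis" for e
    proof -
      have "(\<lambda>x. frechet_derivative ?f (at x) e) = (\<lambda>x. if x \<in> unit_ball - {0} then dd (0, e) F (0, x) else 0)"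
        by (rule HOL.ext) (subst dd_eqI[OF ext[OF Suc.prems]], simp_all)
      then show ?thesis
        by (simp only: Suc.IH[OF sym_dx[OF Suc.prems(1) e] symbol_annulus_dx[OF Suc.prems(1) d Suc.prems(2)]])
    qed
    ultimately show ?case by simp
  }
qed

lemma measurable_sgn: "(sgn :: 'a::euclidean_space => 'a) \<in> borel_measurable borel"
  unfolding sgn_div_norm[abs_def] by (intro borel_measurable_scaleR borel_measurable_inverse borel_measurable_norm) auto

text \<open>The extension by 0 is itself smooth up to the boundary, so the constant sequence shows that the
  trace vanishes.\<close>

lemma has_trace_0:
  fixes F :: "real \<times> 'a::euclidean_space => 'b::euclidean_space"
  assumes d: "0 < d" and r: "0 < r1" "r2 < 1" and F: "symbol d k F" "2 * (k + 1) < DIM('a)"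
    and van: "\<And>x. (0, x) \<in> cyl d ==> norm x < r1 \<or> r2 < norm x ==> F (0, x) = 0"
    and u: "rep 0 F u"
  shows "has_trace u (\<lambda>_. 0)"
  unfolding has_trace_def
proof (intro conjI exI allI)
  let ?f = "\<lambda>x. if x \<in> unit_ball - {0} then F (0, x) else 0"
  have d0: "\<bar>0\<bar> < d" using d by simp
  show "sobolev 1 u" by (rule rep_sobolev[OF F d0 u])
  show "(\<lambda>_. 0) \<in> borel_measurable borel" by simp
  have Ck: "C_k N ?f" for N by (rule C_k_extension[OF d r F(1) van])
  then show "smooth ((\<lambda>_::nat. ?f) k)" for k by (simp add: smooth_def)
  have "rep 0 (\<lambda>z. 0) (\<lambda>x. ?f x - u x)"
    using u AE_lebesgue_ball_nz unfolding rep_def by eventually_elim auto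
  note rep0 = this
  have "(LINT x|lebesgue_on unit_ball. (norm (weak_partials es (\<lambda>x. ?f x - u x) x))\<^sup>2) = 0"
    if "set es \<subseteq> Basis \<and> length es \<le> 1" for es
  proof -
    have z: "dds es (\<lambda>z. 0) = (\<lambda>z. 0 :: 'b)" for es :: "'a list"
      by (induction es) auto
    have "rep 0 (dds es (\<lambda>z. 0)) (weak_partials es (\<lambda>x. ?f x - u x))"
      by (rule rep_weak_partials[OF sym_const[of d 0 0] d0 rep0]) (use that F(2) in auto)
    then have "AE x in lebesgue_on unit_ball. (norm (weak_partials es (\<lambda>x. ?f x - u x) x))\<^sup>2 = 0"
      unfolding rep_def z by eventually_elim simp
    then show ?thesis by (rule integral_eq_zero_AE)
  qed
  then have "sobolev_norm 1 (\<lambda>x. ?f x - u x) = 0" unfolding sobolev_norm_def by simp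
  then show "(\<lambda>k. sobolev_norm 1 (\<lambda>x. (\<lambda>_::nat. ?f) k x - u x)) \<longlonglongrightarrow> 0" by simp
  have fm: "?f \<in> borel_measurable borel"
    using Ck[of 0] by (simp add: borel_measurable_continuous_onI)
  have "(\<integral>\<^sup>+ x. ennreal ((norm (?f x - 0))\<^sup>2) \<partial>surface_measure) = 0"
  proof -
    have "(\<integral>\<^sup>+ x. ennreal ((norm (?f x - 0))\<^sup>2) \<partial>surface_measure) =
        (\<integral>\<^sup>+ x. ennreal ((norm (?f (sgn x) - 0))\<^sup>2) \<partial>(scale_measure (of_nat DIM('a)) (restrict_space lborel unit_ball)))"
      unfolding surface_measure_def
    proof (rule nn_integral_distr)
      have "(sgn :: 'a => 'a) \<in> restrict_space borel unit_ball \<rightarrow>\<^sub>M borel"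
        by (rule measurable_restrict_space1[OF measurable_sgn])
      then show "(sgn :: 'a => 'a) \<in> scale_measure (of_nat DIM('a)) (restrict_space lborel unit_ball) \<rightarrow>\<^sub>M borel"
        by (simp add: measurable_cong_sets[OF trans[OF sets_scale_measure sets_restrict_space_cong[OF sets_lborel]] refl])
      have "(\<lambda>x. ennreal ((norm (?f x - 0))\<^sup>2)) \<in> borel_measurable borel"
        using fm by (intro measurable_compose[OF _ measurable_ennreal] borel_measurable_power borel_measurable_norm borel_measurable_diff) auto
      then show "(\<lambda>x. ennreal ((norm (?f x - 0))\<^sup>2)) \<in> borel_measurable (distr (scale_measure (of_nat DIM('a)) (restrict_space lborel unit_ball)) borel sgn)"
        by simp
    qed
    also have "?f (sgn x) = 0" for x by (auto simp: norm_sgn)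
    then have "(\<lambda>x. ennreal ((norm (?f (sgn x) - 0))\<^sup>2)) = (\<lambda>x. 0)" by (intro ext) simp
    finally show ?thesis by simp
  qed
  then show "(\<lambda>k. \<integral>\<^sup>+ x. ennreal ((norm ((\<lambda>_::nat. ?f) k x - 0))\<^sup>2) \<partial>surface_measure) \<longlonglongrightarrow> 0" by simp
qed

section \<open>The second variation as a quadratic form\<close>

definition lin :: "real => real => (nat => real) => nat => real" where
  "lin n a b j = b (j + 2) + (n - 2) * b (j + 1) - (n - 1) * ((cos a)\<^sup>2 - (sin a)\<^sup>2) * b j"

lemmas jet2_rules = jet2_const jet2_times jet2_sin jet2_cos jet2_add jet2_diff jet2_minus jet2_power2 jet2_mult

text \<open>In each of the following jets the first order part is the linearised operator \<open>lin\<close> and its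
  derivatives, and the second order part comes from the expansion of the trigonometric terms.\<close>

lemma jet2_tens:
  "jet2 (tens n a b) (- ((n - 1) * (sin a * cos a))) (lin n a b 0) (4 * (n - 1) * (sin a * cos a) * (b 0)\<^sup>2)"
  unfolding tens_def[abs_def]
  by (rule jet2_eqI, (rule jet2_rules)+) (simp_all add: lin_def power2_eq_square numeral_2_eq_2 algebra_simps)

lemma jet2_tens1:
  "jet2 (tens1 n a b) 0 (lin n a b 1) (8 * (n - 1) * (sin a * cos a) * (b 0 * b 1))"
  unfolding tens1_def[abs_def]
  by (rule jet2_eqI, (rule jet2_rules)+) (simp_all add: lin_def power2_eq_square eval_nat_numeral algebra_simps)

lemma jet2_tens2:
  "jet2 (tens2 n a b) 0 (lin n a b 2) (8 * (n - 1) * (sin a * cos a) * ((b 1)\<^sup>2 + b 0 * b 2))"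
  unfolding tens2_def[abs_def]
  by (rule jet2_eqI, (rule jet2_rules)+) (simp_all add: lin_def power2_eq_square eval_nat_numeral algebra_simps)

lemma jet2_tens3:
  "jet2 (tens3 n a b) 0 (lin n a b 3) (8 * (n - 1) * (sin a * cos a) * (3 * (b 1 * b 2) + b 0 * b 3))"
  unfolding tens3_def[abs_def]
  by (rule jet2_eqI, (rule jet2_rules)+) (simp_all add: lin_def power2_eq_square eval_nat_numeral algebra_simps)

definition lap_coeff :: "real => real => real" where
  "lap_coeff n a = 8 - 2 * n - (n - 1) * (cos a)\<^sup>2"

lemma jet2_lap_coeff:
  "jet2 (\<lambda>t. 8 - 2 * n - (n - 1) * (cos (a + t * b))\<^sup>2) (lap_coeff n a)
    (2 * (n - 1) * (sin a * cos a) * b) (2 * (n - 1) * ((cos a)\<^sup>2 - (sin a)\<^sup>2) * b\<^sup>2)"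
  by (rule jet2_eqI, (rule jet2_rules)+) (simp_all add: lap_coeff_def power2_eq_square algebra_simps)

definition dlap :: "real => real => (nat => real) => real" where
  "dlap n a b = - (lin n a b 2 + (n - 6) * lin n a b 1 + lap_coeff n a * lin n a b 0 -
     2 * ((n - 1) * (sin a * cos a))\<^sup>2 * b 0)"

definition ddlap :: "real => real => (nat => real) => real" where
  "ddlap n a b = - ((n - 1) * (sin a * cos a)) *
     (8 * ((b 1)\<^sup>2 + b 0 * b 2) + 8 * (n - 6) * (b 0 * b 1) + 4 * lap_coeff n a * (b 0)\<^sup>2 +
      4 * b 0 * lin n a b 0 - 2 * (n - 1) * ((cos a)\<^sup>2 - (sin a)\<^sup>2) * (b 0)\<^sup>2)"

lemma jet2_lap: "jet2 (lap n a b) (lap_coeff n a * ((n - 1) * (sin a * cos a))) (dlap n a b) (ddlap n a b)"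
  unfolding lap_def[abs_def]
  by (rule jet2_eqI, rule jet2_minus jet2_add jet2_mult jet2_const jet2_lap_coeff jet2_tens jet2_tens1 jet2_tens2,
      (rule jet2_lap_coeff jet2_tens jet2_tens1 jet2_tens2 jet2_const jet2_add jet2_mult)+)
    (simp_all add: dlap_def ddlap_def power2_eq_square algebra_simps)

definition dlap1 :: "real => real => (nat => real) => real" where
  "dlap1 n a b = - (lin n a b 3 + (n - 6) * lin n a b 2 + lap_coeff n a * lin n a b 1 -
     2 * ((n - 1) * (sin a * cos a))\<^sup>2 * b 1)"

definition ddlap1 :: "real => real => (nat => real) => real" where
  "ddlap1 n a b = - ((n - 1) * (sin a * cos a)) *
     (8 * (3 * (b 1 * b 2) + b 0 * b 3) + 8 * (n - 6) * ((b 1)\<^sup>2 + b 0 * b 2) + 8 * lap_coeff n a * (b 0 * b 1) +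
      4 * b 0 * lin n a b 1 + 4 * b 1 * lin n a b 0 - 4 * (n - 1) * ((cos a)\<^sup>2 - (sin a)\<^sup>2) * (b 0 * b 1))"

lemma jet2_lap1: "jet2 (lap1 n a b) 0 (dlap1 n a b) (ddlap1 n a b)"
  unfolding lap1_def[abs_def]
  by (rule jet2_eqI, rule jet2_minus,
      (rule jet2_lap_coeff jet2_tens jet2_tens1 jet2_tens2 jet2_tens3 jet2_const jet2_times jet2_sin jet2_cos jet2_add jet2_mult)+)
    (simp_all add: dlap1_def ddlap1_def power2_eq_square algebra_simps)

lemma jet2_curvc:
  "jet2 (curvc n a b) 0 (- ((n - 1) * (sin a * cos a)) * (sin a * b 1))
    (2 * sin a * b 1 * lin n a b 0 - 2 * ((n - 1) * (sin a * cos a)) * (cos a * (b 0 * b 1)))"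
  unfolding curvc_def[abs_def]
  by (rule jet2_eqI, (rule jet2_tens jet2_times jet2_sin jet2_mult)+) (simp_all add: algebra_simps)

lemma jet2_curvc1:
  "jet2 (curvc1 n a b) 0 (- ((n - 1) * (sin a * cos a)) * (sin a * b 2))
    (2 * sin a * b 1 * lin n a b 1 + 2 * sin a * b 2 * lin n a b 0 -
     2 * ((n - 1) * (sin a * cos a)) * (cos a * ((b 1)\<^sup>2 + b 0 * b 2)))"
  unfolding curvc1_def[abs_def]
  by (rule jet2_eqI, (rule jet2_tens jet2_tens1 jet2_times jet2_sin jet2_cos jet2_add jet2_power2 jet2_mult)+)
    (simp_all add: power2_eq_square algebra_simps)

lemma jet2_sum_squares:
  assumes "jet2 f x0 x1 x2" "jet2 g y0 y1 y2"
  shows "jet2 (\<lambda>t. (f t)\<^sup>2 + k * (g t)\<^sup>2) (x0\<^sup>2 + k * y0\<^sup>2) (2 * x0 * x1 + k * (2 * y0 * y1))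
    (2 * x1\<^sup>2 + 2 * x0 * x2 + k * (2 * y1\<^sup>2 + 2 * y0 * y2))"
  by (intro jet2_add jet2_cmult jet2_power2 assms)

lemma jet2_mult_cos:
  assumes "jet2 f x0 x1 x2"
  shows "jet2 (\<lambda>t. f t * cos (a + t * b)) (x0 * cos a) (x1 * cos a - x0 * sin a * b)
    (x2 * cos a - 2 * x1 * sin a * b - x0 * cos a * b\<^sup>2)"
  by (rule jet2_eqI[OF jet2_mult[OF assms jet2_cos]]) (simp_all add: algebra_simps)

definition form_odd :: "real => real => (nat => real) => real => real => real => real => real => real => real" where
  "form_odd n a b k x0 x1 x2 y1 y2 =
     2 * (y1 - k * x1)\<^sup>2 - 2 * (k * x0) * (y2 - k * x2) +
     (n - 1) * (2 * (x1 * cos a - x0 * sin a * b 0)\<^sup>2 +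
       2 * (x0 * cos a) * (x2 * cos a - 2 * x1 * sin a * b 0 - x0 * cos a * (b 0)\<^sup>2))"

text \<open>To be applied with \<open>f\<close> the coefficient of the tension field or of its Laplacian and \<open>g\<close> its
  derivative with respect to $\ln |x|$, which vanishes at \<open>t = 0\<close> because the latitude is constant.\<close>

lemma jet2_odd:
  assumes f: "jet2 f x0 x1 x2" and g: "jet2 g 0 y1 y2"
  shows "\<exists>u v. jet2 (\<lambda>t. (g t - k * f t)\<^sup>2 + (n - 1) * (f t * cos (a + t * b 0))\<^sup>2) u v (form_odd n a b k x0 x1 x2 y1 y2)"
proof (intro exI)
  show "jet2 (\<lambda>t. (g t - k * f t)\<^sup>2 + (n - 1) * (f t * cos (a + t * b 0))\<^sup>2)
      ((0 - k * x0)\<^sup>2 + (n - 1) * (x0 * cos a)\<^sup>2)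
      (2 * (0 - k * x0) * (y1 - k * x1) + (n - 1) * (2 * (x0 * cos a) * (x1 * cos a - x0 * sin a * b 0)))
      (form_odd n a b k x0 x1 x2 y1 y2)"
    by (rule jet2_eqI[OF jet2_sum_squares[OF jet2_diff[OF g jet2_cmult[OF f]] jet2_mult_cos[OF f]]]) (simp_all add: form_odd_def)
qed

text \<open>A quadratic form in the derivatives of a profile with respect to $s = \ln |x|$ acts on the
  borderline profile $e^{-s/2} = |x|^{-1/2}$ through the values \<open>(- 1/2) ^ j\<close>. When the result is
  negative, continuity and homogeneity allow this profile to be cut off slowly without losing the
  sign.\<close>

definition negative_form :: "((nat => real) => real) => bool" where
  "negative_form Q \<longleftrightarrow>
     (\<forall>S f. (\<forall>j. continuous_on S (f j)) --> continuous_on S (\<lambda>z::real \<times> real. Q (\<lambda>j. f j z))) \<and>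
     (\<forall>c b. Q (\<lambda>j. c * b j) = c\<^sup>2 * Q b) \<and> Q (\<lambda>j. (- 1/2) ^ j) < 0"

definition form3 :: "real => (nat => real) => real" where
  "form3 a b = form_odd 7 a b 2 (- (6 * (sin a * cos a))) (lin 7 a b 0) (24 * (sin a * cos a) * (b 0)\<^sup>2)
     (lin 7 a b 1) (48 * (sin a * cos a) * (b 0 * b 1))"

definition form4 :: "real => (nat => real) => real" where
  "form4 a b = 2 * (dlap 9 a b)\<^sup>2 + 2 * (lap_coeff 9 a * (8 * (sin a * cos a))) * ddlap 9 a b"

definition form4_ES :: "real => (nat => real) => real" where
  "form4_ES a b = form4 a b + 16 * (8 * (sin a * cos a) * (sin a * b 1))\<^sup>2"

definition form5 :: "real => (nat => real) => real" where
  "form5 a b = form_odd 11 a b 4 (lap_coeff 11 a * (10 * (sin a * cos a))) (dlap 11 a b) (ddlap 11 a b)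
     (dlap1 11 a b) (ddlap1 11 a b)"

definition form5_ES :: "real => (nat => real) => real" where
  "form5_ES a b = (let p = 10 * (sin a * cos a); x0 = lap_coeff 11 a * p;
       u1 = - p * (sin a * b 1); u2 = 2 * sin a * b 1 * lin 11 a b 0 - 2 * p * (cos a * (b 0 * b 1));
       v1 = - p * (sin a * b 2);
       v2 = 2 * sin a * b 1 * lin 11 a b 1 + 2 * sin a * b 2 * lin 11 a b 0 - 2 * p * (cos a * ((b 1)\<^sup>2 + b 0 * b 2))
     in 2 * (dlap1 11 a b - 4 * dlap 11 a b + 10 * (u1 * cos a))\<^sup>2 -
       2 * (4 * x0) * (ddlap1 11 a b - 4 * ddlap 11 a b + 10 * (u2 * cos a - 2 * u1 * sin a * b 0)) +
       10 * (2 * (dlap 11 a b * cos a - x0 * sin a * b 0 + v1 + 5 * u1)\<^sup>2 +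
         2 * (x0 * cos a) * (ddlap 11 a b * cos a - 2 * dlap 11 a b * sin a * b 0 - x0 * cos a * (b 0)\<^sup>2 + v2 + 5 * u2)))"

lemmas form_defs = form3_def form4_def form4_ES_def form5_def form5_ES_def Let_def form_odd_def dlap_def ddlap_def dlap1_def
  ddlap1_def lap_coeff_def lin_def

lemma form_continuous:
  fixes f :: "nat => real \<times> real => real"
  assumes "\<And>j. continuous_on S (f j)"
  shows "continuous_on S (\<lambda>z. form3 a (\<lambda>j. f j z))" "continuous_on S (\<lambda>z. form4 a (\<lambda>j. f j z))"
    "continuous_on S (\<lambda>z. form4_ES a (\<lambda>j. f j z))" "continuous_on S (\<lambda>z. form5 a (\<lambda>j. f j z))"
    "continuous_on S (\<lambda>z. form5_ES a (\<lambda>j. f j z))"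
  unfolding form_defs by (intro continuous_intros assms)+

lemma form_scale:
  "form3 a (\<lambda>j. c * b j) = c\<^sup>2 * form3 a b" "form4 a (\<lambda>j. c * b j) = c\<^sup>2 * form4 a b"
  "form4_ES a (\<lambda>j. c * b j) = c\<^sup>2 * form4_ES a b" "form5 a (\<lambda>j. c * b j) = c\<^sup>2 * form5 a b"
  "form5_ES a (\<lambda>j. c * b j) = c\<^sup>2 * form5_ES a b"
  subgoal unfolding form_defs by algebra
  subgoal unfolding form_defs by algebra
  subgoal unfolding form_defs by algebra
  subgoal unfolding form_defs by algebra
  subgoal unfolding form_defs by algebra
  done

text \<open>The values are those of \<open>32 * (- 1/2) ^ j\<close>; the factor clears denominators. Only even powers of
  \<open>sin a\<close> and of \<open>cos a\<close> remain after expansion, so the result is a polynomial in \<open>(cos a)\<^sup>2\<close>.\<close>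

lemma form_geometric:
  fixes b :: "nat => real"
  assumes b: "b 0 = 32" "b 1 = - 16" "b 2 = 8" "b 3 = - 4" "b 4 = 2" "b 5 = - 1"
    and s: "(sin a)\<^sup>2 = 1 - w" and c: "(cos a)\<^sup>2 = w"
  shows "form3 a b = 180000 - 1200384 * w - 5234688 * w ^ 2 + 7962624 * w ^ 3"
    "form4 a b = 5848200 - 20103680 * w - 219996160 * w ^ 2 + 61865984 * w ^ 3 + 268435456 * w ^ 4"
    "form4_ES a b = 5848200 - 19841536 * w - 220520448 * w ^ 2 + 62128128 * w ^ 3 + 268435456 * w ^ 4"
    "form5 a b = 362074050 - 534280400 * w - 14411907200 * w ^ 2 - 5583232000 * w ^ 3 + 18595840000 * w ^ 4 + 10240000000 * w ^ 5"
    "form5_ES a b = 362074050 - 509576400 * w - 14445955200 * w ^ 2 - 5589248000 * w ^ 3 + 18611200000 * w ^ 4 + 10240000000 * w ^ 5"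
proof -
  have [simp]: "b (Suc 0) = - 16" "b (Suc (Suc 0)) = 8" "b (Suc (Suc (Suc 0))) = - 4" using b by (simp_all add: eval_nat_numeral)
  note b' = b b(2)[unfolded One_nat_def]
  show "form3 a b = 180000 - 1200384 * w - 5234688 * w ^ 2 + 7962624 * w ^ 3"
    unfolding form_defs using s c by (simp add: b', algebra)
  show "form4 a b = 5848200 - 20103680 * w - 219996160 * w ^ 2 + 61865984 * w ^ 3 + 268435456 * w ^ 4"
    unfolding form_defs using s c by (simp add: b', algebra)
  show "form4_ES a b = 5848200 - 19841536 * w - 220520448 * w ^ 2 + 62128128 * w ^ 3 + 268435456 * w ^ 4"
    unfolding form_defs using s c by (simp add: b', algebra)
  show "form5 a b = 362074050 - 534280400 * w - 14411907200 * w ^ 2 - 5583232000 * w ^ 3 + 18595840000 * w ^ 4 + 10240000000 * w ^ 5"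
    unfolding form_defs using s c by (simp add: b', algebra)
  show "form5_ES a b = 362074050 - 509576400 * w - 14445955200 * w ^ 2 - 5589248000 * w ^ 3 + 18611200000 * w ^ 4 + 10240000000 * w ^ 5"
    unfolding form_defs using s c by (simp add: b', algebra)
qed

definition r_energy_form :: "nat => real => (nat => real) => real" where
  "r_energy_form r = (if r = 3 then form3 else if r = 4 then form4 else form5)"

definition ES_energy_form :: "nat => real => (nat => real) => real" where
  "ES_energy_form r = (if r = 3 then form3 else if r = 4 then form4_ES else form5_ES)"

text \<open>Modulo the quadratic equation for \<open>w = (cos a)\<^sup>2\<close> each form is an increasing affine function of \<open>w\<close>
  that is negative at \<open>1/4\<close>, and \<open>w < 1/4\<close> in all cases.\<close>

lemma negative_energy_form:
  assumes "critical_latitude r n a"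
  shows "negative_form (r_energy_form r a)" "negative_form (ES_energy_form r a)"
proof -
  let ?b = "\<lambda>j. 32 * (- 1/2) ^ j :: real"
  define w where "w = (cos a)\<^sup>2"
  have s: "(sin a)\<^sup>2 = 1 - w" by (simp add: w_def sin_squared_eq)
  have b: "?b 0 = 32" "?b 1 = - 16" "?b 2 = 8" "?b 3 = - 4" "?b 4 = 2" "?b 5 = - 1"
    by (simp_all add: power_divide)
  note geo = form_geometric[OF b s w_def[symmetric]]
  have w: "r = 3 \<and> 9 * w\<^sup>2 + 2 * w - 1 = 0 \<or> r = 4 \<and> 32 * w\<^sup>2 + 6 * w - 3 = 0 \<or> r = 5 \<and> 25 * w\<^sup>2 + 4 * w - 2 = 0"
    using assms unfolding critical_latitude_def w_def by blast
  \<comment> \<open>at \<open>w = 1/4\<close> each of the quadratic polynomials is positive\<close>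
  have w4: "w < 1/4"
  proof (rule ccontr)
    assume *: "\<not> w < 1/4"
    then have "(1/4)\<^sup>2 \<le> w\<^sup>2" by (intro power_mono) auto
    with w * show False by (auto simp: power2_eq_square)
  qed
  have "r_energy_form r a ?b < 0 \<and> ES_energy_form r a ?b < 0"
    using w
  proof (elim disjE conjE)
    assume r: "r = 3" and w: "9 * w\<^sup>2 + 2 * w - 1 = 0"
    have "form3 a ?b = 1240832 * w - 598240" unfolding geo using w by algebra
    with r w4 show ?thesis by (simp add: r_energy_form_def ES_energy_form_def)
  next
    assume r: "r = 4" and w: "32 * w\<^sup>2 + 6 * w - 3 = 0"
    have "form4 a ?b = 17913856 * w - 12619896" "form4_ES a ?b = 18308096 * w - 12673656" unfolding geo using w by algebra+
    with r w4 show ?thesis by (simp add: r_energy_form_def ES_energy_form_def)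
  next
    assume r: "r = 5" and w: "25 * w\<^sup>2 + 4 * w - 2 = 0"
    have "25 * form5 a ?b = 19124370864 * w - 14666061582" "25 * form5_ES a ?b = 19850877360 * w - 14728988430"
      unfolding geo using w by algebra+
    with r w4 show ?thesis by (simp add: r_energy_form_def ES_energy_form_def)
  qed
  then have neg: "r_energy_form r a (\<lambda>j. (- 1/2) ^ j) < 0" "ES_energy_form r a (\<lambda>j. (- 1/2) ^ j) < 0"
    using w form_scale[of a 32 "\<lambda>j. (- 1/2) ^ j"] by (auto simp: r_energy_form_def ES_energy_form_def)
  show "negative_form (r_energy_form r a)" "negative_form (ES_energy_form r a)"
    unfolding negative_form_def using neg w
    by (auto simp: r_energy_form_def ES_energy_form_def form_scale intro!: form_continuous)
qed

text \<open>The densities along the family are explicit functions of \<open>t\<close> and of the derivatives of the profile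
  at \<open>x\<close>, so the second variation of the density is a quadratic form in these derivatives.\<close>

lemma (in profile) second_derivative_energy_density:
  assumes crit: "critical_latitude r DIM('a) a" and x: "(0, x) \<in> cyl d"
  shows "dd (1, 0) (dd (1, 0) (r_density r (eqv lat))) (0, x) = qq (0, x) ^ (2 * r) * r_energy_form r a (prof \<beta> (0, x))"
    "dd (1, 0) (dd (1, 0) (ES_density r (eqv lat))) (0, x) = qq (0, x) ^ (2 * r) * ES_energy_form r a (prof \<beta> (0, x))"
proof -
  let ?b = "prof \<beta> (0, x)"
  have p: "prof \<beta> (t, x) = ?b" for t by (simp add: prof_def fun_eq_iff)
  have q: "qq (t, x) = qq (0, x)" for t by (simp add: qq_def)
  have sr: "symbol d (2 * r) (r_density r (eqv lat))" and sE: "symbol d (2 * r) (ES_density r (eqv lat))"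
    using energy_density_r[OF crit, where ?'b = "'a \<times> real"] sym_Phi unfolding energy_density_def by blast+
  have c: "r = 3 \<and> DIM('a) = 7 \<or> r = 4 \<and> DIM('a) = 9 \<or> r = 5 \<and> DIM('a) = 11"
    using crit unfolding critical_latitude_def by blast
  have odd: "dd (1, 0) (dd (1, 0) G) (0, x) = qq (0, x) ^ m * y"
    if G: "symbol d k G" and j: "\<exists>u v. jet2 h u v y" and e: "\<And>t. (t, x) \<in> cyl d ==> G (t, x) = qq (t, x) ^ m * h t" for k m and G :: "real \<times> 'a => real" and h :: "real => real" and y :: real
  proof -
    obtain u v where "jet2 h u v y" using j by blast
    have "G (t, x) = qq (0, x) ^ m * h t" if "(t, x) \<in> cyl d" for t using e[OF that] q[of t] by simp
    from dd_time_jet2[OF G x \<open>jet2 h u v y\<close> this] show ?thesis .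
  qed
  from c show "dd (1, 0) (dd (1, 0) (r_density r (eqv lat))) (0, x) = qq (0, x) ^ (2 * r) * r_energy_form r a ?b"
  proof (elim disjE conjE)
    assume r: "r = 3" and n: "DIM('a) = 7"
    show ?thesis
    proof (rule odd[OF sr])
      show "\<exists>u v. jet2 (\<lambda>t. (tens1 7 a ?b t - 2 * tens 7 a ?b t)\<^sup>2 + (7 - 1) * (tens 7 a ?b t * cos (a + t * ?b 0))\<^sup>2) u v (r_energy_form r a ?b)"
        using jet2_odd[OF jet2_tens[of 7 a ?b] jet2_tens1[of 7 a ?b], where k = 2 and n = 7 and a = a and b = ?b] r by (simp add: r_energy_form_def form3_def)
      show "r_density r (eqv lat) (t, x) = qq (t, x) ^ (2 * r) * ((tens1 7 a ?b t - 2 * tens 7 a ?b t)\<^sup>2 + (7 - 1) * (tens 7 a ?b t * cos (a + t * ?b 0))\<^sup>2)"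
        if "(t, x) \<in> cyl d" for t using dens_odd_0_profile[OF that] r n by (simp add: r_density_def p[of t])
    qed
  next
    assume r: "r = 4" and n: "DIM('a) = 9"
    show ?thesis
    proof (rule odd[OF sr])
      show "\<exists>u v. jet2 (\<lambda>t. (lap 9 a ?b t)\<^sup>2) u v (r_energy_form r a ?b)"
        using jet2_power2[OF jet2_lap[of 9 a ?b]] r by (auto simp: r_energy_form_def form4_def)
      show "r_density r (eqv lat) (t, x) = qq (t, x) ^ (2 * r) * (lap 9 a ?b t)\<^sup>2"
        if "(t, x) \<in> cyl d" for t using dens_even_1_profile[OF that] r n by (simp add: r_density_def p[of t])
    qed
  next
    assume r: "r = 5" and n: "DIM('a) = 11"
    show ?thesis
    proof (rule odd[OF sr])
      show "\<exists>u v. jet2 (\<lambda>t. (lap1 11 a ?b t - 4 * lap 11 a ?b t)\<^sup>2 + (11 - 1) * (lap 11 a ?b t * cos (a + t * ?b 0))\<^sup>2) u v (r_energy_form r a ?b)"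
        using jet2_odd[OF jet2_lap[of 11 a ?b] jet2_lap1[of 11 a ?b], where k = 4 and n = 11 and a = a and b = ?b] r by (simp add: r_energy_form_def form5_def)
      show "r_density r (eqv lat) (t, x) = qq (t, x) ^ (2 * r) * ((lap1 11 a ?b t - 4 * lap 11 a ?b t)\<^sup>2 + (11 - 1) * (lap 11 a ?b t * cos (a + t * ?b 0))\<^sup>2)"
        if "(t, x) \<in> cyl d" for t using dens_odd_1_profile[OF that] r n by (simp add: r_density_def p[of t])
    qed
  qed
  from c show "dd (1, 0) (dd (1, 0) (ES_density r (eqv lat))) (0, x) = qq (0, x) ^ (2 * r) * ES_energy_form r a ?b"
  proof (elim disjE conjE)
    assume r: "r = 3" and n: "DIM('a) = 7"
    show ?thesis
    proof (rule odd[OF sE])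
      show "\<exists>u v. jet2 (\<lambda>t. (tens1 7 a ?b t - 2 * tens 7 a ?b t)\<^sup>2 + (7 - 1) * (tens 7 a ?b t * cos (a + t * ?b 0))\<^sup>2) u v (ES_energy_form r a ?b)"
        using jet2_odd[OF jet2_tens[of 7 a ?b] jet2_tens1[of 7 a ?b], where k = 2 and n = 7 and a = a and b = ?b] r by (simp add: ES_energy_form_def form3_def)
      show "ES_density r (eqv lat) (t, x) = qq (t, x) ^ (2 * r) * ((tens1 7 a ?b t - 2 * tens 7 a ?b t)\<^sup>2 + (7 - 1) * (tens 7 a ?b t * cos (a + t * ?b 0))\<^sup>2)"
        if "(t, x) \<in> cyl d" for t using dens_odd_0_profile[OF that] r n by (simp add: ES_density_def p[of t])
    qed
  next
    assume r: "r = 4" and n: "DIM('a) = 9"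
    show ?thesis
    proof (rule odd[OF sE])
      show "\<exists>u v. jet2 (\<lambda>t. (lap 9 a ?b t)\<^sup>2 + 8 * (curvc 9 a ?b t)\<^sup>2) u v (ES_energy_form r a ?b)"
        using jet2_sum_squares[OF jet2_lap[of 9 a ?b] jet2_curvc[of 9 a ?b], of 8] r
        by (auto simp: ES_energy_form_def form4_ES_def form4_def)
      show "ES_density r (eqv lat) (t, x) = qq (t, x) ^ (2 * r) * ((lap 9 a ?b t)\<^sup>2 + 8 * (curvc 9 a ?b t)\<^sup>2)"
        if "(t, x) \<in> cyl d" for t using dens_ES4_profile[OF that] r n by (simp add: ES_density_def p[of t])
    qed
  next
    assume r: "r = 5" and n: "DIM('a) = 11"
    let ?f = "\<lambda>t. lap1 11 a ?b t - 4 * lap 11 a ?b t + 10 * (curvc 11 a ?b t * cos (a + t * ?b 0))"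
    let ?g = "\<lambda>t. lap 11 a ?b t * cos (a + t * ?b 0) + curvc1 11 a ?b t + 5 * curvc 11 a ?b t"
    show ?thesis
    proof (rule odd[OF sE])
      note f = jet2_add[OF jet2_diff[OF jet2_lap1[of 11 a ?b] jet2_cmult[OF jet2_lap[of 11 a ?b], of 4]] jet2_cmult[OF jet2_mult_cos[OF jet2_curvc[of 11 a ?b], of a "?b 0"], of 10]]
      note g = jet2_add[OF jet2_add[OF jet2_mult_cos[OF jet2_lap[of 11 a ?b], of a "?b 0"] jet2_curvc1[of 11 a ?b]] jet2_cmult[OF jet2_curvc[of 11 a ?b], of 5]]
      show "\<exists>u v. jet2 (\<lambda>t. (?f t)\<^sup>2 + 10 * (?g t)\<^sup>2) u v (ES_energy_form r a ?b)"
        by (rule exI, rule exI, rule jet2_eqI[OF jet2_sum_squares[OF f g, of 10] refl refl])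
          (simp add: r ES_energy_form_def form5_ES_def Let_def)
      show "ES_density r (eqv lat) (t, x) = qq (t, x) ^ (2 * r) * ((?f t)\<^sup>2 + 10 * (?g t)\<^sup>2)"
        if "(t, x) \<in> cyl d" for t using dens_ES5_profile[OF that] r n by (simp add: ES_density_def p[of t])
    qed
  qed
qed

section \<open>Slowly cut off profiles\<close>

lemma derivative_sequence_vanish:
  assumes B: "derivative_sequence B" and S: "open S" "\<And>s. s \<in> S ==> B 0 s = 0"
  shows "s \<in> S ==> B j s = 0"
proof (induction j arbitrary: s)
  case (Suc j)
  have "(B j has_real_derivative 0) (at s)"
    by (rule has_field_derivative_transform_within_open[OF DERIV_const S(1) Suc.prems]) (simp add: Suc.IH)
  then show ?case using DERIV_unique[OF derivative_sequenceD[OF B]] by simp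
qed (rule S(2))

lemma bump_derivative_sequence:
  obtains B m where "derivative_sequence B" "\<And>j s. s \<le> - 4 \<or> - 1 \<le> s ==> B j s = 0"
    "0 < m" "\<And>s. - 3 \<le> s ==> s \<le> - 2 ==> m \<le> B 0 s"
proof -
  let ?b = "\<lambda>s::real. exp_inv 0 (s + 7/2) * exp_inv 0 (- 3/2 + (- 1) * s)"
  have "C_k k ?b" for k
  proof -
    have "C_k k (\<lambda>s::real. s + 7/2)" by (rule C_k_add[OF C_k_linear[OF bounded_linear_ident] C_k_const])
    note 1 = C_k_compose_real[OF derivative_sequence_exp_inv this, of 0]
    have "C_k k (\<lambda>s::real. - 3/2 + (- 1) * s)" by (rule C_k_add[OF C_k_const C_k_linear[OF bounded_linear_mult_right]])
    note 2 = C_k_compose_real[OF derivative_sequence_exp_inv this, of 0]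
    show ?thesis by (rule C_k_mult[OF 1 2])
  qed
  then have "smooth ?b" by (simp add: smooth_def)
  from smooth_derivative_sequence[OF this] obtain B where B: "derivative_sequence B" "B 0 = ?b" by metis
  \<comment> \<open>the support of the bump is kept inside the open interval, so that all derivatives vanish at its ends\<close>
  have o: "open ({..<-7/2} \<union> {-3/2<..} :: real set)" by auto
  have z: "B j s = 0" if "s \<in> {..<-7/2} \<union> {-3/2<..}" for j s
    by (rule derivative_sequence_vanish[OF B(1) o _ that]) (auto simp: B(2) exp_inv_0)
  have "\<exists>x\<in>{-3..-2}. \<forall>y\<in>{-3..-2}. B 0 x \<le> B 0 y"
    by (rule continuous_attains_inf) (auto intro: derivative_sequence_continuous[OF B(1)])
  then obtain u where u: "u \<in> {-3..-2}" "\<And>y. y \<in> {-3..-2} ==> B 0 u \<le> B 0 y" by blast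
  have "0 < B 0 u" using u(1) by (auto simp: B(2) exp_inv_0)
  with u z show thesis by (intro that[OF B(1), of "B 0 u"]) auto
qed

text \<open>If each \<open>B (Suc i)\<close> is the derivative of \<open>B i\<close>, then the \<open>j\<close>-th derivative of
  \<open>s \<mapsto> exp (- s / 2) * B 0 (\<kappa> * s)\<close> is \<open>exp (- s / 2) * damped B \<kappa> j 0 (\<kappa> * s)\<close>. For
  \<open>\<kappa> = 0\<close> only the derivatives of the exponential remain.\<close>

primrec damped :: "(nat => real => real) => real => nat => nat => real => real" where
  "damped B \<kappa> 0 i \<sigma> = B i \<sigma>"
| "damped B \<kappa> (Suc j) i \<sigma> = - 1/2 * damped B \<kappa> j i \<sigma> + \<kappa> * damped B \<kappa> j (Suc i) \<sigma>"

lemma damped_derivative: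
  assumes "derivative_sequence B"
  shows "(damped B \<kappa> j i has_real_derivative damped B \<kappa> j (Suc i) \<sigma>) (at \<sigma>)"
proof (induction j arbitrary: i)
  case 0
  then show ?case using derivative_sequenceD[OF assms] by (simp add: fun_eq_iff[of "damped B \<kappa> 0 i"])
next
  case (Suc j)
  have "((\<lambda>\<sigma>. - 1/2 * damped B \<kappa> j i \<sigma> + \<kappa> * damped B \<kappa> j (Suc i) \<sigma>) has_real_derivative
      - 1/2 * damped B \<kappa> j (Suc i) \<sigma> + \<kappa> * damped B \<kappa> j (Suc (Suc i)) \<sigma>) (at \<sigma>)"
    by (intro DERIV_add DERIV_cmult Suc.IH)
  then show ?case by simp
qed

lemma damped_continuous:
  assumes "derivative_sequence B"
  shows "continuous_on UNIV (\<lambda>z. damped B (fst z) j i (snd z))"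
proof (induction j arbitrary: i)
  case 0
  show ?case using continuous_on_compose2[OF derivative_sequence_continuous[OF assms, of UNIV i] continuous_on_snd[OF continuous_on_id, of UNIV]] by simp
next
  case (Suc j)
  show ?case unfolding damped.simps by (intro continuous_intros Suc.IH)
qed

lemma damped_0: "damped B 0 j i \<sigma> = (- 1/2) ^ j * B i \<sigma>"
  by (induction j) auto

lemma damped_vanish: "(\<And>i. B i \<sigma> = 0) ==> damped B \<kappa> j i \<sigma> = 0"
  by (induction j arbitrary: i) auto

text \<open>The profile is \<open>exp (- s / 2) * b (s / L)\<close> for a fixed bump \<open>b\<close>. The derivatives of \<open>b\<close> carry
  factors \<open>1 / L\<close>, so for large \<open>L\<close> the form, multiplied by \<open>exp s\<close>, is uniformly close to \<open>- c * (b (s / L))\<^sup>2\<close>, which is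
  negative on the middle part and nowhere positive. The error has to stay small after
  multiplication by \<open>P\<close>, a bound for the distortion of the weight on a unit interval.\<close>

lemma negative_profile:
  assumes Q: "negative_form Q" and P: "0 < P"
  obtains L :: nat and \<beta> B \<epsilon> m where "0 < L" "derivative_sequence \<beta>" "\<And>j s. \<bar>\<beta> j s\<bar> \<le> B j"
    "\<And>j s. s \<le> - 4 * real L \<or> - real L \<le> s ==> \<beta> j s = 0"
    "0 < \<epsilon>" "2 * \<epsilon> * P < m" "\<And>s. exp s * Q (\<lambda>j. \<beta> j s) \<le> \<epsilon>"
    "\<And>s. - 3 * real L \<le> s ==> s \<le> - 2 * real L ==> exp s * Q (\<lambda>j. \<beta> j s) \<le> - m"
proof -
  from Q have cont: "\<And>S f. (\<And>j. continuous_on S (f j)) ==> continuous_on S (\<lambda>z::real \<times> real. Q (\<lambda>j. f j z))"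
    and scale: "\<And>c b. Q (\<lambda>j. c * b j) = c\<^sup>2 * Q b" and neg: "Q (\<lambda>j. (- 1/2) ^ j) < 0"
    unfolding negative_form_def by blast+
  obtain b \<mu> where b: "derivative_sequence b" and van: "\<And>j s. s \<le> - 4 \<or> - 1 \<le> s ==> b j s = 0"
    and \<mu>: "0 < \<mu>" "\<And>s. - 3 \<le> s ==> s \<le> - 2 ==> \<mu> \<le> b 0 s"
    using bump_derivative_sequence by metis
  define K where "K z = Q (\<lambda>j. damped b (fst z) j 0 (snd z))" for z :: "real \<times> real"
  have "continuous_on UNIV K" unfolding K_def by (intro cont damped_continuous b)
  then have "uniformly_continuous_on ({0..1} \<times> {-4..-1}) K"
    by (intro compact_uniformly_continuous compact_Times compact_Icc) (rule continuous_on_subset, auto)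
  note uc = this[unfolded uniformly_continuous_on_def]
  define c where "c = - Q (\<lambda>j. (- 1/2) ^ j)"
  have c: "0 < c" using neg by (simp add: c_def)
  have K0: "K (0, \<sigma>) = - c * (b 0 \<sigma>)\<^sup>2" for \<sigma>
    using scale[of "b 0 \<sigma>" "\<lambda>j. (- 1/2) ^ j"] by (simp add: K_def damped_0 c_def mult.commute)
  \<comment> \<open>chosen so that \<open>2 * \<epsilon> * P < c * \<mu>\<^sup>2 - \<epsilon>\<close>\<close>
  define \<epsilon> where "\<epsilon> = c * \<mu>\<^sup>2 / (2 * P + 2)"
  have e: "0 < \<epsilon>" using c \<mu>(1) P by (simp add: \<epsilon>_def)
  have "\<epsilon> * (2 * P + 2) = c * \<mu>\<^sup>2" using P by (simp add: \<epsilon>_def)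
  then have m: "2 * \<epsilon> * P < c * \<mu>\<^sup>2 - \<epsilon>" using e by (simp add: algebra_simps)
  obtain \<delta> where \<delta>: "0 < \<delta>" "\<And>z w. z \<in> {0..1} \<times> {-4..-1} ==> w \<in> {0..1} \<times> {-4..-1} ==> dist w z < \<delta> ==> dist (K w) (K z) < \<epsilon>"
    using uc e by metis
  obtain L0 :: nat where L0: "1 / \<delta> < real L0" using reals_Archimedean2 by blast
  define L where "L = Suc L0"
  define \<kappa> where "\<kappa> = 1 / real L"
  have L: "0 < L" by (simp add: L_def)
  have l: "0 < \<kappa>" "\<kappa> \<le> 1" by (simp_all add: \<kappa>_def L_def)
  have "1 / \<delta> < real L" using L0 by (simp add: L_def)
  then have l\<delta>: "\<kappa> < \<delta>" using \<delta>(1) L by (simp add: \<kappa>_def field_simps)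
  have close: "\<bar>K (\<kappa>, \<sigma>) - K (0, \<sigma>)\<bar> < \<epsilon>" if "- 4 \<le> \<sigma>" "\<sigma> \<le> - 1" for \<sigma>
    using \<delta>(2)[of "(0, \<sigma>)" "(\<kappa>, \<sigma>)"] that l l\<delta> by (simp add: dist_Pair_Pair dist_real_def)
  have K_le: "K (\<kappa>, \<sigma>) \<le> \<epsilon>" for \<sigma>
  proof (cases "- 4 \<le> \<sigma> \<and> \<sigma> \<le> - 1")
    case True
    then have "K (\<kappa>, \<sigma>) < K (0, \<sigma>) + \<epsilon>" using close[of \<sigma>] by auto
    moreover have "K (0, \<sigma>) \<le> 0" unfolding K0 using c by simp
    ultimately show ?thesis by simp
  next
    case False
    then have "b i \<sigma> = 0" for i using van[of \<sigma> i] by auto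
    then have "K (\<kappa>, \<sigma>) = Q (\<lambda>j. 0 * 0)" unfolding K_def by (simp add: damped_vanish)
    also have "\<dots> = 0" by (subst scale[of 0 "\<lambda>_. 0"]) simp
    finally show ?thesis using e by simp
  qed
  have K_neg: "K (\<kappa>, \<sigma>) \<le> - (c * \<mu>\<^sup>2 - \<epsilon>)" if "- 3 \<le> \<sigma>" "\<sigma> \<le> - 2" for \<sigma>
  proof -
    have "\<mu>\<^sup>2 \<le> (b 0 \<sigma>)\<^sup>2" using \<mu> that by (intro power_mono) auto
    then have "K (0, \<sigma>) \<le> - (c * \<mu>\<^sup>2)" unfolding K0 using c by simp
    then show ?thesis using close[of \<sigma>] that by auto
  qed
  define \<beta> where "\<beta> j s = exp (- s / 2) * damped b \<kappa> j 0 (\<kappa> * s)" for j s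
  have \<beta>': "(\<beta> j has_real_derivative \<beta> (Suc j) s) (at s)" for j s
  proof -
    have "((\<lambda>s. damped b \<kappa> j 0 (\<kappa> * s)) has_real_derivative damped b \<kappa> j (Suc 0) (\<kappa> * s) * \<kappa>) (at s)"
      by (rule DERIV_chain2[OF damped_derivative[OF b]]) (auto intro!: derivative_eq_intros)
    moreover have "((\<lambda>s. exp (- s / 2)) has_real_derivative - 1/2 * exp (- s / 2)) (at s)"
      by (auto intro!: derivative_eq_intros)
    ultimately have "((\<lambda>s. exp (- s / 2) * damped b \<kappa> j 0 (\<kappa> * s)) has_real_derivative
        - 1/2 * exp (- s / 2) * damped b \<kappa> j 0 (\<kappa> * s) + damped b \<kappa> j (Suc 0) (\<kappa> * s) * \<kappa> * exp (- s / 2)) (at s)"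
      by (intro DERIV_mult)
    then show ?thesis unfolding \<beta>_def[abs_def] by (simp add: algebra_simps)
  qed
  then have ds: "derivative_sequence \<beta>" by (simp add: derivative_sequence_def)
  have \<beta>0: "\<beta> j s = 0" if "s \<le> - 4 * real L \<or> - real L \<le> s" for j s
  proof -
    have "\<kappa> * s \<le> - 4 \<or> - 1 \<le> \<kappa> * s" using that L by (auto simp: \<kappa>_def field_simps)
    then show ?thesis unfolding \<beta>_def by (simp add: damped_vanish van)
  qed
  have "\<exists>M. \<forall>s. \<bar>\<beta> j s\<bar> \<le> M" for j
  proof -
    have "compact (\<beta> j ` {- 4 * real L..- real L})"
      by (intro compact_continuous_image derivative_sequence_continuous ds compact_Icc)
    then obtain M where M: "\<And>y. y \<in> \<beta> j ` {- 4 * real L..- real L} ==> norm y \<le> M"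
      using compact_imp_bounded bounded_iff by metis
    have "\<bar>\<beta> j s\<bar> \<le> max M 0" for s
    proof (cases "s \<in> {- 4 * real L..- real L}")
      case True
      then show ?thesis using M[of "\<beta> j s"] by auto
    next
      case False
      then show ?thesis using \<beta>0[of s j] by auto
    qed
    then show ?thesis by blast
  qed
  then obtain B where B: "\<And>j s. \<bar>\<beta> j s\<bar> \<le> B j" by metis
  \<comment> \<open>the factor \<open>exp s\<close> cancels the square of \<open>exp (- s / 2)\<close>\<close>
  have QK: "exp s * Q (\<lambda>j. \<beta> j s) = K (\<kappa>, \<kappa> * s)" for s
  proof -
    have "Q (\<lambda>j. \<beta> j s) = (exp (- s / 2))\<^sup>2 * K (\<kappa>, \<kappa> * s)" unfolding \<beta>_def K_def by (simp add: scale)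
    also have "(exp (- s / 2))\<^sup>2 = exp (- s)" by (simp add: power2_eq_square flip: exp_add)
    finally show ?thesis by (simp add: exp_minus)
  qed
  show thesis
  proof (rule that[OF L ds B \<beta>0 e m])
    show "exp s * Q (\<lambda>j. \<beta> j s) \<le> \<epsilon>" for s unfolding QK by (rule K_le)
    show "exp s * Q (\<lambda>j. \<beta> j s) \<le> - (c * \<mu>\<^sup>2 - \<epsilon>)" if "- 3 * real L \<le> s" "s \<le> - 2 * real L" for s
      unfolding QK using that L by (intro K_neg) (auto simp: \<kappa>_def field_simps)
  qed
qed

section \<open>Instability\<close>

definition annulus :: "nat => 'a::euclidean_space set" where
  "annulus k = ball 0 (exp (- real k)) - ball 0 (exp (- real (Suc k)))"

lemma annulus_iff:
  fixes x :: "'a::euclidean_space"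
  assumes "x \<noteq> 0"
  shows "x \<in> annulus k \<longleftrightarrow> - real (Suc k) \<le> ln (norm x) \<and> ln (norm x) < - real k"
proof -
  have "norm x = exp (ln (norm x))" using assms by simp
  then obtain s where s: "norm x = exp s" "ln (norm x) = s" by metis
  show ?thesis unfolding annulus_def s by (auto simp: s(1) not_less)
qed

lemma annulus_lmeasurable: "annulus k \<in> lmeasurable"
  unfolding annulus_def by (intro fmeasurable.Diff) auto

lemma annulus_subset: "annulus k \<subseteq> unit_ball"
  unfolding annulus_def by (rule order_trans[OF Diff_subset subset_ball]) simp

lemma measure_annulus:
  "measure (lebesgue_on unit_ball) (annulus k :: 'a::euclidean_space set) =
     exp (- (real DIM('a) * real k)) * (measure lborel (ball (0::'a) 1) * (1 - exp (- real DIM('a))))"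
proof -
  have b: "measure lebesgue (ball (0::'a) (exp s)) = exp (real DIM('a) * s) * measure lborel (ball (0::'a) 1)" for s
    using content_ball_conv_unit_ball[of "exp s" "0::'a"] by (simp add: exp_of_nat_mult)
  have "measure (lebesgue_on unit_ball) (annulus k :: 'a set) = measure lebesgue (annulus k :: 'a set)"
    by (rule measure_restrict_space) (use annulus_subset[of k] in auto)
  also have "\<dots> = measure lebesgue (ball (0::'a) (exp (- real k))) - measure lebesgue (ball (0::'a) (exp (- real (Suc k))))"
    unfolding annulus_def by (rule measurable_measure_Diff) (auto intro!: subset_ball)
  also have "\<dots> = exp (- (real DIM('a) * real k)) * (measure lborel (ball (0::'a) 1) * (1 - exp (- real DIM('a))))"
    unfolding b by (simp add: algebra_simps exp_add exp_diff exp_minus divide_inverse)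
  finally show ?thesis .
qed

text \<open>The weight $|x|^{-n}$ is scale invariant, so the annuli \<open>annulus k\<close> all have comparable mass: the
  weight lies between \<open>exp (n * k)\<close> and \<open>exp n * exp (n * k)\<close> there, and the volume is proportional to
  \<open>exp (- n * k)\<close>. The \<open>L\<close> middle annuli outweigh the \<open>2 * L\<close> others.\<close>

lemma integral_annuli_negative:
  fixes g :: "'a::euclidean_space => real"
  assumes int: "integrable (lebesgue_on unit_ball) g"
    and g: "\<And>x. x \<in> unit_ball ==> x \<noteq> 0 ==> g x = inverse (norm x) ^ DIM('a) * \<kappa> (ln (norm x))"
    and L: "0 < L" and e: "0 < \<epsilon>" "2 * \<epsilon> * exp (real DIM('a)) < m"
    and \<kappa>: "\<And>s. \<kappa> s \<le> \<epsilon>" "\<And>s. - 3 * real L \<le> s ==> s \<le> - 2 * real L ==> \<kappa> s \<le> - m"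
      "\<And>s. s \<le> - 4 * real L \<or> - real L \<le> s ==> \<kappa> s = 0"
  shows "(LINT x|lebesgue_on unit_ball. g x) < 0"
proof -
  let ?n = "real DIM('a)" and ?M = "lebesgue_on (unit_ball :: 'a set)"
  \<comment> \<open>upper bounds of \<open>g\<close> on the annuli: a negative value calls for the lower bound of the weight\<close>
  define c where "c k = (if k \<in> {2 * L..<3 * L} then - m * exp (?n * real k) else \<epsilon> * exp ?n * exp (?n * real k))" for k
  define h where "h x = (\<Sum>k\<in>{L..<4 * L}. c k * indicator (annulus k) x)" for x :: 'a
  define \<mu> where "\<mu> = measure lborel (ball (0::'a) 1) * (1 - exp (- ?n))"
  have \<mu>: "0 < \<mu>" unfolding \<mu>_def by (intro mult_pos_pos content_ball_pos) auto
  have m: "0 < m" using e by (meson exp_gt_zero mult_pos_pos order_less_trans zero_less_numeral)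
  have fin: "emeasure ?M (annulus k) < \<infinity>" for k
    using annulus_lmeasurable[of k] annulus_subset[of k] by (subst emeasure_restrict_space) (auto simp: fmeasurable_def)
  have sets: "annulus k \<in> sets ?M" for k
    using fmeasurableD[OF annulus_lmeasurable[of k, where ?'a = 'a]] annulus_subset[of k, where ?'a = 'a] by (simp add: sets_restrict_space_iff)
  have ind: "integrable ?M (indicator (annulus k) :: 'a => real)" for k
    by (rule integrable_real_indicator[OF sets fin])
  have hint: "integrable ?M h" unfolding h_def by (intro Bochner_Integration.integrable_sum integrable_mult_right ind)
  have le: "g x \<le> h x" if x: "x \<noteq> 0" "x \<in> unit_ball" for x
  proof -
    define s where "s = ln (norm x)"
    have "norm x = exp s" using x by (simp add: s_def)
    then have q: "inverse (norm x) ^ DIM('a) = exp (- ?n * s)"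
      by (simp add: exp_minus power_inverse flip: exp_of_nat_mult)
    have gx: "g x = exp (- ?n * s) * \<kappa> s" using g[OF x(2,1)] q by (simp add: s_def)
    note an = annulus_iff[OF x(1), folded s_def]
    show ?thesis
    proof (cases "- 4 * real L \<le> s \<and> s < - real L")
      case False
      then have "\<kappa> s = 0" by (intro \<kappa>(3)) auto
      moreover have "x \<notin> annulus k" if "k \<in> {L..<4 * L}" for k
      proof
        assume "x \<in> annulus k"
        moreover have "real (Suc k) \<le> 4 * real L" "real L \<le> real k" using that by auto
        ultimately show False using False unfolding an by linarith
      qed
      then have "h x = 0" unfolding h_def by simp
      ultimately show ?thesis using gx by simp
    next
      case True
      \<comment> \<open>the annulus that contains \<open>x\<close>, that is \<open>k < - s \<le> k + 1\<close>\<close>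
      define k where "k = nat (\<lceil>- s\<rceil> - 1)"
      have "\<lceil>- s\<rceil> \<ge> 1" using True L by linarith
      then have rk: "real k = real_of_int \<lceil>- s\<rceil> - 1" by (simp add: k_def)
      have k: "real k < - s" "- s \<le> real (Suc k)" using rk by linarith+
      then have xk: "x \<in> annulus k" by (simp add: an)
      have "real L < real (Suc k)" "real k < real (4 * L)" using k True by auto
      then have kL: "k \<in> {L..<4 * L}" by auto
      have "x \<notin> annulus j" if "j \<noteq> k" for j
      proof
        assume "x \<in> annulus j"
        then have "real j < real (Suc k)" "real k < real (Suc j)" using k by (auto simp: an)
        with that show False by simp
      qed
      then have "h x = (\<Sum>j\<in>{L..<4 * L}. if j = k then c k else 0)"
        unfolding h_def using xk by (intro sum.cong) auto
      then have hx: "h x = c k" using kL by simp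
      show ?thesis
      proof (cases "k \<in> {2 * L..<3 * L}")
        case True
        then have "real (2 * L) \<le> real k" "real (Suc k) \<le> real (3 * L)" by auto
        then have "\<kappa> s \<le> - m" using k by (intro \<kappa>(2)) auto
        then have "g x \<le> exp (- ?n * s) * (- m)" unfolding gx by (intro mult_left_mono) auto
        also have "\<dots> \<le> exp (?n * real k) * (- m)"
        proof -
          have "?n * real k \<le> - ?n * s" using k mult_left_mono[of "real k" "- s" ?n] by simp
          then show ?thesis using m by (intro mult_right_mono_neg) auto
        qed
        finally show ?thesis unfolding hx c_def using True by (simp add: mult.commute)
      next
        case False
        have "g x \<le> exp (- ?n * s) * \<epsilon>" unfolding gx by (intro mult_left_mono \<kappa>) auto
        also have "\<dots> \<le> exp (?n + ?n * real k) * \<epsilon>"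
        proof -
          have "- ?n * s \<le> ?n + ?n * real k" using k mult_left_mono[of "- s" "real (Suc k)" ?n] by (simp add: algebra_simps)
          then show ?thesis using e by (intro mult_right_mono) auto
        qed
        also have "\<dots> = c k" unfolding c_def if_not_P[OF False] by (simp add: exp_add mult_ac)
        finally show ?thesis unfolding hx .
      qed
    qed
  qed
  have "(LINT x|?M. g x) \<le> (LINT x|?M. h x)"
    by (rule integral_mono_AE[OF int hint]) (use AE_lebesgue_ball_nz in eventually_elim, auto intro: le)
  also have "\<dots> = (\<Sum>k\<in>{L..<4 * L}. c k * measure ?M (annulus k))"
  proof -
    have "(LINT x|?M. h x) = (\<Sum>k\<in>{L..<4 * L}. LINT x|?M. c k * indicator (annulus k) x)"
      unfolding h_def by (rule Bochner_Integration.integral_sum) (rule integrable_mult_right[OF ind])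
    moreover have "(LINT x|?M. c k * indicator (annulus k) x) = c k * measure ?M (annulus k)" for k
      using annulus_subset[of k, where ?'a = 'a] by (simp add: Int_absorb2)
    ultimately show ?thesis by (simp only:)
  qed
  also have "\<dots> = (\<Sum>k\<in>{L..<4 * L}. if k \<in> {2 * L..<3 * L} then - m * \<mu> else \<epsilon> * exp ?n * \<mu>)"
  proof (rule sum.cong[OF refl])
    fix k
    have "exp (?n * real k) * measure ?M (annulus k) = \<mu>"
      unfolding measure_annulus \<mu>_def[symmetric] by (simp add: exp_minus)
    then show "c k * measure ?M (annulus k) = (if k \<in> {2 * L..<3 * L} then - m * \<mu> else \<epsilon> * exp ?n * \<mu>)"
      by (simp add: c_def mult.assoc)
  qed
  also have "\<dots> = real L * (- m * \<mu>) + real (2 * L) * (\<epsilon> * exp ?n * \<mu>)"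
  proof -
    have 1: "{L..<4 * L} \<inter> {k. k \<in> {2 * L..<3 * L}} = {2 * L..<3 * L}" by auto
    have 2: "{L..<4 * L} \<inter> - {k. k \<in> {2 * L..<3 * L}} = {L..<2 * L} \<union> {3 * L..<4 * L}" by auto
    have "card ({L..<2 * L} \<union> {3 * L..<4 * L}) = 2 * L" by (subst card_Un_disjoint) auto
    then show ?thesis by (subst sum.If_cases) (simp_all only: 1 2 finite_atLeastLessThan sum_constant card_atLeastLessThan, simp)
  qed
  also have "\<dots> = real L * \<mu> * (2 * \<epsilon> * exp ?n - m)" by (simp add: algebra_simps)
  also have "\<dots> < 0" using L \<mu> e by (intro mult_pos_neg mult_pos_pos) auto
  finally show ?thesis .
qed

lemma dds_vanish:
  assumes U: "open U" and G: "\<And>z. z \<in> U ==> G z = 0"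
  shows "z \<in> U ==> dds es G z = 0"
proof (induction es arbitrary: z)
  case (Cons e es)
  have "dd (0, e) (dds es G) z = dd (0, e) (\<lambda>_. 0) z"
    by (rule dd_cong[OF U Cons.prems Cons.IH])
  then show ?case by simp
qed (simp add: G)

text \<open>Moving the latitude by \<open>t\<close> times a slowly cut off profile is an admissible variation: it is fixed
  near the boundary and near the origin, and smooth in between. In dimension \<open>2 * r + 1\<close> the weight
  $|x|^{-2r}$ of the density and the factor $|x|^{-1}$ from the square of the profile combine to the
  scale invariant $|x|^{-n}$.\<close>

lemma cone_map_unstable:
  fixes F :: "('a::euclidean_space => 'a \<times> real) => real"
  assumes D: "energy_density F r D" and dim: "DIM('a) = 2 * r + 1"
    and crit: "weakly_critical F r (cone_map a)" and Q: "negative_form Q"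
    and hess: "\<And>\<beta> B x. derivative_sequence \<beta> ==> (\<And>j s. \<bar>\<beta> j s\<bar> \<le> B j) ==> (0, x) \<in> cyl 1 ==>
      dd (1, 0) (dd (1, 0) (D (eqv (\<lambda>z. a + fst z * prof \<beta> z 0)))) (0, x) = qq (0, x) ^ (2 * r) * Q (prof \<beta> (0, x))"
  shows "unstable F r (cone_map a)"
proof -
  obtain L :: nat and \<beta> B \<epsilon> m where L: "0 < L" and \<beta>: "derivative_sequence \<beta>" "\<And>j s. \<bar>\<beta> j s\<bar> \<le> B j"
    and \<beta>0: "\<And>j s. s \<le> - 4 * real L \<or> - real L \<le> s ==> \<beta> j s = 0"
    and e: "0 < \<epsilon>" "2 * \<epsilon> * exp (real DIM('a)) < m"
    and \<kappa>: "\<And>s. exp s * Q (\<lambda>j. \<beta> j s) \<le> \<epsilon>"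
      "\<And>s. - 3 * real L \<le> s ==> s \<le> - 2 * real L ==> exp s * Q (\<lambda>j. \<beta> j s) \<le> - m"
    using negative_profile[OF Q, of "exp (real DIM('a))"] by (metis exp_gt_zero)
  interpret profile a \<beta> B 1 "TYPE('a)" by unfold_locales (use \<beta> in auto)
  let ?\<Phi> = "eqv lat :: real \<times> 'a => 'a \<times> real"
  define \<phi> where "\<phi> t x = ?\<Phi> (t, x)" for t x
  have r2: "2 * r < DIM('a)" using dim by simp
  have rep: "rep t ?\<Phi> (\<phi> t)" for t by (simp add: rep_def \<phi>_def)
  have \<phi>0: "\<phi> 0 = cone_map a" by (rule ext) (simp add: \<phi>_def eqv_def cone_map_def uu_def)
  have sD: "symbol 1 (2 * r) (D ?\<Phi>)" using D sym_Phi unfolding energy_density_def by blast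
  let ?I = "\<lambda>t. 1/2 * (LINT x|lebesgue_on unit_ball. dd (1, 0) (D ?\<Phi>) (t, x))"
  let ?J = "1/2 * (LINT x|lebesgue_on unit_ball. dd (1, 0) (dd (1, 0) (D ?\<Phi>)) (0, x))"
  have "has_second_derivative_at_0 (\<lambda>s. F (\<phi> s)) 1 ?J"
    unfolding has_second_derivative_at_0_def
  proof (intro exI[of _ ?I] conjI ballI)
    show "((\<lambda>s. F (\<phi> s)) has_real_derivative ?I s) (at s within {0..<1})" if "s \<in> {0..<1}" for s
      by (rule has_field_derivative_at_within[OF energy_derivative[OF D r2 sym_Phi rep]]) (use that in auto)
    show "(?I has_real_derivative ?J) (at 0 within {0..<1})"
      by (rule has_field_derivative_at_within[OF DERIV_cmult[OF has_real_derivative_integral_symbol[OF sym_dt[OF sD] r2]]]) simp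
  qed
  moreover have "?J < 0"
  proof -
    have "(LINT x|lebesgue_on unit_ball. dd (1, 0) (dd (1, 0) (D ?\<Phi>)) (0, x)) < 0"
    proof (rule integral_annuli_negative[OF _ _ L e, where \<kappa> = "\<lambda>s. exp s * Q (\<lambda>j. \<beta> j s)"])
      show "integrable (lebesgue_on unit_ball) (\<lambda>x. dd (1, 0) (dd (1, 0) (D ?\<Phi>)) (0, x))"
        by (rule integrable_slice[OF sym_dt[OF sym_dt[OF sD]] _ r2]) simp
      fix x :: 'a assume x: "x \<in> unit_ball" "x \<noteq> 0"
      have "dd (1, 0) (dd (1, 0) (D ?\<Phi>)) (0, x) = qq (0, x) ^ (2 * r) * Q (prof \<beta> (0, x))"
        by (rule hess[OF \<beta>]) (use x in \<open>simp add: cyl_def\<close>)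
      also have "\<dots> = inverse (norm x) ^ DIM('a) * (exp (ln (norm x)) * Q (\<lambda>j. \<beta> j (ln (norm x))))"
        using x unfolding dim by (simp add: qq_def prof_def[abs_def])
      finally show "dd (1, 0) (dd (1, 0) (D ?\<Phi>)) (0, x) = inverse (norm x) ^ DIM('a) * (exp (ln (norm x)) * Q (\<lambda>j. \<beta> j (ln (norm x))))" .
    next
      fix s assume "s \<le> - 4 * real L \<or> - real L \<le> s"
      then have "Q (\<lambda>j. \<beta> j s) = Q (\<lambda>j. 0 * 0)" by (simp add: \<beta>0)
      also have "\<dots> = 0"
      proof -
        have "Q (\<lambda>j. c * b j) = c\<^sup>2 * Q b" for c b using Q unfolding negative_form_def by blast
        from this[of 0 "\<lambda>_. 0"] show ?thesis by simp
      qed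
      finally show "exp s * Q (\<lambda>j. \<beta> j s) = 0" by simp
    qed (use \<kappa> in auto)
    then show ?thesis by simp
  qed
  moreover have "variation r (cone_map a) 1 \<phi>"
    unfolding variation_def
  proof (intro conjI ballI exI[of _ "\<lambda>k s x. (dd (1, 0) ^^ k) ?\<Phi> (s, x)"] allI)
    have s: "symbol 1 0 ((dd (1, 0) ^^ k) ?\<Phi>)" for k by (induction k) (auto intro: sym_dt sym_Phi)
    show "\<phi> 0 = cone_map a" by (rule \<phi>0)
    show "(\<lambda>s x. (dd (1, 0) ^^ 0) ?\<Phi> (s, x)) = \<phi>" by (intro ext) (simp add: \<phi>_def)
    fix t :: real assume t: "t \<in> {0..<1}"
    then have t1: "\<bar>t\<bar> < 1" by simp
    show "sobolev r (\<lambda>x. (dd (1, 0) ^^ k) ?\<Phi> (t, x))" for k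
      by (rule rep_sobolev[OF s _ t1]) (use r2 in \<open>auto simp: rep_def\<close>)
    show "((\<lambda>u. sobolev_norm r (\<lambda>x. ((dd (1, 0) ^^ k) ?\<Phi> (u, x) - (dd (1, 0) ^^ k) ?\<Phi> (t, x)) /\<^sub>R (u - t) -
        (dd (1, 0) ^^ Suc k) ?\<Phi> (t, x))) \<longlongrightarrow> 0) (at t within {0..<1})" for k
      unfolding funpow.simps comp_apply by (rule sobolev_norm_difference_quotient[OF s r2 t1]) auto
    show "sobolev_sphere_rel r (cone_map a) (\<phi> t)"
      unfolding sobolev_sphere_rel_def
    proof (intro conjI allI impI)
      show "sobolev_sphere r (\<phi> t)" by (rule sobolev_sphere_rep[OF sphere_family_axioms t1 rep r2])
      fix es :: "'a list" assume es: "set es \<subseteq> Basis \<and> length es < r"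
      let ?G = "\<lambda>z. freeze t ?\<Phi> z + (- 1) *\<^sub>R freeze 0 ?\<Phi> z"
      have sG: "symbol 1 0 ?G" by (intro sym_add sym_cmult sym_freeze sym_Phi t1) simp
      have rG: "rep 0 ?G (\<lambda>x. \<phi> t x - cone_map a x)"
        unfolding \<phi>0[symmetric] by (simp add: rep_def freeze_def \<phi>_def)
      \<comment> \<open>on this open set the family is constant in time\<close>
      let ?U = "cyl 1 \<inter> {z :: real \<times> 'a. norm (snd z) < exp (- 4 * real L) \<or> exp (- real L) < norm (snd z)}"
      have U: "open ?U"
        unfolding Collect_disj_eq by (intro open_Int open_cyl open_Un open_Collect_less continuous_intros)
      have G0: "?G z = 0" if z: "z \<in> ?U" for z
      proof -
        have n: "0 < norm (snd z)" using z by (auto simp: cyl_def)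
        have "ln (norm (snd z)) < - 4 * real L \<or> - real L < ln (norm (snd z))"
          using z ln_less_cancel_iff[OF n, of "exp (- 4 * real L)"] ln_less_cancel_iff[OF _ n, of "exp (- real L)"] by simp
        then have "\<beta> 0 (ln (norm (snd z))) = 0" by (intro \<beta>0) auto
        then show ?thesis by (simp add: freeze_def eqv_def prof_def uu_def zero_prod_def)
      qed
      show "has_trace (weak_partials es (\<lambda>x. \<phi> t x - cone_map a x)) (\<lambda>_. 0)"
      proof (rule has_trace_0)
        show "(0::real) < 1" "0 < exp (- 4 * real L)" "exp (- real L) < 1" using L by auto
        show "symbol 1 (length es) (dds es ?G)" using sym_dds[OF sG, of es] es by simp
        show "2 * (length es + 1) < DIM('a)" using es dim by auto
        show "rep 0 (dds es ?G) (weak_partials es (\<lambda>x. \<phi> t x - cone_map a x))"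
          by (rule rep_weak_partials[OF sG _ rG]) (use es dim in auto)
        show "dds es ?G (0, x) = 0" if "(0, x) \<in> cyl 1" "norm x < exp (- 4 * real L) \<or> exp (- real L) < norm x" for x
          by (rule dds_vanish[OF U G0]) (use that in auto)
      qed
    qed
  qed simp
  ultimately have "\<not> stable F r (cone_map a)" unfolding stable_def by (meson not_le)
  with crit show ?thesis by (simp add: unstable_def)
qed

text \<open>With \<open>cos (2 * a) = 2 * (cos a)\<^sup>2 - 1\<close> the explicit values are roots of the quadratic equations.\<close>

lemma critical_latitude_cases:
  assumes a: "0 < a" "a < pi / 2"
    and r: "(r, n, a) \<in>
      {(3, 7, arccos (1 / 9 * (2 * sqrt 10 - 11)) / 2),
       (4, 9, arccos (1 / 16 * (sqrt 105 - 19)) / 2),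
       (5, 11, arccos (1 / 25 * (6 * sqrt 6 - 29)) / 2)}"
  shows "critical_latitude r n a"
proof -
  have w: "cos (2 * a) = v" if "a = arccos v / 2" "- 1 \<le> v" "v \<le> 1" for v
  proof -
    have "2 * a = arccos v" using that(1) by simp
    then show ?thesis by (simp only: cos_arccos[OF that(2,3)])
  qed
  have c2: "(cos a)\<^sup>2 = (cos (2 * a) + 1) / 2" by (simp add: cos_double_cos)
  from r consider (3) "r = 3" "n = 7" "a = arccos (1 / 9 * (2 * sqrt 10 - 11)) / 2"
    | (4) "r = 4" "n = 9" "a = arccos (1 / 16 * (sqrt 105 - 19)) / 2"
    | (5) "r = 5" "n = 11" "a = arccos (1 / 25 * (6 * sqrt 6 - 29)) / 2" by auto
  then show ?thesis
  proof cases
    case 3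
    have "sqrt 10 \<le> 10" "1 \<le> sqrt 10" by (auto intro!: real_le_lsqrt real_le_rsqrt)
    then have v: "cos (2 * a) = 1 / 9 * (2 * sqrt 10 - 11)" by (intro w 3) auto
    have "(sqrt 10)\<^sup>2 = 10" by simp
    then show ?thesis using 3(1,2) unfolding critical_latitude_def c2 v by (simp add: power2_eq_square field_simps)
  next
    case 4
    have "sqrt 105 \<le> 35" "3 \<le> sqrt 105" by (auto intro!: real_le_lsqrt real_le_rsqrt)
    then have v: "cos (2 * a) = 1 / 16 * (sqrt 105 - 19)" by (intro w 4) auto
    have "(sqrt 105)\<^sup>2 = 105" by simp
    then show ?thesis using 4(1,2) unfolding critical_latitude_def c2 v by (simp add: power2_eq_square field_simps)
  next
    case 5
    have "sqrt 6 \<le> 9" "2 \<le> sqrt 6" by (auto intro!: real_le_lsqrt real_le_rsqrt)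
    then have v: "cos (2 * a) = 1 / 25 * (6 * sqrt 6 - 29)" by (intro w 5) auto
    have "(sqrt 6)\<^sup>2 = 6" by simp
    then show ?thesis using 5(1,2) unfolding critical_latitude_def c2 v by (simp add: power2_eq_square field_simps)
  qed
qed

lemma cone_map_energies_unstable:
  assumes crit: "critical_latitude r DIM('a) a"
  shows "unstable (r_energy r) r (cone_map a :: 'a::euclidean_space => 'a \<times> real)"
    "unstable (ES_energy r) r (cone_map a :: 'a => 'a \<times> real)"
proof -
  have dim: "DIM('a) = 2 * r + 1" using crit unfolding critical_latitude_def by auto
  have p: "profile \<beta> B 1" if "derivative_sequence \<beta>" "\<And>j s. \<bar>\<beta> j s\<bar> \<le> B j" for \<beta> B
    by unfold_locales (use that in auto)
  show "unstable (r_energy r) r (cone_map a :: 'a => 'a \<times> real)"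
    by (rule cone_map_unstable[OF energy_density_r(1)[OF crit] dim cone_map_critical(1)[OF crit] negative_energy_form(1)[OF crit]])
      (rule profile.second_derivative_energy_density(1)[OF p crit])
  show "unstable (ES_energy r) r (cone_map a :: 'a => 'a \<times> real)"
    by (rule cone_map_unstable[OF energy_density_r(2)[OF crit] dim cone_map_critical(2)[OF crit] negative_energy_form(2)[OF crit]])
      (rule profile.second_derivative_energy_density(2)[OF p crit])
qed

theorem theorem1p6:
  fixes r :: nat and a :: real and \<phi> :: "real ^ 'n \<Rightarrow> (real ^ 'n) \<times> real"
  assumes "0 < a" "a < pi / 2"
    and "(r, CARD('n), a) \<in>
      {(3, 7, arccos (1 / 9 * (2 * sqrt 10 - 11)) / 2),
       (4, 9, arccos (1 / 16 * (sqrt 105 - 19)) / 2),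
       (5, 11, arccos (1 / 25 * (6 * sqrt 6 - 29)) / 2)}"
    and "\<phi> = phi a"
  shows "proper \<phi> \<and> weakly_r_harmonic r \<phi> \<and> weakly_ES_r_harmonic r \<phi> \<and>
    unstable (r_energy r) r \<phi> \<and> unstable (ES_energy r) r \<phi>"
proof -
  have sc: "0 < sin a" "0 < cos a" using assms(1,2) by (auto intro: sin_gt_zero cos_gt_zero)
  have \<phi>: "\<phi> = cone_map a" unfolding assms(4) by (intro ext) (simp add: phi_def cone_map_def sgn_div_norm)
  have crit: "critical_latitude r DIM(real ^ 'n) a"
    using critical_latitude_cases[OF assms(1-3)] by simp
  then have "2 < DIM(real ^ 'n)" unfolding critical_latitude_def by auto
  from cone_map_not_harmonic[OF this sc] show ?thesis
    unfolding \<phi> proper_def weakly_r_harmonic_def[of r] weakly_ES_r_harmonic_def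
    using cone_map_critical[OF crit] cone_map_energies_unstable[OF crit] by blast
qed

end
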